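(* Let $\mathbf f\in L^2(0,T;H^{-1}(\Omega)^d)$ and $\mathbf u_0\in L^2(\Omega)^d$, and let $\widehat{\mathbf u}_h:[0,T]\to\mathcal V_h$ be given. Then the linearised semi-discrete problem: find $(\mathbf u_h,p_h,\tilde{\mathbf u}_1,\tilde{\mathbf u}_2):[0,T]\to\mathcal V_h\times Q_h\times\widetilde V_1\times\widetilde V_2$ such that, for all $(\mathbf v_h,q_h,\tilde{\mathbf v}_1,\tilde{\mathbf v}_2)\in\mathcal V_h\times Q_h\times\widetilde V_1\times\widetilde V_2$ and a.e. in $(0,T)$, \begin{align*} &(\partial_t\mathbf u_h,\mathbf v_h)+(2\mu(\cdot,|\nabla^s\widehat{\mathbf u}_h|)\nabla^s\mathbf u_h,\nabla^s\mathbf v_h)+\overline c(\widehat{\mathbf u}_h,\mathbf u_h,\mathbf v_h)-(p_h,\operatorname{div}\mathbf v_h)\\ &\qquad+(\tau_2\operatorname{div}\mathbf v_h,P_p^\perp[\operatorname{div}\mathbf u_h])-\overline c(\widehat{\mathbf u}_h,\mathbf v_h,\tilde{\mathbf u}_1)=\langle\mathbf f,\mathbf v_h\rangle,\\ &(q_h,\operatorname{div}\mathbf u_h)-(\nabla q_h,\tilde{\mathbf u}_2)=0,\\ &(\partial_t\tilde{\mathbf u}_1,\tilde{\mathbf v}_1)+\tau_1^{-1}(\tilde{\mathbf u}_1,\tilde{\mathbf v}_1)+\overline c(\widehat{\mathbf u}_h,\mathbf u_h,\tilde{\mathbf v}_1)=0,\\ &(\partial_t\tilde{\mathbf u}_2,\tilde{\mathbf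 v}_2)+\tau_1^{-1}(\tilde{\mathbf u}_2,\tilde{\mathbf v}_2)+(\nabla p_h,\tilde{\mathbf v}_2)=0, \end{align*} with initial conditions $\mathbf u_h(0)=P_{u,0}[\mathbf u_0]$, $\tilde{\mathbf u}_1(0)=\widetilde P_1[\mathbf u_0]$, $\tilde{\mathbf u}_2(0)=\widetilde P_2[\mathbf u_0]$, where $\tau_i=\tau_i(\widehat{\mathbf u}_h)$, admits a unique solution satisfying $\mathbf u_h,\tilde{\mathbf u}_1,\tilde{\mathbf u}_2\in L^\infty(0,T;L^2(\Omega)^d)$ and $\mathbf u_h\in L^2(0,T;H^1(\Omega)^d)$, and the following estimate holds: $$\sup_{0\le t\le T}\|\mathbf u_h(t)\|^2+\sup_{0\le t\le T}\|\tilde{\mathbf u}_1(t)\|^2+\sup_{0\le t\le T}\|\tilde{\mathbf u}_2(t)\|^2+\mu_\infty\int_0^T\|\nabla^s\mathbf u_h\|^2\,ds\;\lesssim\;\frac{c_K^2}{\mu_\infty}\int_0^T\|\mathbf f\|_{H^{-1}}^2\,ds+\|\mathbf u_0\|^2 .$$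
   Context: $\Omega\subset\mathbb R^d$, $d\in\{2,3\}$, is a bounded polyhedral domain, $0<T\le\infty$. $\|\cdot\|$ and $(\cdot,\cdot)$ are the $L^2(\Omega)$ norm and inner product (scalar, vector or tensor fields), $\|\cdot\|_\infty$ the $L^\infty(\Omega)$ norm, $H^{-1}(\Omega)$ is the dual of $H^1_0(\Omega)$ with norm $\|\cdot\|_{H^{-1}}$ and pairing $\langle\cdot,\cdot\rangle$. $\nabla^s\mathbf v=\frac12(\nabla\mathbf v+(\nabla\mathbf v)^T)$; $|\cdot|$ is the Frobenius norm. $c_K$ is a constant depending only on $\Omega$ with $\|\mathbf v\|_{H^1}\le c_K\|\nabla^s\mathbf v\|$ for all $\mathbf v\in H^1_0(\Omega)^d$ (Korn). $A\lesssim B$ means $A\le CB$ with $C>0$ independent of the mesh size $h$ and of the physical parameters. Viscosity: $\mu:\overline\Omega\times\mathbb R_{\ge0}\to\mathbb R$ satisfies, for some $C_\mu>0$ and $\mu_0>\mu_\infty>0$: $|\mu(\mathbf x,t)-\mu(\mathbf x,s)|\le C_\mu|t-s|$ and $\mu_\infty\le\mu(\mathbf x,t)\le\mu_0$ for all $s,t\ge0$, $\mathbf x\in\overline\Omega$. Convective form: $\mathcal N(\mathbf u,\mathbf v)=\mathbf u\cdot\nabla\mathbf v+\frac12(\operatorname{div}\mathbf u)\mathbf v$ and $\overline c(\mathbf u,\mathbf v,\mathbf w)=\int_\Omega\mathcal N(\mathbf u,\mathbf v)\cdot\mathbf w\,dx$. Finite elements: $\{\mathcal T_h\}$ is a quasi-uniform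 family of finite element partitions of $\Omega$, $h=\max_{K\in\mathcal T_h}\operatorname{diam}K$. For fixed $k\ge1$, $S_h=\{v\in C(\overline\Omega):v|_K\in P_k(K)\ \forall K\in\mathcal T_h\}$ with $P_k(K)$ the polynomials of degree $\le k$; $\mathcal V_h=[S_h\cap H^1_0(\Omega)]^d$, $Q_h=S_h/\mathbb R$. $P_u$, $P_p$, $P_{u,0}$ are the $L^2(\Omega)$-orthogonal projections onto $S_h^d$, $S_h$, $\mathcal V_h$ respectively; $P_u^\perp=I-P_u$, $P_p^\perp=I-P_p$. Subscale spaces: with $\{\phi_i\}_{i=1}^{n_u}$, $\{\varphi_k\}_{k=1}^{n_p}$ bases of the discrete velocity and pressure spaces, $\widetilde V_1=\operatorname{span}\{P_u^\perp[\mathcal N(\phi_i,\phi_j)]\}_{i,j=1}^{n_u}$, $\widetilde V_2=\operatorname{span}\{P_u^\perp[\nabla\varphi_k]\}_{k=1}^{n_p}$; $\widetilde P_1,\widetilde P_2$ are the $L^2(\Omega)$-orthogonal projections onto $\widetilde V_1,\widetilde V_2$. Stabilisation parameters (constant in space, functions of time): $\tau_1(\widehat{\mathbf u}_h)=\big(c_1\mu_c/h^2+c_2\|\widehat{\mathbf u}_h\|_\infty/h\big)^{-1}$, $\tau_2(\widehat{\mathbf u}_h)=h^2/(c_1\tau_1(\widehat{\mathbf u}_h))$, where $c_1,c_2>0$ are algorithmic constants and $\mu_c$ is a characteristic viscosity with $\mu_\infty\le\mu_c\le\mu_0$ (e.g. the spatial average of $\mu(\mathbf x,|\nabla^s\widehat{\mathbf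 u}_h|)$ over $\Omega$). The inequality $\|\mathbf z_h\|\le\frac1{\beta_0}\|P_{u,0}[\mathbf z_h]+P_u^\perp[\mathbf z_h]\|\le\frac1{\beta_0}(\|P_{u,0}[\mathbf z_h]\|+\|P_u^\perp[\mathbf z_h]\|)$ is assumed for every piecewise polynomial vector field $\mathbf z_h$, with $\beta_0>0$ independent of $h$.
   Formalization: Added: û_h is measurable in time with ‖û_h‖ integrable on [0,t] for finite t≤T; u_0 satisfies (q_h,div P_{u,0}u_0)=(∇q_h,P̃_2u_0) for all q_h, which existence forces; μ in x and μ_c in t are measurable. The β_0-inequality is assumed only for z_h=∇q_h. *)

theory Defs
  imports "HOL-Analysis.Analysis" "HOL-Probability.Essential_Supremum"
begin

section \<open>Lebesgue and Sobolev spaces on a domain\<close>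

text \<open>
  Elements of Lebesgue and Sobolev spaces are represented by functions on the whole space; only
  their values almost everywhere on \<open>\<Omega>\<close> matter, and equality in \<open>L\<^sup>2(\<Omega>)\<close> is \<open>l2_eq\<close>. On matrices
  \<open>real^'d^'d\<close> the library's inner product and norm are the Frobenius ones.
\<close>

definition L2 :: "'a::euclidean_space set \<Rightarrow> ('a \<Rightarrow> 'b::euclidean_space) set" where
  "L2 \<Omega> = {u \<in> borel_measurable (lebesgue_on \<Omega>). integrable (lebesgue_on \<Omega>) (\<lambda>x. (norm (u x))\<^sup>2)}"

definition l2_eq :: "'a::euclidean_space set \<Rightarrow> ('a \<Rightarrow> 'b::euclidean_space) \<Rightarrow> ('a \<Rightarrow> 'b) \<Rightarrow> bool" where
  "l2_eq \<Omega> u v \<longleftrightarrow> (AE x in lebesgue_on \<Omega>. u x = v x)"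

definition l2_inner ::
    "'a::euclidean_space set \<Rightarrow> ('a \<Rightarrow> 'b::euclidean_space) \<Rightarrow> ('a \<Rightarrow> 'b) \<Rightarrow> real" where
  "l2_inner \<Omega> u v = (\<integral>x. u x \<bullet> v x \<partial>lebesgue_on \<Omega>)"

definition l2_norm :: "'a::euclidean_space set \<Rightarrow> ('a \<Rightarrow> 'b::euclidean_space) \<Rightarrow> real" where
  "l2_norm \<Omega> u = sqrt (l2_inner \<Omega> u u)"

definition linf_norm :: "'a::euclidean_space set \<Rightarrow> ('a \<Rightarrow> 'b::euclidean_space) \<Rightarrow> real" where
  "linf_norm \<Omega> u = real_of_ereal (esssup (lebesgue_on \<Omega>) (\<lambda>x. ereal (norm (u x))))"

definition partial_deriv :: "'d::finite \<Rightarrow> (real^'d \<Rightarrow> real) \<Rightarrow> real^'d \<Rightarrow> real" where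
  "partial_deriv i f x = frechet_derivative f (at x) (axis i 1)"

primrec continuously_differentiable :: "nat \<Rightarrow> (real^'d::finite \<Rightarrow> real) \<Rightarrow> bool" where
  "continuously_differentiable 0 f \<longleftrightarrow> continuous_on UNIV f"
| "continuously_differentiable (Suc n) f \<longleftrightarrow>
     f differentiable_on UNIV \<and> (\<forall>i. continuously_differentiable n (partial_deriv i f))"

text \<open>The space of smooth functions with compact support in \<open>\<Omega>\<close>.\<close>

definition test_functions :: "(real^'d::finite) set \<Rightarrow> (real^'d \<Rightarrow> real) set" where
  "test_functions \<Omega> = {\<phi>. (\<forall>n. continuously_differentiable n \<phi>) \<and>
     compact (closure {x. \<phi> x \<noteq> 0}) \<and> closure {x. \<phi> x \<noteq> 0} \<subseteq> \<Omega>}"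

definition is_weak_grad ::
    "(real^'d::finite) set \<Rightarrow> (real^'d \<Rightarrow> real) \<Rightarrow> (real^'d \<Rightarrow> real^'d) \<Rightarrow> bool" where
  "is_weak_grad \<Omega> u g \<longleftrightarrow> g \<in> L2 \<Omega> \<and>
     (\<forall>\<phi>\<in>test_functions \<Omega>. \<forall>i. (\<integral>x. u x * partial_deriv i \<phi> x \<partial>lebesgue_on \<Omega>)
        = - (\<integral>x. g x $ i * \<phi> x \<partial>lebesgue_on \<Omega>))"

definition grad :: "(real^'d::finite) set \<Rightarrow> (real^'d \<Rightarrow> real) \<Rightarrow> real^'d \<Rightarrow> real^'d" where
  "grad \<Omega> u = (SOME g. is_weak_grad \<Omega> u g)"

definition H1 :: "(real^'d::finite) set \<Rightarrow> (real^'d \<Rightarrow> real) set" where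
  "H1 \<Omega> = {u \<in> L2 \<Omega>. \<exists>g. is_weak_grad \<Omega> u g}"

definition h1_norm :: "(real^'d::finite) set \<Rightarrow> (real^'d \<Rightarrow> real) \<Rightarrow> real" where
  "h1_norm \<Omega> u = sqrt ((l2_norm \<Omega> u)\<^sup>2 + (l2_norm \<Omega> (grad \<Omega> u))\<^sup>2)"

text \<open>\<open>H\<^sup>1\<^sub>0(\<Omega>)\<close> is the closure of the test functions in \<open>H\<^sup>1(\<Omega>)\<close>.\<close>

definition H10 :: "(real^'d::finite) set \<Rightarrow> (real^'d \<Rightarrow> real) set" where
  "H10 \<Omega> = {u \<in> H1 \<Omega>. \<exists>\<phi>. (\<forall>n. \<phi> n \<in> test_functions \<Omega>) \<and>
     (\<lambda>n::nat. h1_norm \<Omega> (\<lambda>x. \<phi> n x - u x)) \<longlonglongrightarrow> 0}"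

definition vec_fields :: "(real^'d::finite \<Rightarrow> real) set \<Rightarrow> (real^'d \<Rightarrow> real^'d) set" where
  "vec_fields X = {v. \<forall>i. (\<lambda>x. v x $ i) \<in> X}"

text \<open>Jacobian convention: \<open>vgrad \<Omega> v x $ i $ j\<close> is the derivative of \<open>v\<^sub>i\<close> in direction \<open>j\<close>.\<close>

definition vgrad :: "(real^'d::finite) set \<Rightarrow> (real^'d \<Rightarrow> real^'d) \<Rightarrow> real^'d \<Rightarrow> real^'d^'d" where
  "vgrad \<Omega> v x = (\<chi> i. grad \<Omega> (\<lambda>y. v y $ i) x)"

definition sym_grad :: "(real^'d::finite) set \<Rightarrow> (real^'d \<Rightarrow> real^'d) \<Rightarrow> real^'d \<Rightarrow> real^'d^'d" where
  "sym_grad \<Omega> v x = (1/2) *\<^sub>R (vgrad \<Omega> v x + transpose (vgrad \<Omega> v x))"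

definition vdiv :: "(real^'d::finite) set \<Rightarrow> (real^'d \<Rightarrow> real^'d) \<Rightarrow> real^'d \<Rightarrow> real" where
  "vdiv \<Omega> v x = (\<Sum>i\<in>UNIV. vgrad \<Omega> v x $ i $ i)"

definition vh1_norm :: "(real^'d::finite) set \<Rightarrow> (real^'d \<Rightarrow> real^'d) \<Rightarrow> real" where
  "vh1_norm \<Omega> v = sqrt ((l2_norm \<Omega> v)\<^sup>2 + (l2_norm \<Omega> (vgrad \<Omega> v))\<^sup>2)"

text \<open>
  \<open>H\<^sup>-\<^sup>1(\<Omega>)\<close>. Boundedness makes the functionals insensitive to changes on null sets.
  Elements of \<open>H\<^sup>-\<^sup>1(\<Omega>)\<^sup>d\<close> are families of functionals indexed by \<open>'d\<close>.
\<close>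

definition Hm1 :: "(real^'d::finite) set \<Rightarrow> ((real^'d \<Rightarrow> real) \<Rightarrow> real) set" where
  "Hm1 \<Omega> = {F. (\<forall>v\<in>H10 \<Omega>. \<forall>w\<in>H10 \<Omega>. \<forall>a b. F (\<lambda>x. a * v x + b * w x) = a * F v + b * F w) \<and>
     (\<exists>M. \<forall>v\<in>H10 \<Omega>. \<bar>F v\<bar> \<le> M * h1_norm \<Omega> v)}"

definition hm1_norm :: "(real^'d::finite) set \<Rightarrow> ((real^'d \<Rightarrow> real) \<Rightarrow> real) \<Rightarrow> real" where
  "hm1_norm \<Omega> F = (SUP v\<in>{v \<in> H10 \<Omega>. h1_norm \<Omega> v \<le> 1}. \<bar>F v\<bar>)"

definition vhm1_norm :: "(real^'d::finite) set \<Rightarrow> ('d \<Rightarrow> (real^'d \<Rightarrow> real) \<Rightarrow> real) \<Rightarrow> real" where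
  "vhm1_norm \<Omega> F = sqrt (\<Sum>i\<in>UNIV. (hm1_norm \<Omega> (F i))\<^sup>2)"

definition pairing :: "('d::finite \<Rightarrow> (real^'d \<Rightarrow> real) \<Rightarrow> real) \<Rightarrow> (real^'d \<Rightarrow> real^'d) \<Rightarrow> real" where
  "pairing F v = (\<Sum>i\<in>UNIV. F i (\<lambda>x. v x $ i))"

section \<open>Functions of time\<close>

text \<open>For \<open>T = \<infinity>\<close> this is \<open>[0,\<infinity>)\<close>.\<close>

definition time_interval :: "ereal \<Rightarrow> real set" where
  "time_interval T = {t. 0 \<le> t \<and> ereal t \<le> T}"

text \<open>
  All the spaces involved are separable Hilbert spaces, so that by Pettis' theorem Bochner
  measurability amounts to weak measurability.
\<close>

definition l2_measurable ::
    "'a::euclidean_space set \<Rightarrow> real set \<Rightarrow> (real \<Rightarrow> 'a \<Rightarrow> 'b::euclidean_space) \<Rightarrow> bool" where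
  "l2_measurable \<Omega> I u \<longleftrightarrow>
     (\<forall>w\<in>L2 \<Omega>. (\<lambda>t. l2_inner \<Omega> (u t) w) \<in> borel_measurable (lebesgue_on I))"

definition Linf_L2 ::
    "'a::euclidean_space set \<Rightarrow> real set \<Rightarrow> (real \<Rightarrow> 'a \<Rightarrow> 'b::euclidean_space) set" where
  "Linf_L2 \<Omega> I = {u. l2_measurable \<Omega> I u \<and> (AE t in lebesgue_on I. u t \<in> L2 \<Omega>) \<and>
     (\<exists>M. AE t in lebesgue_on I. l2_norm \<Omega> (u t) \<le> M)}"

definition L2_H1 :: "(real^'d::finite) set \<Rightarrow> real set \<Rightarrow> (real \<Rightarrow> real^'d \<Rightarrow> real^'d) set" where
  "L2_H1 \<Omega> I = {u. (AE t in lebesgue_on I. u t \<in> vec_fields (H1 \<Omega>)) \<and>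
     l2_measurable \<Omega> I u \<and> l2_measurable \<Omega> I (\<lambda>t. vgrad \<Omega> (u t)) \<and>
     integrable (lebesgue_on I) (\<lambda>t. (vh1_norm \<Omega> (u t))\<^sup>2)}"

definition L2_Hm1 ::
    "(real^'d::finite) set \<Rightarrow> real set \<Rightarrow> (real \<Rightarrow> 'd \<Rightarrow> (real^'d \<Rightarrow> real) \<Rightarrow> real) set" where
  "L2_Hm1 \<Omega> I = {f. (AE t in lebesgue_on I. \<forall>i. f t i \<in> Hm1 \<Omega>) \<and>
     (\<forall>i. \<forall>v\<in>H10 \<Omega>. (\<lambda>t. f t i v) \<in> borel_measurable (lebesgue_on I)) \<and>
     integrable (lebesgue_on I) (\<lambda>t. (vhm1_norm \<Omega> (f t))\<^sup>2)}"

text \<open>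
  \<open>u'\<close> is the time derivative of the locally absolutely continuous function \<open>u\<close>: on every
  interval \<open>[0,t]\<close>, \<open>u\<close> is in \<open>L\<^sup>2(\<Omega>)\<close> the integral of \<open>u'\<close>.
\<close>

definition has_time_deriv :: "'a::euclidean_space set \<Rightarrow> real set \<Rightarrow>
    (real \<Rightarrow> 'a \<Rightarrow> 'b::euclidean_space) \<Rightarrow> (real \<Rightarrow> 'a \<Rightarrow> 'b) \<Rightarrow> bool" where
  "has_time_deriv \<Omega> I u u' \<longleftrightarrow> (\<forall>w\<in>L2 \<Omega>. \<forall>t\<in>I.
     integrable (lebesgue_on {0..t}) (\<lambda>s. l2_inner \<Omega> (u' s) w) \<and>
     l2_inner \<Omega> (u t) w
       = l2_inner \<Omega> (u 0) w + (\<integral>s. l2_inner \<Omega> (u' s) w \<partial>lebesgue_on {0..t}))"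

section \<open>Finite elements\<close>

definition polyhedral_domain :: "'a::euclidean_space set \<Rightarrow> bool" where
  "polyhedral_domain \<Omega> \<longleftrightarrow> \<Omega> \<noteq> {} \<and> connected \<Omega> \<and>
     (\<exists>P. finite P \<and> (\<forall>p\<in>P. polytope p) \<and> \<Omega> = interior (\<Union>P))"

text \<open>Conforming partitions into convex polytopes, in particular simplicial ones.\<close>

definition fe_partition :: "'a::euclidean_space set \<Rightarrow> 'a set set \<Rightarrow> bool" where
  "fe_partition \<Omega> \<T> \<longleftrightarrow> finite \<T> \<and> (\<forall>K\<in>\<T>. polytope K \<and> interior K \<noteq> {}) \<and> \<Union>\<T> = closure \<Omega> \<and>
     (\<forall>K\<in>\<T>. \<forall>L\<in>\<T>. (K \<inter> L) face_of K \<and> (K \<inter> L) face_of L)"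

definition mesh_size :: "'a::euclidean_space set set \<Rightarrow> real" where
  "mesh_size \<T> = Max (diameter ` \<T>)"

definition quasi_uniform :: "'a::euclidean_space set set set \<Rightarrow> bool" where
  "quasi_uniform \<F> \<longleftrightarrow>
     (\<exists>\<rho>>0. \<forall>\<T>\<in>\<F>. \<forall>K\<in>\<T>. \<exists>x. cball x (\<rho> * mesh_size \<T>) \<subseteq> K)"

definition poly_deg_le :: "nat \<Rightarrow> (real^'d::finite \<Rightarrow> real) \<Rightarrow> bool" where
  "poly_deg_le k p \<longleftrightarrow> (\<exists>c :: ('d \<Rightarrow> nat) \<Rightarrow> real. \<forall>x.
     p x = (\<Sum>\<alpha> | (\<Sum>i\<in>UNIV. \<alpha> i) \<le> k. c \<alpha> * (\<Prod>i\<in>UNIV. (x $ i) ^ \<alpha> i)))"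

definition S_h :: "(real^'d::finite) set \<Rightarrow> (real^'d) set set \<Rightarrow> nat \<Rightarrow> (real^'d \<Rightarrow> real) set" where
  "S_h \<Omega> \<T> k = {v. continuous_on (closure \<Omega>) v \<and>
     (\<forall>K\<in>\<T>. \<exists>p. poly_deg_le k p \<and> (\<forall>x\<in>K. v x = p x))}"

definition V_h :: "(real^'d::finite) set \<Rightarrow> (real^'d) set set \<Rightarrow> nat \<Rightarrow> (real^'d \<Rightarrow> real^'d) set" where
  "V_h \<Omega> \<T> k = vec_fields (S_h \<Omega> \<T> k \<inter> H10 \<Omega>)"

definition is_basis ::
    "'a set \<Rightarrow> ('a \<Rightarrow> 'b::real_vector) set \<Rightarrow> nat \<Rightarrow> (nat \<Rightarrow> 'a \<Rightarrow> 'b) \<Rightarrow> bool" where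
  "is_basis \<Omega> V n \<phi> \<longleftrightarrow> (\<forall>i<n. \<phi> i \<in> V) \<and>
     (\<forall>v\<in>V. \<exists>c. \<forall>x\<in>\<Omega>. v x = (\<Sum>i<n. c i *\<^sub>R \<phi> i x)) \<and>
     (\<forall>c. (\<forall>x\<in>\<Omega>. (\<Sum>i<n. c i *\<^sub>R \<phi> i x) = 0) \<longrightarrow> (\<forall>i<n. c i = 0))"

text \<open>
  Elements of \<open>Q\<^sub>h = S\<^sub>h/\<real>\<close> are represented by functions in \<open>S\<^sub>h\<close>, which are identified when they
  differ by a constant. The following two definitions are equality in a quotient by the
  constants, and the notion of a family of representatives of a basis of such a quotient.
\<close>

definition eq_mod_const :: "'a set \<Rightarrow> ('a \<Rightarrow> real) \<Rightarrow> ('a \<Rightarrow> real) \<Rightarrow> bool" where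
  "eq_mod_const \<Omega> p q \<longleftrightarrow> (\<exists>a. \<forall>x\<in>\<Omega>. p x = q x + a)"

definition is_basis_mod_const ::
    "'a set \<Rightarrow> ('a \<Rightarrow> real) set \<Rightarrow> nat \<Rightarrow> (nat \<Rightarrow> 'a \<Rightarrow> real) \<Rightarrow> bool" where
  "is_basis_mod_const \<Omega> S n \<psi> \<longleftrightarrow> (\<forall>i<n. \<psi> i \<in> S) \<and>
     (\<forall>q\<in>S. \<exists>c. eq_mod_const \<Omega> q (\<lambda>x. \<Sum>i<n. c i * \<psi> i x)) \<and>
     (\<forall>c. eq_mod_const \<Omega> (\<lambda>x. \<Sum>i<n. c i * \<psi> i x) (\<lambda>x. 0) \<longrightarrow> (\<forall>i<n. c i = 0))"

text \<open>The \<open>L\<^sup>2(\<Omega>)\<close>-orthogonal projection onto \<open>V\<close> and its complement, unique up to null sets.\<close>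

definition l2_proj :: "'a::euclidean_space set \<Rightarrow> ('a \<Rightarrow> 'b::euclidean_space) set \<Rightarrow>
    ('a \<Rightarrow> 'b) \<Rightarrow> 'a \<Rightarrow> 'b" where
  "l2_proj \<Omega> V z = (SOME w. w \<in> V \<and> (\<forall>v\<in>V. l2_inner \<Omega> (\<lambda>x. z x - w x) v = 0))"

definition l2_perp :: "'a::euclidean_space set \<Rightarrow> ('a \<Rightarrow> 'b::euclidean_space) set \<Rightarrow>
    ('a \<Rightarrow> 'b) \<Rightarrow> 'a \<Rightarrow> 'b" where
  "l2_perp \<Omega> V z x = z x - l2_proj \<Omega> V z x"

text \<open>The span, in \<open>L\<^sup>2(\<Omega>)\<close>, of a family indexed by a finite set.\<close>

definition l2_span :: "'a::euclidean_space set \<Rightarrow> 'i set \<Rightarrow>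
    ('i \<Rightarrow> 'a \<Rightarrow> 'b::euclidean_space) \<Rightarrow> ('a \<Rightarrow> 'b) set" where
  "l2_span \<Omega> A g = {w \<in> L2 \<Omega>. \<exists>c. l2_eq \<Omega> w (\<lambda>x. \<Sum>a\<in>A. c a *\<^sub>R g a x)}"

section \<open>The linearised problem\<close>

text \<open>
  Measurability in the space variable is what makes the viscous term well-defined; together with
  continuity in the second argument it makes \<open>\<mu>\<close> a Caratheodory function.
\<close>

definition viscosity ::
    "(real^'d::finite) set \<Rightarrow> real \<Rightarrow> real \<Rightarrow> real \<Rightarrow> (real^'d \<Rightarrow> real \<Rightarrow> real) \<Rightarrow> bool" where
  "viscosity \<Omega> C\<^sub>\<mu> \<mu>inf \<mu>\<^sub>0 \<mu> \<longleftrightarrow> C\<^sub>\<mu> > 0 \<and> \<mu>\<^sub>0 > \<mu>inf \<and> \<mu>inf > 0 \<and>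
     (\<forall>x\<in>closure \<Omega>. \<forall>s\<ge>0. \<forall>t\<ge>0.
        \<bar>\<mu> x t - \<mu> x s\<bar> \<le> C\<^sub>\<mu> * \<bar>t - s\<bar> \<and> \<mu>inf \<le> \<mu> x t \<and> \<mu> x t \<le> \<mu>\<^sub>0) \<and>
     (\<forall>t\<ge>0. (\<lambda>x. \<mu> x t) \<in> borel_measurable (lebesgue_on \<Omega>))"

definition conv :: "(real^'d::finite) set \<Rightarrow> (real^'d \<Rightarrow> real^'d) \<Rightarrow> (real^'d \<Rightarrow> real^'d) \<Rightarrow>
    real^'d \<Rightarrow> real^'d" where
  "conv \<Omega> u v x = vgrad \<Omega> v x *v u x + (1/2 * vdiv \<Omega> u x) *\<^sub>R v x"

definition conv_form :: "(real^'d::finite) set \<Rightarrow> (real^'d \<Rightarrow> real^'d) \<Rightarrow> (real^'d \<Rightarrow> real^'d) \<Rightarrow>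
    (real^'d \<Rightarrow> real^'d) \<Rightarrow> real" where
  "conv_form \<Omega> u v w = (\<integral>x. conv \<Omega> u v x \<bullet> w x \<partial>lebesgue_on \<Omega>)"

definition subscales1 :: "(real^'d::finite) set \<Rightarrow> (real^'d) set set \<Rightarrow> nat \<Rightarrow>
    nat \<Rightarrow> (nat \<Rightarrow> real^'d \<Rightarrow> real^'d) \<Rightarrow> (real^'d \<Rightarrow> real^'d) set" where
  "subscales1 \<Omega> \<T> k n \<phi> = l2_span \<Omega> ({..<n} \<times> {..<n})
     (\<lambda>(i, j). l2_perp \<Omega> (vec_fields (S_h \<Omega> \<T> k)) (conv \<Omega> (\<phi> i) (\<phi> j)))"

definition subscales2 :: "(real^'d::finite) set \<Rightarrow> (real^'d) set set \<Rightarrow> nat \<Rightarrow>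
    nat \<Rightarrow> (nat \<Rightarrow> real^'d \<Rightarrow> real) \<Rightarrow> (real^'d \<Rightarrow> real^'d) set" where
  "subscales2 \<Omega> \<T> k n \<psi> = l2_span \<Omega> {..<n}
     (\<lambda>i. l2_perp \<Omega> (vec_fields (S_h \<Omega> \<T> k)) (grad \<Omega> (\<psi> i)))"

definition tau1 :: "(real^'d::finite) set \<Rightarrow> real \<Rightarrow> real \<Rightarrow> real \<Rightarrow> real \<Rightarrow>
    (real^'d \<Rightarrow> real^'d) \<Rightarrow> real" where
  "tau1 \<Omega> h c\<^sub>1 c\<^sub>2 m v = inverse (c\<^sub>1 * m / h\<^sup>2 + c\<^sub>2 * linf_norm \<Omega> v / h)"

definition tau2 :: "(real^'d::finite) set \<Rightarrow> real \<Rightarrow> real \<Rightarrow> real \<Rightarrow> real \<Rightarrow>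
    (real^'d \<Rightarrow> real^'d) \<Rightarrow> real" where
  "tau2 \<Omega> h c\<^sub>1 c\<^sub>2 m v = h\<^sup>2 / (c\<^sub>1 * tau1 \<Omega> h c\<^sub>1 c\<^sub>2 m v)"

text \<open>
  The stability inequality for the projections, with constant \<open>\<beta>\<^sub>0\<close>, on pressure gradients
  \<open>z\<^sub>h = \<nabla>q\<^sub>h\<close>. It cannot hold for all piecewise polynomial vector fields: both projections on
  the right vanish on the \<open>L\<^sup>2\<close>-orthogonal complement of \<open>V\<^sub>h\<close> in \<open>S\<^sub>h\<^sup>d\<close>, which is never trivial
  because constant fields belong to \<open>S\<^sub>h\<^sup>d\<close> but not to \<open>V\<^sub>h\<close>.
\<close>

definition projection_stability ::
    "(real^'d::finite) set \<Rightarrow> (real^'d) set set \<Rightarrow> nat \<Rightarrow> real \<Rightarrow> bool" where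
  "projection_stability \<Omega> \<T> k \<beta>\<^sub>0 \<longleftrightarrow> (\<forall>q\<in>S_h \<Omega> \<T> k.
     let z = grad \<Omega> q; a = l2_proj \<Omega> (V_h \<Omega> \<T> k) z; b = l2_perp \<Omega> (vec_fields (S_h \<Omega> \<T> k)) z
     in l2_norm \<Omega> z \<le> 1 / \<beta>\<^sub>0 * l2_norm \<Omega> (\<lambda>x. a x + b x) \<and>
        1 / \<beta>\<^sub>0 * l2_norm \<Omega> (\<lambda>x. a x + b x) \<le> 1 / \<beta>\<^sub>0 * (l2_norm \<Omega> a + l2_norm \<Omega> b))"

text \<open>
  The discrete continuity equation, imposed on the initial values. Solutions are continuous in
  time, so that they satisfy it at time 0, and no solution exists for initial data violating it
  (for instance \<open>P\<^sub>u\<^sub>,\<^sub>0 \<nabla>q + P\<^sub>u\<^sup>\<bottom> \<nabla>q\<close> with a nonconstant \<open>q\<close> in \<open>S\<^sub>h\<close>, if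
  \<open>projection_stability\<close> holds).
\<close>

definition compatible_initial_data :: "(real^'d::finite) set \<Rightarrow> (real^'d) set set \<Rightarrow> nat \<Rightarrow>
    (real^'d \<Rightarrow> real^'d) set \<Rightarrow> (real^'d \<Rightarrow> real^'d) \<Rightarrow> bool" where
  "compatible_initial_data \<Omega> \<T> k V\<^sub>2 u\<^sub>0 \<longleftrightarrow> (\<forall>q\<in>S_h \<Omega> \<T> k.
     l2_inner \<Omega> q (vdiv \<Omega> (l2_proj \<Omega> (V_h \<Omega> \<T> k) u\<^sub>0))
       - l2_inner \<Omega> (grad \<Omega> q) (l2_proj \<Omega> V\<^sub>2 u\<^sub>0) = 0)"

text \<open>
  \<open>V\<^sub>1\<close>, \<open>V\<^sub>2\<close> are the subscale spaces, \<open>w\<close> is the given velocity, \<open>m\<close> the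
  characteristic viscosity as a function of time.
\<close>

definition linearised_solution :: "(real^'d::finite) set \<Rightarrow> (real^'d) set set \<Rightarrow> nat \<Rightarrow>
    (real^'d \<Rightarrow> real^'d) set \<Rightarrow> (real^'d \<Rightarrow> real^'d) set \<Rightarrow> real \<Rightarrow> real \<Rightarrow>
    (real^'d \<Rightarrow> real \<Rightarrow> real) \<Rightarrow> (real \<Rightarrow> real) \<Rightarrow> (real \<Rightarrow> real^'d \<Rightarrow> real^'d) \<Rightarrow>
    (real \<Rightarrow> 'd \<Rightarrow> (real^'d \<Rightarrow> real) \<Rightarrow> real) \<Rightarrow> (real^'d \<Rightarrow> real^'d) \<Rightarrow> real set \<Rightarrow>
    (real \<Rightarrow> real^'d \<Rightarrow> real^'d) \<Rightarrow> (real \<Rightarrow> real^'d \<Rightarrow> real) \<Rightarrow>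
    (real \<Rightarrow> real^'d \<Rightarrow> real^'d) \<Rightarrow> (real \<Rightarrow> real^'d \<Rightarrow> real^'d) \<Rightarrow> bool" where
  "linearised_solution \<Omega> \<T> k V\<^sub>1 V\<^sub>2 c\<^sub>1 c\<^sub>2 \<mu> m w f u\<^sub>0 I u p u\<^sub>1 u\<^sub>2 \<longleftrightarrow>
     (\<forall>t\<in>I. u t \<in> V_h \<Omega> \<T> k \<and> p t \<in> S_h \<Omega> \<T> k \<and> u\<^sub>1 t \<in> V\<^sub>1 \<and> u\<^sub>2 t \<in> V\<^sub>2) \<and>
     (\<exists>u' u\<^sub>1' u\<^sub>2'.
        (\<forall>t\<in>I. u' t \<in> V_h \<Omega> \<T> k \<and> u\<^sub>1' t \<in> V\<^sub>1 \<and> u\<^sub>2' t \<in> V\<^sub>2) \<and>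
        has_time_deriv \<Omega> I u u' \<and> has_time_deriv \<Omega> I u\<^sub>1 u\<^sub>1' \<and> has_time_deriv \<Omega> I u\<^sub>2 u\<^sub>2' \<and>
        (AE t in lebesgue_on I.
           let \<tau>\<^sub>1 = tau1 \<Omega> (mesh_size \<T>) c\<^sub>1 c\<^sub>2 (m t) (w t);
               \<tau>\<^sub>2 = tau2 \<Omega> (mesh_size \<T>) c\<^sub>1 c\<^sub>2 (m t) (w t)
           in (\<forall>v\<in>V_h \<Omega> \<T> k.
                 l2_inner \<Omega> (u' t) v
                 + l2_inner \<Omega> (\<lambda>x. (2 * \<mu> x (norm (sym_grad \<Omega> (w t) x))) *\<^sub>R sym_grad \<Omega> (u t) x)
                     (sym_grad \<Omega> v)
                 + conv_form \<Omega> (w t) (u t) v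
                 - l2_inner \<Omega> (p t) (vdiv \<Omega> v)
                 + l2_inner \<Omega> (\<lambda>x. \<tau>\<^sub>2 * vdiv \<Omega> v x) (l2_perp \<Omega> (S_h \<Omega> \<T> k) (vdiv \<Omega> (u t)))
                 - conv_form \<Omega> (w t) v (u\<^sub>1 t)
                 = pairing (f t) v) \<and>
              (\<forall>q\<in>S_h \<Omega> \<T> k.
                 l2_inner \<Omega> q (vdiv \<Omega> (u t)) - l2_inner \<Omega> (grad \<Omega> q) (u\<^sub>2 t) = 0) \<and>
              (\<forall>v\<^sub>1\<in>V\<^sub>1.
                 l2_inner \<Omega> (u\<^sub>1' t) v\<^sub>1 + inverse \<tau>\<^sub>1 * l2_inner \<Omega> (u\<^sub>1 t) v\<^sub>1
                 + conv_form \<Omega> (w t) (u t) v\<^sub>1 = 0) \<and>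
              (\<forall>v\<^sub>2\<in>V\<^sub>2.
                 l2_inner \<Omega> (u\<^sub>2' t) v\<^sub>2 + inverse \<tau>\<^sub>1 * l2_inner \<Omega> (u\<^sub>2 t) v\<^sub>2
                 + l2_inner \<Omega> (grad \<Omega> (p t)) v\<^sub>2 = 0))) \<and>
     l2_eq \<Omega> (u 0) (l2_proj \<Omega> (V_h \<Omega> \<T> k) u\<^sub>0) \<and>
     l2_eq \<Omega> (u\<^sub>1 0) (l2_proj \<Omega> V\<^sub>1 u\<^sub>0) \<and>
     l2_eq \<Omega> (u\<^sub>2 0) (l2_proj \<Omega> V\<^sub>2 u\<^sub>0)"

end

theory Submission
  imports Defs
begin

text \<open>
  The triple \<open>U = (u\<^sub>h, u\<^sub>1, u\<^sub>2)\<close> lives in a finite-dimensional subspace \<open>W\<close> of \<open>L\<^sup>2(\<Omega>)\<close>, and the discrete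
  continuity equation confines it to a subspace \<open>Z\<close>. Tested with \<open>Z\<close> only, the problem is a linear
  system of ordinary differential equations in \<open>L\<^sup>2\<close>-orthonormal coordinates, with coefficients
  that are integrable in time; Picard iteration solves it. The residual of the solution vanishes on
  \<open>Z\<close>, so it is represented by an element of the orthogonal complement of \<open>Z\<close>, and this complement
  consists of the functionals \<open>(q, div v) - (\<nabla>q, v\<^sub>2)\<close>: the pressure is the Lagrange multiplier.

  Testing with \<open>U\<close> itself, the pressure drops out, the convective terms cancel because the convective
  form is skew-symmetric and the two coupling terms with \<open>u\<^sub>1\<close> are opposite, and Korn's and Young's
  inequalities leave the energy estimate. Applied to the difference of two solutions it gives
  uniqueness of \<open>U\<close>. If \<open>(q, div v) - (\<nabla>q, v\<^sub>2) = 0\<close> for all \<open>v\<close> and \<open>v\<^sub>2\<close>, then both projections of \<open>\<nabla>q\<close>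
  occurring in the stability inequality vanish, hence \<open>\<nabla>q = 0\<close> and \<open>q\<close> is constant.
\<close>

section \<open>Finite-dimensional subspaces of the Lebesgue space\<close>

text \<open>The obstacle is that nothing here lives in a quotient: \<open>grad\<close> and
  \<open>l2_proj\<close>, hence \<open>vdiv\<close> and \<open>conv\<close>, are choices determined
  only up to null sets, so that even \<open>vdiv \<Omega> (\<lambda>x. 0)\<close> vanishes only
  almost everywhere. Linearity is therefore carried by predicates (\<open>lin_closed\<close>,
  \<open>ae_linear\<close>, \<open>ae_functional\<close>) that tolerate null sets, and coefficients
  in an orthonormal basis turn such classes into honest real functions of time. This matters most
  for measurability: \<open>sym_grad \<Omega> (w s)\<close> is chosen separately for each
  \<open>s\<close>, and only its expansion in fixed gradients is jointly measurable in time and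
  space. As the coefficients are merely locally integrable, derivatives exist only through integral
  equations; the product rule behind the energy identity comes from Fubini's theorem, and the rule
  for powers that follows from it supplies the factorials for the Picard iteration. The evolution
  can be posed in \<open>Z\<close> alone because the compatibility of the data says precisely that
  the initial triple lies in \<open>Z\<close>.\<close>

lemma L2_measurable[measurable_dest]: "u \<in> L2 \<Omega> \<Longrightarrow> u \<in> borel_measurable (lebesgue_on \<Omega>)"
  by (simp add: L2_def)

lemma L2_integrable_inner:
  assumes "u \<in> L2 \<Omega>" "v \<in> L2 \<Omega>"
  shows "integrable (lebesgue_on \<Omega>) (\<lambda>x. u x \<bullet> v x)"
proof (rule Bochner_Integration.integrable_bound)
  show "integrable (lebesgue_on \<Omega>) (\<lambda>x. (norm (u x))\<^sup>2 + (norm (v x))\<^sup>2)"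
    using assms by (auto simp: L2_def)
  show "(\<lambda>x. u x \<bullet> v x) \<in> borel_measurable (lebesgue_on \<Omega>)"
    using assms by (auto simp: L2_def)
  have "\<bar>u x \<bullet> v x\<bar> \<le> (norm (u x))\<^sup>2 + (norm (v x))\<^sup>2" for x
  proof -
    have "\<bar>u x \<bullet> v x\<bar> \<le> norm (u x) * norm (v x)" by (rule Cauchy_Schwarz_ineq2)
    also have "\<dots> \<le> (norm (u x))\<^sup>2 + (norm (v x))\<^sup>2"
      using sum_squares_bound[of "norm (u x)" "norm (v x)"] mult_nonneg_nonneg[of "norm (u x)" "norm (v x)"]
      by (simp add: mult.assoc del: mult_nonneg_nonneg)
    finally show ?thesis .
  qed
  then show "AE x in lebesgue_on \<Omega>. norm (u x \<bullet> v x) \<le> norm ((norm (u x))\<^sup>2 + (norm (v x))\<^sup>2)"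
    by auto
qed

lemma L2_lincomb:
  assumes "u \<in> L2 \<Omega>" "v \<in> L2 \<Omega>"
  shows "(\<lambda>x. a *\<^sub>R u x + b *\<^sub>R v x) \<in> L2 \<Omega>"
proof -
  have "integrable (lebesgue_on \<Omega>)
      (\<lambda>x. a\<^sup>2 * (u x \<bullet> u x) + 2 * a * b * (u x \<bullet> v x) + b\<^sup>2 * (v x \<bullet> v x))"
    using L2_integrable_inner[OF assms(1) assms(1)] L2_integrable_inner[OF assms]
      L2_integrable_inner[OF assms(2) assms(2)] by auto
  also have "(\<lambda>x. a\<^sup>2 * (u x \<bullet> u x) + 2 * a * b * (u x \<bullet> v x) + b\<^sup>2 * (v x \<bullet> v x))
      = (\<lambda>x. (norm (a *\<^sub>R u x + b *\<^sub>R v x))\<^sup>2)"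
    unfolding power2_norm_eq_inner
    by (simp add: fun_eq_iff inner_left_distrib inner_right_distrib inner_commute power2_eq_square
        algebra_simps)
  finally show ?thesis using assms by (auto simp: L2_def)
qed

lemma L2_zero[simp]: "(\<lambda>x. 0) \<in> L2 \<Omega>"
  by (simp add: L2_def)

lemma L2_scale: "u \<in> L2 \<Omega> \<Longrightarrow> (\<lambda>x. a *\<^sub>R u x) \<in> L2 \<Omega>"
  using L2_lincomb[of u \<Omega> u a 0] by simp

lemma L2_add: "u \<in> L2 \<Omega> \<Longrightarrow> v \<in> L2 \<Omega> \<Longrightarrow> (\<lambda>x. u x + v x) \<in> L2 \<Omega>"
  using L2_lincomb[of u \<Omega> v 1 1] by simp

lemma L2_diff: "u \<in> L2 \<Omega> \<Longrightarrow> v \<in> L2 \<Omega> \<Longrightarrow> (\<lambda>x. u x - v x) \<in> L2 \<Omega>"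
  using L2_lincomb[of u \<Omega> v 1 "-1"] by simp

lemma L2_sum: "(\<And>i. i \<in> A \<Longrightarrow> u i \<in> L2 \<Omega>) \<Longrightarrow> (\<lambda>x. \<Sum>i\<in>A. c i *\<^sub>R u i x) \<in> L2 \<Omega>"
  by (induction A rule: infinite_finite_induct) (auto intro!: L2_add L2_scale)

text \<open>The workhorse for membership in \<open>L2\<close>: measurability plus domination by a
  multiple of a function already known to be there. The sign of \<open>M\<close> is free, since only
  its square enters the majorant.\<close>

lemma L2_bounded_mult:
  assumes "u \<in> L2 \<Omega>" "v \<in> borel_measurable (lebesgue_on \<Omega>)"
    and "AE x in lebesgue_on \<Omega>. norm (v x) \<le> M * norm (u x)"
  shows "v \<in> L2 \<Omega>"
proof -
  have "integrable (lebesgue_on \<Omega>) (\<lambda>x. (norm (v x))\<^sup>2)"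
  proof (rule Bochner_Integration.integrable_bound)
    show "integrable (lebesgue_on \<Omega>) (\<lambda>x. M\<^sup>2 * (norm (u x))\<^sup>2)"
      using assms by (auto simp: L2_def)
    show "AE x in lebesgue_on \<Omega>. norm ((norm (v x))\<^sup>2) \<le> norm (M\<^sup>2 * (norm (u x))\<^sup>2)"
      using assms(3)
    proof eventually_elim
      case (elim x)
      then have "(norm (v x))\<^sup>2 \<le> (M * norm (u x))\<^sup>2" by (intro power_mono) auto
      then show ?case by (simp add: power_mult_distrib)
    qed
  qed (use assms(2) in auto)
  then show ?thesis using assms(2) by (simp add: L2_def)
qed

section \<open>Inner product and norm on functions modulo null sets\<close>

lemma l2_inner_commute: "l2_inner \<Omega> u v = l2_inner \<Omega> v u"
  by (simp add: l2_inner_def inner_commute)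

lemma l2_inner_lincomb_left:
  assumes "u \<in> L2 \<Omega>" "v \<in> L2 \<Omega>" "w \<in> L2 \<Omega>"
  shows "l2_inner \<Omega> (\<lambda>x. a *\<^sub>R u x + b *\<^sub>R v x) w = a * l2_inner \<Omega> u w + b * l2_inner \<Omega> v w"
  using L2_integrable_inner[OF assms(1,3)] L2_integrable_inner[OF assms(2,3)]
  by (simp add: l2_inner_def inner_left_distrib)

lemma l2_inner_lincomb_right:
  assumes "u \<in> L2 \<Omega>" "v \<in> L2 \<Omega>" "w \<in> L2 \<Omega>"
  shows "l2_inner \<Omega> w (\<lambda>x. a *\<^sub>R u x + b *\<^sub>R v x) = a * l2_inner \<Omega> w u + b * l2_inner \<Omega> w v"
  using l2_inner_lincomb_left[OF assms] by (simp add: l2_inner_commute)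

lemma l2_inner_add_left:
  "u \<in> L2 \<Omega> \<Longrightarrow> v \<in> L2 \<Omega> \<Longrightarrow> w \<in> L2 \<Omega> \<Longrightarrow>
    l2_inner \<Omega> (\<lambda>x. u x + v x) w = l2_inner \<Omega> u w + l2_inner \<Omega> v w"
  using l2_inner_lincomb_left[of u \<Omega> v w 1 1] by simp

lemma l2_inner_diff_left:
  "u \<in> L2 \<Omega> \<Longrightarrow> v \<in> L2 \<Omega> \<Longrightarrow> w \<in> L2 \<Omega> \<Longrightarrow>
    l2_inner \<Omega> (\<lambda>x. u x - v x) w = l2_inner \<Omega> u w - l2_inner \<Omega> v w"
  using l2_inner_lincomb_left[of u \<Omega> v w 1 "-1"] by simp

lemma l2_inner_diff_right:
  "u \<in> L2 \<Omega> \<Longrightarrow> v \<in> L2 \<Omega> \<Longrightarrow> w \<in> L2 \<Omega> \<Longrightarrow>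
    l2_inner \<Omega> w (\<lambda>x. u x - v x) = l2_inner \<Omega> w u - l2_inner \<Omega> w v"
  using l2_inner_lincomb_right[of u \<Omega> v w 1 "-1"] by simp

lemma l2_inner_scale_left: "l2_inner \<Omega> (\<lambda>x. a *\<^sub>R u x) w = a * l2_inner \<Omega> u w"
  by (simp add: l2_inner_def)

lemma l2_inner_scale_right: "l2_inner \<Omega> w (\<lambda>x. a *\<^sub>R u x) = a * l2_inner \<Omega> w u"
  by (simp add: l2_inner_def)

lemma l2_inner_zero[simp]: "l2_inner \<Omega> (\<lambda>x. 0) w = 0" "l2_inner \<Omega> w (\<lambda>x. 0) = 0"
  by (simp_all add: l2_inner_def)

lemma l2_inner_sum_left:
  assumes "\<And>i. i \<in> A \<Longrightarrow> u i \<in> L2 \<Omega>" "w \<in> L2 \<Omega>"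
  shows "l2_inner \<Omega> (\<lambda>x. \<Sum>i\<in>A. c i *\<^sub>R u i x) w = (\<Sum>i\<in>A. c i * l2_inner \<Omega> (u i) w)"
  using assms(1)
proof (induction A rule: infinite_finite_induct)
  case (insert i A)
  then show ?case
    by (simp add: l2_inner_add_left L2_scale L2_sum assms(2) l2_inner_scale_left)
qed auto

lemma l2_inner_sum_right:
  assumes "\<And>i. i \<in> A \<Longrightarrow> u i \<in> L2 \<Omega>" "w \<in> L2 \<Omega>"
  shows "l2_inner \<Omega> w (\<lambda>x. \<Sum>i\<in>A. c i *\<^sub>R u i x) = (\<Sum>i\<in>A. c i * l2_inner \<Omega> w (u i))"
  using l2_inner_sum_left[of A u \<Omega> w c, OF assms] by (simp add: l2_inner_commute)

lemma l2_inner_cong: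
  assumes "l2_eq \<Omega> u u'" "l2_eq \<Omega> v v'"
    and "u \<in> L2 \<Omega>" "v \<in> L2 \<Omega>" "u' \<in> L2 \<Omega>" "v' \<in> L2 \<Omega>"
  shows "l2_inner \<Omega> u v = l2_inner \<Omega> u' v'"
  unfolding l2_inner_def
proof (rule integral_cong_AE)
  show "AE x in lebesgue_on \<Omega>. u x \<bullet> v x = u' x \<bullet> v' x"
    using assms(1,2) unfolding l2_eq_def by eventually_elim simp
qed (use assms in \<open>auto dest: L2_measurable\<close>)

lemma l2_inner_cong_left:
  assumes "l2_eq \<Omega> u u'" "u \<in> L2 \<Omega>" "v \<in> L2 \<Omega>" "u' \<in> L2 \<Omega>"
  shows "l2_inner \<Omega> u v = l2_inner \<Omega> u' v"
  by (rule l2_inner_cong) (use assms in \<open>auto simp: l2_eq_def\<close>)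

lemma l2_eq_refl[simp]: "l2_eq \<Omega> u u" by (simp add: l2_eq_def)
lemma l2_eq_sym: "l2_eq \<Omega> u v \<Longrightarrow> l2_eq \<Omega> v u"
  unfolding l2_eq_def by (erule AE_mp) auto
lemma l2_eq_trans[trans]:
  assumes "l2_eq \<Omega> u v" "l2_eq \<Omega> v w"
  shows "l2_eq \<Omega> u w"
  using assms unfolding l2_eq_def by eventually_elim simp

lemma l2_eq_lincomb:
  assumes "l2_eq \<Omega> u u'" "l2_eq \<Omega> v v'"
  shows "l2_eq \<Omega> (\<lambda>x. a *\<^sub>R u x + b *\<^sub>R v x) (\<lambda>x. a *\<^sub>R u' x + b *\<^sub>R v' x)"
  using assms unfolding l2_eq_def by eventually_elim simp

lemma l2_inner_ge_0: "0 \<le> l2_inner \<Omega> u u"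
  by (simp add: l2_inner_def)

lemma l2_norm_power2: "(l2_norm \<Omega> u)\<^sup>2 = l2_inner \<Omega> u u"
  by (simp add: l2_norm_def l2_inner_ge_0)

lemma l2_norm_ge_0[simp]: "0 \<le> l2_norm \<Omega> u"
  by (simp add: l2_norm_def l2_inner_ge_0)

lemma l2_inner_self_eq_0:
  assumes "u \<in> L2 \<Omega>"
  shows "l2_inner \<Omega> u u = 0 \<longleftrightarrow> l2_eq \<Omega> u (\<lambda>x. 0)"
proof -
  have "l2_inner \<Omega> u u = 0 \<longleftrightarrow> (AE x in lebesgue_on \<Omega>. u x \<bullet> u x = 0)"
    unfolding l2_inner_def
    by (rule integral_nonneg_eq_0_iff_AE) (auto intro: L2_integrable_inner assms)
  then show ?thesis by (simp add: l2_eq_def)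
qed

lemma l2_norm_eq_0: "u \<in> L2 \<Omega> \<Longrightarrow> l2_norm \<Omega> u = 0 \<longleftrightarrow> l2_eq \<Omega> u (\<lambda>x. 0)"
  using l2_inner_self_eq_0[of u \<Omega>] by (simp add: l2_norm_def)

lemma l2_norm_cong: "l2_eq \<Omega> u v \<Longrightarrow> u \<in> L2 \<Omega> \<Longrightarrow> v \<in> L2 \<Omega> \<Longrightarrow> l2_norm \<Omega> u = l2_norm \<Omega> v"
  unfolding l2_norm_def by (simp add: l2_inner_cong[of \<Omega> u v u v])

lemma l2_Cauchy_Schwarz:
  assumes "u \<in> L2 \<Omega>" "v \<in> L2 \<Omega>"
  shows "\<bar>l2_inner \<Omega> u v\<bar> \<le> l2_norm \<Omega> u * l2_norm \<Omega> v"
proof -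
  let ?a = "l2_norm \<Omega> u" and ?b = "l2_norm \<Omega> v"
  have expand: "l2_inner \<Omega> (\<lambda>x. s *\<^sub>R u x + t *\<^sub>R v x) (\<lambda>x. s *\<^sub>R u x + t *\<^sub>R v x)
      = s\<^sup>2 * ?a\<^sup>2 + 2 * s * t * l2_inner \<Omega> u v + t\<^sup>2 * ?b\<^sup>2" for s t
    using assms unfolding l2_norm_power2
    by (simp add: l2_inner_lincomb_left l2_inner_lincomb_right L2_lincomb
        l2_inner_commute[of \<Omega> v u] power2_eq_square algebra_simps)
  show ?thesis
  proof (cases "?a = 0 \<or> ?b = 0")
    case True
    then have "l2_inner \<Omega> u v = 0"
    proof
      assume "?a = 0"
      then have "l2_eq \<Omega> u (\<lambda>x. 0)" using assms by (simp add: l2_norm_eq_0)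
      then show ?thesis using l2_inner_cong_left[of \<Omega> u "\<lambda>x. 0" v] assms by simp
    next
      assume "?b = 0"
      then have "l2_eq \<Omega> v (\<lambda>x. 0)" using assms by (simp add: l2_norm_eq_0)
      then show ?thesis using l2_inner_cong[of \<Omega> u u v "\<lambda>x. 0"] assms by simp
    qed
    then show ?thesis by auto
  next
    case False
    then have pos: "?a > 0" "?b > 0" using l2_norm_ge_0[of \<Omega> u] l2_norm_ge_0[of \<Omega> v] by linarith+
    \<comment> \<open>Expanding the squared norm of \<open>?b * u + ?a * v\<close> gives
      \<open>2 * ?a * ?b\<close> times the bracket; the change of sign below treats the other side
      of the absolute value. The degenerate case was split off so that this factor can be
      cancelled.\<close>
    have "0 \<le> 2 * ?a * ?b * (?a * ?b + l2_inner \<Omega> u v)"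
      using l2_inner_ge_0[of \<Omega> "\<lambda>x. ?b *\<^sub>R u x + ?a *\<^sub>R v x"] unfolding expand
      by (simp add: power2_eq_square algebra_simps)
    moreover have "0 \<le> 2 * ?a * ?b * (?a * ?b - l2_inner \<Omega> u v)"
      using l2_inner_ge_0[of \<Omega> "\<lambda>x. ?b *\<^sub>R u x + (- ?a) *\<^sub>R v x"] unfolding expand
      by (simp add: power2_eq_square algebra_simps)
    moreover have "0 < 2 * ?a * ?b" using pos by simp
    ultimately have "0 \<le> ?a * ?b + l2_inner \<Omega> u v" "0 \<le> ?a * ?b - l2_inner \<Omega> u v"
      by (simp_all only: zero_le_mult_iff) linarith+
    then show ?thesis by linarith
  qed
qed

section \<open>Orthonormal bases and projections in finite-dimensional function spaces\<close>

definition lin_closed :: "('a \<Rightarrow> 'b::real_vector) set \<Rightarrow> bool" where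
  "lin_closed W \<longleftrightarrow> (\<lambda>x. 0) \<in> W \<and> (\<forall>u\<in>W. \<forall>v\<in>W. \<forall>a b. (\<lambda>x. a *\<^sub>R u x + b *\<^sub>R v x) \<in> W)"

lemma lin_closedD:
  assumes "lin_closed W"
  shows lin_closed_zero: "(\<lambda>x. 0) \<in> W"
    and lin_closed_lincomb: "\<And>u v a b. u \<in> W \<Longrightarrow> v \<in> W \<Longrightarrow> (\<lambda>x. a *\<^sub>R u x + b *\<^sub>R v x) \<in> W"
  using assms by (auto simp: lin_closed_def)

lemma lin_closed_scale: "lin_closed W \<Longrightarrow> u \<in> W \<Longrightarrow> (\<lambda>x. a *\<^sub>R u x) \<in> W"
  using lin_closed_lincomb[of W u u a 0] by simp

lemma lin_closed_add: "lin_closed W \<Longrightarrow> u \<in> W \<Longrightarrow> v \<in> W \<Longrightarrow> (\<lambda>x. u x + v x) \<in> W"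
  using lin_closed_lincomb[of W u v 1 1] by simp

lemma lin_closed_diff: "lin_closed W \<Longrightarrow> u \<in> W \<Longrightarrow> v \<in> W \<Longrightarrow> (\<lambda>x. u x - v x) \<in> W"
  using lin_closed_lincomb[of W u v 1 "-1"] by simp

lemma lin_closed_sum:
  "lin_closed W \<Longrightarrow> (\<And>i. i \<in> A \<Longrightarrow> u i \<in> W) \<Longrightarrow> (\<lambda>x. \<Sum>i\<in>A. c i *\<^sub>R u i x) \<in> W"
  by (induction A rule: infinite_finite_induct)
    (auto intro!: lin_closed_add lin_closed_scale lin_closed_zero)

lemma lin_closed_L2: "lin_closed (L2 \<Omega>)"
  by (simp add: lin_closed_def L2_lincomb)

text \<open>The spanning functions may lie outside \<open>W\<close> and span only up to null sets.
  Finite dimension is thus inherited by every linear subspace with the same family.\<close>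

definition l2_fin_dim :: "'a::euclidean_space set \<Rightarrow> ('a \<Rightarrow> 'b::euclidean_space) set \<Rightarrow> bool" where
  "l2_fin_dim \<Omega> W \<longleftrightarrow> W \<subseteq> L2 \<Omega> \<and> lin_closed W \<and> (\<exists>(n::nat) b. (\<forall>i<n. b i \<in> L2 \<Omega>) \<and>
     (\<forall>w\<in>W. \<exists>c. l2_eq \<Omega> w (\<lambda>x. \<Sum>i<n. c i *\<^sub>R b i x)))"

definition l2_onb :: "'a::euclidean_space set \<Rightarrow> ('a \<Rightarrow> 'b::euclidean_space) set \<Rightarrow> nat \<Rightarrow>
    (nat \<Rightarrow> 'a \<Rightarrow> 'b) \<Rightarrow> bool" where
  "l2_onb \<Omega> W N e \<longleftrightarrow> (\<forall>i<N. e i \<in> W) \<and>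
     (\<forall>i<N. \<forall>j<N. l2_inner \<Omega> (e i) (e j) = (if i = j then 1 else 0)) \<and>
     (\<forall>w\<in>W. l2_eq \<Omega> w (\<lambda>x. \<Sum>i<N. l2_inner \<Omega> w (e i) *\<^sub>R e i x))"

lemma orthonormal_coeff:
  fixes N :: nat
  assumes "\<And>i. i < N \<Longrightarrow> e i \<in> L2 \<Omega>" "j < N"
    and "\<And>i j. i < N \<Longrightarrow> j < N \<Longrightarrow> l2_inner \<Omega> (e i) (e j) = (if i = j then 1 else (0::real))"
  shows "l2_inner \<Omega> (\<lambda>x. \<Sum>i<N. c i *\<^sub>R e i x) (e j) = c j"
proof -
  have "l2_inner \<Omega> (\<lambda>x. \<Sum>i<N. c i *\<^sub>R e i x) (e j) = (\<Sum>i<N. c i * l2_inner \<Omega> (e i) (e j))"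
    using assms by (intro l2_inner_sum_left) auto
  also have "\<dots> = (\<Sum>i<N. if i = j then c j else 0)"
    using assms by (intro sum.cong) auto
  also have "\<dots> = c j" using assms(2) by simp
  finally show ?thesis .
qed

text \<open>Gram-Schmidt, organised as an induction on the number of spanning functions. Since these
  need not belong to \<open>W\<close>, the induction runs over all subspaces: the elements of
  \<open>W\<close> that are combinations of the first \<open>n\<close> functions form a subspace
  \<open>W'\<close> of codimension at most one, and one normalised vector orthogonal to
  \<open>W'\<close> completes its basis.\<close>

lemma l2_onb_exists_aux:
  fixes b :: "nat \<Rightarrow> 'a::euclidean_space \<Rightarrow> 'b::euclidean_space"
  assumes "W \<subseteq> L2 \<Omega>" "lin_closed W" "\<And>i. i < n \<Longrightarrow> b i \<in> L2 \<Omega>"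
    and "\<And>w. w \<in> W \<Longrightarrow> \<exists>c. l2_eq \<Omega> w (\<lambda>x. \<Sum>i<n. c i *\<^sub>R b i x)"
  shows "\<exists>N e. l2_onb \<Omega> W N e"
  using assms
proof (induction n arbitrary: W)
  case 0
  have "l2_onb \<Omega> W 0 (\<lambda>i x. 0)" using 0(4) by (auto simp: l2_onb_def)
  then show ?case by blast
next
  case (Suc n)
  define W' where "W' = {w \<in> W. \<exists>c. l2_eq \<Omega> w (\<lambda>x. \<Sum>i<n. c i *\<^sub>R b i x)}"
  have W'_lin: "lin_closed W'"
    unfolding lin_closed_def
  proof (intro conjI ballI allI)
    have "l2_eq \<Omega> (\<lambda>x. 0) (\<lambda>x. \<Sum>i<n. 0 *\<^sub>R b i x)" by simp
    then show "(\<lambda>x. 0) \<in> W'"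
      unfolding W'_def using lin_closed_zero[OF Suc.prems(2)] by (auto intro!: exI[of _ "\<lambda>i. 0"])
    fix u v s t assume "u \<in> W'" "v \<in> W'"
    then obtain c d where cd: "l2_eq \<Omega> u (\<lambda>x. \<Sum>i<n. c i *\<^sub>R b i x)" "l2_eq \<Omega> v (\<lambda>x. \<Sum>i<n. d i *\<^sub>R b i x)"
      and uv: "u \<in> W" "v \<in> W" by (auto simp: W'_def)
    have "l2_eq \<Omega> (\<lambda>x. s *\<^sub>R u x + t *\<^sub>R v x) (\<lambda>x. \<Sum>i<n. (s * c i + t * d i) *\<^sub>R b i x)"
      using l2_eq_lincomb[OF cd, of s t]
      by (simp add: scaleR_add_left sum.distrib scaleR_sum_right)
    then show "(\<lambda>x. s *\<^sub>R u x + t *\<^sub>R v x) \<in> W'"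
      unfolding W'_def using lin_closed_lincomb[OF Suc.prems(2) uv]
      by (auto intro!: exI[of _ "\<lambda>i. s * c i + t * d i"])
  qed
  have W'_sub: "W' \<subseteq> W" by (auto simp: W'_def)
  have "\<exists>N e. l2_onb \<Omega> W' N e"
  proof (rule Suc.IH[OF _ W'_lin])
    show "W' \<subseteq> L2 \<Omega>" using W'_sub Suc.prems(1) by blast
    show "b i \<in> L2 \<Omega>" if "i < n" for i using Suc.prems(3) that by simp
    show "\<exists>c. l2_eq \<Omega> w (\<lambda>x. \<Sum>i<n. c i *\<^sub>R b i x)" if "w \<in> W'" for w
      using that unfolding W'_def by blast
  qed
  then obtain N e where onb: "l2_onb \<Omega> W' N e" by blast
  show ?case
  proof (cases "W' = W")
    case True
    then show ?thesis using onb by blast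
  next
    case False
    then obtain w0 where w0: "w0 \<in> W" "w0 \<notin> W'" using W'_sub by blast
    obtain c0 where c0: "l2_eq \<Omega> w0 (\<lambda>x. \<Sum>i<Suc n. c0 i *\<^sub>R b i x)" using Suc.prems(4) w0 by blast
    \<comment> \<open>If this coefficient vanished, \<open>w0\<close> would be a combination of the
      first \<open>n\<close> functions and belong to \<open>W'\<close>.\<close>
    have c0n: "c0 n \<noteq> 0"
      using c0 w0 by (auto simp: W'_def)
    have eW': "e i \<in> W'" if "i < N" for i using onb that by (auto simp: l2_onb_def)
    have eW: "e i \<in> W" if "i < N" for i using eW' W'_sub that by auto
    have eL: "e i \<in> L2 \<Omega>" if "i < N" for i using eW Suc.prems(1) that by auto
    have w0L: "w0 \<in> L2 \<Omega>" using w0 Suc.prems(1) by auto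
    have eo: "l2_inner \<Omega> (e i) (e j) = (if i = j then 1 else 0)" if "i < N" "j < N" for i j
      using onb that by (auto simp: l2_onb_def)
    define p where "p = (\<lambda>x. \<Sum>i<N. l2_inner \<Omega> w0 (e i) *\<^sub>R e i x)"
    define r where "r = (\<lambda>x. w0 x - p x)"
    have pW': "p \<in> W'" unfolding p_def using eW' by (intro lin_closed_sum W'_lin) auto
    have pW: "p \<in> W" using pW' W'_sub by auto
    have rW: "r \<in> W" unfolding r_def using w0 pW Suc.prems(2) by (intro lin_closed_diff)
    have rL: "r \<in> L2 \<Omega>" using rW Suc.prems(1) by auto
    have pL: "p \<in> L2 \<Omega>" using pW Suc.prems(1) by auto
    have re: "l2_inner \<Omega> r (e j) = 0" if "j < N" for j
      unfolding r_def using orthonormal_coeff[of N e \<Omega> j "\<lambda>i. l2_inner \<Omega> w0 (e i)"] that eL eo w0L pL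
      by (simp add: l2_inner_diff_left p_def)
    have rn: "l2_norm \<Omega> r \<noteq> 0"
    proof
      assume "l2_norm \<Omega> r = 0"
      then have "l2_eq \<Omega> r (\<lambda>x. 0)" using rL by (simp add: l2_norm_eq_0)
      then have "l2_eq \<Omega> w0 p" by (simp add: l2_eq_def r_def)
      moreover obtain c where "l2_eq \<Omega> p (\<lambda>x. \<Sum>i<n. c i *\<^sub>R b i x)" using pW' by (auto simp: W'_def)
      ultimately have "w0 \<in> W'" using w0 unfolding W'_def by (blast intro: l2_eq_trans)
      then show False using w0 by simp
    qed
    define e' where "e' = (\<lambda>i. if i < N then e i else (\<lambda>x. (1 / l2_norm \<Omega> r) *\<^sub>R r x))"
    have e'W: "e' i \<in> W" if "i < Suc N" for i
      using that eW rW Suc.prems(2) by (auto simp: e'_def intro: lin_closed_scale)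
    have e'L: "e' i \<in> L2 \<Omega>" if "i < Suc N" for i
      using e'W that Suc.prems(1) by auto
    have e'o: "l2_inner \<Omega> (e' i) (e' j) = (if i = j then 1 else 0)" if "i < Suc N" "j < Suc N" for i j
    proof -
      have rr: "l2_inner \<Omega> r r = l2_norm \<Omega> r * l2_norm \<Omega> r"
        using l2_norm_power2[of \<Omega> r] by (simp add: power2_eq_square)
      have "l2_inner \<Omega> (e' N) (e' N) = 1"
        using rn by (simp add: e'_def l2_inner_scale_left l2_inner_scale_right rr)
      moreover have "l2_inner \<Omega> (e' N) (e' k) = 0 \<and> l2_inner \<Omega> (e' k) (e' N) = 0" if "k < N" for k
        using re[OF that] that
        by (simp add: e'_def l2_inner_scale_left l2_inner_scale_right l2_inner_commute[of \<Omega> "e k"])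
      ultimately show ?thesis using that eo
        by (cases "i = N"; cases "j = N") (auto simp: e'_def[of] less_Suc_eq)
    qed
    have span: "l2_eq \<Omega> w (\<lambda>x. \<Sum>i<Suc N. l2_inner \<Omega> w (e' i) *\<^sub>R e' i x)" if w: "w \<in> W" for w
    proof -
      obtain c where c: "l2_eq \<Omega> w (\<lambda>x. \<Sum>i<Suc n. c i *\<^sub>R b i x)" using Suc.prems(4) w by blast
      \<comment> \<open>Chosen so that \<open>w - d * w0\<close> loses its \<open>b n\<close>
        component and falls into \<open>W'\<close>.\<close>
      define d where "d = c n / c0 n"
      define v where "v = (\<lambda>x. 1 *\<^sub>R w x + (- d) *\<^sub>R w0 x)"
      have vW: "v \<in> W" unfolding v_def using w w0 Suc.prems(2) by (intro lin_closed_lincomb)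
      have "l2_eq \<Omega> v (\<lambda>x. 1 *\<^sub>R (\<Sum>i<Suc n. c i *\<^sub>R b i x) + (- d) *\<^sub>R (\<Sum>i<Suc n. c0 i *\<^sub>R b i x))"
        unfolding v_def by (rule l2_eq_lincomb[OF c c0])
      also have "(\<lambda>x. 1 *\<^sub>R (\<Sum>i<Suc n. c i *\<^sub>R b i x) + (- d) *\<^sub>R (\<Sum>i<Suc n. c0 i *\<^sub>R b i x))
          = (\<lambda>x. \<Sum>i<n. (c i - d * c0 i) *\<^sub>R b i x)"
        using c0n by (simp add: d_def scaleR_diff_left sum_subtractf scaleR_sum_right sum_negf algebra_simps)
      finally have "v \<in> W'" using vW unfolding W'_def
        by (auto intro!: exI[of _ "\<lambda>i. c i - d * c0 i"])
      then have "l2_eq \<Omega> v (\<lambda>x. \<Sum>i<N. l2_inner \<Omega> v (e i) *\<^sub>R e i x)"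
        using onb by (simp add: l2_onb_def)
      moreover have "w = (\<lambda>x. 1 *\<^sub>R v x + d *\<^sub>R w0 x)" by (simp add: v_def)
      \<comment> \<open>The coefficients of \<open>w = v + d * w0\<close> after writing
        \<open>w0\<close> as its projection \<open>p\<close> plus \<open>r\<close>; the last one
        compensates for the normalisation of \<open>r\<close>.\<close>
      moreover define \<alpha> where "\<alpha> = (\<lambda>i. if i < N then l2_inner \<Omega> v (e i) + d * l2_inner \<Omega> w0 (e i)
          else d * l2_norm \<Omega> r)"
      moreover have "(\<Sum>i<N. l2_inner \<Omega> v (e i) *\<^sub>R e i x) + d *\<^sub>R w0 x = (\<Sum>i<Suc N. \<alpha> i *\<^sub>R e' i x)" for x
      proof -
        have "w0 x = r x + (\<Sum>i<N. l2_inner \<Omega> w0 (e i) *\<^sub>R e i x)" by (simp add: r_def p_def)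
        then show ?thesis using rn
          by (simp add: \<alpha>_def e'_def scaleR_add_left scaleR_add_right sum.distrib scaleR_sum_right)
      qed
      ultimately have weq: "l2_eq \<Omega> w (\<lambda>x. \<Sum>i<Suc N. \<alpha> i *\<^sub>R e' i x)"
        using l2_eq_lincomb[OF _ l2_eq_refl[of \<Omega> w0], of v "\<lambda>x. \<Sum>i<N. l2_inner \<Omega> v (e i) *\<^sub>R e i x" 1 d]
        by simp
      have "l2_inner \<Omega> w (e' j) = \<alpha> j" if "j < Suc N" for j
      proof -
        have "l2_inner \<Omega> w (e' j) = l2_inner \<Omega> (\<lambda>x. \<Sum>i<Suc N. \<alpha> i *\<^sub>R e' i x) (e' j)"
          using weq w Suc.prems(1) that e'L by (intro l2_inner_cong_left L2_sum) auto
        then show ?thesis using orthonormal_coeff[OF e'L that e'o] by simp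
      qed
      then have "(\<lambda>x. \<Sum>i<Suc N. l2_inner \<Omega> w (e' i) *\<^sub>R e' i x) = (\<lambda>x. \<Sum>i<Suc N. \<alpha> i *\<^sub>R e' i x)"
        by (intro ext sum.cong) auto
      then show ?thesis using weq by simp
    qed
    show ?thesis using e'W e'o span unfolding l2_onb_def by blast
  qed
qed

lemma l2_onb_exists:
  assumes "l2_fin_dim \<Omega> W"
  shows "\<exists>N e. l2_onb \<Omega> W N e"
proof -
  obtain n :: nat and b where "\<forall>i<n. b i \<in> L2 \<Omega>" "\<forall>w\<in>W. \<exists>c. l2_eq \<Omega> w (\<lambda>x. \<Sum>i<n. c i *\<^sub>R b i x)"
    and "W \<subseteq> L2 \<Omega>" "lin_closed W"
    using assms unfolding l2_fin_dim_def by blast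
  then show ?thesis using l2_onb_exists_aux[of W \<Omega> n b] by simp
qed

lemma l2_fin_dim_subset:
  assumes "l2_fin_dim \<Omega> W" "Z \<subseteq> W" "lin_closed Z"
  shows "l2_fin_dim \<Omega> Z"
proof -
  obtain n :: nat and b where "\<forall>i<n. b i \<in> L2 \<Omega>" "\<forall>w\<in>W. \<exists>c. l2_eq \<Omega> w (\<lambda>x. \<Sum>i<n. c i *\<^sub>R b i x)"
    and "W \<subseteq> L2 \<Omega>"
    using assms(1) unfolding l2_fin_dim_def by blast
  then show ?thesis using assms(2,3) unfolding l2_fin_dim_def by blast
qed

lemma l2_onbD:
  assumes "l2_onb \<Omega> W N e"
  shows "\<And>i. i < N \<Longrightarrow> e i \<in> W"
    and "\<And>i j. i < N \<Longrightarrow> j < N \<Longrightarrow> l2_inner \<Omega> (e i) (e j) = (if i = j then 1 else 0)"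
    and "\<And>w. w \<in> W \<Longrightarrow> l2_eq \<Omega> w (\<lambda>x. \<Sum>i<N. l2_inner \<Omega> w (e i) *\<^sub>R e i x)"
  using assms by (auto simp: l2_onb_def)

lemma l2_proj_exists:
  assumes "l2_fin_dim \<Omega> W" "z \<in> L2 \<Omega>"
  shows "\<exists>w. w \<in> W \<and> (\<forall>v\<in>W. l2_inner \<Omega> (\<lambda>x. z x - w x) v = 0)"
proof -
  obtain N e where onb: "l2_onb \<Omega> W N e" using l2_onb_exists[OF assms(1)] by blast
  have W: "W \<subseteq> L2 \<Omega>" "lin_closed W" using assms(1) by (auto simp: l2_fin_dim_def)
  have eL: "e i \<in> L2 \<Omega>" if "i < N" for i using l2_onbD(1)[OF onb that] W by auto
  define w where "w = (\<lambda>x. \<Sum>i<N. l2_inner \<Omega> z (e i) *\<^sub>R e i x)"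
  have wW: "w \<in> W" unfolding w_def by (intro lin_closed_sum W(2)) (simp add: l2_onbD(1)[OF onb])
  have wL: "w \<in> L2 \<Omega>" using wW W by auto
  have zw: "l2_inner \<Omega> (\<lambda>x. z x - w x) (e j) = 0" if "j < N" for j
    using orthonormal_coeff[OF eL that l2_onbD(2)[OF onb]] assms(2) wL eL[OF that]
    by (simp add: l2_inner_diff_left w_def)
  have "l2_inner \<Omega> (\<lambda>x. z x - w x) v = 0" if v: "v \<in> W" for v
  proof -
    have "l2_inner \<Omega> (\<lambda>x. z x - w x) v
        = l2_inner \<Omega> (\<lambda>x. z x - w x) (\<lambda>x. \<Sum>i<N. l2_inner \<Omega> v (e i) *\<^sub>R e i x)"
      using l2_onbD(3)[OF onb v] v W assms(2) wL eL by (intro l2_inner_cong L2_diff L2_sum) auto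
    also have "\<dots> = (\<Sum>i<N. l2_inner \<Omega> v (e i) * l2_inner \<Omega> (\<lambda>x. z x - w x) (e i))"
      using assms(2) wL eL by (intro l2_inner_sum_right L2_diff) auto
    also have "\<dots> = 0" using zw by simp
    finally show ?thesis .
  qed
  then show ?thesis using wW by blast
qed

lemma l2_proj_props:
  assumes "l2_fin_dim \<Omega> W" "z \<in> L2 \<Omega>"
  shows l2_proj_mem: "l2_proj \<Omega> W z \<in> W"
    and l2_proj_orth: "\<And>v. v \<in> W \<Longrightarrow> l2_inner \<Omega> (\<lambda>x. z x - l2_proj \<Omega> W z x) v = 0"
  using someI_ex[OF l2_proj_exists[OF assms]] unfolding l2_proj_def by auto

lemma l2_proj_L2: "l2_fin_dim \<Omega> W \<Longrightarrow> z \<in> L2 \<Omega> \<Longrightarrow> l2_proj \<Omega> W z \<in> L2 \<Omega>"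
  using l2_proj_mem[of \<Omega> W z] by (auto simp: l2_fin_dim_def)

lemma l2_perp_L2: "l2_fin_dim \<Omega> W \<Longrightarrow> z \<in> L2 \<Omega> \<Longrightarrow> l2_perp \<Omega> W z \<in> L2 \<Omega>"
  unfolding l2_perp_def[abs_def] by (intro L2_diff l2_proj_L2)

lemma l2_inner_proj:
  assumes "l2_fin_dim \<Omega> W" "z \<in> L2 \<Omega>" "v \<in> W"
  shows "l2_inner \<Omega> (l2_proj \<Omega> W z) v = l2_inner \<Omega> z v"
proof -
  have "v \<in> L2 \<Omega>" using assms by (auto simp: l2_fin_dim_def)
  then show ?thesis
    using l2_proj_orth[OF assms] l2_inner_diff_left[OF assms(2) l2_proj_L2[OF assms(1,2)], of v] by simp
qed

lemma l2_inner_perp: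
  assumes "l2_fin_dim \<Omega> W" "z \<in> L2 \<Omega>" "v \<in> W"
  shows "l2_inner \<Omega> (l2_perp \<Omega> W z) v = 0"
  using l2_proj_orth[OF assms] by (simp add: l2_perp_def[abs_def])

text \<open>The difference \<open>u - v\<close> is itself an admissible test function, so its norm
  vanishes. This is how elements of \<open>W\<close> that were produced by choice are
  identified.\<close>

lemma l2_eq_iff_inner:
  assumes "lin_closed W" "W \<subseteq> L2 \<Omega>" "u \<in> W" "v \<in> W"
    and "\<And>w. w \<in> W \<Longrightarrow> l2_inner \<Omega> u w = l2_inner \<Omega> v w"
  shows "l2_eq \<Omega> u v"
proof -
  have d: "(\<lambda>x. u x - v x) \<in> W" using assms by (intro lin_closed_diff)
  then have dL: "(\<lambda>x. u x - v x) \<in> L2 \<Omega>" using assms by auto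
  have uL: "u \<in> L2 \<Omega>" "v \<in> L2 \<Omega>" using assms by auto
  have "l2_inner \<Omega> (\<lambda>x. u x - v x) (\<lambda>x. u x - v x) = 0"
    using assms(5)[OF d] by (simp add: l2_inner_diff_left uL dL)
  then show ?thesis using dL by (simp add: l2_inner_self_eq_0 l2_eq_def)
qed

text \<open>\<open>l2_proj\<close> picks some representative, so its linearity can hold only up to
  null sets; both sides have the same products with \<open>W\<close>.\<close>

lemma l2_proj_lincomb:
  assumes "l2_fin_dim \<Omega> W" "z \<in> L2 \<Omega>" "y \<in> L2 \<Omega>"
  shows "l2_eq \<Omega> (l2_proj \<Omega> W (\<lambda>x. a *\<^sub>R z x + b *\<^sub>R y x))
    (\<lambda>x. a *\<^sub>R l2_proj \<Omega> W z x + b *\<^sub>R l2_proj \<Omega> W y x)"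
proof -
  have W: "W \<subseteq> L2 \<Omega>" "lin_closed W" using assms(1) by (auto simp: l2_fin_dim_def)
  show ?thesis
  proof (rule l2_eq_iff_inner[OF W(2,1)])
    fix w assume w: "w \<in> W"
    then have "w \<in> L2 \<Omega>" using W by auto
    then show "l2_inner \<Omega> (l2_proj \<Omega> W (\<lambda>x. a *\<^sub>R z x + b *\<^sub>R y x)) w
        = l2_inner \<Omega> (\<lambda>x. a *\<^sub>R l2_proj \<Omega> W z x + b *\<^sub>R l2_proj \<Omega> W y x) w"
      using assms w by (simp add: l2_inner_proj l2_inner_lincomb_left L2_lincomb l2_proj_L2)
  next
    show "l2_proj \<Omega> W (\<lambda>x. a *\<^sub>R z x + b *\<^sub>R y x) \<in> W"
      by (intro l2_proj_mem assms(1) L2_lincomb assms(2,3))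
    show "(\<lambda>x. a *\<^sub>R l2_proj \<Omega> W z x + b *\<^sub>R l2_proj \<Omega> W y x) \<in> W"
      by (intro lin_closed_lincomb W(2) l2_proj_mem assms)
  qed
qed

text \<open>Pythagoras: the two sides differ by the squared norm of
  \<open>z - l2_proj \<Omega> W z\<close>. This bounds the projected initial data.\<close>

lemma l2_proj_norm_le:
  assumes "l2_fin_dim \<Omega> W" "z \<in> L2 \<Omega>"
  shows "l2_inner \<Omega> (l2_proj \<Omega> W z) (l2_proj \<Omega> W z) \<le> l2_inner \<Omega> z z"
proof -
  let ?w = "l2_proj \<Omega> W z"
  have w: "?w \<in> L2 \<Omega>" "l2_inner \<Omega> ?w ?w = l2_inner \<Omega> z ?w"
    using assms l2_inner_proj[OF assms l2_proj_mem[OF assms]] by (auto intro: l2_proj_L2)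
  have "0 \<le> l2_inner \<Omega> (\<lambda>x. z x - ?w x) (\<lambda>x. z x - ?w x)" by (rule l2_inner_ge_0)
  also have "\<dots> = l2_inner \<Omega> z z - l2_inner \<Omega> ?w ?w"
    using assms w by (simp add: l2_inner_diff_left l2_inner_diff_right L2_diff l2_inner_commute[of \<Omega> ?w z])
  finally show ?thesis by simp
qed

section \<open>Test functions and the fundamental lemma of the calculus of variations\<close>

text \<open>Boxes form an intersection-stable generator of the Borel sets, so the vanishing of the
  integral spreads from boxes to all Borel sets by Dynkin's argument; then \<open>h\<close> and 0
  are densities of the same set function.\<close>

lemma AE_lborel_zeroI_box:
  fixes h :: "'a::euclidean_space \<Rightarrow> real"
  assumes h: "integrable lborel h"
    and box: "\<And>a b. (LINT x:box a b|lborel. h x) = 0"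
  shows "AE x in lborel. h x = 0"
proof -
  have si: "set_integrable lborel A h" if "A \<in> sets lborel" for A
    using integrable_mult_indicator[OF that h] by (simp add: set_integrable_def)
  \<comment> \<open>The case of complements needs the whole space, which is not a box but an
    increasing union of boxes.\<close>
  have UNIV: "(LINT x:UNIV|lborel. h x) = 0"
  proof -
    let ?A = "\<lambda>n::nat. box (- (real n *\<^sub>R One)) (real n *\<^sub>R One) :: 'a set"
    have U: "(\<Union>n. ?A n) = UNIV" by (rule UN_box_eq_UNIV)
    have "(\<lambda>n. LINT x:?A n|lborel. h x) \<longlonglongrightarrow> (LINT x:(\<Union>n. ?A n)|lborel. h x)"
    proof (intro set_integral_cont_up si)
      have "?A m \<subseteq> ?A n" if "m \<le> n" for m n
        by (rule subset_box_imp) (use that in auto)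
      then show "incseq ?A" by (simp add: incseq_def)
    qed auto
    then show ?thesis by (simp add: box U LIMSEQ_const_iff)
  qed
  have all: "(LINT x:A|lborel. h x) = 0" if A: "A \<in> sets lborel" for A
  proof -
    let ?E = "range (\<lambda>(a, b). box a b::'a set)"
    have eq: "sigma_sets UNIV ?E = sets (lborel :: 'a measure)" by (simp add: borel_eq_box)
    have "A \<in> sigma_sets UNIV ?E" using A unfolding eq .
    have "Int_stable ?E" by (auto simp: Int_stable_def box_Int_box)
    moreover have "?E \<subseteq> Pow UNIV" by simp
    ultimately show ?thesis using \<open>A \<in> sigma_sets UNIV ?E\<close>
    proof (induction rule: sigma_sets_induct_disjoint)
      case (compl A)
      then have As: "A \<in> sets lborel" by (simp only: eq)
      have "(LINT x:A \<union> (UNIV - A)|lborel. h x) = (LINT x:A|lborel. h x) + (LINT x:(UNIV - A)|lborel. h x)"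
        by (intro set_integral_Un si) (use As in auto)
      then show ?case using compl UNIV by (simp add: Un_Diff_cancel)
    next
      case (union A)
      have As: "A i \<in> sets lborel" for i using subsetD[OF union(2), of "A i"] unfolding eq by blast
      have "(LINT x:(\<Union>i. A i)|lborel. h x) = (\<Sum>i. LINT x:A i|lborel. h x)"
        using union(1) by (intro lebesgue_integral_countable_add As si)
          (use As in \<open>auto simp: disjoint_family_on_def\<close>)
      then show ?case using union(3) by simp
    next
      case (basic A)
      then show ?case using box by auto
    qed (simp add: set_lebesgue_integral_def)
  qed
  show ?thesis
    by (rule density_unique_real[of _ h "\<lambda>x. 0"]) (use h all in auto)
qed

text \<open>The generator argument is about Borel sets, so the function is replaced by a Borel
  representative with the same integrals.\<close>

lemma AE_lebesgue_zeroI_box: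
  fixes h :: "'a::euclidean_space \<Rightarrow> real"
  assumes h: "integrable lebesgue h"
    and box: "\<And>a b. (\<integral>x. indicator (box a b) x * h x \<partial>lebesgue) = 0"
  shows "AE x in lebesgue. h x = 0"
proof -
  obtain h' where h': "h' \<in> borel_measurable lborel" "AE x in lborel. h x = h' x"
    using completion_ex_borel_measurable_real[of h lborel] h by auto
  have ae: "AE x in lebesgue. h x = h' x" using h'(2) by (rule AE_completion)
  have "integrable lebesgue h'"
    using h ae h'(1) by (subst integrable_cong_AE[of _ _ h]) (auto intro: measurable_completion elim: AE_mp)
  then have "integrable lborel h'" using h'(1) by (simp add: integrable_completion)
  moreover have "(LINT x:box a b|lborel. h' x) = 0" for a b
  proof -
    have "(LINT x:box a b|lborel. h' x) = (\<integral>x. indicator (box a b) x * h' x \<partial>lebesgue)"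
      unfolding set_lebesgue_integral_def using h'(1) by (subst integral_completion) auto
    also have "\<dots> = (\<integral>x. indicator (box a b) x * h x \<partial>lebesgue)"
    proof (rule integral_cong_AE)
      have "box a b \<in> sets lebesgue" by simp
      then show "(\<lambda>x. indicator (box a b) x * h' x) \<in> borel_measurable lebesgue"
        "(\<lambda>x. indicator (box a b) x * h x) \<in> borel_measurable lebesgue"
        by (intro borel_measurable_times borel_measurable_indicator measurable_completion[OF h'(1)]
          borel_measurable_integrable[OF h]; assumption)+
      show "AE x in lebesgue. indicator (box a b) x * h' x = indicator (box a b) x * h x"
        using ae by eventually_elim simp
    qed
    finally show ?thesis using box by simp
  qed
  ultimately have "AE x in lborel. h' x = 0" by (rule AE_lborel_zeroI_box)
  then have "AE x in lebesgue. h' x = 0" by (rule AE_completion)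
  with ae show ?thesis by eventually_elim simp
qed

section \<open>Calculus of the smoothness classes and a smooth function that is flat at the
  origin\<close>

lemma partial_deriv_eq: "(f has_derivative f') (at x) \<Longrightarrow> partial_deriv i f x = f' (axis i 1)"
  unfolding partial_deriv_def using frechet_derivative_at by metis

lemma has_derivative_frechet:
  "f differentiable_on UNIV \<Longrightarrow> (f has_derivative frechet_derivative f (at x)) (at x)"
  by (simp add: differentiable_on_def frechet_derivative_works[symmetric])

lemma cd_SucD: "continuously_differentiable (Suc n) f \<Longrightarrow> continuously_differentiable n f"
  by (induction n arbitrary: f) (auto intro: differentiable_imp_continuous_on)

lemma cd_mono: "n \<le> m \<Longrightarrow> continuously_differentiable m f \<Longrightarrow> continuously_differentiable n f"
  by (induction m rule: dec_induct) (auto dest: cd_SucD simp del: continuously_differentiable.simps)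

lemma cd_lincomb:
  "continuously_differentiable n f \<Longrightarrow> continuously_differentiable n g \<Longrightarrow>
    continuously_differentiable n (\<lambda>x. a * f x + b * g x)"
proof (induction n arbitrary: f g)
  case 0
  then show ?case by (auto intro!: continuous_intros)
next
  case (Suc n)
  then have d: "f differentiable_on UNIV" "g differentiable_on UNIV" by auto
  have "((\<lambda>x. a * f x + b * g x) has_derivative
      (\<lambda>h. a * frechet_derivative f (at x) h + b * frechet_derivative g (at x) h)) (at x)" for x
    by (intro derivative_intros has_derivative_frechet d)
  note hd = this
  have "partial_deriv i (\<lambda>x. a * f x + b * g x) = (\<lambda>x. a * partial_deriv i f x + b * partial_deriv i g x)" for i
    using partial_deriv_eq[OF hd] by (simp add: fun_eq_iff partial_deriv_def)
  moreover have "(\<lambda>x. a * f x + b * g x) differentiable_on UNIV"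
    using hd by (auto simp: differentiable_on_def differentiable_def)
  ultimately show ?case using Suc by simp
qed

lemma cd_const: "continuously_differentiable n (\<lambda>x. c)"
proof (induction n arbitrary: c)
  case (Suc n)
  have "partial_deriv i (\<lambda>x. c) = (\<lambda>x. 0)" for i :: 'a
    by (intro ext) (rule partial_deriv_eq, rule has_derivative_const)
  then show ?case using Suc by simp
qed simp

lemma partial_deriv_mult:
  assumes "f differentiable_on UNIV" "g differentiable_on UNIV"
  shows "partial_deriv i (\<lambda>x. f x * g x) = (\<lambda>x. f x * partial_deriv i g x + partial_deriv i f x * g x)"
proof
  fix x
  have "((\<lambda>x. f x * g x) has_derivative
      (\<lambda>h. f x * frechet_derivative g (at x) h + frechet_derivative f (at x) h * g x)) (at x)"
    by (intro derivative_intros has_derivative_frechet assms)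
  from partial_deriv_eq[OF this]
  show "partial_deriv i (\<lambda>x. f x * g x) x = f x * partial_deriv i g x + partial_deriv i f x * g x"
    by (simp add: partial_deriv_def)
qed

lemma cd_mult:
  "continuously_differentiable n f \<Longrightarrow> continuously_differentiable n g \<Longrightarrow>
    continuously_differentiable n (\<lambda>x. f x * g x)"
proof (induction n arbitrary: f g)
  case 0
  then show ?case by (auto intro!: continuous_intros)
next
  case (Suc n)
  have fg: "continuously_differentiable n f" "continuously_differentiable n g"
    using Suc.prems by (auto intro: cd_SucD simp del: continuously_differentiable.simps)
  have d: "f differentiable_on UNIV" "g differentiable_on UNIV" using Suc.prems by auto
  have "continuously_differentiable n (\<lambda>x. 1 * (f x * partial_deriv i g x) + 1 * (partial_deriv i f x * g x))" for i
    using Suc.prems fg by (intro cd_lincomb Suc.IH) auto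
  moreover have "(\<lambda>x. f x * g x) differentiable_on UNIV" using d by (rule differentiable_on_mult)
  ultimately show ?case by (simp add: partial_deriv_mult[OF d])
qed

lemma cd_prod: "(\<And>i. i \<in> A \<Longrightarrow> continuously_differentiable n (f i)) \<Longrightarrow>
    continuously_differentiable n (\<lambda>x. \<Prod>i\<in>A. f i x)"
  by (induction A rule: infinite_finite_induct) (auto intro!: cd_mult cd_const)

lemma cd_sum: "(\<And>i. i \<in> A \<Longrightarrow> continuously_differentiable n (f i)) \<Longrightarrow>
    continuously_differentiable n (\<lambda>x. \<Sum>i\<in>A. f i x)"
proof (induction A rule: infinite_finite_induct)
  case (insert i A)
  then have "continuously_differentiable n (\<lambda>x. 1 * f i x + 1 * (\<Sum>i\<in>A. f i x))"
    by (intro cd_lincomb) auto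
  then show ?case using insert by simp
qed (auto intro!: cd_const)

text \<open>\<open>D 0\<close>, \<open>D 1\<close>, ... is a chain of successive derivatives on the
  line. Each partial derivative of the ridge function for \<open>D k\<close> is a constant multiple
  of the one for \<open>D (Suc k)\<close>, so the induction on \<open>n\<close> is for all
  \<open>k\<close> at once.\<close>

lemma cd_ridge:
  assumes "\<And>k s. (D k has_real_derivative D (Suc k) s) (at s)"
  shows "continuously_differentiable n (\<lambda>x::real^'d::finite. D k (a * (x $ i) + b))"
proof (induction n arbitrary: k)
  have hd: "((\<lambda>x::real^'d. D k (a * (x $ i) + b)) has_derivative
      (\<lambda>h. D (Suc k) (a * (x $ i) + b) * (a * (h $ i)))) (at x)" for k x
  proof -
    have "((\<lambda>x::real^'d. a * (x $ i) + b) has_derivative (\<lambda>h. a * (h $ i))) (at x)"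
      by (auto intro!: derivative_eq_intros bounded_linear.has_derivative[OF bounded_linear_vec_nth])
    then show ?thesis
      using assms[of k "a * (x $ i) + b"] unfolding has_field_derivative_def
      by (rule has_derivative_compose)
  qed
  {
    case 0
    have "(\<lambda>x::real^'d. D k (a * (x $ i) + b)) differentiable_on UNIV"
      using hd by (auto simp: differentiable_on_def differentiable_def)
    then show ?case by (simp add: differentiable_imp_continuous_on)
  next
    case (Suc n)
    \<comment> \<open>The term \<open>0 * 0\<close> makes the right-hand side an instance of
      \<open>cd_lincomb\<close> with a constant second function.\<close>
    have "partial_deriv j (\<lambda>x::real^'d. D k (a * (x $ i) + b))
        = (\<lambda>x. (a * (if j = i then 1 else 0)) * D (Suc k) (a * (x $ i) + b) + 0 * 0)" for j
      using partial_deriv_eq[OF hd] by (auto simp: fun_eq_iff axis_def)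
    then have "continuously_differentiable n (partial_deriv j (\<lambda>x::real^'d. D k (a * (x $ i) + b)))" for j
      using cd_lincomb[OF Suc[of "Suc k"] cd_const] by metis
    moreover have "(\<lambda>x::real^'d. D k (a * (x $ i) + b)) differentiable_on UNIV"
      using hd by (auto simp: differentiable_on_def differentiable_def)
    ultimately show ?case by simp
  }
qed

lemma cd_nth: "continuously_differentiable n (\<lambda>x::real^'d::finite. x $ i)"
proof -
  define D :: "nat \<Rightarrow> real \<Rightarrow> real" where "D = (\<lambda>k s. if k = 0 then s else if k = 1 then 1 else 0)"
  have "(D k has_real_derivative D (Suc k) s) (at s)" for k s
    by (auto simp: D_def)
  from cd_ridge[of D n 0 1 i 0, OF this] show ?thesis by (simp add: D_def)
qed

text \<open>The polynomials in the derivatives of \<open>exp (- 1 / s)\<close>: the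
  \<open>n\<close>-th derivative is \<open>P n (1 / s) * exp (- 1 / s)\<close>, and differentiating
  once more gives \<open>P (n + 1) = y^2 * (P n - P' n)\<close> in the variable
  \<open>y = 1 / s\<close>. The factor \<open>[:0, 0, 1:]\<close> is \<open>y^2\<close>.\<close>

primrec bump_poly :: "nat \<Rightarrow> real poly" where
  "bump_poly 0 = 1"
| "bump_poly (Suc n) = [:0, 0, 1:] * (bump_poly n - pderiv (bump_poly n))"

text \<open>The flat function and all its derivatives in one family, extended by 0 to the left. Only
  \<open>bump 0\<close> is used to build test functions; the others witness its smoothness through
  \<open>cd_ridge\<close>.\<close>

definition bump :: "nat \<Rightarrow> real \<Rightarrow> real" where
  "bump n s = (if s > 0 then poly (bump_poly n) (inverse s) * exp (- inverse s) else 0)"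

lemma poly_div_exp_tendsto_0: "((\<lambda>y::real. poly p y * exp (- y)) \<longlongrightarrow> 0) at_top"
proof -
  have "((\<lambda>y. \<Sum>i\<le>degree p. coeff p i * (y ^ i / exp y)) \<longlongrightarrow> (\<Sum>i\<le>degree p. coeff p i * 0)) at_top"
    by (intro tendsto_intros tendsto_power_div_exp_0)
  then show ?thesis by (simp add: poly_altdef sum_distrib_right exp_minus divide_inverse mult.assoc)
qed

lemma bump_deriv: "(bump n has_real_derivative bump (Suc n) s) (at s)"
proof -
  consider "s > 0" | "s < 0" | "s = 0" by linarith
  then show ?thesis
  proof cases
    case 1
    have "((\<lambda>s. poly (bump_poly n) (inverse s) * exp (- inverse s)) has_real_derivative bump (Suc n) s) (at s)"
      using 1 by (auto intro!: derivative_eq_intros simp: bump_def power2_eq_square field_simps)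
    then show ?thesis
      by (rule has_field_derivative_transform_within_open[of _ _ _ "{0<..}"]) (use 1 in \<open>auto simp: bump_def\<close>)
  next
    case 2
    have "((\<lambda>s. 0) has_real_derivative bump (Suc n) s) (at s)" using 2 by (simp add: bump_def)
    then show ?thesis
      by (rule has_field_derivative_transform_within_open[of _ _ _ "{..<0}"]) (use 2 in \<open>auto simp: bump_def\<close>)
  next
    case 3
    have "((\<lambda>s. bump n s / s) \<longlongrightarrow> 0) (at_right 0)"
    proof -
      \<comment> \<open>At the origin the difference quotient is \<open>bump n s / s\<close>. With
        \<open>y = 1 / s\<close> the division by \<open>s\<close> is a multiplication by
        \<open>y\<close>, hence the extra \<open>pCons 0\<close>, and the exponential beats every
        polynomial.\<close>
      have "((\<lambda>s. poly (pCons 0 (bump_poly n)) (inverse s) * exp (- inverse s)) \<longlongrightarrow> 0) (at_right (0::real))"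
        by (rule filterlim_compose[OF poly_div_exp_tendsto_0 filterlim_inverse_at_top_right])
      moreover have "\<forall>\<^sub>F s in at_right (0::real). poly (pCons 0 (bump_poly n)) (inverse s) * exp (- inverse s) = bump n s / s"
        using eventually_at_right_less[of "0::real"] by eventually_elim (simp add: bump_def divide_inverse)
      ultimately show ?thesis by (rule Lim_transform_eventually)
    qed
    moreover have "((\<lambda>s. bump n s / s) \<longlongrightarrow> 0) (at_left 0)"
    proof -
      have "\<forall>\<^sub>F s in at_left (0::real). 0 = bump n s / s"
        by (auto simp: eventually_at_filter bump_def)
      then show ?thesis by (rule Lim_transform_eventually[OF tendsto_const])
    qed
    ultimately have "((\<lambda>s. bump n s / s) \<longlongrightarrow> 0) (at 0)"
      by (simp add: filterlim_split_at)
    then show ?thesis using 3 by (simp add: has_field_derivative_iff bump_def)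
  qed
qed

lemma bump_0: "bump 0 s = (if s > 0 then exp (- inverse s) else 0)"
  by (simp add: bump_def)

section \<open>Test functions, in particular those approximating the indicator of a box\<close>

lemma cd_continuous: "continuously_differentiable n f \<Longrightarrow> continuous_on UNIV f"
  using cd_mono[of 0 n f] by simp

lemma test_functions_continuous: "\<phi> \<in> test_functions \<Omega> \<Longrightarrow> continuous_on UNIV \<phi>"
  unfolding test_functions_def using cd_continuous[of 0 \<phi>] by blast

lemma test_functions_lincomb:
  assumes "\<phi> \<in> test_functions \<Omega>" "\<psi> \<in> test_functions \<Omega>"
  shows "(\<lambda>x. a * \<phi> x + b * \<psi> x) \<in> test_functions \<Omega>"
proof -
  let ?A = "closure {x. \<phi> x \<noteq> 0} \<union> closure {x. \<psi> x \<noteq> 0}"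
  have A: "compact ?A" "?A \<subseteq> \<Omega>" using assms by (auto simp: test_functions_def)
  have sub: "closure {x. a * \<phi> x + b * \<psi> x \<noteq> 0} \<subseteq> ?A"
    unfolding closure_Un[symmetric] by (intro closure_mono) auto
  moreover have "compact (closure {x. a * \<phi> x + b * \<psi> x \<noteq> 0})"
    using compact_Int_closed[OF A(1) closed_closure, of "{x. a * \<phi> x + b * \<psi> x \<noteq> 0}"] sub
    by (simp only: Int_absorb1)
  ultimately show ?thesis using assms A(2) by (auto simp: test_functions_def intro!: cd_lincomb)
qed

lemma test_functions_zero: "(\<lambda>x. 0) \<in> test_functions \<Omega>"
  by (simp add: test_functions_def cd_const)

lemma test_functions_outside: "\<phi> \<in> test_functions \<Omega> \<Longrightarrow> x \<notin> \<Omega> \<Longrightarrow> \<phi> x = 0"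
  unfolding test_functions_def using closure_subset[of "{x. \<phi> x \<noteq> 0}"] by auto

lemma test_functions_cd: "\<phi> \<in> test_functions \<Omega> \<Longrightarrow> continuously_differentiable n \<phi>"
  by (simp add: test_functions_def)

lemma cd_partial: "continuously_differentiable (Suc n) f \<Longrightarrow> continuously_differentiable n (partial_deriv i f)"
  by simp

text \<open>The affine arguments are written out so that \<open>cd_ridge\<close> applies literally;
  the readable form is \<open>box_bump_alt\<close>. The factor \<open>Suc n\<close> stretches the
  arguments, so the values tend to 1 inside the box while they stay 0 outside.\<close>

definition box_bump :: "nat \<Rightarrow> real^'d::finite \<Rightarrow> real^'d \<Rightarrow> real^'d \<Rightarrow> real" where
  "box_bump n a b x = (\<Prod>i\<in>UNIV. bump 0 (real (Suc n) * (x $ i) + - real (Suc n) * a $ i)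
      * bump 0 (- real (Suc n) * (x $ i) + real (Suc n) * b $ i))"

lemma box_bump_alt: "box_bump n a b x = (\<Prod>i\<in>UNIV. bump 0 (real (Suc n) * (x $ i - a $ i))
    * bump 0 (real (Suc n) * (b $ i - x $ i)))"
  unfolding box_bump_def by (intro prod.cong arg_cong2[where f="(*)"] arg_cong[where f="bump 0"])
    (simp_all add: algebra_simps)

lemma box_bump_nonzero: "box_bump n a b x \<noteq> 0 \<Longrightarrow> x \<in> box a b"
  by (auto simp: box_bump_alt bump_0 mem_box_cart zero_less_mult_iff split: if_splits)

lemma continuous_measurable_lebesgue_on:
  "continuous_on UNIV f \<Longrightarrow> f \<in> borel_measurable (lebesgue_on S)"
  by (intro measurable_restrict_space1 measurable_completion) (simp add: borel_measurable_continuous_onI)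

lemma box_bump_test:
  assumes "cbox a b \<subseteq> \<Omega>"
  shows "box_bump n a b \<in> test_functions \<Omega>"
proof -
  have "continuously_differentiable m (box_bump n a b)" for m
    unfolding box_bump_def[abs_def]
    by (intro cd_prod cd_mult cd_ridge[where D=bump] bump_deriv)
  moreover have "closure {x. box_bump n a b x \<noteq> 0} \<subseteq> cbox a b"
  proof (rule closure_minimal)
    show "{x. box_bump n a b x \<noteq> 0} \<subseteq> cbox a b"
      using box_bump_nonzero[of n a b] box_subset_cbox[of a b] by blast
  qed (rule closed_cbox)
  moreover from this have "bounded {x. box_bump n a b x \<noteq> 0}"
    using bounded_subset[OF bounded_cbox] closure_subset subset_trans by metis
  ultimately show ?thesis using assms unfolding test_functions_def
    by (auto simp: compact_closure)
qed

lemma box_bump_le: "\<bar>box_bump n a b x\<bar> \<le> 1"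
proof -
  have "0 \<le> bump 0 s \<and> bump 0 s \<le> 1" for s by (auto simp: bump_0)
  then show ?thesis unfolding box_bump_def abs_prod
    by (intro prod_le_1) (auto simp: abs_mult intro!: mult_le_one)
qed

lemma box_bump_tendsto: "(\<lambda>n. box_bump n a b x) \<longlonglongrightarrow> indicator (box a b) x"
proof (cases "x \<in> box a b")
  case True
  have pos: "a $ i < x $ i" "x $ i < b $ i" for i using True by (auto simp: mem_box_cart)
  have lim: "(\<lambda>n. exp (- inverse (real (Suc n) * c))) \<longlonglongrightarrow> 1" if "c > 0" for c
  proof -
    have "(\<lambda>n. exp (- (inverse (real (Suc n)) * inverse c))) \<longlonglongrightarrow> exp (- (0 * inverse c))"
      by (intro tendsto_intros LIMSEQ_inverse_real_of_nat)
    then show ?thesis by simp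
  qed
  have e1: "bump 0 (real (Suc n) * (x $ i - a $ i)) = exp (- inverse (real (Suc n) * (x $ i - a $ i)))" for n i
    using pos[of i] by (auto simp: bump_0)
  have e2: "bump 0 (real (Suc n) * (b $ i - x $ i)) = exp (- inverse (real (Suc n) * (b $ i - x $ i)))" for n i
    using pos[of i] by (auto simp: bump_0)
  have "(\<lambda>n. box_bump n a b x) \<longlonglongrightarrow> (\<Prod>i\<in>(UNIV::'a set). 1 * 1)"
    unfolding box_bump_alt e1 e2 using pos by (intro tendsto_intros lim) auto
  then show ?thesis using True by simp
next
  case False
  then have "box_bump n a b x = 0" for n using box_bump_nonzero by blast
  then show ?thesis using False by simp
qed

text \<open>Box bumps and dominated convergence show that \<open>g\<close> has integral 0 over every
  open box whose closed box lies in \<open>\<Omega>\<close>. Since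
  \<open>AE_lebesgue_zeroI_box\<close> asks for all boxes, \<open>g\<close> is cut off to the
  members of a countable cover of \<open>\<Omega>\<close> by closed boxes and treated on each of
  them.\<close>

lemma fundamental_lemma_calculus_of_variations:
  fixes g :: "real^'d::finite \<Rightarrow> real"
  assumes \<Omega>: "open \<Omega>" and g: "integrable (lebesgue_on \<Omega>) g"
    and z: "\<And>\<phi>. \<phi> \<in> test_functions \<Omega> \<Longrightarrow> (\<integral>x. g x * \<phi> x \<partial>lebesgue_on \<Omega>) = 0"
  shows "AE x in lebesgue_on \<Omega>. g x = 0"
proof -
  have \<Omega>s: "\<Omega> \<inter> space lebesgue \<in> sets lebesgue" "\<Omega> \<in> sets lebesgue" using \<Omega> by auto
  have box0: "(\<integral>x. g x * indicator (box a b) x \<partial>lebesgue_on \<Omega>) = 0" if ab: "cbox a b \<subseteq> \<Omega>" for a b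
  proof -
    have "(\<lambda>n. \<integral>x. g x * box_bump n a b x \<partial>lebesgue_on \<Omega>) \<longlonglongrightarrow> (\<integral>x. g x * indicator (box a b) x \<partial>lebesgue_on \<Omega>)"
    proof (rule integral_dominated_convergence[where w="\<lambda>x. norm (g x)"])
      have "box_bump n a b \<in> borel_measurable (lebesgue_on \<Omega>)" for n
        using test_functions_continuous[OF box_bump_test[OF ab, of n]]
        by (rule continuous_measurable_lebesgue_on)
      then show "(\<lambda>x. g x * box_bump n a b x) \<in> borel_measurable (lebesgue_on \<Omega>)" for n
        using g by auto
      have "box a b \<in> sets lebesgue" by auto
      then show "(\<lambda>x. g x * indicator (box a b) x) \<in> borel_measurable (lebesgue_on \<Omega>)"
        by (intro borel_measurable_times borel_measurable_integrable[OF g]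
          measurable_restrict_space1 borel_measurable_indicator)
      show "AE x in lebesgue_on \<Omega>. (\<lambda>n. g x * box_bump n a b x) \<longlonglongrightarrow> g x * indicator (box a b) x"
        by (intro AE_I2 tendsto_intros box_bump_tendsto)
      show "AE x in lebesgue_on \<Omega>. norm (g x * box_bump n a b x) \<le> norm (g x)" for n
        using box_bump_le by (auto simp: abs_mult intro!: AE_I2 mult_left_le)
    qed (use g in auto)
    then show ?thesis using z[OF box_bump_test[OF ab]] by (simp add: LIMSEQ_const_iff)
  qed
  define G where "G = (\<lambda>x. indicator \<Omega> x * g x)"
  have G: "integrable lebesgue G"
    using g integrable_restrict_space[OF \<Omega>s(1), of g] by (simp add: G_def)
  have G0: "(\<integral>x. indicator (box a b) x * G x \<partial>lebesgue) = 0" if ab: "cbox a b \<subseteq> \<Omega>" for a b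
  proof -
    have "(\<integral>x. g x * indicator (box a b) x \<partial>lebesgue_on \<Omega>) = (\<integral>x. indicator \<Omega> x *\<^sub>R (g x * indicator (box a b) x) \<partial>lebesgue)"
      by (rule integral_restrict_space[OF \<Omega>s(1)])
    then show ?thesis using box0[OF ab] by (simp add: G_def mult_ac)
  qed
  obtain \<D> where D: "countable \<D>" "\<D> \<subseteq> Pow \<Omega>" "\<And>X. X \<in> \<D> \<Longrightarrow> \<exists>a b. X = cbox a b" "\<Union>\<D> = \<Omega>"
    using open_countable_Union_open_cbox[OF \<Omega>] by metis
  have "AE x in lebesgue. \<forall>X\<in>\<D>. x \<in> X \<longrightarrow> G x = 0"
  proof (subst AE_ball_countable[OF D(1)], intro ballI)
    fix X assume X: "X \<in> \<D>"
    then obtain c d where cd: "X = cbox c d" "cbox c d \<subseteq> \<Omega>" using D by blast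
    have h: "integrable lebesgue (\<lambda>x. indicator (box c d) x * G x)"
      using integrable_mult_indicator[OF _ G, of "box c d"] by simp
    have "AE x in lebesgue. indicator (box c d) x * G x = 0"
    proof (rule AE_lebesgue_zeroI_box[OF h])
      fix a b
      \<comment> \<open>Cutting an arbitrary box down to \<open>box c d\<close> leaves a box that is
        compactly contained in \<open>\<Omega>\<close> or empty, so the first part of the proof
        applies to it.\<close>
      let ?l = "\<chi> i. max (a $ i) (c $ i)" and ?u = "\<chi> i. min (b $ i) (d $ i)"
      have I: "box a b \<inter> box c d = box ?l ?u" by (auto simp: mem_box_cart set_eq_iff)
      have eq: "indicator (box a b) x * (indicator (box c d) x * G x) = indicator (box ?l ?u) x * G x" for x
        unfolding I[symmetric] by (simp add: indicator_inter_arith)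
      show "(\<integral>x. indicator (box a b) x * (indicator (box c d) x * G x) \<partial>lebesgue) = 0"
      proof (cases "box ?l ?u = {}")
        case True
        then show ?thesis unfolding eq by simp
      next
        case False
        have "cbox ?l ?u \<subseteq> cbox c d" by (auto simp: mem_box_cart)
        then show ?thesis unfolding eq using cd G0 by blast
      qed
    qed
    \<comment> \<open>The argument used open boxes, the cover consists of closed ones; the faces are
      negligible.\<close>
    moreover have "AE x in lebesgue. x \<notin> cbox c d - box c d"
      using negligible_frontier_interval[of c d] by (intro AE_not_in) (simp add: negligible_iff_null_sets)
    ultimately show "AE x in lebesgue. x \<in> X \<longrightarrow> G x = 0"
      unfolding cd by eventually_elim (auto simp: indicator_def)
  qed
  then have "AE x in lebesgue. x \<in> \<Omega> \<longrightarrow> g x = 0"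
    by eventually_elim (use D(4) in \<open>auto simp: G_def indicator_def\<close>)
  then show ?thesis using \<Omega>s by (simp add: AE_restrict_space_iff)
qed

section \<open>Weak gradients\<close>

text \<open>By translation invariance every difference quotient of \<open>\<psi>\<close> has
  integral 0. The Lipschitz bound and the bounded support dominate the quotients, so the limit has
  integral 0 as well. The derivative may be missing on a null set, which is the situation of a
  piecewise smooth function.\<close>

lemma integral_directional_deriv_eq_0:
  fixes \<psi> :: "'a::euclidean_space \<Rightarrow> real"
  assumes lip: "\<And>x y. \<bar>\<psi> x - \<psi> y\<bar> \<le> L * norm (x - y)" and L: "L \<ge> 0"
    and supp: "\<And>x. \<psi> x \<noteq> 0 \<Longrightarrow> norm x \<le> R"
    and D: "D \<in> borel_measurable lebesgue"
    and deriv: "AE x in lebesgue. ((\<lambda>s. \<psi> (x + s *\<^sub>R e)) has_real_derivative D x) (at 0)"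
  shows "(\<integral>x. D x \<partial>lebesgue) = 0"
proof -
  define F where "F = (\<lambda>n x. (\<psi> (x + inverse (real (Suc n)) *\<^sub>R e) - \<psi> x) / inverse (real (Suc n)))"
  have "continuous_on UNIV \<psi>"
  proof (rule lipschitz_on_continuous_on)
    show "lipschitz_on L UNIV \<psi>" using lip L by (intro lipschitz_onI) (auto simp: dist_norm)
  qed
  then have meas: "\<psi> \<in> borel_measurable borel" by (rule borel_measurable_continuous_onI)
  then have Fm: "F n \<in> borel_measurable borel" for n
    unfolding F_def by (intro borel_measurable_divide borel_measurable_diff
        measurable_compose[OF _ meas] borel_measurable_add) auto
  have bound: "\<bar>F n x\<bar> \<le> L * norm e * indicator (cball 0 (R + norm e)) x" for n x
  proof (cases "x \<in> cball 0 (R + norm e)")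
    case True
    have "\<bar>\<psi> (x + inverse (real (Suc n)) *\<^sub>R e) - \<psi> x\<bar> \<le> L * norm (inverse (real (Suc n)) *\<^sub>R e)"
      using lip[of "x + inverse (real (Suc n)) *\<^sub>R e" x] by simp
    then have "\<bar>\<psi> (x + inverse (real (Suc n)) *\<^sub>R e) - \<psi> x\<bar> \<le> (L * norm e) * inverse (real (Suc n))"
      by (simp add: mult_ac del: of_nat_Suc)
    moreover have "inverse (real (Suc n)) > 0" by simp
    ultimately have "\<bar>\<psi> (x + inverse (real (Suc n)) *\<^sub>R e) - \<psi> x\<bar> / inverse (real (Suc n)) \<le> L * norm e"
      using pos_divide_le_eq by blast
    then show ?thesis using True by (simp add: F_def abs_divide del: of_nat_Suc)
  next
    case False
    \<comment> \<open>The increments have length at most \<open>norm e\<close>, so beyond the radius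
      \<open>R + norm e\<close> both points of the difference quotient lie outside the
      support.\<close>
    have "norm (inverse (real (Suc n)) *\<^sub>R e) \<le> norm e"
      by (simp add: field_simps mult_left_le)
    then have "norm (x + inverse (real (Suc n)) *\<^sub>R e) > R"
      using False norm_triangle_ineq2[of x "- (inverse (real (Suc n)) *\<^sub>R e)"] by simp
    moreover have "norm x > R"
    proof -
      have "R + norm e < norm x" using False by simp
      then show ?thesis using norm_ge_zero[of e] by linarith
    qed
    ultimately have "\<psi> (x + inverse (real (Suc n)) *\<^sub>R e) = 0" "\<psi> x = 0" using supp by fastforce+
    then show ?thesis using L by (simp add: F_def)
  qed
  have ib: "integrable lborel (\<lambda>x. C * indicator (cball 0 r) x :: real)" for C r
    by (intro integrable_mult_right integrable_real_indicator) (use emeasure_bounded_finite[OF bounded_cball] in auto)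
  have \<psi>i: "integrable lborel \<psi>"
  proof (rule Bochner_Integration.integrable_bound[OF ib[of "L * (2 * \<bar>R\<bar> + 2)" "\<bar>R\<bar>"]])
    show "AE x in lborel. norm (\<psi> x) \<le> norm (L * (2 * \<bar>R\<bar> + 2) * indicator (cball 0 \<bar>R\<bar>) x)"
    proof (intro AE_I2)
      fix x :: 'a
      obtain b :: 'a where b: "b \<in> Basis" using nonempty_Basis by blast
      \<comment> \<open>A point outside the ball in which \<open>\<psi>\<close> may be nonzero:
        comparison with its value 0 turns the Lipschitz condition into a bound for
        \<open>\<psi>\<close> itself, hence the constant
        \<open>2 * \<bar>R\<bar> + 2\<close>.\<close>
      let ?y = "(\<bar>R\<bar> + 1) *\<^sub>R b"
      have "norm ?y = \<bar>R\<bar> + 1" using b by simp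
      then have y0: "\<psi> ?y = 0" using supp[of ?y] by fastforce
      show "norm (\<psi> x) \<le> norm (L * (2 * \<bar>R\<bar> + 2) * indicator (cball 0 \<bar>R\<bar>) x)"
      proof (cases "\<psi> x = 0")
        case False
        then have x: "norm x \<le> \<bar>R\<bar>" using supp by fastforce
        have "\<bar>\<psi> x\<bar> \<le> L * norm (x - ?y)" using lip[of x ?y] y0 by simp
        also have "\<dots> \<le> L * (2 * \<bar>R\<bar> + 2)"
          using norm_triangle_ineq4[of x ?y] x \<open>norm ?y = _\<close> L by (intro mult_left_mono) auto
        finally show ?thesis using x by simp
      qed simp
    qed
  qed (use meas in simp)
  have F0: "(\<integral>x. F n x \<partial>lebesgue) = 0" for n
  proof -
    let ?v = "inverse (real (Suc n)) *\<^sub>R e"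
    have tr: "integrable lborel (\<lambda>x. \<psi> (x + ?v)) \<and> (\<integral>x. \<psi> (x + ?v) \<partial>lborel) = (\<integral>x. \<psi> x \<partial>lborel)"
    proof -
      have d: "distr lborel borel ((+) ?v) = lborel" by (rule lborel_distr_plus)
      have "integrable (distr lborel borel ((+) ?v)) \<psi> = integrable lborel (\<lambda>x. \<psi> (?v + x))"
        by (rule integrable_distr_eq) (use meas in auto)
      moreover have "(\<integral>x. \<psi> x \<partial>distr lborel borel ((+) ?v)) = (\<integral>x. \<psi> (?v + x) \<partial>lborel)"
        by (rule integral_distr) (use meas in auto)
      ultimately show ?thesis using \<psi>i unfolding d by (simp add: add.commute)
    qed
    have "(\<integral>x. F n x \<partial>lebesgue) = (\<integral>x. F n x \<partial>lborel)"
      by (rule integral_completion) (use Fm in simp)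
    also have "\<dots> = 0" using tr \<psi>i unfolding F_def by simp
    finally show ?thesis .
  qed
  have "(\<lambda>n. \<integral>x. F n x \<partial>lebesgue) \<longlonglongrightarrow> (\<integral>x. D x \<partial>lebesgue)"
  proof (rule integral_dominated_convergence[where w="\<lambda>x. L * norm e * indicator (cball 0 (R + norm e)) x"])
    show "AE x in lebesgue. (\<lambda>n. F n x) \<longlonglongrightarrow> D x"
      using deriv
    proof eventually_elim
      case (elim x)
      then have "((\<lambda>y. (\<psi> (x + y *\<^sub>R e) - \<psi> (x + 0 *\<^sub>R e)) / (y - 0)) \<longlongrightarrow> D x) (at 0)"
        by (simp add: has_field_derivative_iff)
      then have "((\<lambda>y. (\<psi> (x + y *\<^sub>R e) - \<psi> (x + 0 *\<^sub>R e)) / (y - 0)) \<circ> (\<lambda>n. inverse (real (Suc n)))) \<longlonglongrightarrow> D x"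
        unfolding tendsto_at_iff_sequentially using LIMSEQ_inverse_real_of_nat by (auto simp del: of_nat_Suc)
      then show ?case by (simp add: F_def o_def)
    qed
    show "AE x in lebesgue. norm (F n x) \<le> L * norm e * indicator (cball 0 (R + norm e)) x" for n
      using bound by simp
    show "F n \<in> borel_measurable lebesgue" for n
      by (rule measurable_completion) (use Fm in simp)
    show "integrable lebesgue (\<lambda>x. L * norm e * indicator (cball 0 (R + norm e)) x)"
      unfolding integrable_completion[OF borel_measurable_integrable[OF ib]] by (rule ib)
  qed (rule D)
  then show ?thesis by (simp add: F0 LIMSEQ_const_iff)
qed

lemma has_directional_deriv:
  assumes "f differentiable (at x)"
  shows "((\<lambda>s. f (x + s *\<^sub>R axis i 1)) has_real_derivative partial_deriv i f x) (at 0)"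
proof -
  have f: "(f has_derivative frechet_derivative f (at x)) (at (x + 0 *\<^sub>R axis i 1))"
    using assms by (simp add: frechet_derivative_works[symmetric])
  have "((\<lambda>s. x + s *\<^sub>R axis i (1::real)) has_derivative (\<lambda>s. s *\<^sub>R axis i 1)) (at 0)"
    by (auto intro!: derivative_eq_intros)
  from has_derivative_compose[OF this f]
  have "((\<lambda>s. f (x + s *\<^sub>R axis i 1)) has_derivative (\<lambda>s. frechet_derivative f (at x) (s *\<^sub>R axis i 1))) (at 0)" .
  moreover have "frechet_derivative f (at x) (s *\<^sub>R axis i 1) = partial_deriv i f x * s" for s
    using linear_frechet_derivative[OF assms] by (simp add: partial_deriv_def linear_cmul)
  ultimately show ?thesis by (simp add: has_field_derivative_def)
qed

lemma frechet_partial: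
  assumes "f differentiable (at x)"
  shows "frechet_derivative f (at x) h = (\<Sum>i\<in>UNIV. h $ i * partial_deriv i f x)"
proof -
  have lin: "linear (frechet_derivative f (at x))" by (rule linear_frechet_derivative[OF assms])
  have "frechet_derivative f (at x) h = frechet_derivative f (at x) (\<Sum>i\<in>UNIV. h $ i *\<^sub>R axis i 1)"
    using basis_expansion[of h] by (simp add: scalar_mult_eq_scaleR)
  also have "\<dots> = (\<Sum>i\<in>UNIV. h $ i * partial_deriv i f x)"
    by (simp add: linear_sum[OF lin] linear_cmul[OF lin] partial_deriv_def)
  finally show ?thesis .
qed

lemma continuous_on_compact_norm_bounded:
  assumes "compact K" "continuous_on K f"
  shows "\<exists>M. \<forall>x\<in>K. norm (f x) \<le> M"
  using compact_imp_bounded[OF compact_continuous_image[OF assms(2,1)]] by (auto simp: bounded_iff)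

text \<open>The mean value inequality on a convex set; on the compact set the sum of the absolute
  partial derivatives is bounded, and it bounds the operator norm of the derivative.\<close>

lemma cd_lipschitz:
  fixes f :: "real^'d::finite \<Rightarrow> real"
  assumes f: "continuously_differentiable (Suc 0) f" and K: "compact K" "convex K"
  shows "\<exists>L\<ge>0. \<forall>x\<in>K. \<forall>y\<in>K. \<bar>f x - f y\<bar> \<le> L * norm (x - y)"
proof -
  have d: "f differentiable (at x)" for x using f by (simp add: differentiable_on_def)
  have "continuous_on K (\<lambda>x. \<Sum>i\<in>UNIV. \<bar>partial_deriv i f x\<bar>)"
    using f by (intro continuous_intros) (auto intro: continuous_on_subset)
  from continuous_on_compact_norm_bounded[OF K(1) this]
  obtain B where B: "\<And>x. x \<in> K \<Longrightarrow> \<bar>\<Sum>i\<in>UNIV. \<bar>partial_deriv i f x\<bar>\<bar> \<le> B"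
    by (auto simp: real_norm_def)
  have "norm (f x - f y) \<le> \<bar>B\<bar> * norm (x - y)" if "x \<in> K" "y \<in> K" for x y
  proof (rule differentiable_bound[OF K(2) _ _ that])
    show "(f has_derivative frechet_derivative f (at x)) (at x within K)" for x
      using d[of x] has_derivative_at_withinI frechet_derivative_works by blast
    show "onorm (frechet_derivative f (at x)) \<le> \<bar>B\<bar>" if "x \<in> K" for x
    proof (rule onorm_le)
      fix h
      have "\<bar>frechet_derivative f (at x) h\<bar> \<le> (\<Sum>i\<in>UNIV. \<bar>h $ i * partial_deriv i f x\<bar>)"
        unfolding frechet_partial[OF d] by (rule sum_abs)
      also have "\<dots> \<le> (\<Sum>i\<in>UNIV. norm h * \<bar>partial_deriv i f x\<bar>)"
        by (intro sum_mono) (auto simp: abs_mult intro!: mult_right_mono component_le_norm_cart)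
      also have "\<dots> \<le> norm h * \<bar>B\<bar>"
        unfolding sum_distrib_left[symmetric] using B[OF that] by (intro mult_left_mono) auto
      finally show "norm (frechet_derivative f (at x) h) \<le> \<bar>B\<bar> * norm h" by (simp add: mult.commute)
    qed
  qed
  then show ?thesis by (intro exI[of _ "\<bar>B\<bar>"]) auto
qed

text \<open>On the segment from \<open>x\<close> to \<open>y\<close> the pieces become finitely many
  closed sets that cover an interval, and there Lipschitz bounds with a common constant glue
  together.\<close>

lemma lipschitz_from_closed_cover:
  fixes \<psi> :: "'a::real_normed_vector \<Rightarrow> real"
  assumes "finite \<C>" "\<And>C. C \<in> \<C> \<Longrightarrow> closed C" "\<Union>\<C> = UNIV" "L \<ge> 0"
    and lip: "\<And>C x y. C \<in> \<C> \<Longrightarrow> x \<in> C \<Longrightarrow> y \<in> C \<Longrightarrow> \<bar>\<psi> x - \<psi> y\<bar> \<le> L * norm (x - y)"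
  shows "\<bar>\<psi> x - \<psi> y\<bar> \<le> L * norm (x - y)"
proof -
  define l where "l = (\<lambda>s. x + s *\<^sub>R (y - x))"
  have cl: "continuous_on UNIV l" unfolding l_def by (intro continuous_intros)
  have nl: "norm (l s - l t) = \<bar>s - t\<bar> * norm (x - y)" for s t
  proof -
    have "l s - l t = (s - t) *\<^sub>R (y - x)" by (simp add: l_def algebra_simps)
    then show ?thesis by (simp add: norm_minus_commute)
  qed
  have "lipschitz_on (L * norm (x - y)) {0..1} (\<psi> \<circ> l)"
  proof (rule lipschitz_on_closed_Union[where U="\<lambda>C. l -` C"])
    fix C assume C: "C \<in> \<C>"
    show "lipschitz_on (L * norm (x - y)) (l -` C) (\<psi> \<circ> l)"
    proof (rule lipschitz_onI)
      fix s t assume "s \<in> l -` C" "t \<in> l -` C"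
      then show "dist ((\<psi> \<circ> l) s) ((\<psi> \<circ> l) t) \<le> L * norm (x - y) * dist s t"
        using lip[OF C, of "l s" "l t"] by (simp add: nl dist_norm mult_ac)
    qed (use assms in simp)
    show "closed (l -` C)" using assms(2)[OF C] cl by (rule closed_vimage)
  next
    have "l s \<in> \<Union>\<C>" for s using assms(3) by simp
    then show "{0..1} \<subseteq> (\<Union>C\<in>\<C>. l -` C)" by blast
  qed (use assms(1,4) in auto)
  from lipschitz_onD[OF this, of 0 1] show ?thesis by (simp add: l_def dist_norm)
qed

text \<open>Interiors are open, so a nested case distinction over them is Borel. Overlapping
  interiors are allowed: some piece is picked there, and its agreement with the others is left to
  the application.\<close>

lemma measurable_piece_selection:
  fixes G :: "'a::euclidean_space set \<Rightarrow> 'a \<Rightarrow> 'b::euclidean_space"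
  assumes "finite \<T>" "\<And>K. K \<in> \<T> \<Longrightarrow> G K \<in> borel_measurable borel"
  shows "\<exists>g\<in>borel_measurable borel. (\<forall>x. g x = 0 \<or> (\<exists>K\<in>\<T>. g x = G K x)) \<and>
    (\<forall>x\<in>\<Union>(interior ` \<T>). \<exists>K\<in>\<T>. x \<in> interior K \<and> g x = G K x)"
  using assms
proof (induction \<T>)
  case empty
  then show ?case by (intro bexI[of _ "\<lambda>x. 0"]) auto
next
  case (insert K \<T>)
  then obtain g where g: "g \<in> borel_measurable borel" "\<forall>x. g x = 0 \<or> (\<exists>K\<in>\<T>. g x = G K x)"
      "\<forall>x\<in>\<Union>(interior ` \<T>). \<exists>K\<in>\<T>. x \<in> interior K \<and> g x = G K x"
    by auto
  have "(\<lambda>x. if x \<in> interior K then G K x else g x) \<in> borel_measurable borel"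
    using g(1) insert.prems by (intro measurable_If_set) auto
  then show ?case using g(2,3) by (intro bexI[of _ "\<lambda>x. if x \<in> interior K then G K x else g x"]) auto
qed

section \<open>Components of vector fields, and weak gradients on a bounded open set\<close>

lemma L2_nth: "g \<in> L2 \<Omega> \<Longrightarrow> (\<lambda>x. g x $ i) \<in> L2 \<Omega>"
proof (rule L2_bounded_mult[where M=1])
  assume g: "g \<in> L2 \<Omega>"
  show "(\<lambda>x. g x $ i) \<in> borel_measurable (lebesgue_on \<Omega>)"
    by (rule measurable_compose[OF L2_measurable[OF g]])
      (rule borel_measurable_continuous_onI[OF linear_continuous_on[OF bounded_linear_vec_nth]])
qed (auto intro!: AE_I2 Finite_Cartesian_Product.norm_nth_le)

lemma L2_vecI:
  fixes g :: "'a::euclidean_space \<Rightarrow> 'b::euclidean_space^'d::finite"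
  assumes "\<And>i. (\<lambda>x. g x $ i) \<in> L2 \<Omega>"
  shows "g \<in> L2 \<Omega>"
proof -
  have m: "g \<in> borel_measurable (lebesgue_on \<Omega>)"
    unfolding borel_measurable_euclidean_space[of g]
  proof
    fix b :: "'b^'d" assume "b \<in> Basis"
    then obtain i c where b: "b = axis i c" by (auto simp: Basis_vec_def)
    have "(\<lambda>x. g x $ i \<bullet> c) \<in> borel_measurable (lebesgue_on \<Omega>)" using L2_measurable[OF assms[of i]] by auto
    then show "(\<lambda>x. g x \<bullet> b) \<in> borel_measurable (lebesgue_on \<Omega>)" by (simp add: b inner_axis)
  qed
  have "integrable (lebesgue_on \<Omega>) (\<lambda>x. \<Sum>i\<in>UNIV. (norm (g x $ i))\<^sup>2)"
    using assms by (auto simp: L2_def)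
  moreover have "(norm (g x))\<^sup>2 = (\<Sum>i\<in>UNIV. (norm (g x $ i))\<^sup>2)" for x
    by (simp add: norm_vec_def L2_set_def sum_nonneg)
  ultimately show ?thesis using m by (simp add: L2_def)
qed

lemma l2_inner_vec:
  fixes u v :: "'a::euclidean_space \<Rightarrow> 'b::euclidean_space^'d::finite"
  assumes "u \<in> L2 \<Omega>" "v \<in> L2 \<Omega>"
  shows "l2_inner \<Omega> u v = (\<Sum>i\<in>UNIV. l2_inner \<Omega> (\<lambda>x. u x $ i) (\<lambda>x. v x $ i))"
proof -
  have "integrable (lebesgue_on \<Omega>) (\<lambda>x. u x $ i \<bullet> v x $ i)" for i
    using L2_integrable_inner[OF L2_nth[OF assms(1)] L2_nth[OF assms(2)]] .
  then show ?thesis by (simp add: l2_inner_def inner_vec_def)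
qed

lemma l2_norm_triangle:
  assumes "u \<in> L2 \<Omega>" "v \<in> L2 \<Omega>"
  shows "l2_norm \<Omega> (\<lambda>x. a *\<^sub>R u x + b *\<^sub>R v x) \<le> \<bar>a\<bar> * l2_norm \<Omega> u + \<bar>b\<bar> * l2_norm \<Omega> v"
proof (rule power2_le_imp_le)
  have "(l2_norm \<Omega> (\<lambda>x. a *\<^sub>R u x + b *\<^sub>R v x))\<^sup>2
      = a\<^sup>2 * (l2_norm \<Omega> u)\<^sup>2 + 2 * (a * b * l2_inner \<Omega> u v) + b\<^sup>2 * (l2_norm \<Omega> v)\<^sup>2"
    unfolding l2_norm_power2 using assms
    by (simp add: l2_inner_lincomb_left l2_inner_lincomb_right L2_lincomb
        l2_inner_commute[of \<Omega> v u] power2_eq_square algebra_simps)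
  moreover have "a * b * l2_inner \<Omega> u v \<le> \<bar>a\<bar> * \<bar>b\<bar> * (l2_norm \<Omega> u * l2_norm \<Omega> v)"
    unfolding abs_mult[symmetric]
    by (rule order_trans[OF abs_ge_self]) (auto simp: abs_mult intro!: mult_left_mono l2_Cauchy_Schwarz assms)
  moreover have "(\<bar>a\<bar> * l2_norm \<Omega> u + \<bar>b\<bar> * l2_norm \<Omega> v)\<^sup>2 = a\<^sup>2 * (l2_norm \<Omega> u)\<^sup>2
      + 2 * (\<bar>a\<bar> * \<bar>b\<bar> * (l2_norm \<Omega> u * l2_norm \<Omega> v)) + b\<^sup>2 * (l2_norm \<Omega> v)\<^sup>2"
    by (simp add: power2_sum power_mult_distrib algebra_simps)
  ultimately show "(l2_norm \<Omega> (\<lambda>x. a *\<^sub>R u x + b *\<^sub>R v x))\<^sup>2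
      \<le> (\<bar>a\<bar> * l2_norm \<Omega> u + \<bar>b\<bar> * l2_norm \<Omega> v)\<^sup>2" by linarith
qed simp

text \<open>Boundedness makes the measure finite, so that \<open>L2\<close> functions are integrable
  and functions continuous on the closure belong to \<open>L2\<close>.\<close>

locale bounded_open =
  fixes \<Omega> :: "(real^'d::finite) set"
  assumes open_\<Omega>: "open \<Omega>" and bounded_\<Omega>: "bounded \<Omega>"
begin

lemma lmeasurable_\<Omega>: "\<Omega> \<in> lmeasurable"
  using open_\<Omega> bounded_\<Omega> by (simp add: lmeasurable_open)

sublocale fm: finite_measure "lebesgue_on \<Omega>"
  using lmeasurable_\<Omega> by (rule finite_measure_lebesgue_on)

lemma L2_one: "(\<lambda>x. 1::real) \<in> L2 \<Omega>"
  by (simp add: L2_def)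

lemma L2_bounded:
  assumes "f \<in> borel_measurable (lebesgue_on \<Omega>)" "\<And>x. x \<in> \<Omega> \<Longrightarrow> norm (f x) \<le> M"
  shows "f \<in> L2 \<Omega>"
  by (rule L2_bounded_mult[OF L2_one assms(1), of M]) (use assms(2) in \<open>auto intro!: AE_I2\<close>)

lemma L2_integrable:
  assumes "f \<in> L2 \<Omega>" shows "integrable (lebesgue_on \<Omega>) f"
proof (rule Bochner_Integration.integrable_bound[where f="\<lambda>x. 1 + (norm (f x))\<^sup>2"])
  show "AE x in lebesgue_on \<Omega>. norm (f x) \<le> norm (1 + (norm (f x))\<^sup>2)"
  proof (intro AE_I2)
    fix x
    have "0 \<le> (norm (f x) - 1)\<^sup>2" by simp
    then have "2 * norm (f x) \<le> (norm (f x))\<^sup>2 + 1" by (simp add: power2_diff)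
    with norm_ge_zero[of "f x"] have "norm (f x) \<le> 1 + (norm (f x))\<^sup>2" by linarith
    then show "norm (f x) \<le> norm (1 + (norm (f x))\<^sup>2)" by simp
  qed
qed (use assms in \<open>auto simp: L2_def\<close>)

lemma L2_continuous:
  assumes "continuous_on (closure \<Omega>) f" shows "f \<in> L2 \<Omega>"
proof -
  obtain M where M: "\<And>x. x \<in> closure \<Omega> \<Longrightarrow> norm (f x) \<le> M"
    using continuous_on_compact_norm_bounded[OF _ assms] bounded_\<Omega> compact_closure by blast
  have "f \<in> borel_measurable (lebesgue_on \<Omega>)"
    by (rule continuous_imp_measurable_on_sets_lebesgue)
      (use assms closure_subset open_\<Omega> in \<open>auto intro: continuous_on_subset\<close>)
  then show ?thesis by (rule L2_bounded[where M=M]) (use M closure_subset in auto)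
qed

lemma L2_cd: "continuously_differentiable n f \<Longrightarrow> f \<in> L2 \<Omega>"
  using cd_continuous[of n f] by (intro L2_continuous) (auto intro: continuous_on_subset)

lemma L2_test: "\<phi> \<in> test_functions \<Omega> \<Longrightarrow> \<phi> \<in> L2 \<Omega>"
  using L2_cd[OF test_functions_cd[of \<phi> \<Omega> 0]] .

lemma L2_test_partial: "\<phi> \<in> test_functions \<Omega> \<Longrightarrow> partial_deriv i \<phi> \<in> L2 \<Omega>"
  using L2_cd[OF cd_partial[OF test_functions_cd[of \<phi> \<Omega> "Suc 0"]]] .

lemma weak_grad_iff: "is_weak_grad \<Omega> u g \<longleftrightarrow> g \<in> L2 \<Omega> \<and> (\<forall>\<phi>\<in>test_functions \<Omega>. \<forall>i.
    l2_inner \<Omega> u (partial_deriv i \<phi>) = - l2_inner \<Omega> (\<lambda>x. g x $ i) \<phi>)"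
  by (simp add: is_weak_grad_def l2_inner_def)

text \<open>Each component of the difference has vanishing integral against every test function, so
  the fundamental lemma applies.\<close>

lemma weak_grad_unique:
  assumes "is_weak_grad \<Omega> u g" "is_weak_grad \<Omega> u g'"
  shows "l2_eq \<Omega> g g'"
proof -
  have gL: "g \<in> L2 \<Omega>" "g' \<in> L2 \<Omega>" using assms by (auto simp: is_weak_grad_def)
  have "AE x in lebesgue_on \<Omega>. g x $ i - g' x $ i = 0" for i
  proof (rule fundamental_lemma_calculus_of_variations[OF open_\<Omega>])
    show "integrable (lebesgue_on \<Omega>) (\<lambda>x. g x $ i - g' x $ i)"
      by (intro L2_integrable L2_diff L2_nth gL)
    fix \<phi> assume \<phi>: "\<phi> \<in> test_functions \<Omega>"
    have "l2_inner \<Omega> (\<lambda>x. g x $ i - g' x $ i) \<phi> = 0"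
      using assms \<phi> gL by (simp add: weak_grad_iff l2_inner_diff_left L2_nth L2_test)
    then show "(\<integral>x. (g x $ i - g' x $ i) * \<phi> x \<partial>lebesgue_on \<Omega>) = 0" by (simp add: l2_inner_def)
  qed
  then have "AE x in lebesgue_on \<Omega>. \<forall>i\<in>UNIV. g x $ i - g' x $ i = 0"
    by (intro AE_finite_allI) auto
  then show ?thesis unfolding l2_eq_def by eventually_elim (simp add: vec_eq_iff)
qed

lemma weak_grad_cong:
  assumes "is_weak_grad \<Omega> u g" "u \<in> L2 \<Omega>" "u' \<in> L2 \<Omega>" "l2_eq \<Omega> u u'"
  shows "is_weak_grad \<Omega> u' g"
  using assms by (auto simp: weak_grad_iff L2_test_partial l2_inner_cong_left[of \<Omega> u u', symmetric])

lemma grad_weak: "u \<in> H1 \<Omega> \<Longrightarrow> is_weak_grad \<Omega> u (grad \<Omega> u)"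
  unfolding grad_def H1_def using someI_ex[of "is_weak_grad \<Omega> u"] by blast

lemma H1_L2: "u \<in> H1 \<Omega> \<Longrightarrow> u \<in> L2 \<Omega>" by (simp add: H1_def)

lemma grad_L2: "u \<in> H1 \<Omega> \<Longrightarrow> grad \<Omega> u \<in> L2 \<Omega>"
  using grad_weak[of u] by (simp add: is_weak_grad_def)

lemma H1I: "u \<in> L2 \<Omega> \<Longrightarrow> is_weak_grad \<Omega> u g \<Longrightarrow> u \<in> H1 \<Omega>"
  by (auto simp: H1_def)

text \<open>\<open>grad\<close> is an arbitrary weak gradient, so computing it always means
  exhibiting some weak gradient and identifying the two almost everywhere.\<close>

lemma grad_eq: "is_weak_grad \<Omega> u g \<Longrightarrow> l2_eq \<Omega> (grad \<Omega> u) g"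
  using weak_grad_unique someI[of "is_weak_grad \<Omega> u" g] unfolding grad_def by blast

lemma weak_grad_lincomb:
  assumes "is_weak_grad \<Omega> u g" "is_weak_grad \<Omega> v k" "u \<in> L2 \<Omega>" "v \<in> L2 \<Omega>"
  shows "is_weak_grad \<Omega> (\<lambda>x. a *\<^sub>R u x + b *\<^sub>R v x) (\<lambda>x. a *\<^sub>R g x + b *\<^sub>R k x)"
proof -
  have gk: "g \<in> L2 \<Omega>" "k \<in> L2 \<Omega>" using assms by (auto simp: is_weak_grad_def)
  have "l2_inner \<Omega> (\<lambda>x. a *\<^sub>R u x + b *\<^sub>R v x) (partial_deriv i \<phi>)
      = - l2_inner \<Omega> (\<lambda>x. (a *\<^sub>R g x + b *\<^sub>R k x) $ i) \<phi>" if "\<phi> \<in> test_functions \<Omega>" for \<phi> i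
    using that assms l2_inner_lincomb_left[OF L2_nth[OF gk(1)] L2_nth[OF gk(2)] L2_test[OF that], of a i b i]
      l2_inner_lincomb_left[OF assms(3,4) L2_test_partial[OF that], of a b]
    by (simp add: weak_grad_iff)
  then show ?thesis using gk by (simp add: weak_grad_iff L2_lincomb)
qed

lemma H1_lincomb:
  assumes "u \<in> H1 \<Omega>" "v \<in> H1 \<Omega>"
  shows "(\<lambda>x. a *\<^sub>R u x + b *\<^sub>R v x) \<in> H1 \<Omega>"
  using H1I[OF L2_lincomb weak_grad_lincomb, OF H1_L2 H1_L2 grad_weak grad_weak H1_L2 H1_L2] assms by blast

lemma grad_lincomb: "u \<in> H1 \<Omega> \<Longrightarrow> v \<in> H1 \<Omega> \<Longrightarrow>
    l2_eq \<Omega> (grad \<Omega> (\<lambda>x. a *\<^sub>R u x + b *\<^sub>R v x)) (\<lambda>x. a *\<^sub>R grad \<Omega> u x + b *\<^sub>R grad \<Omega> v x)"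
  by (intro grad_eq weak_grad_lincomb grad_weak H1_L2)

lemma grad_cong: "u \<in> H1 \<Omega> \<Longrightarrow> v \<in> H1 \<Omega> \<Longrightarrow> l2_eq \<Omega> u v \<Longrightarrow> l2_eq \<Omega> (grad \<Omega> u) (grad \<Omega> v)"
  using grad_eq[OF weak_grad_cong[of v "grad \<Omega> v" u]] grad_weak[of v] H1_L2 l2_eq_sym by blast

lemma H1_zero: "(\<lambda>x. 0) \<in> H1 \<Omega>"
  by (rule H1I[where g="\<lambda>x. 0"]) (auto simp: weak_grad_iff)

lemma lin_closed_H1: "lin_closed (H1 \<Omega>)"
  unfolding lin_closed_def using H1_zero H1_lincomb by blast

lemma grad_sum:
  assumes "finite A" "\<And>i. i \<in> A \<Longrightarrow> u i \<in> H1 \<Omega>"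
  shows "l2_eq \<Omega> (grad \<Omega> (\<lambda>x. \<Sum>i\<in>A. c i *\<^sub>R u i x)) (\<lambda>x. \<Sum>i\<in>A. c i *\<^sub>R grad \<Omega> (u i) x)"
  using assms
proof (induction A)
  case empty
  show ?case using grad_eq[of "\<lambda>x. 0" "\<lambda>x. 0"] by (simp add: weak_grad_iff)
next
  case (insert j A)
  have s: "(\<lambda>x. \<Sum>i\<in>A. c i *\<^sub>R u i x) \<in> H1 \<Omega>" using insert by (intro lin_closed_sum lin_closed_H1) auto
  have "l2_eq \<Omega> (grad \<Omega> (\<lambda>x. c j *\<^sub>R u j x + 1 *\<^sub>R (\<Sum>i\<in>A. c i *\<^sub>R u i x)))
      (\<lambda>x. c j *\<^sub>R grad \<Omega> (u j) x + 1 *\<^sub>R grad \<Omega> (\<lambda>x. \<Sum>i\<in>A. c i *\<^sub>R u i x) x)"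
    by (rule grad_lincomb) (use insert s in auto)
  also have "l2_eq \<Omega> \<dots> (\<lambda>x. c j *\<^sub>R grad \<Omega> (u j) x + 1 *\<^sub>R (\<Sum>i\<in>A. c i *\<^sub>R grad \<Omega> (u i) x))"
    by (rule l2_eq_lincomb) (use insert in auto)
  finally show ?case using insert by simp
qed

text \<open>
  A Lipschitz function with compact support has vanishing integral of any directional derivative,
  so integration by parts across the cells needs no divergence theorem on polyhedra: the product
  of a continuous piecewise smooth function and a test function is globally Lipschitz.
\<close>

lemma piecewise_weak_grad:
  assumes fin: "finite \<T>" and KK: "\<And>K. K \<in> \<T> \<Longrightarrow> compact K \<and> convex K"
    and cov: "\<Omega> \<subseteq> \<Union>\<T>" and P: "\<And>K. K \<in> \<T> \<Longrightarrow> continuously_differentiable (Suc 0) (P K)"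
    and u: "\<And>K x. K \<in> \<T> \<Longrightarrow> x \<in> K \<Longrightarrow> u x = P K x"
    and um: "u \<in> L2 \<Omega>"
  shows "\<exists>g M. is_weak_grad \<Omega> u g \<and> (\<forall>x\<in>\<Omega>. norm (g x) \<le> M) \<and>
    (\<forall>K\<in>\<T>. \<forall>x\<in>interior K. \<forall>i. g x $ i = partial_deriv i (P K) x)"
proof -
  have Pd: "P K differentiable (at x)" if "K \<in> \<T>" for K x
    using P[OF that] by (simp add: differentiable_on_def)
  have Gc: "continuous_on UNIV (\<lambda>x. (\<chi> i. partial_deriv i (P K) x)::real^'d)" if "K \<in> \<T>" for K
    using P[OF that] by (intro continuous_on_vec_lambda) auto
  obtain g where g: "g \<in> borel_measurable borel" "\<And>x. g x = 0 \<or> (\<exists>K\<in>\<T>. g x = (\<chi> i. partial_deriv i (P K) x))"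
    "\<And>x. x \<in> \<Union>(interior ` \<T>) \<Longrightarrow> \<exists>K\<in>\<T>. x \<in> interior K \<and> g x = (\<chi> i. partial_deriv i (P K) x)"
    using measurable_piece_selection[OF fin, of "\<lambda>K x. (\<chi> i. partial_deriv i (P K) x)::real^'d",
      OF borel_measurable_continuous_onI[OF Gc]] by blast
  have gK: "g x $ i = partial_deriv i (P K) x" if K: "K \<in> \<T>" "x \<in> interior K" for K x i
  proof -
    obtain J where J: "J \<in> \<T>" "x \<in> interior J" "g x = (\<chi> i. partial_deriv i (P J) x)"
      using g(3)[of x] K by auto
    have "(P J has_derivative frechet_derivative (P J) (at x)) (at x)"
      using Pd[OF J(1)] by (simp add: frechet_derivative_works[symmetric])
    \<comment> \<open>On the open set where the interiors of both cells overlap both pieces equal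
      \<open>u\<close>, so their derivatives agree and it does not matter that \<open>J\<close> was
      selected.\<close>
    then have "(P K has_derivative frechet_derivative (P J) (at x)) (at x)"
    proof (rule has_derivative_transform_within_open[of _ _ _ _ "interior K \<inter> interior J"])
      fix y assume y: "y \<in> interior K \<inter> interior J"
      then have "y \<in> K" "y \<in> J" using interior_subset by auto
      then show "P J y = P K y" using u K(1) J(1) by metis
    qed (use K J in auto)
    from partial_deriv_eq[OF this, of i] J(3) show ?thesis by (simp add: partial_deriv_def)
  qed
  have cpt: "compact (closure \<Omega>)" using bounded_\<Omega> by (simp add: compact_closure)
  have "\<exists>M. \<forall>x\<in>\<Omega>. norm ((\<chi> i. partial_deriv i (P K) x)::real^'d) \<le> M" if "K \<in> \<T>" for K
  proof -
    show ?thesis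
      using continuous_on_compact_norm_bounded[OF cpt continuous_on_subset[OF Gc[OF that] subset_UNIV]]
        closure_subset[of \<Omega>] by blast
  qed
  then obtain M where M: "\<And>K x. K \<in> \<T> \<Longrightarrow> x \<in> \<Omega> \<Longrightarrow> norm ((\<chi> i. partial_deriv i (P K) x)::real^'d) \<le> M K"
    by metis
  have gM: "norm (g x) \<le> (\<Sum>K\<in>\<T>. \<bar>M K\<bar>)" if x: "x \<in> \<Omega>" for x
  proof (cases "g x = 0")
    case False
    then obtain K where K: "K \<in> \<T>" "g x = (\<chi> i. partial_deriv i (P K) x)" using g(2) by blast
    have "norm (g x) \<le> \<bar>M K\<bar>" using M[OF K(1) x] K(2) by simp
    also have "\<dots> \<le> (\<Sum>K\<in>\<T>. \<bar>M K\<bar>)" using fin K(1) by (intro member_le_sum) auto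
    finally show ?thesis .
  qed (simp add: sum_nonneg)
  have "g \<in> borel_measurable (lebesgue_on \<Omega>)"
    by (intro measurable_restrict_space1 measurable_completion) (use g(1) in simp)
  then have gL: "g \<in> L2 \<Omega>" using gM by (rule L2_bounded)
  have "l2_inner \<Omega> u (partial_deriv i \<phi>) = - l2_inner \<Omega> (\<lambda>x. g x $ i) \<phi>"
    if \<phi>: "\<phi> \<in> test_functions \<Omega>" for \<phi> i
  proof -
    have \<phi>d: "\<phi> differentiable (at x)" for x
      using test_functions_cd[OF \<phi>, of "Suc 0"] by (simp add: differentiable_on_def)
    define \<psi> where "\<psi> = (\<lambda>x. u x * \<phi> x)"
    have "\<exists>L\<ge>0. \<forall>x\<in>K. \<forall>y\<in>K. \<bar>P K x * \<phi> x - P K y * \<phi> y\<bar> \<le> L * norm (x - y)" if "K \<in> \<T>" for K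
      using KK[OF that] by (intro cd_lipschitz cd_mult P that test_functions_cd[OF \<phi>]) auto
    then obtain L where L: "\<And>K. K \<in> \<T> \<Longrightarrow> L K \<ge> 0"
      "\<And>K x y. K \<in> \<T> \<Longrightarrow> x \<in> K \<Longrightarrow> y \<in> K \<Longrightarrow> \<bar>P K x * \<phi> x - P K y * \<phi> y\<bar> \<le> L K * norm (x - y)"
      by metis
    have Ls: "L K \<le> sum L \<T>" if "K \<in> \<T>" for K using fin L(1) that by (intro member_le_sum) auto
    have Lip: "\<bar>\<psi> x - \<psi> y\<bar> \<le> sum L \<T> * norm (x - y)" for x y
    \<comment> \<open>The complement of \<open>\<Omega>\<close> completes the cells to a closed
      cover of the whole space; on it the test function, hence the product, vanishes.\<close>
    proof (rule lipschitz_from_closed_cover[of "insert (- \<Omega>) \<T>"])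
      fix C x y assume C: "C \<in> insert (- \<Omega>) \<T>" and xy: "x \<in> C" "y \<in> C"
      show "\<bar>\<psi> x - \<psi> y\<bar> \<le> sum L \<T> * norm (x - y)"
      proof (cases "C \<in> \<T>")
        case True
        then have "\<bar>\<psi> x - \<psi> y\<bar> \<le> L C * norm (x - y)"
          using L(2)[OF True xy] u[OF True] xy by (simp add: \<psi>_def)
        also have "\<dots> \<le> sum L \<T> * norm (x - y)" using Ls[OF True] by (intro mult_right_mono) auto
        finally show ?thesis .
      next
        case False
        then have "\<phi> x = 0" "\<phi> y = 0" using C xy test_functions_outside[OF \<phi>] by auto
        then show ?thesis using L(1) by (simp add: \<psi>_def sum_nonneg)
      qed
    qed (use fin KK cov open_\<Omega> L(1) in \<open>auto intro: compact_imp_closed sum_nonneg\<close>)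
    obtain R where R: "\<And>x. x \<in> \<Omega> \<Longrightarrow> norm x \<le> R" using bounded_\<Omega> by (auto simp: bounded_iff)
    \<comment> \<open>The derivative of \<open>u * \<phi>\<close> in direction \<open>i\<close>,
      computed with \<open>g\<close> and extended by 0. Off the frontiers of the cells it is the
      classical derivative of \<open>\<psi>\<close>.\<close>
    define D where "D = (\<lambda>x. if x \<in> \<Omega> then u x * partial_deriv i \<phi> x + g x $ i * \<phi> x else 0)"
    have D0: "(\<integral>x. D x \<partial>lebesgue) = 0"
    proof (rule integral_directional_deriv_eq_0[where \<psi>=\<psi> and L="sum L \<T>" and R=R and e="axis i 1"])
      show "\<psi> x \<noteq> 0 \<Longrightarrow> norm x \<le> R" for x
        using R test_functions_outside[OF \<phi>, of x] by (auto simp: \<psi>_def)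
      have "(\<lambda>x. u x * partial_deriv i \<phi> x + g x $ i * \<phi> x) \<in> borel_measurable (lebesgue_on \<Omega>)"
        using L2_measurable[OF um] L2_measurable[OF L2_nth[OF gL]] L2_measurable[OF L2_test[OF \<phi>]]
          L2_measurable[OF L2_test_partial[OF \<phi>]]
        by (intro borel_measurable_add borel_measurable_times)
      then show "D \<in> borel_measurable lebesgue"
        unfolding D_def using open_\<Omega> by (intro borel_measurable_if_I) auto
      have "AE x in lebesgue. x \<notin> (\<Union>K\<in>\<T>. frontier K)"
      proof (intro AE_not_in)
        have "negligible (\<Union>K\<in>\<T>. frontier K)"
          using fin KK by (intro negligible_Union) (auto intro: negligible_convex_frontier)
        then show "(\<Union>K\<in>\<T>. frontier K) \<in> null_sets lebesgue" by (simp add: negligible_iff_null_sets)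
      qed
      then show "AE x in lebesgue. ((\<lambda>s. \<psi> (x + s *\<^sub>R axis i 1)) has_real_derivative D x) (at 0)"
      proof eventually_elim
        case (elim x)
        have line: "continuous_on UNIV (\<lambda>s. x + s *\<^sub>R axis i (1::real))" by (intro continuous_intros)
        show ?case
        proof (cases "x \<in> \<Omega>")
          case True
          then obtain K where K: "K \<in> \<T>" "x \<in> K" using cov by auto
          then have xK: "x \<in> interior K" using elim KK[OF K(1)] compact_imp_closed
            by (auto simp: frontier_def closure_closed compact_imp_closed)
          have "((\<lambda>s. P K (x + s *\<^sub>R axis i 1) * \<phi> (x + s *\<^sub>R axis i 1)) has_real_derivative
              (P K x * partial_deriv i \<phi> x + partial_deriv i (P K) x * \<phi> x)) (at 0)"
            using DERIV_mult[OF has_directional_deriv[OF Pd[OF K(1)], of x i] has_directional_deriv[OF \<phi>d, of x i]]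
            by (simp add: algebra_simps)
          also have "P K x * partial_deriv i \<phi> x + partial_deriv i (P K) x * \<phi> x = D x"
            using True u[OF K] gK[OF K(1) xK] by (simp add: D_def)
          finally show ?thesis
            by (rule has_field_derivative_transform_within_open[of _ _ _ "(\<lambda>s. x + s *\<^sub>R axis i 1) -` interior K"])
              (use line xK K interior_subset[of K] u in \<open>auto simp: \<psi>_def intro!: open_vimage\<close>)
        next
          case False
          let ?S = "closure {x. \<phi> x \<noteq> 0}"
          \<comment> \<open>Here it matters that the closed support lies inside
            \<open>\<Omega>\<close>: a point outside \<open>\<Omega>\<close> has a whole
            neighbourhood on which the product is zero.\<close>
          have xS: "x \<notin> ?S" using False \<phi> by (auto simp: test_functions_def)
          have "((\<lambda>s. 0) has_real_derivative D x) (at 0)" using False by (simp add: D_def)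
          then show ?thesis
            by (rule has_field_derivative_transform_within_open[of _ _ _ "(\<lambda>s. x + s *\<^sub>R axis i 1) -` (- ?S)"])
              (use line xS closure_subset[of "{x. \<phi> x \<noteq> 0}"] in \<open>auto simp: \<psi>_def intro!: open_vimage\<close>)
        qed
      qed
    qed (use Lip L(1) in \<open>auto intro: sum_nonneg\<close>)
    have i1: "integrable (lebesgue_on \<Omega>) (\<lambda>x. u x * partial_deriv i \<phi> x)"
      using L2_integrable_inner[OF um L2_test_partial[OF \<phi>]] by simp
    have i2: "integrable (lebesgue_on \<Omega>) (\<lambda>x. g x $ i * \<phi> x)"
      using L2_integrable_inner[OF L2_nth[OF gL] L2_test[OF \<phi>]] by simp
    have "(\<integral>x. u x * partial_deriv i \<phi> x + g x $ i * \<phi> x \<partial>lebesgue_on \<Omega>)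
        = (\<integral>x. indicator \<Omega> x *\<^sub>R (u x * partial_deriv i \<phi> x + g x $ i * \<phi> x) \<partial>lebesgue)"
      using open_\<Omega> by (intro integral_restrict_space) auto
    also have "\<dots> = 0" unfolding D0[symmetric]
      by (intro Bochner_Integration.integral_cong) (auto simp: D_def)
    finally show ?thesis using i1 i2 by (simp add: l2_inner_def)
  qed
  then have "is_weak_grad \<Omega> u g" using gL by (simp add: weak_grad_iff)
  then show ?thesis using gM gK by blast
qed

end

section \<open>Operators on classes modulo null sets\<close>

lemma lin_closed_vec_fields:
  assumes "lin_closed X" shows "lin_closed (vec_fields X)"
proof -
  have "(\<lambda>x. (0::real^'d::finite) $ i) \<in> X" for i using lin_closed_zero[OF assms] by simp
  moreover have "(\<lambda>x. (a *\<^sub>R u x + b *\<^sub>R v x) $ i) \<in> X" if "u \<in> vec_fields X" "v \<in> vec_fields X" for u v a b i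
    using lin_closed_lincomb[OF assms, of "\<lambda>x. u x $ i" "\<lambda>x. v x $ i" a b] that by (simp add: vec_fields_def)
  ultimately show ?thesis unfolding lin_closed_def vec_fields_def by blast
qed

lemma lin_closed_Int: "lin_closed X \<Longrightarrow> lin_closed Y \<Longrightarrow> lin_closed (X \<inter> Y)"
  by (simp add: lin_closed_def)

lemma l2_norm_scale: "l2_norm \<Omega> (\<lambda>x. a *\<^sub>R w x) = \<bar>a\<bar> * l2_norm \<Omega> w"
  by (simp add: l2_norm_def l2_inner_scale_left l2_inner_scale_right real_sqrt_mult flip: mult.assoc)

text \<open>An operator on classes, presented through representatives. Invariance under changes on
  null sets is a separate clause, because linearity alone would allow a function that is zero almost
  everywhere to have a nonzero image.\<close>

definition ae_linear :: "'a::euclidean_space set \<Rightarrow> ('a \<Rightarrow> 'b::euclidean_space) set \<Rightarrow>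
    (('a \<Rightarrow> 'b) \<Rightarrow> 'a \<Rightarrow> 'c::euclidean_space) \<Rightarrow> bool" where
  "ae_linear \<Omega> X A \<longleftrightarrow> X \<subseteq> L2 \<Omega> \<and> lin_closed X \<and> (\<forall>u\<in>X. A u \<in> L2 \<Omega>) \<and>
     (\<forall>u\<in>X. \<forall>v\<in>X. \<forall>a b. l2_eq \<Omega> (A (\<lambda>x. a *\<^sub>R u x + b *\<^sub>R v x)) (\<lambda>x. a *\<^sub>R A u x + b *\<^sub>R A v x)) \<and>
     (\<forall>u\<in>X. \<forall>v\<in>X. l2_eq \<Omega> u v \<longrightarrow> l2_eq \<Omega> (A u) (A v))"

lemma ae_linearD:
  assumes "ae_linear \<Omega> X A"
  shows "X \<subseteq> L2 \<Omega>" "lin_closed X" "\<And>u. u \<in> X \<Longrightarrow> A u \<in> L2 \<Omega>"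
    "\<And>u v a b. u \<in> X \<Longrightarrow> v \<in> X \<Longrightarrow> l2_eq \<Omega> (A (\<lambda>x. a *\<^sub>R u x + b *\<^sub>R v x)) (\<lambda>x. a *\<^sub>R A u x + b *\<^sub>R A v x)"
    "\<And>u v. u \<in> X \<Longrightarrow> v \<in> X \<Longrightarrow> l2_eq \<Omega> u v \<Longrightarrow> l2_eq \<Omega> (A u) (A v)"
  using assms by (simp_all add: ae_linear_def)

lemma ae_linearI:
  assumes "X \<subseteq> L2 \<Omega>" "lin_closed X" "\<And>u. u \<in> X \<Longrightarrow> A u \<in> L2 \<Omega>"
    "\<And>u v a b. u \<in> X \<Longrightarrow> v \<in> X \<Longrightarrow> l2_eq \<Omega> (A (\<lambda>x. a *\<^sub>R u x + b *\<^sub>R v x)) (\<lambda>x. a *\<^sub>R A u x + b *\<^sub>R A v x)"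
    "\<And>u v. u \<in> X \<Longrightarrow> v \<in> X \<Longrightarrow> l2_eq \<Omega> u v \<Longrightarrow> l2_eq \<Omega> (A u) (A v)"
  shows "ae_linear \<Omega> X A"
  using assms by (simp add: ae_linear_def)

lemma ae_linear_subset: "ae_linear \<Omega> X A \<Longrightarrow> Y \<subseteq> X \<Longrightarrow> lin_closed Y \<Longrightarrow> ae_linear \<Omega> Y A"
  unfolding ae_linear_def by blast

lemma ae_linear_zero:
  assumes "ae_linear \<Omega> X A" shows "l2_eq \<Omega> (A (\<lambda>x. 0)) (\<lambda>x. 0)"
  using ae_linearD(4)[OF assms, of "\<lambda>x. 0" "\<lambda>x. 0" 0 0] lin_closed_zero[OF ae_linearD(2)[OF assms]] by simp

lemma ae_linear_sum:
  assumes A: "ae_linear \<Omega> X A" and "finite I" "\<And>i. i \<in> I \<Longrightarrow> u i \<in> X"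
  shows "l2_eq \<Omega> (A (\<lambda>x. \<Sum>i\<in>I. c i *\<^sub>R u i x)) (\<lambda>x. \<Sum>i\<in>I. c i *\<^sub>R A (u i) x)"
  using assms(2,3)
proof (induction I)
  case empty
  show ?case using ae_linear_zero[OF A] by simp
next
  case (insert j I)
  have s: "(\<lambda>x. \<Sum>i\<in>I. c i *\<^sub>R u i x) \<in> X"
    using insert by (intro lin_closed_sum ae_linearD(2)[OF A]) auto
  have "l2_eq \<Omega> (A (\<lambda>x. c j *\<^sub>R u j x + 1 *\<^sub>R (\<Sum>i\<in>I. c i *\<^sub>R u i x)))
      (\<lambda>x. c j *\<^sub>R A (u j) x + 1 *\<^sub>R A (\<lambda>x. \<Sum>i\<in>I. c i *\<^sub>R u i x) x)"
    by (rule ae_linearD(4)[OF A _ s]) (use insert in auto)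
  also have "l2_eq \<Omega> \<dots> (\<lambda>x. c j *\<^sub>R A (u j) x + 1 *\<^sub>R (\<Sum>i\<in>I. c i *\<^sub>R A (u i) x))"
    by (rule l2_eq_lincomb) (use insert in auto)
  finally show ?case using insert by simp
qed

lemma ae_linear_bounded_linear:
  assumes A: "ae_linear \<Omega> X A" and L: "bounded_linear L"
  shows "ae_linear \<Omega> X (\<lambda>u x. L (A u x))"
proof -
  interpret L: bounded_linear L by fact
  obtain M where M: "\<And>y. norm (L y) \<le> norm y * M" using L.bounded by blast
  have "(\<lambda>x. L (A u x)) \<in> L2 \<Omega>" if "u \<in> X" for u
  proof (rule L2_bounded_mult[OF ae_linearD(3)[OF A that], of _ M])
    show "(\<lambda>x. L (A u x)) \<in> borel_measurable (lebesgue_on \<Omega>)"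
      by (rule measurable_compose[OF L2_measurable[OF ae_linearD(3)[OF A that]]])
        (rule borel_measurable_continuous_onI[OF linear_continuous_on[OF L]])
  qed (use M in \<open>simp add: mult.commute\<close>)
  moreover have "l2_eq \<Omega> (\<lambda>x. L (A (\<lambda>x. a *\<^sub>R u x + b *\<^sub>R v x) x)) (\<lambda>x. a *\<^sub>R L (A u x) + b *\<^sub>R L (A v x))"
    if "u \<in> X" "v \<in> X" for u v a b
    using ae_linearD(4)[OF A that, of a b] unfolding l2_eq_def
    by eventually_elim (simp add: L.add L.scaleR)
  moreover have "l2_eq \<Omega> (\<lambda>x. L (A u x)) (\<lambda>x. L (A v x))" if "u \<in> X" "v \<in> X" "l2_eq \<Omega> u v" for u v
    using ae_linearD(5)[OF A that] unfolding l2_eq_def by eventually_elim simp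
  ultimately show ?thesis using ae_linearD(1,2)[OF A] unfolding ae_linear_def by blast
qed

lemma ae_linear_add:
  assumes "ae_linear \<Omega> X A" "ae_linear \<Omega> X B"
  shows "ae_linear \<Omega> X (\<lambda>u x. A u x + B u x)"
proof -
  have "l2_eq \<Omega> (\<lambda>x. A (\<lambda>x. a *\<^sub>R u x + b *\<^sub>R v x) x + B (\<lambda>x. a *\<^sub>R u x + b *\<^sub>R v x) x)
      (\<lambda>x. a *\<^sub>R (A u x + B u x) + b *\<^sub>R (A v x + B v x))" if "u \<in> X" "v \<in> X" for u v a b
    using ae_linearD(4)[OF assms(1) that, of a b] ae_linearD(4)[OF assms(2) that, of a b]
    unfolding l2_eq_def by eventually_elim (simp add: scaleR_add_right)
  moreover have "l2_eq \<Omega> (\<lambda>x. A u x + B u x) (\<lambda>x. A v x + B v x)" if "u \<in> X" "v \<in> X" "l2_eq \<Omega> u v" for u v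
    using ae_linearD(5)[OF assms(1) that] ae_linearD(5)[OF assms(2) that]
    unfolding l2_eq_def by eventually_elim simp
  moreover have "(\<lambda>x. A u x + B u x) \<in> L2 \<Omega>" if "u \<in> X" for u
    using L2_add ae_linearD(3)[OF assms(1) that] ae_linearD(3)[OF assms(2) that] by blast
  ultimately show ?thesis using ae_linearD(1,2)[OF assms(1)] by (intro ae_linearI)
qed

text \<open>A bounded coefficient maps \<open>L2\<close> to \<open>L2\<close>. The bilinear
  operation is left open to cover both the scalar multiplication by the viscosity and the
  matrix-vector product of the convective term.\<close>

lemma ae_linear_bounded_mult:
  fixes A :: "('a::euclidean_space \<Rightarrow> 'b::euclidean_space) \<Rightarrow> 'a \<Rightarrow> 'c::euclidean_space"
    and h :: "'a \<Rightarrow> 'e::euclidean_space"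
  assumes A: "ae_linear \<Omega> X A" and op: "bounded_bilinear op"
    and h: "h \<in> borel_measurable (lebesgue_on \<Omega>)" "\<And>x. x \<in> \<Omega> \<Longrightarrow> norm (h x) \<le> M"
  shows "ae_linear \<Omega> X (\<lambda>u x. op (h x) (A u x) :: 'f::euclidean_space)"
proof -
  interpret op: bounded_bilinear op by fact
  obtain C where C: "\<And>a b. norm (op a b) \<le> norm a * norm b * C" "C > 0" using op.pos_bounded by blast
  have "(\<lambda>x. op (h x) (A u x)) \<in> L2 \<Omega>" if "u \<in> X" for u
  proof (rule L2_bounded_mult[OF ae_linearD(3)[OF A that], of _ "\<bar>M\<bar> * C"])
    show "(\<lambda>x. op (h x) (A u x)) \<in> borel_measurable (lebesgue_on \<Omega>)"
      using borel_measurable_continuous_Pair[OF h(1) L2_measurable[OF ae_linearD(3)[OF A that]], of op]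
        op.continuous_on[OF continuous_on_fst continuous_on_snd, OF continuous_on_id continuous_on_id]
      by simp
    show "AE x in lebesgue_on \<Omega>. norm (op (h x) (A u x)) \<le> \<bar>M\<bar> * C * norm (A u x)"
    proof (intro AE_I2)
      fix x assume "x \<in> space (lebesgue_on \<Omega>)"
      then have "norm (h x) \<le> \<bar>M\<bar>" using h(2)[of x] by simp
      then have "norm (h x) * norm (A u x) * C \<le> \<bar>M\<bar> * norm (A u x) * C"
        using C(2) by (intro mult_right_mono) auto
      then show "norm (op (h x) (A u x)) \<le> \<bar>M\<bar> * C * norm (A u x)"
        using C(1)[of "h x" "A u x"] by (simp add: mult_ac)
    qed
  qed
  moreover have "l2_eq \<Omega> (\<lambda>x. op (h x) (A (\<lambda>x. a *\<^sub>R u x + b *\<^sub>R v x) x)) (\<lambda>x. a *\<^sub>R op (h x) (A u x) + b *\<^sub>R op (h x) (A v x))"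
    if "u \<in> X" "v \<in> X" for u v a b
    using ae_linearD(4)[OF A that, of a b] unfolding l2_eq_def
    by eventually_elim (simp add: op.add_right op.scaleR_right)
  moreover have "l2_eq \<Omega> (\<lambda>x. op (h x) (A u x)) (\<lambda>x. op (h x) (A v x))" if "u \<in> X" "v \<in> X" "l2_eq \<Omega> u v" for u v
    using ae_linearD(5)[OF A that] unfolding l2_eq_def by eventually_elim simp
  ultimately show ?thesis using ae_linearD(1,2)[OF A] unfolding ae_linear_def by blast
qed

lemma ae_linear_compose:
  assumes A: "ae_linear \<Omega> X A" and B: "ae_linear \<Omega> Y B" and AY: "\<And>u. u \<in> X \<Longrightarrow> A u \<in> Y"
  shows "ae_linear \<Omega> X (\<lambda>u. B (A u))"
proof -
  have "l2_eq \<Omega> (B (A (\<lambda>x. a *\<^sub>R u x + b *\<^sub>R v x))) (\<lambda>x. a *\<^sub>R B (A u) x + b *\<^sub>R B (A v) x)"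
    if uv: "u \<in> X" "v \<in> X" for u v a b
  proof -
    have "l2_eq \<Omega> (B (A (\<lambda>x. a *\<^sub>R u x + b *\<^sub>R v x))) (B (\<lambda>x. a *\<^sub>R A u x + b *\<^sub>R A v x))"
      by (intro ae_linearD(5)[OF B] ae_linearD(4)[OF A] AY uv
          lin_closed_lincomb[OF ae_linearD(2)[OF A]] lin_closed_lincomb[OF ae_linearD(2)[OF B]])
    also have "l2_eq \<Omega> \<dots> (\<lambda>x. a *\<^sub>R B (A u) x + b *\<^sub>R B (A v) x)"
      by (intro ae_linearD(4)[OF B] AY uv)
    finally show ?thesis .
  qed
  then show ?thesis
    using ae_linearD(1,2)[OF A] ae_linearD(3)[OF B AY] ae_linearD(5)[OF B AY AY ae_linearD(5)[OF A]]
    by (intro ae_linearI)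
qed

context bounded_open begin

lemma ae_linear_grad: "ae_linear \<Omega> (H1 \<Omega>) (grad \<Omega>)"
  unfolding ae_linear_def using H1_L2 lin_closed_H1 grad_L2 grad_lincomb grad_cong by blast

text \<open>A smooth function is piecewise smooth for the mesh that consists of one box containing
  \<open>\<Omega>\<close>, so \<open>piecewise_weak_grad\<close> also yields the classical
  gradient.\<close>

lemma cd_weak_grad:
  assumes "continuously_differentiable (Suc 0) f"
  shows "f \<in> H1 \<Omega>" "l2_eq \<Omega> (grad \<Omega> f) (\<lambda>x. \<chi> i. partial_deriv i f x)"
proof -
  obtain a where a: "\<Omega> \<subseteq> box (- a) a" using bounded_subset_box_symmetric[OF bounded_\<Omega>] by blast
  have fL: "f \<in> L2 \<Omega>" by (rule L2_cd[OF assms])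
  have "\<Omega> \<subseteq> \<Union>{cbox (- a) a}" using a box_subset_cbox by auto
  then obtain g where g: "is_weak_grad \<Omega> f g" "\<And>x i. x \<in> box (- a) a \<Longrightarrow> g x $ i = partial_deriv i f x"
    using piecewise_weak_grad[of "{cbox (- a) a}" "\<lambda>_. f" f] assms fL by (auto simp: interior_cbox)
  show "f \<in> H1 \<Omega>" by (rule H1I[OF fL g(1)])
  have "l2_eq \<Omega> g (\<lambda>x. \<chi> i. partial_deriv i f x)"
    unfolding l2_eq_def using g(2) a by (intro AE_I2) (auto simp: vec_eq_iff)
  then show "l2_eq \<Omega> (grad \<Omega> f) (\<lambda>x. \<chi> i. partial_deriv i f x)"
    by (rule l2_eq_trans[OF grad_eq[OF g(1)]])
qed

lemma test_H1: "\<phi> \<in> test_functions \<Omega> \<Longrightarrow> \<phi> \<in> H1 \<Omega>"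
  by (rule cd_weak_grad(1)[OF test_functions_cd])

lemma H1_const: "(\<lambda>x. c) \<in> H1 \<Omega>" "l2_eq \<Omega> (grad \<Omega> (\<lambda>x. c)) (\<lambda>x. 0)"
proof -
  show "(\<lambda>x. c) \<in> H1 \<Omega>" by (rule cd_weak_grad(1)[OF cd_const])
  have "partial_deriv i (\<lambda>x. c) x = 0" for i and x :: "real^'d"
    by (rule partial_deriv_eq[of _ "\<lambda>h. 0"]) auto
  then show "l2_eq \<Omega> (grad \<Omega> (\<lambda>x. c)) (\<lambda>x. 0)"
    using cd_weak_grad(2)[OF cd_const, of c] by (simp add: zero_vec_def)
qed

section \<open>The space \<open>H10\<close>, its dual, and integration by parts\<close>

lemma h1_norm_power2: "(h1_norm \<Omega> u)\<^sup>2 = (l2_norm \<Omega> u)\<^sup>2 + (l2_norm \<Omega> (grad \<Omega> u))\<^sup>2"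
  by (simp add: h1_norm_def)

lemma h1_norm_ge_0[simp]: "0 \<le> h1_norm \<Omega> u" by (simp add: h1_norm_def)

lemma h1_norm_ge: "l2_norm \<Omega> u \<le> h1_norm \<Omega> u" "l2_norm \<Omega> (grad \<Omega> u) \<le> h1_norm \<Omega> u"
  unfolding h1_norm_def by (auto intro: real_le_rsqrt)

lemma h1_norm_le: "h1_norm \<Omega> u \<le> l2_norm \<Omega> u + l2_norm \<Omega> (grad \<Omega> u)"
  unfolding h1_norm_def by (rule sqrt_sum_squares_le_sum) auto

lemma H10_H1: "H10 \<Omega> \<subseteq> H1 \<Omega>" by (auto simp: H10_def)

lemma lin_closed_H10: "lin_closed (H10 \<Omega>)"
  unfolding lin_closed_def
proof (intro conjI ballI allI)
  have "h1_norm \<Omega> (\<lambda>x. 0) = 0"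
    using l2_norm_cong[OF H1_const(2)[of 0]] grad_L2[OF H1_zero]
    by (simp add: h1_norm_def l2_norm_def)
  then show "(\<lambda>x. 0) \<in> H10 \<Omega>"
    by (auto simp: H10_def H1_zero intro!: exI[of _ "\<lambda>n x. 0"] test_functions_zero)
  fix u v a b assume u: "u \<in> H10 \<Omega>" and v: "v \<in> H10 \<Omega>"
  obtain \<phi> \<psi> where \<phi>: "\<And>n. \<phi> n \<in> test_functions \<Omega>" "(\<lambda>n::nat. h1_norm \<Omega> (\<lambda>x. \<phi> n x - u x)) \<longlonglongrightarrow> 0"
    and \<psi>: "\<And>n. \<psi> n \<in> test_functions \<Omega>" "(\<lambda>n::nat. h1_norm \<Omega> (\<lambda>x. \<psi> n x - v x)) \<longlonglongrightarrow> 0"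
    using u v unfolding H10_def by blast
  have uH: "u \<in> H1 \<Omega>" "v \<in> H1 \<Omega>" using u v H10_H1 by auto
  define s where "s = (\<lambda>n x. a * \<phi> n x + b * \<psi> n x)"
  \<comment> \<open>The factor 2 arises because \<open>h1_norm\<close> is estimated by the sum of
    the two norms inside it, each of which is again at most \<open>h1_norm\<close>.\<close>
  have le: "h1_norm \<Omega> (\<lambda>x. s n x - (a *\<^sub>R u x + b *\<^sub>R v x))
      \<le> 2 * \<bar>a\<bar> * h1_norm \<Omega> (\<lambda>x. \<phi> n x - u x) + 2 * \<bar>b\<bar> * h1_norm \<Omega> (\<lambda>x. \<psi> n x - v x)" for n
  proof -
    let ?d = "\<lambda>x. \<phi> n x - u x" and ?e = "\<lambda>x. \<psi> n x - v x"
    have d: "?d \<in> H1 \<Omega>" "?e \<in> H1 \<Omega>"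
      by (intro lin_closed_diff lin_closed_H1 test_H1 \<phi> \<psi> uH)+
    have eq: "(\<lambda>x. s n x - (a *\<^sub>R u x + b *\<^sub>R v x)) = (\<lambda>x. a *\<^sub>R ?d x + b *\<^sub>R ?e x)"
      by (simp add: s_def algebra_simps)
    have "l2_norm \<Omega> (grad \<Omega> (\<lambda>x. a *\<^sub>R ?d x + b *\<^sub>R ?e x))
        = l2_norm \<Omega> (\<lambda>x. a *\<^sub>R grad \<Omega> ?d x + b *\<^sub>R grad \<Omega> ?e x)"
      by (intro l2_norm_cong grad_lincomb L2_lincomb grad_L2 H1_lincomb d)
    then show ?thesis
      unfolding eq
      using h1_norm_le[of "\<lambda>x. a *\<^sub>R ?d x + b *\<^sub>R ?e x"]
        l2_norm_triangle[OF H1_L2[OF d(1)] H1_L2[OF d(2)], of a b]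
        l2_norm_triangle[OF grad_L2[OF d(1)] grad_L2[OF d(2)], of a b]
        mult_left_mono[OF h1_norm_ge(1)[of ?d] abs_ge_zero[of a]]
        mult_left_mono[OF h1_norm_ge(2)[of ?d] abs_ge_zero[of a]]
        mult_left_mono[OF h1_norm_ge(1)[of ?e] abs_ge_zero[of b]]
        mult_left_mono[OF h1_norm_ge(2)[of ?e] abs_ge_zero[of b]]
      by linarith
  qed
  have "(\<lambda>n. h1_norm \<Omega> (\<lambda>x. s n x - (a *\<^sub>R u x + b *\<^sub>R v x))) \<longlonglongrightarrow> 0"
  proof (rule tendsto_sandwich[of "\<lambda>_. 0"])
    have "(\<lambda>n. 2 * \<bar>a\<bar> * h1_norm \<Omega> (\<lambda>x. \<phi> n x - u x) + 2 * \<bar>b\<bar> * h1_norm \<Omega> (\<lambda>x. \<psi> n x - v x))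
        \<longlonglongrightarrow> 2 * \<bar>a\<bar> * 0 + 2 * \<bar>b\<bar> * 0"
      by (intro tendsto_intros \<phi> \<psi>)
    then show "(\<lambda>n. 2 * \<bar>a\<bar> * h1_norm \<Omega> (\<lambda>x. \<phi> n x - u x) + 2 * \<bar>b\<bar> * h1_norm \<Omega> (\<lambda>x. \<psi> n x - v x)) \<longlonglongrightarrow> 0"
      by simp
  qed (use le in auto)
  moreover have "s n \<in> test_functions \<Omega>" for n
    unfolding s_def by (rule test_functions_lincomb[OF \<phi>(1) \<psi>(1)])
  ultimately show "(\<lambda>x. a *\<^sub>R u x + b *\<^sub>R v x) \<in> H10 \<Omega>"
    using H1_lincomb[OF uH, of a b] unfolding H10_def by blast
qed

text \<open>For test functions in place of \<open>v\<close> this is the definition of the weak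
  gradient of \<open>q\<close>, and both sides are continuous in \<open>v\<close> with respect to
  \<open>h1_norm\<close>.\<close>

lemma H10_integration_by_parts:
  assumes q: "q \<in> H1 \<Omega>" and v: "v \<in> H10 \<Omega>"
  shows "l2_inner \<Omega> q (\<lambda>x. grad \<Omega> v x $ i) = - l2_inner \<Omega> (\<lambda>x. grad \<Omega> q x $ i) v"
proof -
  obtain \<phi> where \<phi>: "\<And>n. \<phi> n \<in> test_functions \<Omega>" "(\<lambda>n::nat. h1_norm \<Omega> (\<lambda>x. \<phi> n x - v x)) \<longlonglongrightarrow> 0"
    using v unfolding H10_def by blast
  have vH: "v \<in> H1 \<Omega>" using v H10_H1 by auto
  have qL: "q \<in> L2 \<Omega>" and gqL: "(\<lambda>x. grad \<Omega> q x $ i) \<in> L2 \<Omega>"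
    using H1_L2[OF q] L2_nth[OF grad_L2[OF q]] by auto
  let ?d = "\<lambda>n x. \<phi> n x - v x"
  have dH: "?d n \<in> H1 \<Omega>" for n by (intro lin_closed_diff lin_closed_H1 test_H1 \<phi> vH)
  \<comment> \<open>The sum of the two products vanishes at the test function, so its value at
    \<open>v\<close> is minus its value at the approximation error.\<close>
  have key: "l2_inner \<Omega> q (\<lambda>x. grad \<Omega> v x $ i) + l2_inner \<Omega> (\<lambda>x. grad \<Omega> q x $ i) v
      = - l2_inner \<Omega> q (\<lambda>x. grad \<Omega> (?d n) x $ i) - l2_inner \<Omega> (\<lambda>x. grad \<Omega> q x $ i) (?d n)" for n
  proof -
    have \<phi>H: "\<phi> n \<in> H1 \<Omega>" by (rule test_H1[OF \<phi>(1)])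
    have "l2_eq \<Omega> (grad \<Omega> (\<lambda>x. 1 *\<^sub>R \<phi> n x + (-1) *\<^sub>R v x)) (\<lambda>x. 1 *\<^sub>R grad \<Omega> (\<phi> n) x + (-1) *\<^sub>R grad \<Omega> v x)"
      by (rule grad_lincomb[OF \<phi>H vH])
    then have "l2_eq \<Omega> (\<lambda>x. grad \<Omega> (?d n) x $ i) (\<lambda>x. grad \<Omega> (\<phi> n) x $ i - grad \<Omega> v x $ i)"
      unfolding l2_eq_def by (auto elim!: eventually_mono)
    then have "l2_inner \<Omega> q (\<lambda>x. grad \<Omega> (?d n) x $ i) = l2_inner \<Omega> q (\<lambda>x. grad \<Omega> (\<phi> n) x $ i - grad \<Omega> v x $ i)"
      by (intro l2_inner_cong l2_eq_refl qL L2_nth[OF grad_L2[OF dH]]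
          L2_diff[OF L2_nth[OF grad_L2[OF \<phi>H]] L2_nth[OF grad_L2[OF vH]]])
    also have "\<dots> = l2_inner \<Omega> q (\<lambda>x. grad \<Omega> (\<phi> n) x $ i) - l2_inner \<Omega> q (\<lambda>x. grad \<Omega> v x $ i)"
      by (intro l2_inner_diff_right qL L2_nth grad_L2 \<phi>H vH)
    also have "l2_inner \<Omega> q (\<lambda>x. grad \<Omega> (\<phi> n) x $ i) = l2_inner \<Omega> q (partial_deriv i (\<phi> n))"
    proof (intro l2_inner_cong)
      show "l2_eq \<Omega> (\<lambda>x. grad \<Omega> (\<phi> n) x $ i) (partial_deriv i (\<phi> n))"
        using cd_weak_grad(2)[OF test_functions_cd[OF \<phi>(1)[of n]]] unfolding l2_eq_def by eventually_elim simp
    qed (auto intro: qL L2_nth grad_L2 \<phi>H L2_test_partial \<phi>)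
    also have "\<dots> = - l2_inner \<Omega> (\<lambda>x. grad \<Omega> q x $ i) (\<phi> n)"
      using grad_weak[OF q] \<phi>(1) by (simp add: weak_grad_iff)
    finally show ?thesis
      using l2_inner_diff_right[OF H1_L2[OF \<phi>H] H1_L2[OF vH] gqL] by simp
  qed
  have le: "\<bar>l2_inner \<Omega> q (\<lambda>x. grad \<Omega> v x $ i) + l2_inner \<Omega> (\<lambda>x. grad \<Omega> q x $ i) v\<bar>
      \<le> (l2_norm \<Omega> q + l2_norm \<Omega> (\<lambda>x. grad \<Omega> q x $ i)) * h1_norm \<Omega> (?d n)" for n
  proof -
    have "l2_norm \<Omega> (\<lambda>x. grad \<Omega> (?d n) x $ i) \<le> l2_norm \<Omega> (grad \<Omega> (?d n))"
    proof (rule power2_le_imp_le)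
      have "(\<Sum>j\<in>UNIV. l2_inner \<Omega> (\<lambda>x. grad \<Omega> (?d n) x $ j) (\<lambda>x. grad \<Omega> (?d n) x $ j))
          \<ge> l2_inner \<Omega> (\<lambda>x. grad \<Omega> (?d n) x $ i) (\<lambda>x. grad \<Omega> (?d n) x $ i)"
        by (rule member_le_sum) (auto intro: l2_inner_ge_0)
      then show "(l2_norm \<Omega> (\<lambda>x. grad \<Omega> (?d n) x $ i))\<^sup>2 \<le> (l2_norm \<Omega> (grad \<Omega> (?d n)))\<^sup>2"
        unfolding l2_norm_power2 by (simp add: l2_inner_vec[OF grad_L2[OF dH] grad_L2[OF dH]])
    qed simp
    then have "l2_norm \<Omega> (\<lambda>x. grad \<Omega> (?d n) x $ i) \<le> h1_norm \<Omega> (?d n)"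
      using h1_norm_ge(2) order_trans by blast
    then have "l2_norm \<Omega> q * l2_norm \<Omega> (\<lambda>x. grad \<Omega> (?d n) x $ i) \<le> l2_norm \<Omega> q * h1_norm \<Omega> (?d n)"
      by (intro mult_left_mono) auto
    moreover have "l2_norm \<Omega> (\<lambda>x. grad \<Omega> q x $ i) * l2_norm \<Omega> (?d n) \<le> l2_norm \<Omega> (\<lambda>x. grad \<Omega> q x $ i) * h1_norm \<Omega> (?d n)"
      by (intro mult_left_mono h1_norm_ge) auto
    ultimately show ?thesis unfolding key[of n]
      using l2_Cauchy_Schwarz[OF qL L2_nth[OF grad_L2[OF dH[of n]], of i]]
        l2_Cauchy_Schwarz[OF gqL H1_L2[OF dH[of n]]] by (simp add: distrib_right)
  qed
  have "\<bar>l2_inner \<Omega> q (\<lambda>x. grad \<Omega> v x $ i) + l2_inner \<Omega> (\<lambda>x. grad \<Omega> q x $ i) v\<bar> \<le> 0"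
  proof (rule LIMSEQ_le_const)
    show "(\<lambda>n. (l2_norm \<Omega> q + l2_norm \<Omega> (\<lambda>x. grad \<Omega> q x $ i)) * h1_norm \<Omega> (?d n)) \<longlonglongrightarrow> 0"
      using tendsto_mult_right_zero[OF \<phi>(2)] by simp
  qed (use le in auto)
  then show ?thesis by simp
qed

lemma h1_norm_scale:
  assumes "u \<in> H1 \<Omega>" shows "h1_norm \<Omega> (\<lambda>x. a *\<^sub>R u x) = \<bar>a\<bar> * h1_norm \<Omega> u"
proof -
  have "l2_eq \<Omega> (grad \<Omega> (\<lambda>x. a *\<^sub>R u x)) (\<lambda>x. a *\<^sub>R grad \<Omega> u x)"
    using grad_lincomb[OF assms assms, of a 0] by simp
  then have "l2_norm \<Omega> (grad \<Omega> (\<lambda>x. a *\<^sub>R u x)) = l2_norm \<Omega> (\<lambda>x. a *\<^sub>R grad \<Omega> u x)"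
    by (intro l2_norm_cong L2_scale grad_L2 assms lin_closed_scale lin_closed_H1)
  then have "(h1_norm \<Omega> (\<lambda>x. a *\<^sub>R u x))\<^sup>2 = (\<bar>a\<bar> * h1_norm \<Omega> u)\<^sup>2"
    unfolding power_mult_distrib h1_norm_power2 by (simp only: l2_norm_scale power_mult_distrib distrib_left)
  then show ?thesis by (rule power2_eq_imp_eq) auto
qed

lemma Hm1_lincomb:
  "F \<in> Hm1 \<Omega> \<Longrightarrow> v \<in> H10 \<Omega> \<Longrightarrow> w \<in> H10 \<Omega> \<Longrightarrow> F (\<lambda>x. a * v x + b * w x) = a * F v + b * F w"
  by (simp add: Hm1_def)

text \<open>By scaling to the unit ball; an element of norm 0 cannot be scaled and is handled by the
  bound \<open>M\<close> from the definition. The same bound makes the values on the unit ball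
  bounded, without which the real supremum would be meaningless.\<close>

lemma Hm1_bound:
  assumes F: "F \<in> Hm1 \<Omega>" and v: "v \<in> H10 \<Omega>"
  shows "\<bar>F v\<bar> \<le> hm1_norm \<Omega> F * h1_norm \<Omega> v" and "0 \<le> hm1_norm \<Omega> F"
proof -
  obtain M where M: "\<And>v. v \<in> H10 \<Omega> \<Longrightarrow> \<bar>F v\<bar> \<le> M * h1_norm \<Omega> v" using F unfolding Hm1_def by blast
  let ?S = "{v \<in> H10 \<Omega>. h1_norm \<Omega> v \<le> 1}"
  have bdd: "bdd_above ((\<lambda>v. \<bar>F v\<bar>) ` ?S)"
  proof (rule bdd_aboveI2)
    fix v assume "v \<in> ?S"
    then have "\<bar>F v\<bar> \<le> \<bar>M\<bar> * h1_norm \<Omega> v" using M[of v] mult_right_mono[OF abs_ge_self h1_norm_ge_0, of M v] by auto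
    also have "\<dots> \<le> \<bar>M\<bar> * 1" using \<open>v \<in> ?S\<close> by (intro mult_left_mono) auto
    finally show "\<bar>F v\<bar> \<le> \<bar>M\<bar>" by simp
  qed
  have z: "(\<lambda>x. 0) \<in> ?S"
    using lin_closed_zero[OF lin_closed_H10] h1_norm_scale[OF H1_zero, of 0] by simp
  show "0 \<le> hm1_norm \<Omega> F"
    unfolding hm1_norm_def by (rule cSUP_upper2[OF _ z]) (use bdd in auto)
  show "\<bar>F v\<bar> \<le> hm1_norm \<Omega> F * h1_norm \<Omega> v"
  proof (cases "h1_norm \<Omega> v = 0")
    case True
    then show ?thesis using M[OF v] by simp
  next
    case False
    then have pos: "h1_norm \<Omega> v > 0" using h1_norm_ge_0[of v] by linarith
    let ?w = "\<lambda>x. (1 / h1_norm \<Omega> v) *\<^sub>R v x"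
    have w: "?w \<in> ?S"
      using lin_closed_scale[OF lin_closed_H10 v, of "1 / h1_norm \<Omega> v"]
        h1_norm_scale[of v "1 / h1_norm \<Omega> v"] v H10_H1 pos by auto
    have "\<bar>F ?w\<bar> \<le> hm1_norm \<Omega> F" unfolding hm1_norm_def by (rule cSUP_upper[OF w bdd])
    moreover have "F ?w = (1 / h1_norm \<Omega> v) * F v" using Hm1_lincomb[OF F v v, of "1 / h1_norm \<Omega> v" 0] by simp
    moreover have "\<bar>(1 / h1_norm \<Omega> v) * F v\<bar> = \<bar>F v\<bar> / h1_norm \<Omega> v" using pos by (simp add: abs_mult)
    ultimately show ?thesis using pos by (simp only: pos_divide_le_eq)
  qed
qed

text \<open>The difference has vanishing \<open>h1_norm\<close>, because weak gradients do not see
  null sets, and so the functional vanishes on it.\<close>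

lemma Hm1_cong:
  assumes F: "F \<in> Hm1 \<Omega>" and uv: "u \<in> H10 \<Omega>" "v \<in> H10 \<Omega>" "l2_eq \<Omega> u v"
  shows "F u = F v"
proof -
  let ?d = "\<lambda>x. 1 * u x + (-1) * v x"
  have d: "?d \<in> H10 \<Omega>" using lin_closed_lincomb[OF lin_closed_H10 uv(1,2), of 1 "-1"] by simp
  then have dH: "?d \<in> H1 \<Omega>" using H10_H1 by auto
  have dz: "l2_eq \<Omega> ?d (\<lambda>x. 0)" using uv(3) unfolding l2_eq_def by eventually_elim simp
  have "l2_eq \<Omega> (grad \<Omega> ?d) (\<lambda>x. 0)"
    using l2_eq_trans[OF grad_cong[OF dH H1_zero dz] H1_const(2)[of 0]] .
  then have "h1_norm \<Omega> ?d = 0"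
    using dz H1_L2[OF dH] grad_L2[OF dH] by (simp add: h1_norm_def l2_norm_eq_0[THEN iffD2])
  then have "F ?d = 0" using Hm1_bound(1)[OF F d] by simp
  moreover have "F ?d = 1 * F u + (-1) * F v" using F uv(1,2) unfolding Hm1_def by blast
  ultimately show ?thesis by simp
qed

section \<open>Differential operators on vector fields and the dual pairing\<close>

lemma vec_fields_L2: "v \<in> vec_fields (L2 \<Omega>) \<Longrightarrow> v \<in> L2 \<Omega>"
  by (rule L2_vecI) (simp add: vec_fields_def)

lemma vec_fields_mono: "X \<subseteq> Y \<Longrightarrow> vec_fields X \<subseteq> vec_fields Y"
  by (auto simp: vec_fields_def)

lemma vgrad_nth: "(\<lambda>x. vgrad \<Omega> v x $ i) = grad \<Omega> (\<lambda>x. v x $ i)"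
  by (simp add: vgrad_def)

lemma ae_linear_vgrad: "ae_linear \<Omega> (vec_fields (H1 \<Omega>)) (vgrad \<Omega>)"
proof -
  let ?X = "vec_fields (H1 \<Omega>)"
  have X: "?X \<subseteq> L2 \<Omega>" using vec_fields_mono[of "H1 \<Omega>" "L2 \<Omega>"] vec_fields_L2 H1_L2 by blast
  have Xi: "(\<lambda>x. u x $ i) \<in> H1 \<Omega>" if "u \<in> ?X" for u i using that by (simp add: vec_fields_def)
  have "vgrad \<Omega> u \<in> L2 \<Omega>" if "u \<in> ?X" for u
    by (rule L2_vecI) (simp add: vgrad_nth grad_L2 Xi that)
  moreover have "l2_eq \<Omega> (vgrad \<Omega> (\<lambda>x. a *\<^sub>R u x + b *\<^sub>R v x)) (\<lambda>x. a *\<^sub>R vgrad \<Omega> u x + b *\<^sub>R vgrad \<Omega> v x)"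
    if "u \<in> ?X" "v \<in> ?X" for u v a b
  proof -
    have "AE x in lebesgue_on \<Omega>. \<forall>i\<in>UNIV. vgrad \<Omega> (\<lambda>x. a *\<^sub>R u x + b *\<^sub>R v x) x $ i
        = (a *\<^sub>R vgrad \<Omega> u x + b *\<^sub>R vgrad \<Omega> v x) $ i"
    proof (intro AE_finite_allI)
      fix i
      show "AE x in lebesgue_on \<Omega>. vgrad \<Omega> (\<lambda>x. a *\<^sub>R u x + b *\<^sub>R v x) x $ i
        = (a *\<^sub>R vgrad \<Omega> u x + b *\<^sub>R vgrad \<Omega> v x) $ i"
        using grad_lincomb[OF Xi[OF that(1), of i] Xi[OF that(2), of i], of a b] by (simp add: l2_eq_def vgrad_def)
    qed simp
    then show ?thesis unfolding l2_eq_def by eventually_elim (simp add: vec_eq_iff)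
  qed
  moreover have "l2_eq \<Omega> (vgrad \<Omega> u) (vgrad \<Omega> v)" if "u \<in> ?X" "v \<in> ?X" "l2_eq \<Omega> u v" for u v
  proof -
    have "AE x in lebesgue_on \<Omega>. \<forall>i\<in>UNIV. vgrad \<Omega> u x $ i = vgrad \<Omega> v x $ i"
    proof (intro AE_finite_allI)
      fix i
      have "l2_eq \<Omega> (\<lambda>x. u x $ i) (\<lambda>x. v x $ i)" using that(3) unfolding l2_eq_def by eventually_elim simp
      then show "AE x in lebesgue_on \<Omega>. vgrad \<Omega> u x $ i = vgrad \<Omega> v x $ i"
        using grad_cong[OF Xi[OF that(1), of i] Xi[OF that(2), of i]] by (simp add: l2_eq_def vgrad_def)
    qed simp
    then show ?thesis unfolding l2_eq_def by eventually_elim (simp add: vec_eq_iff)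
  qed
  ultimately show ?thesis
    using X lin_closed_vec_fields[OF lin_closed_H1] unfolding ae_linear_def by blast
qed

lemma bounded_linear_transpose: "bounded_linear (transpose :: real^'d^'d \<Rightarrow> real^'d^'d)"
  by (rule linear_conv_bounded_linear[THEN iffD1]) (auto intro!: linearI simp: transpose_def vec_eq_iff)

lemma bounded_linear_trace: "bounded_linear (\<lambda>A :: real^'d^'d. \<Sum>i\<in>UNIV. A $ i $ i)"
  by (rule linear_conv_bounded_linear[THEN iffD1])
    (auto intro!: linearI simp: sum.distrib sum_distrib_left)

lemma ae_linear_sym_grad: "ae_linear \<Omega> (vec_fields (H1 \<Omega>)) (sym_grad \<Omega>)"
  using ae_linear_bounded_linear[OF ae_linear_vgrad bounded_linear_compose[OF bounded_linear_scaleR_right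
        bounded_linear_add[OF bounded_linear_ident bounded_linear_transpose]], of "1/2"]
  by (simp add: sym_grad_def[abs_def])

lemma ae_linear_vdiv: "ae_linear \<Omega> (vec_fields (H1 \<Omega>)) (vdiv \<Omega>)"
  using ae_linear_bounded_linear[OF ae_linear_vgrad bounded_linear_trace] by (simp add: vdiv_def[abs_def])

lemma vh1_norm_power2:
  assumes "v \<in> vec_fields (H1 \<Omega>)"
  shows "(vh1_norm \<Omega> v)\<^sup>2 = (\<Sum>i\<in>UNIV. (h1_norm \<Omega> (\<lambda>x. v x $ i))\<^sup>2)"
proof -
  have "v \<in> L2 \<Omega>" "vgrad \<Omega> v \<in> L2 \<Omega>" using ae_linearD(1,3)[OF ae_linear_vgrad] assms by auto
  then show ?thesis
    by (simp add: vh1_norm_def h1_norm_power2 l2_norm_power2 l2_inner_ge_0 sum.distrib sum_nonneg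
        l2_inner_vec[where u=v] l2_inner_vec[where u="vgrad \<Omega> v"] vgrad_nth)
qed

lemma vh1_norm_ge_0[simp]: "0 \<le> vh1_norm \<Omega> v" by (simp add: vh1_norm_def)

text \<open>Cauchy-Schwarz over the components, which is what the Euclidean combination of the
  component norms in \<open>vhm1_norm\<close> is made for.\<close>

lemma pairing_bound:
  assumes F: "\<And>i. F i \<in> Hm1 \<Omega>" and v: "v \<in> vec_fields (H10 \<Omega>)"
  shows "\<bar>pairing F v\<bar> \<le> vhm1_norm \<Omega> F * vh1_norm \<Omega> v"
proof -
  have vi: "(\<lambda>x. v x $ i) \<in> H10 \<Omega>" for i using v by (simp add: vec_fields_def)
  have vH: "v \<in> vec_fields (H1 \<Omega>)" using v H10_H1 vec_fields_mono by blast
  have "\<bar>pairing F v\<bar> \<le> (\<Sum>i\<in>UNIV. \<bar>F i (\<lambda>x. v x $ i)\<bar>)" unfolding pairing_def by (rule sum_abs)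
  also have "\<dots> \<le> (\<Sum>i\<in>UNIV. hm1_norm \<Omega> (F i) * h1_norm \<Omega> (\<lambda>x. v x $ i))"
    by (intro sum_mono Hm1_bound(1) F vi)
  also have "\<dots> \<le> vhm1_norm \<Omega> F * vh1_norm \<Omega> v"
  proof (rule power2_le_imp_le)
    have "(\<Sum>i\<in>UNIV. hm1_norm \<Omega> (F i) * h1_norm \<Omega> (\<lambda>x. v x $ i))\<^sup>2
        \<le> (\<Sum>i\<in>UNIV. (hm1_norm \<Omega> (F i))\<^sup>2) * (\<Sum>i\<in>UNIV. (h1_norm \<Omega> (\<lambda>x. v x $ i))\<^sup>2)"
      by (rule Cauchy_Schwarz_ineq_sum)
    then show "(\<Sum>i\<in>UNIV. hm1_norm \<Omega> (F i) * h1_norm \<Omega> (\<lambda>x. v x $ i))\<^sup>2 \<le> (vhm1_norm \<Omega> F * vh1_norm \<Omega> v)\<^sup>2"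
      by (simp add: power_mult_distrib vh1_norm_power2[OF vH] vhm1_norm_def sum_nonneg)
  qed (simp add: vhm1_norm_def sum_nonneg)
  finally show ?thesis .
qed

lemma pairing_lincomb:
  assumes F: "\<And>i. F i \<in> Hm1 \<Omega>" and u: "u \<in> vec_fields (H10 \<Omega>)" and v: "v \<in> vec_fields (H10 \<Omega>)"
  shows "pairing F (\<lambda>x. a *\<^sub>R u x + b *\<^sub>R v x) = a * pairing F u + b * pairing F v"
proof -
  have "F i (\<lambda>x. a * u x $ i + b * v x $ i) = a * F i (\<lambda>x. u x $ i) + b * F i (\<lambda>x. v x $ i)" for i
  proof -
    have "(\<lambda>x. u x $ i) \<in> H10 \<Omega>" "(\<lambda>x. v x $ i) \<in> H10 \<Omega>" using u v by (auto simp: vec_fields_def)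
    then show ?thesis using Hm1_lincomb[OF F] by simp
  qed
  then show ?thesis by (simp add: pairing_def sum.distrib sum_distrib_left)
qed

lemma pairing_cong:
  assumes F: "\<And>i. F i \<in> Hm1 \<Omega>" and u: "u \<in> vec_fields (H10 \<Omega>)" and v: "v \<in> vec_fields (H10 \<Omega>)"
    and eq: "l2_eq \<Omega> u v"
  shows "pairing F u = pairing F v"
  unfolding pairing_def
proof (intro sum.cong refl)
  fix i
  have "l2_eq \<Omega> (\<lambda>x. u x $ i) (\<lambda>x. v x $ i)" using eq unfolding l2_eq_def by eventually_elim simp
  then show "F i (\<lambda>x. u x $ i) = F i (\<lambda>x. v x $ i)"
    using F u v by (intro Hm1_cong) (auto simp: vec_fields_def)
qed

end

section \<open>Finite element spaces\<close>

lemma l2_fin_dimI: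
  assumes A: "finite A" "\<And>a. a \<in> A \<Longrightarrow> g a \<in> L2 \<Omega>" and W: "W \<subseteq> L2 \<Omega>" "lin_closed W"
    and span: "\<And>w. w \<in> W \<Longrightarrow> \<exists>c. l2_eq \<Omega> w (\<lambda>x. \<Sum>a\<in>A. c a *\<^sub>R g a x)"
  shows "l2_fin_dim \<Omega> W"
proof -
  obtain h where h: "bij_betw h {..<card A} A"
    using ex_bij_betw_nat_finite[OF A(1)] by (auto simp: atLeast0LessThan)
  have mem: "g (h i) \<in> L2 \<Omega>" if "i < card A" for i
    using h that by (intro A(2)) (auto simp: bij_betw_def)
  have "\<exists>c. l2_eq \<Omega> w (\<lambda>x. \<Sum>i<card A. c i *\<^sub>R g (h i) x)" if w: "w \<in> W" for w
  proof -
    obtain c where c: "l2_eq \<Omega> w (\<lambda>x. \<Sum>a\<in>A. c a *\<^sub>R g a x)" using span[OF w] by blast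
    have "(\<lambda>x. \<Sum>a\<in>A. c a *\<^sub>R g a x) = (\<lambda>x. \<Sum>i<card A. c (h i) *\<^sub>R g (h i) x)"
      using sum.reindex_bij_betw[OF h, of "\<lambda>a. c a *\<^sub>R g a _"] by (simp add: fun_eq_iff)
    with c show ?thesis by (intro exI[of _ "\<lambda>i. c (h i)"]) simp
  qed
  then show ?thesis unfolding l2_fin_dim_def using W mem by (intro conjI exI[of _ "card A"] exI[of _ "\<lambda>i. g (h i)"]) auto
qed

lemma l2_fin_dimE:
  assumes "l2_fin_dim \<Omega> W"
  obtains n :: nat and b where "\<And>i. i < n \<Longrightarrow> b i \<in> L2 \<Omega>"
    "\<And>w. w \<in> W \<Longrightarrow> \<exists>c. l2_eq \<Omega> w (\<lambda>x. \<Sum>i<n. c i *\<^sub>R b i x)"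
  using assms unfolding l2_fin_dim_def by blast

lemma l2_fin_dimD: "l2_fin_dim \<Omega> W \<Longrightarrow> W \<subseteq> L2 \<Omega>" "l2_fin_dim \<Omega> W \<Longrightarrow> lin_closed W"
  by (simp_all add: l2_fin_dim_def)

lemma l2_span_L2: "l2_span \<Omega> A g \<subseteq> L2 \<Omega>"
  by (auto simp: l2_span_def)

lemma lin_closed_l2_span: "lin_closed (l2_span \<Omega> A g)"
  unfolding lin_closed_def
proof (intro conjI ballI allI)
  show "(\<lambda>x. 0) \<in> l2_span \<Omega> A g"
    by (auto simp: l2_span_def intro!: exI[of _ "\<lambda>a. 0"])
  fix u v s t assume "u \<in> l2_span \<Omega> A g" "v \<in> l2_span \<Omega> A g"
  then obtain c d where uv: "u \<in> L2 \<Omega>" "v \<in> L2 \<Omega>"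
    and cd: "l2_eq \<Omega> u (\<lambda>x. \<Sum>a\<in>A. c a *\<^sub>R g a x)" "l2_eq \<Omega> v (\<lambda>x. \<Sum>a\<in>A. d a *\<^sub>R g a x)"
    by (auto simp: l2_span_def)
  have "l2_eq \<Omega> (\<lambda>x. s *\<^sub>R u x + t *\<^sub>R v x) (\<lambda>x. \<Sum>a\<in>A. (s * c a + t * d a) *\<^sub>R g a x)"
    using l2_eq_lincomb[OF cd, of s t] by (simp add: scaleR_add_left sum.distrib scaleR_sum_right)
  then show "(\<lambda>x. s *\<^sub>R u x + t *\<^sub>R v x) \<in> l2_span \<Omega> A g"
    using L2_lincomb[OF uv, of s t] unfolding l2_span_def
    by (auto intro!: exI[of _ "\<lambda>a. s * c a + t * d a"])
qed

lemma l2_fin_dim_l2_span: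
  "finite A \<Longrightarrow> (\<And>a. a \<in> A \<Longrightarrow> g a \<in> L2 \<Omega>) \<Longrightarrow> l2_fin_dim \<Omega> (l2_span \<Omega> A g)"
  by (rule l2_fin_dimI[of A g]) (auto simp: l2_span_L2 lin_closed_l2_span, auto simp: l2_span_def)

lemma ae_linear_l2_perp:
  assumes "l2_fin_dim \<Omega> W" shows "ae_linear \<Omega> (L2 \<Omega>) (l2_perp \<Omega> W)"
proof (rule ae_linearI)
  show "l2_perp \<Omega> W u \<in> L2 \<Omega>" if "u \<in> L2 \<Omega>" for u by (rule l2_perp_L2[OF assms that])
  show "l2_eq \<Omega> (l2_perp \<Omega> W (\<lambda>x. a *\<^sub>R u x + b *\<^sub>R v x)) (\<lambda>x. a *\<^sub>R l2_perp \<Omega> W u x + b *\<^sub>R l2_perp \<Omega> W v x)"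
    if "u \<in> L2 \<Omega>" "v \<in> L2 \<Omega>" for u v a b
    using l2_proj_lincomb[OF assms that, of a b] unfolding l2_eq_def
    by eventually_elim (simp add: l2_perp_def scaleR_diff_right)
  show "l2_eq \<Omega> (l2_perp \<Omega> W u) (l2_perp \<Omega> W v)" if "u \<in> L2 \<Omega>" "v \<in> L2 \<Omega>" "l2_eq \<Omega> u v" for u v
  proof -
    have "l2_eq \<Omega> (l2_proj \<Omega> W u) (l2_proj \<Omega> W v)"
    proof (rule l2_eq_iff_inner[OF l2_fin_dimD(2,1)[OF assms]])
      fix w assume "w \<in> W"
      then show "l2_inner \<Omega> (l2_proj \<Omega> W u) w = l2_inner \<Omega> (l2_proj \<Omega> W v) w"
        using l2_inner_cong_left[OF that(3), of w] that l2_fin_dimD(1)[OF assms]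
        by (auto simp: l2_inner_proj[OF assms])
    qed (use that assms in \<open>auto intro: l2_proj_mem\<close>)
    with that(3) show ?thesis unfolding l2_eq_def by eventually_elim (simp add: l2_perp_def)
  qed
qed (auto simp: lin_closed_L2)

context bounded_open begin

text \<open>The products of a spanning function with a unit vector span the vector fields. The
  coefficients are found component by component, and the finitely many exceptional null sets are
  joined.\<close>

lemma l2_fin_dim_vec_fields:
  assumes "l2_fin_dim \<Omega> X"
  shows "l2_fin_dim \<Omega> (vec_fields X)"
proof -
  obtain n :: nat and b where b: "\<And>i. i < n \<Longrightarrow> b i \<in> L2 \<Omega>"
    "\<And>w. w \<in> X \<Longrightarrow> \<exists>c. l2_eq \<Omega> w (\<lambda>x. \<Sum>i<n. c i *\<^sub>R b i x)"
    using l2_fin_dimE[OF assms] by blast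
  let ?A = "{..<n} \<times> (UNIV :: 'd set)"
  let ?g = "\<lambda>(i, j) x. b i x *\<^sub>R axis j (1::real)"
  show ?thesis
  proof (rule l2_fin_dimI[of ?A ?g])
    fix a assume "a \<in> ?A"
    then obtain i j where a: "a = (i, j)" "i < n" by auto
    show "?g a \<in> L2 \<Omega>" unfolding a prod.case
      by (rule L2_bounded_mult[OF b(1)[OF a(2)], of _ 1]) (use L2_measurable[OF b(1)[OF a(2)]] in auto)
  next
    show "vec_fields X \<subseteq> L2 \<Omega>" using vec_fields_L2 vec_fields_mono[OF l2_fin_dimD(1)[OF assms]] by blast
    show "lin_closed (vec_fields X)" by (rule lin_closed_vec_fields[OF l2_fin_dimD(2)[OF assms]])
    fix w assume "w \<in> vec_fields X"
    then have "\<forall>j. \<exists>c. l2_eq \<Omega> (\<lambda>x. w x $ j) (\<lambda>x. \<Sum>i<n. c i *\<^sub>R b i x)"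
      using b(2) by (auto simp: vec_fields_def)
    then obtain c where "\<And>j. l2_eq \<Omega> (\<lambda>x. w x $ j) (\<lambda>x. \<Sum>i<n. c j i *\<^sub>R b i x)" by metis
    then have "AE x in lebesgue_on \<Omega>. \<forall>j\<in>UNIV. w x $ j = (\<Sum>i<n. c j i *\<^sub>R b i x)"
      by (intro AE_finite_allI) (auto simp: l2_eq_def)
    then have "l2_eq \<Omega> w (\<lambda>x. \<Sum>a\<in>?A. (case a of (i, j) \<Rightarrow> c j i) *\<^sub>R ?g a x)"
      unfolding l2_eq_def
    proof eventually_elim
      case (elim x)
      have "w x = (\<Sum>j\<in>UNIV. w x $ j *\<^sub>R axis j 1)"
        using basis_expansion[of "w x"] by (simp add: scalar_mult_eq_scaleR)
      also have "\<dots> = (\<Sum>j\<in>UNIV. \<Sum>i<n. c j i *\<^sub>R b i x *\<^sub>R axis j 1)"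
        using elim by (simp add: scaleR_sum_left)
      also have "\<dots> = (\<Sum>i<n. \<Sum>j\<in>UNIV. c j i *\<^sub>R b i x *\<^sub>R axis j 1)" by (rule sum.swap)
      also have "\<dots> = (\<Sum>a\<in>?A. (case a of (i, j) \<Rightarrow> c j i) *\<^sub>R ?g a x)"
        by (simp add: sum.cartesian_product case_prod_beta)
      finally show ?case .
    qed
    then show "\<exists>c. l2_eq \<Omega> w (\<lambda>x. \<Sum>a\<in>?A. c a *\<^sub>R ?g a x)" by blast
  qed auto
qed

end

lemma cd_power: "continuously_differentiable n f \<Longrightarrow> continuously_differentiable n (\<lambda>x. f x ^ m)"
  by (induction m) (auto intro: cd_const cd_mult)

lemma poly_deg_le_cd:
  assumes "poly_deg_le k p" shows "continuously_differentiable n p"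
proof -
  obtain c :: "('a \<Rightarrow> nat) \<Rightarrow> real" where c: "\<And>x. p x = (\<Sum>\<alpha> | (\<Sum>i\<in>UNIV. \<alpha> i) \<le> k. c \<alpha> * (\<Prod>i\<in>UNIV. (x $ i) ^ \<alpha> i))"
    using assms unfolding poly_deg_le_def by blast
  have "p = (\<lambda>x. \<Sum>\<alpha> | (\<Sum>i\<in>UNIV. \<alpha> i) \<le> k. c \<alpha> * (\<Prod>i\<in>UNIV. (x $ i) ^ \<alpha> i))" using c by blast
  moreover have "continuously_differentiable n \<dots>"
    by (intro cd_sum cd_mult cd_const cd_prod cd_power cd_nth)
  ultimately show ?thesis by simp
qed

lemma poly_deg_le_lincomb:
  assumes "poly_deg_le k p" "poly_deg_le k q" shows "poly_deg_le k (\<lambda>x. a * p x + b * q x)"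
proof -
  obtain c d where "\<And>x. p x = (\<Sum>\<alpha> | (\<Sum>i\<in>UNIV. \<alpha> i) \<le> k. c \<alpha> * (\<Prod>i\<in>UNIV. (x $ i) ^ \<alpha> i))"
    "\<And>x. q x = (\<Sum>\<alpha> | (\<Sum>i\<in>UNIV. \<alpha> i) \<le> k. d \<alpha> * (\<Prod>i\<in>UNIV. (x $ i) ^ \<alpha> i))"
    using assms unfolding poly_deg_le_def by blast
  then show ?thesis unfolding poly_deg_le_def
    by (intro exI[of _ "\<lambda>\<alpha>. a * c \<alpha> + b * d \<alpha>"])
      (simp add: sum_distrib_left distrib_right sum.distrib mult.assoc)
qed

text \<open>The vector comes first because \<open>ae_linear_bounded_mult\<close> expects the bounded
  factor there: the velocity is bounded, the matrix is a gradient in \<open>L2\<close>.\<close>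

lemma bounded_bilinear_matvec: "bounded_bilinear (\<lambda>(x::real^'d::finite) (A::real^'d^'d). A *v x)"
  unfolding bilinear_conv_bounded_bilinear[symmetric] bilinear_def
  by (auto intro!: linearI simp: matrix_vector_right_distrib matrix_vector_mult_add_rdistrib
      matrix_vector_mult_scaleR scaleR_matrix_vector_assoc)

section \<open>The cells of a partition and the piecewise smooth functions on it\<close>

locale fe_space =
  fixes \<Omega> :: "(real^'d::finite) set" and \<T> :: "(real^'d) set set" and k :: nat
  assumes domain: "polyhedral_domain \<Omega>" and partition: "fe_partition \<Omega> \<T>"
begin

sublocale bounded_open \<Omega>
proof
  obtain P where P: "finite P" "\<forall>p\<in>P. polytope p" "\<Omega> = interior (\<Union>P)"
    using domain unfolding polyhedral_domain_def by blast
  show "open \<Omega>" using P by simp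
  have "bounded (\<Union>P)" using P by (intro bounded_Union) (auto intro: polytope_imp_bounded)
  then show "bounded \<Omega>" using P(3) interior_subset bounded_subset by blast
qed

lemma finite_convex_cells: "finite \<T>" "\<And>K. K \<in> \<T> \<Longrightarrow> compact K \<and> convex K" "\<Union>\<T> = closure \<Omega>"
    "\<And>K. K \<in> \<T> \<Longrightarrow> interior K \<noteq> {}"
  using partition by (auto simp: fe_partition_def intro: polytope_imp_compact polytope_imp_convex)

lemma cells_cover: "\<Omega> \<subseteq> \<Union>\<T>"
  using finite_convex_cells(3) closure_subset by auto

text \<open>An open set can be smaller than the interior of its closure. Here
  \<open>\<Omega>\<close> is the interior of a finite union of polytopes; this union is closed,
  hence contains the closure of \<open>\<Omega>\<close> and every cell.\<close>

lemma interior_cell: "K \<in> \<T> \<Longrightarrow> interior K \<subseteq> \<Omega>"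
proof -
  assume K: "K \<in> \<T>"
  obtain P where P: "finite P" "\<forall>p\<in>P. polytope p" "\<Omega> = interior (\<Union>P)"
    using domain unfolding polyhedral_domain_def by blast
  have "closed (\<Union>P)" using P by (intro closed_Union) (auto intro: polytope_imp_closed)
  then have "closure \<Omega> \<subseteq> \<Union>P" using P(3) interior_subset by (intro closure_minimal) auto
  then have "K \<subseteq> \<Union>P" using K finite_convex_cells(3) by auto
  then show ?thesis using P(3) interior_mono by blast
qed

text \<open>Frontiers of convex sets are negligible. Identities almost everywhere therefore need
  only be checked inside the cells.\<close>

lemma AE_interior_cell: "AE x in lebesgue_on \<Omega>. \<exists>K\<in>\<T>. x \<in> interior K"
proof -
  have "AE x in lebesgue. x \<notin> (\<Union>K\<in>\<T>. frontier K)"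
  proof (intro AE_not_in)
    have "negligible (\<Union>K\<in>\<T>. frontier K)"
      using finite_convex_cells by (intro negligible_Union) (auto intro: negligible_convex_frontier)
    then show "(\<Union>K\<in>\<T>. frontier K) \<in> null_sets lebesgue" by (simp add: negligible_iff_null_sets)
  qed
  then have "AE x in lebesgue. x \<in> \<Omega> \<longrightarrow> (\<exists>K\<in>\<T>. x \<in> interior K)"
  proof eventually_elim
    case (elim x)
    show ?case
    proof
      assume "x \<in> \<Omega>"
      then obtain K where K: "K \<in> \<T>" "x \<in> K" using cells_cover by auto
      then have "x \<in> interior K" using elim finite_convex_cells(2)[OF K(1)]
        by (auto simp: frontier_def closure_closed compact_imp_closed)
      then show "\<exists>K\<in>\<T>. x \<in> interior K" using K(1) by blast
    qed
  qed
  then show ?thesis using open_\<Omega> by (simp add: AE_restrict_space_iff)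
qed

text \<open>
  Unlike \<open>S\<^sub>h\<close>, this class is closed under products, as needed for the skew-symmetry of the
  convective form.
\<close>

definition pc1 :: "(real^'d \<Rightarrow> real) set" where
  "pc1 = {u. continuous_on (closure \<Omega>) u \<and>
     (\<forall>K\<in>\<T>. \<exists>p. continuously_differentiable (Suc 0) p \<and> (\<forall>x\<in>K. u x = p x))}"

lemma S_h_pc1: "S_h \<Omega> \<T> k \<subseteq> pc1"
  unfolding S_h_def pc1_def using poly_deg_le_cd by blast

lemma pc1_L2: "u \<in> pc1 \<Longrightarrow> u \<in> L2 \<Omega>"
  by (simp add: pc1_def L2_continuous)

lemma pc1_bounded:
  assumes "u \<in> pc1" shows "\<exists>M. \<forall>x\<in>\<Omega>. norm (u x) \<le> M"
proof -
  have "compact (closure \<Omega>)" using bounded_\<Omega> by (simp add: compact_closure)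
  then show ?thesis
    using continuous_on_compact_norm_bounded[of "closure \<Omega>" u] assms closure_subset[of \<Omega>]
    unfolding pc1_def by blast
qed

lemma pc1_weak_grad:
  assumes "u \<in> pc1"
  obtains g P where "is_weak_grad \<Omega> u g"
    "\<And>K x. K \<in> \<T> \<Longrightarrow> x \<in> K \<Longrightarrow> u x = P K x" "\<And>K. K \<in> \<T> \<Longrightarrow> continuously_differentiable (Suc 0) (P K)"
    "\<And>K x i. K \<in> \<T> \<Longrightarrow> x \<in> interior K \<Longrightarrow> g x $ i = partial_deriv i (P K) x"
proof -
  have "\<forall>K\<in>\<T>. \<exists>p. continuously_differentiable (Suc 0) p \<and> (\<forall>x\<in>K. u x = p x)"
    using assms by (simp add: pc1_def)
  then obtain P where P: "\<And>K. K \<in> \<T> \<Longrightarrow> continuously_differentiable (Suc 0) (P K)"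
    "\<And>K x. K \<in> \<T> \<Longrightarrow> x \<in> K \<Longrightarrow> u x = P K x" by metis
  have "\<exists>g M. is_weak_grad \<Omega> u g \<and> (\<forall>x\<in>\<Omega>. norm (g x) \<le> M) \<and>
    (\<forall>K\<in>\<T>. \<forall>x\<in>interior K. \<forall>i. g x $ i = partial_deriv i (P K) x)"
    by (rule piecewise_weak_grad[OF finite_convex_cells(1,2) cells_cover])
      (use P pc1_L2[OF assms] in \<open>auto simp del: continuously_differentiable.simps\<close>)
  then obtain g where
    "is_weak_grad \<Omega> u g" "\<And>K x i. K \<in> \<T> \<Longrightarrow> x \<in> interior K \<Longrightarrow> g x $ i = partial_deriv i (P K) x" by blast
  with P that show ?thesis by blast
qed

lemma pc1_H1: "u \<in> pc1 \<Longrightarrow> u \<in> H1 \<Omega>"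
  by (rule pc1_weak_grad) (auto intro: H1I pc1_L2)

lemma pc1_mult: "u \<in> pc1 \<Longrightarrow> v \<in> pc1 \<Longrightarrow> (\<lambda>x. u x * v x) \<in> pc1"
proof -
  assume uv: "u \<in> pc1" "v \<in> pc1"
  have "\<exists>p. continuously_differentiable (Suc 0) p \<and> (\<forall>x\<in>K. u x * v x = p x)" if K: "K \<in> \<T>" for K
  proof -
    obtain p q where "continuously_differentiable (Suc 0) p" "\<forall>x\<in>K. u x = p x"
      "continuously_differentiable (Suc 0) q" "\<forall>x\<in>K. v x = q x"
      using uv K unfolding pc1_def by blast
    then show ?thesis by (intro exI[of _ "\<lambda>x. p x * q x"] conjI cd_mult) auto
  qed
  then show ?thesis using uv by (auto simp: pc1_def intro: continuous_on_mult)
qed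

text \<open>Inside each cell this is the classical product rule for the smooth pieces, and the weak
  gradient of the product, itself piecewise smooth, is the classical one there.\<close>

lemma pc1_grad_mult:
  assumes u: "u \<in> pc1" and v: "v \<in> pc1"
  shows "l2_eq \<Omega> (grad \<Omega> (\<lambda>x. u x * v x)) (\<lambda>x. u x *\<^sub>R grad \<Omega> v x + v x *\<^sub>R grad \<Omega> u x)"
proof -
  obtain gu P where gu: "is_weak_grad \<Omega> u gu" "\<And>K x. K \<in> \<T> \<Longrightarrow> x \<in> K \<Longrightarrow> u x = P K x"
    "\<And>K. K \<in> \<T> \<Longrightarrow> continuously_differentiable (Suc 0) (P K)"
    "\<And>K x i. K \<in> \<T> \<Longrightarrow> x \<in> interior K \<Longrightarrow> gu x $ i = partial_deriv i (P K) x"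
    using pc1_weak_grad[OF u] by metis
  obtain gv Q where gv: "is_weak_grad \<Omega> v gv" "\<And>K x. K \<in> \<T> \<Longrightarrow> x \<in> K \<Longrightarrow> v x = Q K x"
    "\<And>K. K \<in> \<T> \<Longrightarrow> continuously_differentiable (Suc 0) (Q K)"
    "\<And>K x i. K \<in> \<T> \<Longrightarrow> x \<in> interior K \<Longrightarrow> gv x $ i = partial_deriv i (Q K) x"
    using pc1_weak_grad[OF v] by metis
  have "\<exists>g M. is_weak_grad \<Omega> (\<lambda>x. u x * v x) g \<and> (\<forall>x\<in>\<Omega>. norm (g x) \<le> M) \<and>
    (\<forall>K\<in>\<T>. \<forall>x\<in>interior K. \<forall>i. g x $ i = partial_deriv i (\<lambda>x. P K x * Q K x) x)"
    by (rule piecewise_weak_grad[OF finite_convex_cells(1,2) cells_cover])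
      (use gu(2,3) gv(2,3) pc1_L2[OF pc1_mult[OF u v]] in \<open>auto intro!: cd_mult simp del: continuously_differentiable.simps\<close>)
  then obtain g where g: "is_weak_grad \<Omega> (\<lambda>x. u x * v x) g"
    "\<And>K x i. K \<in> \<T> \<Longrightarrow> x \<in> interior K \<Longrightarrow> g x $ i = partial_deriv i (\<lambda>x. P K x * Q K x) x" by blast
  have "l2_eq \<Omega> g (\<lambda>x. u x *\<^sub>R gv x + v x *\<^sub>R gu x)"
    using AE_interior_cell unfolding l2_eq_def
  proof eventually_elim
    case (elim x)
    then obtain K where K: "K \<in> \<T>" "x \<in> interior K" by blast
    have xK: "x \<in> K" using K interior_subset by blast
    have d: "P K differentiable_on UNIV" "Q K differentiable_on UNIV" using gu(3)[OF K(1)] gv(3)[OF K(1)] by auto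
    show ?case
      using g(2)[OF K] gu(4)[OF K] gv(4)[OF K] gu(2)[OF K(1) xK] gv(2)[OF K(1) xK]
      by (simp add: vec_eq_iff partial_deriv_mult[OF d] mult.commute)
  qed
  with grad_eq[OF g(1)] grad_eq[OF gu(1)] grad_eq[OF gv(1)]
  show ?thesis unfolding l2_eq_def by eventually_elim simp
qed

text \<open>Inside a cell the partial derivatives are continuous and vanish almost everywhere, hence
  everywhere, and \<open>u\<close> is constant there. With finitely many cells \<open>u\<close>
  takes finitely many values; as a continuous function on the connected set \<open>\<Omega>\<close>
  it takes only one. This avoids any discussion of adjacent cells.\<close>

lemma zero_grad_const:
  assumes u: "u \<in> pc1" and z: "l2_eq \<Omega> (grad \<Omega> u) (\<lambda>x. 0)"
  shows "\<exists>c. \<forall>x\<in>\<Omega>. u x = c"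
proof -
  obtain g P where g: "is_weak_grad \<Omega> u g" "\<And>K x. K \<in> \<T> \<Longrightarrow> x \<in> K \<Longrightarrow> u x = P K x"
    "\<And>K. K \<in> \<T> \<Longrightarrow> continuously_differentiable (Suc 0) (P K)"
    "\<And>K x i. K \<in> \<T> \<Longrightarrow> x \<in> interior K \<Longrightarrow> g x $ i = partial_deriv i (P K) x"
    using pc1_weak_grad[OF u] by metis
  have "l2_eq \<Omega> g (\<lambda>x. 0)" using l2_eq_trans[OF l2_eq_sym[OF grad_eq[OF g(1)]] z] .
  then have gz: "AE x in lebesgue. x \<in> \<Omega> \<longrightarrow> g x = 0"
    using open_\<Omega> by (simp add: l2_eq_def AE_restrict_space_iff)
  have "\<exists>c. \<forall>x\<in>K. u x = c" if K: "K \<in> \<T>" for K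
  proof -
    have pz: "partial_deriv i (P K) x = 0" if x: "x \<in> interior K" for x i
    proof (rule ccontr)
      assume nz: "partial_deriv i (P K) x \<noteq> 0"
      \<comment> \<open>The set where the derivative is nonzero is open; if it contained
        \<open>x\<close> it would have positive measure, contrary to the vanishing of the gradient
        almost everywhere.\<close>
      let ?S = "interior K \<inter> partial_deriv i (P K) -` (- {0})"
      have "continuous_on UNIV (partial_deriv i (P K))" using g(3)[OF K] by simp
      then have op: "open ?S" by (intro open_Int open_vimage) auto
      have "AE x in lebesgue. x \<notin> ?S"
        using gz
      proof eventually_elim
        case (elim x)
        show ?case
        proof
          assume x: "x \<in> ?S"
          then have "g x = 0" using elim interior_cell[OF K] by blast
          with x show False using g(4)[OF K, of x i] by auto
        qed
      qed
      then have "?S \<in> null_sets lebesgue" using op by (simp add: AE_iff_null_sets)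
      then have "negligible ?S" by (simp add: negligible_iff_null_sets)
      then show False using open_not_negligible[OF op] x nz by auto
    qed
    have "\<exists>c. \<forall>x\<in>interior K. P K x = c"
    proof (rule has_derivative_zero_constant)
      show "convex (interior K)" using finite_convex_cells(2)[OF K] by (simp add: convex_interior)
      fix x assume x: "x \<in> interior K"
      have d: "P K differentiable (at x)" using g(3)[OF K] by (simp add: differentiable_on_def)
      have "frechet_derivative (P K) (at x) = (\<lambda>h. 0)"
        using frechet_partial[OF d] pz[OF x] by (simp add: fun_eq_iff)
      then show "(P K has_derivative (\<lambda>h. 0)) (at x within interior K)"
        using d frechet_derivative_works has_derivative_at_withinI by metis
    qed
    then obtain c where c: "\<And>x. x \<in> interior K \<Longrightarrow> P K x = c" by blast
    have "closure (interior K) = K"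
      using convex_closure_interior[of K] finite_convex_cells(2,4)[OF K] by (simp add: compact_imp_closed)
    moreover have "continuous_on UNIV (P K)" by (rule cd_continuous[OF g(3)[OF K]])
    ultimately have "P K x = c" if "x \<in> K" for x
      using continuous_constant_on_closure[of "interior K" "P K" c x] c that
      by (metis continuous_on_subset subset_UNIV)
    then show ?thesis using g(2)[OF K] by auto
  qed
  then obtain C where C: "\<And>K x. K \<in> \<T> \<Longrightarrow> x \<in> K \<Longrightarrow> u x = C K" by metis
  have "u ` \<Omega> \<subseteq> C ` \<T>" using C cells_cover by fastforce
  then have "finite (u ` \<Omega>)" using finite_convex_cells(1) finite_subset by blast
  moreover have "continuous_on \<Omega> u" using u continuous_on_subset[OF _ closure_subset, of \<Omega> u] by (simp add: pc1_def)
  moreover have "connected \<Omega>" using domain by (simp add: polyhedral_domain_def)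
  ultimately have "u constant_on \<Omega>" using continuous_finite_range_constant by blast
  then show ?thesis by (auto simp: constant_on_def)
qed

section \<open>The discrete velocity space and the convective form\<close>

lemma lin_closed_S_h: "lin_closed (S_h \<Omega> \<T> k)"
  unfolding lin_closed_def
proof (intro conjI ballI allI)
  have "poly_deg_le k (\<lambda>x::real^'d. 0)" unfolding poly_deg_le_def by (intro exI[of _ "\<lambda>\<alpha>. 0"]) simp
  then show "(\<lambda>x. 0) \<in> S_h \<Omega> \<T> k" by (auto simp: S_h_def)
  fix u v a b assume uv: "u \<in> S_h \<Omega> \<T> k" "v \<in> S_h \<Omega> \<T> k"
  have "\<exists>p. poly_deg_le k p \<and> (\<forall>x\<in>K. a *\<^sub>R u x + b *\<^sub>R v x = p x)" if K: "K \<in> \<T>" for K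
  proof -
    obtain p q where "poly_deg_le k p" "\<forall>x\<in>K. u x = p x" "poly_deg_le k q" "\<forall>x\<in>K. v x = q x"
      using uv K unfolding S_h_def by blast
    then show ?thesis by (intro exI[of _ "\<lambda>x. a * p x + b * q x"] conjI poly_deg_le_lincomb) auto
  qed
  then show "(\<lambda>x. a *\<^sub>R u x + b *\<^sub>R v x) \<in> S_h \<Omega> \<T> k"
    using uv by (auto simp: S_h_def intro!: continuous_intros)
qed

lemma S_h_H1: "S_h \<Omega> \<T> k \<subseteq> H1 \<Omega>" using S_h_pc1 pc1_H1 by blast

lemma lin_closed_V_h: "lin_closed (V_h \<Omega> \<T> k)"
  unfolding V_h_def by (intro lin_closed_vec_fields lin_closed_Int lin_closed_S_h lin_closed_H10)

lemma V_h_nth: "v \<in> V_h \<Omega> \<T> k \<Longrightarrow> (\<lambda>x. v x $ i) \<in> pc1 \<and> (\<lambda>x. v x $ i) \<in> H10 \<Omega> \<and> (\<lambda>x. v x $ i) \<in> S_h \<Omega> \<T> k"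
  using S_h_pc1 by (auto simp: V_h_def vec_fields_def)

lemma V_h_sub: "V_h \<Omega> \<T> k \<subseteq> vec_fields (H1 \<Omega>)" "V_h \<Omega> \<T> k \<subseteq> vec_fields (H10 \<Omega>)" "V_h \<Omega> \<T> k \<subseteq> L2 \<Omega>"
proof -
  show a: "V_h \<Omega> \<T> k \<subseteq> vec_fields (H1 \<Omega>)" "V_h \<Omega> \<T> k \<subseteq> vec_fields (H10 \<Omega>)"
    using V_h_nth H10_H1 by (auto simp: vec_fields_def)
  show "V_h \<Omega> \<T> k \<subseteq> L2 \<Omega>" using a(1) ae_linearD(1)[OF ae_linear_vgrad] by blast
qed

lemma V_h_bounded:
  assumes "v \<in> V_h \<Omega> \<T> k" shows "\<exists>M. \<forall>x\<in>\<Omega>. norm (v x) \<le> M"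
proof -
  have "\<forall>i. \<exists>M. \<forall>x\<in>\<Omega>. norm (v x $ i) \<le> M" using pc1_bounded V_h_nth[OF assms] by blast
  then obtain M where M: "\<And>i x. x \<in> \<Omega> \<Longrightarrow> norm (v x $ i) \<le> M i" by metis
  have "norm (v x) \<le> (\<Sum>i\<in>UNIV. M i)" if "x \<in> \<Omega>" for x
    using norm_le_l1_cart[of "v x"] sum_mono[of UNIV "\<lambda>i. \<bar>v x $ i\<bar>" M] M[OF that] by fastforce
  then show ?thesis by blast
qed

lemma ae_linear_V_h: "ae_linear \<Omega> (vec_fields (H1 \<Omega>)) A \<Longrightarrow> ae_linear \<Omega> (V_h \<Omega> \<T> k) A"
  by (rule ae_linear_subset[OF _ V_h_sub(1) lin_closed_V_h])

text \<open>Here the roles are reversed: the coefficient \<open>h\<close>, in the application a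
  divergence, is an \<open>L2\<close> function, and the bounded factor is the discrete field
  \<open>v\<close>.\<close>

lemma bounded_scale_L2:
  assumes "h \<in> L2 \<Omega>" "v \<in> V_h \<Omega> \<T> k"
  shows "(\<lambda>x. (1/2 * h x) *\<^sub>R v x) \<in> L2 \<Omega>"
proof -
  obtain M where M: "\<And>x. x \<in> \<Omega> \<Longrightarrow> norm (v x) \<le> M" using V_h_bounded[OF assms(2)] by blast
  have m: "h \<in> borel_measurable (lebesgue_on \<Omega>)" "v \<in> borel_measurable (lebesgue_on \<Omega>)"
    using L2_measurable[OF assms(1)] L2_measurable[of v \<Omega>] assms(2) V_h_sub(3) by auto
  show ?thesis
  proof (rule L2_bounded_mult[OF assms(1), of _ "\<bar>M\<bar>"])
    show "AE x in lebesgue_on \<Omega>. norm ((1/2 * h x) *\<^sub>R v x) \<le> \<bar>M\<bar> * norm (h x)"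
    proof (intro AE_I2)
      fix x assume "x \<in> space (lebesgue_on \<Omega>)"
      then have "norm (v x) \<le> \<bar>M\<bar>" using M[of x] by simp
      then have "\<bar>h x\<bar> * norm (v x) \<le> \<bar>h x\<bar> * \<bar>M\<bar>" by (intro mult_left_mono) auto
      moreover have "0 \<le> \<bar>M\<bar> * \<bar>h x\<bar>" by simp
      moreover have "norm ((1/2 * h x) *\<^sub>R v x) = (\<bar>h x\<bar> * norm (v x)) / 2" by (simp add: abs_mult)
      moreover have "\<bar>h x\<bar> * \<bar>M\<bar> = \<bar>M\<bar> * \<bar>h x\<bar>" by (rule mult.commute)
      ultimately show "norm ((1/2 * h x) *\<^sub>R v x) \<le> \<bar>M\<bar> * norm (h x)" unfolding real_norm_def by linarith
    qed
  qed (use m in auto)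
qed

lemma ae_linear_conv_right:
  assumes w: "w \<in> V_h \<Omega> \<T> k"
  shows "ae_linear \<Omega> (V_h \<Omega> \<T> k) (conv \<Omega> w)"
proof -
  obtain M where M: "\<And>x. x \<in> \<Omega> \<Longrightarrow> norm (w x) \<le> M" using V_h_bounded[OF w] by blast
  have wm: "w \<in> borel_measurable (lebesgue_on \<Omega>)" using L2_measurable[of w \<Omega>] V_h_sub(3) w by blast
  have dw: "vdiv \<Omega> w \<in> L2 \<Omega>" using ae_linearD(3)[OF ae_linear_vdiv] w V_h_sub(1) by blast
  have 1: "ae_linear \<Omega> (V_h \<Omega> \<T> k) (\<lambda>v x. vgrad \<Omega> v x *v w x)"
    by (rule ae_linear_bounded_mult[OF ae_linear_V_h[OF ae_linear_vgrad] bounded_bilinear_matvec wm M])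
  have 2: "ae_linear \<Omega> (V_h \<Omega> \<T> k) (\<lambda>v x. (1/2 * vdiv \<Omega> w x) *\<^sub>R v x)"
  proof (rule ae_linearI[OF V_h_sub(3) lin_closed_V_h])
    show "(\<lambda>x. (1/2 * vdiv \<Omega> w x) *\<^sub>R v x) \<in> L2 \<Omega>" if "v \<in> V_h \<Omega> \<T> k" for v
      by (rule bounded_scale_L2[OF dw that])
    show "l2_eq \<Omega> (\<lambda>x. (1/2 * vdiv \<Omega> w x) *\<^sub>R u x) (\<lambda>x. (1/2 * vdiv \<Omega> w x) *\<^sub>R v x)" if "l2_eq \<Omega> u v" for u v
      using that unfolding l2_eq_def by eventually_elim simp
  qed (simp add: l2_eq_def scaleR_add_right mult_ac)
  show ?thesis using ae_linear_add[OF 1 2] by (simp add: conv_def[abs_def])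
qed

text \<open>Linearity in the advecting field allows the time dependence of the given velocity to be
  pulled out in the form of scalar coefficients.\<close>

lemma ae_linear_conv_left:
  assumes v: "v \<in> V_h \<Omega> \<T> k"
  shows "ae_linear \<Omega> (V_h \<Omega> \<T> k) (\<lambda>w. conv \<Omega> w v)"
proof (rule ae_linearI[OF V_h_sub(3) lin_closed_V_h])
  show "conv \<Omega> w v \<in> L2 \<Omega>" if "w \<in> V_h \<Omega> \<T> k" for w
    by (rule ae_linearD(3)[OF ae_linear_conv_right[OF that] v])
  have d: "ae_linear \<Omega> (V_h \<Omega> \<T> k) (vdiv \<Omega>)" by (rule ae_linear_V_h[OF ae_linear_vdiv])
  show "l2_eq \<Omega> (conv \<Omega> (\<lambda>x. a *\<^sub>R u x + b *\<^sub>R w x) v) (\<lambda>x. a *\<^sub>R conv \<Omega> u v x + b *\<^sub>R conv \<Omega> w v x)"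
    if "u \<in> V_h \<Omega> \<T> k" "w \<in> V_h \<Omega> \<T> k" for u w a b
    using ae_linearD(4)[OF d that, of a b] unfolding l2_eq_def
    by eventually_elim (simp add: conv_def matrix_vector_right_distrib matrix_vector_mult_scaleR
        scaleR_add_right scaleR_add_left algebra_simps)
  show "l2_eq \<Omega> (conv \<Omega> u v) (conv \<Omega> w v)" if "u \<in> V_h \<Omega> \<T> k" "w \<in> V_h \<Omega> \<T> k" "l2_eq \<Omega> u w" for u w
    using ae_linearD(5)[OF d that] that(3) unfolding l2_eq_def by eventually_elim (simp add: conv_def)
qed

text \<open>With \<open>q i\<close> the square of component \<open>i\<close> of \<open>v\<close>,
  the integrand is half the sum over \<open>i\<close> and \<open>j\<close> of
  \<open>w j * d_j (q i) + q i * d_j (w j)\<close>, which is a divergence. Integration by parts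
  against the components of \<open>w\<close>, which lie in \<open>H10\<close>, makes each summand
  integrate to 0.\<close>

lemma conv_form_skew:
  assumes w: "w \<in> V_h \<Omega> \<T> k" and v: "v \<in> V_h \<Omega> \<T> k"
  shows "conv_form \<Omega> w v v = 0"
proof -
  define g where "g = (\<lambda>i. grad \<Omega> (\<lambda>x. v x $ i))"
  define q where "q = (\<lambda>i x. v x $ i * v x $ i)"
  have qpc: "q i \<in> pc1" for i unfolding q_def using pc1_mult V_h_nth[OF v] by blast
  have wj: "(\<lambda>x. w x $ j) \<in> H10 \<Omega>" for j using V_h_nth[OF w] by blast
  then have wH: "(\<lambda>x. w x $ j) \<in> H1 \<Omega>" for j using H10_H1 by blast
  define dw where "dw = (\<lambda>j x. grad \<Omega> (\<lambda>x. w x $ j) x $ j)"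
  have dwL: "dw j \<in> L2 \<Omega>" for j unfolding dw_def by (intro L2_nth grad_L2 wH)
  have gqL: "(\<lambda>x. grad \<Omega> (q i) x $ j) \<in> L2 \<Omega>" for i j by (intro L2_nth grad_L2 pc1_H1 qpc)
  have ibp: "l2_inner \<Omega> (q i) (dw j) = - l2_inner \<Omega> (\<lambda>x. grad \<Omega> (q i) x $ j) (\<lambda>x. w x $ j)" for i j
    unfolding dw_def by (rule H10_integration_by_parts[OF pc1_H1[OF qpc] wj])
  have I1: "integrable (lebesgue_on \<Omega>) (\<lambda>x. q i x * dw j x)" for i j
    using L2_integrable_inner[OF pc1_L2[OF qpc] dwL] by simp
  have I2: "integrable (lebesgue_on \<Omega>) (\<lambda>x. grad \<Omega> (q i) x $ j * w x $ j)" for i j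
    using L2_integrable_inner[OF gqL H1_L2[OF wH]] by simp
  have "AE x in lebesgue_on \<Omega>. \<forall>i\<in>UNIV. grad \<Omega> (q i) x = (2 * v x $ i) *\<^sub>R g i x"
  proof (intro AE_finite_allI)
    fix i
    have "(\<lambda>x. v x $ i) \<in> pc1" using V_h_nth[OF v] by blast
    from pc1_grad_mult[OF this this]
    show "AE x in lebesgue_on \<Omega>. grad \<Omega> (q i) x = (2 * v x $ i) *\<^sub>R g i x"
      unfolding l2_eq_def q_def g_def by eventually_elim (simp flip: scaleR_add_left)
  qed simp
  then have eq: "AE x in lebesgue_on \<Omega>. conv \<Omega> w v x \<bullet> v x
      = (\<Sum>i\<in>UNIV. \<Sum>j\<in>UNIV. 1/2 * (grad \<Omega> (q i) x $ j * w x $ j) + 1/2 * (q i x * dw j x))"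
  proof eventually_elim
    case (elim x)
    have "conv \<Omega> w v x \<bullet> v x = (\<Sum>i\<in>UNIV. (\<Sum>j\<in>UNIV. g i x $ j * w x $ j) * v x $ i)
        + (\<Sum>i\<in>UNIV. 1/2 * (\<Sum>j\<in>UNIV. dw j x) * v x $ i * v x $ i)"
      by (simp add: conv_def inner_vec_def matrix_vector_mult_def vgrad_def vdiv_def g_def dw_def
          distrib_right sum.distrib)
    also have "\<dots> = (\<Sum>i\<in>UNIV. \<Sum>j\<in>UNIV. 1/2 * (grad \<Omega> (q i) x $ j * w x $ j) + 1/2 * (q i x * dw j x))"
      using elim by (simp add: sum.distrib sum_distrib_left sum_distrib_right q_def mult_ac)
    finally show ?case .
  qed
  have cL: "conv \<Omega> w v \<in> L2 \<Omega>" "v \<in> L2 \<Omega>"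
    using ae_linearD(3)[OF ae_linear_conv_right[OF w] v] v V_h_sub(3) by auto
  have "conv_form \<Omega> w v v = (\<integral>x. (\<Sum>i\<in>UNIV. \<Sum>j\<in>UNIV. 1/2 * (grad \<Omega> (q i) x $ j * w x $ j) + 1/2 * (q i x * dw j x)) \<partial>lebesgue_on \<Omega>)"
    unfolding conv_form_def
    by (rule integral_cong_AE[OF _ _ eq])
      (use borel_measurable_integrable[OF L2_integrable_inner[OF cL]] borel_measurable_integrable[OF I1]
        borel_measurable_integrable[OF I2] in auto)
  also have "\<dots> = (\<Sum>i\<in>UNIV. \<Sum>j\<in>UNIV. 1/2 * l2_inner \<Omega> (\<lambda>x. grad \<Omega> (q i) x $ j) (\<lambda>x. w x $ j)
      + 1/2 * l2_inner \<Omega> (q i) (dw j))"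
    using I1 I2 by (simp add: l2_inner_def)
  also have "\<dots> = 0" unfolding ibp by simp
  finally show ?thesis .
qed

end

section \<open>Linear differential equations with integrable coefficients\<close>

lemma integrable_prod_lborel:
  fixes f g :: "real \<Rightarrow> real"
  assumes f: "integrable lborel f" and g: "integrable lborel g"
  shows "integrable (lborel \<Otimes>\<^sub>M lborel) (\<lambda>(x, y). f x * g y)"
proof (rule lborel_pair.Fubini_integrable)
  show "(\<lambda>(x, y). f x * g y) \<in> borel_measurable (lborel \<Otimes>\<^sub>M lborel)"
    using borel_measurable_integrable[OF f] borel_measurable_integrable[OF g] by measurable
  have "integrable lborel (\<lambda>x. norm (f x) * (\<integral>y. norm (g y) \<partial>lborel))"
    using f by auto
  then show "integrable lborel (\<lambda>x. \<integral>y. norm (case (x, y) of (x, y) \<Rightarrow> f x * g y) \<partial>lborel)"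
    by (simp add: abs_mult)
  show "AE x in lborel. integrable lborel (\<lambda>y. case (x, y) of (x, y) \<Rightarrow> f x * g y)"
    using g by simp
qed

text \<open>Fubini's theorem for the product function, with the plane split along the diagonal: each
  half integrates to one of the two terms.\<close>

lemma indefinite_integral_product_lborel:
  fixes f g :: "real \<Rightarrow> real"
  assumes f: "integrable lborel f" and g: "integrable lborel g"
  shows "integrable lborel (\<lambda>x. f x * (\<integral>y. indicator {..x} y * g y \<partial>lborel))"
    and "(\<integral>x. f x \<partial>lborel) * (\<integral>x. g x \<partial>lborel)
      = (\<integral>x. f x * (\<integral>y. indicator {..x} y * g y \<partial>lborel) \<partial>lborel)
      + (\<integral>y. (\<integral>x. indicator {..y} x * f x \<partial>lborel) * g y \<partial>lborel)"
proof -
  let ?P = "lborel \<Otimes>\<^sub>M lborel :: (real \<times> real) measure"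
  define S where "S = {p::real \<times> real. snd p \<le> fst p}"
  have Sm: "S \<in> sets ?P"
  proof -
    have "{p \<in> space ?P. snd p \<le> fst p} \<in> sets ?P" by measurable
    then show ?thesis by (simp add: S_def space_pair_measure)
  qed
  note h = integrable_prod_lborel[OF f g]
  have h1: "integrable ?P (\<lambda>(x, y). f x * (indicator {..x} y * g y))"
  proof -
    have "integrable ?P (\<lambda>p. indicator S p *\<^sub>R (case p of (x, y) \<Rightarrow> f x * g y))"
      by (rule integrable_mult_indicator[OF Sm h])
    then show ?thesis
      by (rule back_subst[of "integrable ?P"]) (auto simp: fun_eq_iff S_def indicator_def)
  qed
  have h2: "integrable ?P (\<lambda>(x, y). (indicator {..<y} x * f x) * g y)"
  proof -
    have "integrable ?P (\<lambda>p. indicator (space ?P - S) p *\<^sub>R (case p of (x, y) \<Rightarrow> f x * g y))"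
      by (rule integrable_mult_indicator[OF sets.compl_sets[OF Sm] h])
    then show ?thesis
      by (rule back_subst[of "integrable ?P"]) (auto simp: fun_eq_iff S_def indicator_def space_pair_measure)
  qed
  show "integrable lborel (\<lambda>x. f x * (\<integral>y. indicator {..x} y * g y \<partial>lborel))"
    using lborel_pair.integrable_fst'[OF h1] by simp
  have "(\<integral>x. f x \<partial>lborel) * (\<integral>x. g x \<partial>lborel) = (\<integral>x. (\<integral>y. f x * g y \<partial>lborel) \<partial>lborel)"
    by simp
  also have "\<dots> = (\<integral>p. (case p of (x, y) \<Rightarrow> f x * g y) \<partial>?P)"
    using lborel_pair.integral_fst'[OF h] by simp
  also have "\<dots> = (\<integral>p. (case p of (x, y) \<Rightarrow> f x * (indicator {..x} y * g y))
      + (case p of (x, y) \<Rightarrow> (indicator {..<y} x * f x) * g y) \<partial>?P)"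
    by (intro Bochner_Integration.integral_cong) (auto simp: indicator_def)
  also have "\<dots> = (\<integral>p. (case p of (x, y) \<Rightarrow> f x * (indicator {..x} y * g y)) \<partial>?P)
      + (\<integral>p. (case p of (x, y) \<Rightarrow> (indicator {..<y} x * f x) * g y) \<partial>?P)"
    by (rule Bochner_Integration.integral_add[OF h1 h2])
  also have "(\<integral>p. (case p of (x, y) \<Rightarrow> f x * (indicator {..x} y * g y)) \<partial>?P)
      = (\<integral>x. f x * (\<integral>y. indicator {..x} y * g y \<partial>lborel) \<partial>lborel)"
    using lborel_pair.integral_fst'[OF h1] by simp
  also have "(\<integral>p. (case p of (x, y) \<Rightarrow> (indicator {..<y} x * f x) * g y) \<partial>?P)
      = (\<integral>y. (\<integral>x. indicator {..<y} x * f x \<partial>lborel) * g y \<partial>lborel)"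
    using lborel_pair.integral_snd[OF h2] by simp
  \<comment> \<open>The diagonal was assigned to one half, so the other half carries a strict
    inequality; a single point does not change the integral.\<close>
  also have "(\<lambda>y. (\<integral>x. indicator {..<y} x * f x \<partial>lborel) * g y) = (\<lambda>y. (\<integral>x. indicator {..y} x * f x \<partial>lborel) * g y)"
  proof (intro ext arg_cong2[where f="(*)"] refl integral_cong_AE)
    fix y :: real
    show "AE x in lborel. indicator {..<y} x * f x = indicator {..y} x * f x"
      using AE_lborel_singleton[of y] by eventually_elim (auto simp: indicator_def)
  qed (use borel_measurable_integrable[OF f] in auto)
  finally show "(\<integral>x. f x \<partial>lborel) * (\<integral>x. g x \<partial>lborel)
      = (\<integral>x. f x * (\<integral>y. indicator {..x} y * g y \<partial>lborel) \<partial>lborel)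
      + (\<integral>y. (\<integral>x. indicator {..y} x * f x \<partial>lborel) * g y \<partial>lborel)" .
qed

definition itg :: "real \<Rightarrow> (real \<Rightarrow> real) \<Rightarrow> real" where
  "itg t f = (\<integral>s. f s \<partial>lebesgue_on {0..t})"

lemma integrable_Icc_subset:
  fixes f :: "real \<Rightarrow> real"
  assumes "integrable (lebesgue_on {0..t}) f" "s \<le> t"
  shows "integrable (lebesgue_on {0..s}) f"
  by (rule integrable_subinterval[of 0 t f 0 s]) (use assms in auto)

text \<open>Fubini's theorem is applied to Borel functions on the line, while the time integrals are
  Lebesgue integrals over \<open>{0..t}\<close>. The representative carries over all indefinite
  integrals at once.\<close>

lemma borel_representative:
  fixes f :: "real \<Rightarrow> real"
  assumes f: "integrable (lebesgue_on {0..t}) f"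
  obtains f' where "integrable lborel f'" "\<And>x. x \<notin> {0..t} \<Longrightarrow> f' x = 0"
    "AE x in lebesgue. x \<in> {0..t} \<longrightarrow> f x = f' x"
    "\<And>s. s \<in> {0..t} \<Longrightarrow> itg s f = (\<integral>x. indicator {..s} x * f' x \<partial>lborel)"
    "itg t f = (\<integral>x. f' x \<partial>lborel)"
proof -
  let ?f = "\<lambda>x. indicator {0..t} x *\<^sub>R f x"
  have fi: "integrable lebesgue ?f"
    using f integrable_restrict_space[of "{0..t}" lebesgue f] by simp
  obtain g where g: "g \<in> borel_measurable lborel" "AE x in lborel. ?f x = g x"
    using completion_ex_borel_measurable_real[of ?f lborel] borel_measurable_integrable[OF fi] by blast
  define f' where "f' = (\<lambda>x. indicator {0..t} x * g x)"
  have f'm: "f' \<in> borel_measurable lborel" unfolding f'_def using g(1) by simp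
  have ae0: "AE x in lborel. ?f x = f' x"
    using g(2)
  proof eventually_elim
    case (elim x)
    show ?case unfolding f'_def elim[symmetric] by (simp add: indicator_def)
  qed
  have ae: "AE x in lebesgue. ?f x = f' x" using ae0 by (rule AE_completion)
  have "integrable lebesgue f'"
    using integrable_cong_AE[OF _ _ ae] fi borel_measurable_integrable[OF fi] measurable_completion[OF f'm] by blast
  then have i: "integrable lborel f'" using f'm by (simp add: integrable_completion)
  have eq: "itg s f = (\<integral>x. indicator {..s} x * f' x \<partial>lborel)" if s: "s \<in> {0..t}" for s
  proof -
    have m: "(\<lambda>x. indicator {..s} x * f' x) \<in> borel_measurable lborel" using f'm by simp
    have "itg s f = (\<integral>x. indicator {0..s} x *\<^sub>R f x \<partial>lebesgue)"
      unfolding itg_def by (rule integral_restrict_space) simp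
    also have "\<dots> = (\<integral>x. indicator {..s} x * f' x \<partial>lebesgue)"
    proof (rule integral_cong_AE)
      show "AE x in lebesgue. indicator {0..s} x *\<^sub>R f x = indicator {..s} x * f' x"
        using ae by eventually_elim (use s in \<open>auto simp: indicator_def f'_def split: if_splits\<close>)
      show "(\<lambda>x. indicator {0..s} x *\<^sub>R f x) \<in> borel_measurable lebesgue"
        using integrable_Icc_subset[OF f, of s] s integrable_restrict_space[of "{0..s}" lebesgue f] by auto
    qed (rule measurable_completion[OF m])
    also have "\<dots> = (\<integral>x. indicator {..s} x * f' x \<partial>lborel)" by (rule integral_completion[OF m])
    finally show ?thesis .
  qed
  have eqt: "itg t f = (\<integral>x. f' x \<partial>lborel)"
  proof -
    have "itg t f = (\<integral>x. ?f x \<partial>lebesgue)"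
      unfolding itg_def by (rule integral_restrict_space) simp
    also have "\<dots> = (\<integral>x. f' x \<partial>lebesgue)"
      by (rule integral_cong_AE[OF borel_measurable_integrable[OF fi] measurable_completion[OF f'm] ae])
    also have "\<dots> = (\<integral>x. f' x \<partial>lborel)" by (rule integral_completion[OF f'm])
    finally show ?thesis .
  qed
  show ?thesis
  proof (rule that[OF i _ _ eq eqt])
    show "AE x in lebesgue. x \<in> {0..t} \<longrightarrow> f x = f' x"
      using ae by eventually_elim auto
  qed (simp_all add: f'_def)
qed

lemma itg_continuous:
  fixes f :: "real \<Rightarrow> real"
  assumes f: "integrable (lebesgue_on {0..t}) f"
  shows "continuous_on {0..t} (\<lambda>s. itg s f)"
  unfolding itg_def by (rule indefinite_integral_continuous_real[OF f])

lemma itg_0[simp]: "itg 0 f = 0"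
proof -
  have "{0::real} \<in> null_sets lebesgue" by (simp add: negligible_iff_null_sets[symmetric])
  moreover have "itg 0 f = (\<integral>s. indicator {0} s *\<^sub>R f s \<partial>lebesgue)"
    unfolding itg_def atLeastAtMost_singleton by (rule integral_restrict_space) simp
  moreover have "AE s in lebesgue. indicator {0} s *\<^sub>R f s = 0"
    using AE_not_in[OF calculation(1)] by eventually_elim simp
  then have "(\<integral>s. indicator {0} s *\<^sub>R f s \<partial>lebesgue) = 0" by (rule integral_eq_zero_AE)
  ultimately show ?thesis by simp
qed

lemma itg_cong: "(\<And>s. s \<in> {0..t} \<Longrightarrow> f s = g s) \<Longrightarrow> itg t f = itg t g"
  unfolding itg_def by (intro Bochner_Integration.integral_cong) auto

lemma integrable_mult_continuous:
  fixes f h :: "real \<Rightarrow> real"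
  assumes f: "integrable (lebesgue_on {0..t}) f" and h: "continuous_on {0..t} h"
  shows "integrable (lebesgue_on {0..t}) (\<lambda>s. f s * h s)"
proof -
  obtain M where M: "\<And>s. s \<in> {0..t} \<Longrightarrow> norm (h s) \<le> M"
    using continuous_on_compact_norm_bounded[OF compact_Icc h] by blast
  have hm: "h \<in> borel_measurable (lebesgue_on {0..t})"
    by (rule continuous_imp_measurable_on_sets_lebesgue[OF h]) simp
  show ?thesis
  proof (rule Bochner_Integration.integrable_bound[of _ "\<lambda>s. M * norm (f s)"])
    show "integrable (lebesgue_on {0..t}) (\<lambda>s. M * norm (f s))" using f by auto
    show "AE s in lebesgue_on {0..t}. norm (f s * h s) \<le> norm (M * norm (f s))"
    proof (intro AE_I2)
      fix s assume "s \<in> space (lebesgue_on {0..t})"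
      then have "\<bar>h s\<bar> \<le> \<bar>M\<bar>" using M[of s] by auto
      then show "norm (f s * h s) \<le> norm (M * norm (f s))"
        using mult_left_mono[of "\<bar>h s\<bar>" "\<bar>M\<bar>" "\<bar>f s\<bar>"] by (simp add: abs_mult mult.commute)
    qed
  qed (use hm borel_measurable_integrable[OF f] in auto)
qed

lemma continuous_integrable:
  fixes h :: "real \<Rightarrow> real"
  assumes h: "continuous_on {0..t} h"
  shows "integrable (lebesgue_on {0..t}) h"
proof -
  have "integrable (lebesgue_on {0..t}) (\<lambda>s. 1::real)"
    using finite_measure.integrable_const[OF finite_measure_lebesgue_on] by auto
  from integrable_mult_continuous[OF this h] show ?thesis by simp
qed

text \<open>The product rule for absolutely continuous functions, in the integrated form that makes
  sense for derivatives that are merely integrable.\<close>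

lemma itg_product:
  fixes f g :: "real \<Rightarrow> real"
  assumes f: "integrable (lebesgue_on {0..t}) f" and g: "integrable (lebesgue_on {0..t}) g" and t: "0 \<le> t"
  shows "itg t f * itg t g = itg t (\<lambda>s. f s * itg s g) + itg t (\<lambda>s. itg s f * g s)"
proof -
  obtain f' where f': "integrable lborel f'" "\<And>x. x \<notin> {0..t} \<Longrightarrow> f' x = 0"
    "AE x in lebesgue. x \<in> {0..t} \<longrightarrow> f x = f' x"
    "\<And>s. s \<in> {0..t} \<Longrightarrow> itg s f = (\<integral>x. indicator {..s} x * f' x \<partial>lborel)"
    "itg t f = (\<integral>x. f' x \<partial>lborel)"
    using borel_representative[OF f] by blast
  obtain g' where g': "integrable lborel g'" "\<And>x. x \<notin> {0..t} \<Longrightarrow> g' x = 0"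
    "AE x in lebesgue. x \<in> {0..t} \<longrightarrow> g x = g' x"
    "\<And>s. s \<in> {0..t} \<Longrightarrow> itg s g = (\<integral>x. indicator {..s} x * g' x \<partial>lborel)"
    "itg t g = (\<integral>x. g' x \<partial>lborel)"
    using borel_representative[OF g] by blast
  have one: "itg t (\<lambda>s. a s * itg s b) = (\<integral>x. a' x * (\<integral>y. indicator {..x} y * b' y \<partial>lborel) \<partial>lborel)"
    if a: "integrable (lebesgue_on {0..t}) a" and b: "integrable (lebesgue_on {0..t}) b"
      and a': "integrable lborel a'" "\<And>x. x \<notin> {0..t} \<Longrightarrow> a' x = 0" "AE x in lebesgue. x \<in> {0..t} \<longrightarrow> a x = a' x"
      and b': "integrable lborel b'" "\<And>s. s \<in> {0..t} \<Longrightarrow> itg s b = (\<integral>x. indicator {..s} x * b' x \<partial>lborel)"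
    for a b a' b' :: "real \<Rightarrow> real"
  proof -
    have i: "integrable (lebesgue_on {0..t}) (\<lambda>s. a s * itg s b)"
      by (rule integrable_mult_continuous[OF a itg_continuous[OF b]])
    have m: "(\<lambda>x. a' x * (\<integral>y. indicator {..x} y * b' y \<partial>lborel)) \<in> borel_measurable lborel"
      using indefinite_integral_product_lborel(1)[OF a'(1) b'(1)] by auto
    have "itg t (\<lambda>s. a s * itg s b) = (\<integral>x. indicator {0..t} x *\<^sub>R (a x * itg x b) \<partial>lebesgue)"
      unfolding itg_def[of t] by (rule integral_restrict_space) simp
    also have "\<dots> = (\<integral>x. a' x * (\<integral>y. indicator {..x} y * b' y \<partial>lborel) \<partial>lebesgue)"
    proof (rule integral_cong_AE)
      show "AE x in lebesgue. indicator {0..t} x *\<^sub>R (a x * itg x b) = a' x * (\<integral>y. indicator {..x} y * b' y \<partial>lborel)"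
        using a'(3)
      proof eventually_elim
        case (elim x)
        show ?case
        proof (cases "x \<in> {0..t}")
          case True
          then show ?thesis using elim b'(2)[OF True] by simp
        next
          case False
          then show ?thesis using a'(2) by simp
        qed
      qed
      show "(\<lambda>x. indicator {0..t} x *\<^sub>R (a x * itg x b)) \<in> borel_measurable lebesgue"
        using i integrable_restrict_space[of "{0..t}" lebesgue "\<lambda>s. a s * itg s b"] by auto
    qed (rule measurable_completion[OF m])
    also have "\<dots> = (\<integral>x. a' x * (\<integral>y. indicator {..x} y * b' y \<partial>lborel) \<partial>lborel)"
      by (rule integral_completion[OF m])
    finally show ?thesis .
  qed
  have "itg t (\<lambda>s. g s * itg s f) = (\<integral>x. g' x * (\<integral>y. indicator {..x} y * f' y \<partial>lborel) \<partial>lborel)"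
    by (rule one[OF g f g'(1,2,3) f'(1,4)])
  moreover have "itg t (\<lambda>s. f s * itg s g) = (\<integral>x. f' x * (\<integral>y. indicator {..x} y * g' y \<partial>lborel) \<partial>lborel)"
    by (rule one[OF f g f'(1,2,3) g'(1,4)])
  ultimately show ?thesis
    using indefinite_integral_product_lborel(2)[OF f'(1) g'(1)] f'(5) g'(5) by (simp add: mult.commute)
qed

lemma itg_add:
  "integrable (lebesgue_on {0..t}) f \<Longrightarrow> integrable (lebesgue_on {0..t}) g \<Longrightarrow> itg t (\<lambda>s. f s + g s) = itg t f + itg t g"
  by (simp add: itg_def)

lemma itg_mult_left: "itg t (\<lambda>s. c * f s) = c * itg t f" by (simp add: itg_def)

lemma itg_mult_right: "itg t (\<lambda>s. f s * c) = itg t f * c" by (simp add: itg_def)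

lemma itg_mono:
  assumes "integrable (lebesgue_on {0..t}) f" "integrable (lebesgue_on {0..t}) g"
    "AE s in lebesgue_on {0..t}. f s \<le> g s"
  shows "itg t f \<le> itg t g"
  unfolding itg_def by (rule integral_mono_AE[OF assms])

lemma itg_nonneg: "(\<And>s. s \<in> {0..t} \<Longrightarrow> 0 \<le> f s) \<Longrightarrow> 0 \<le> itg t f"
  unfolding itg_def by (rule integral_nonneg_AE) (auto intro!: AE_I2)

lemma absolutely_continuous_product:
  fixes u v f g :: "real \<Rightarrow> real"
  assumes f: "integrable (lebesgue_on {0..t}) f" and g: "integrable (lebesgue_on {0..t}) g" and t: "0 \<le> t"
    and u: "\<And>s. s \<in> {0..t} \<Longrightarrow> u s = u0 + itg s f" and v: "\<And>s. s \<in> {0..t} \<Longrightarrow> v s = v0 + itg s g"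
  shows "u t * v t = u0 * v0 + itg t (\<lambda>s. f s * v s + u s * g s)"
proof -
  have i1: "integrable (lebesgue_on {0..t}) (\<lambda>s. f s * itg s g)"
    by (rule integrable_mult_continuous[OF f itg_continuous[OF g]])
  have i2: "integrable (lebesgue_on {0..t}) (\<lambda>s. itg s f * g s)"
    using integrable_mult_continuous[OF g itg_continuous[OF f]] by (simp add: mult.commute)
  have "itg t (\<lambda>s. f s * v s + u s * g s)
      = itg t (\<lambda>s. (v0 * f s + f s * itg s g) + (u0 * g s + itg s f * g s))"
    by (rule itg_cong) (use u v in \<open>simp add: algebra_simps\<close>)
  also have "\<dots> = (v0 * itg t f + itg t (\<lambda>s. f s * itg s g)) + (u0 * itg t g + itg t (\<lambda>s. itg s f * g s))"
    using f g i1 i2 by (simp add: itg_add itg_mult_left)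
  finally show ?thesis
    using itg_product[OF f g t] u[of t] v[of t] t by (simp add: algebra_simps)
qed

text \<open>The chain rule for powers, by induction through the product rule. The factor
  \<open>Suc n\<close> is what later turns the Picard bounds into multiples of
  \<open>1 / fact n\<close>.\<close>

lemma itg_power:
  fixes a :: "real \<Rightarrow> real"
  assumes a: "integrable (lebesgue_on {0..t}) a" and t: "0 \<le> t"
  shows "itg t a ^ Suc n = itg t (\<lambda>s. real (Suc n) * (a s * itg s a ^ n))"
  using assms
proof (induction n arbitrary: t)
  case 0
  then show ?case by simp
next
  case (Suc n)
  note a = Suc.prems(1)
  have as: "integrable (lebesgue_on {0..s}) a" if "s \<in> {0..t}" for s
    using integrable_Icc_subset[OF a] that by auto
  have g: "integrable (lebesgue_on {0..t}) (\<lambda>s. real (Suc n) * (a s * itg s a ^ n))"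
    using integrable_mult_continuous[OF a continuous_on_power[OF itg_continuous[OF a], of n]] by auto
  have "itg t a * itg t a ^ Suc n
      = 0 * 0 + itg t (\<lambda>s. a s * itg s a ^ Suc n + itg s a * (real (Suc n) * (a s * itg s a ^ n)))"
  proof (rule absolutely_continuous_product[OF a g Suc.prems(2)])
    show "itg s a ^ Suc n = 0 + itg s (\<lambda>s. real (Suc n) * (a s * itg s a ^ n))" if "s \<in> {0..t}" for s
      using Suc.IH[OF as[OF that]] that by simp
  qed simp
  also have "(\<lambda>s. a s * itg s a ^ Suc n + itg s a * (real (Suc n) * (a s * itg s a ^ n)))
      = (\<lambda>s. real (Suc (Suc n)) * (a s * itg s a ^ Suc n))"
    by (simp add: fun_eq_iff algebra_simps)
  finally show ?case by simp
qed

text \<open>The iterates are defined for all times, without reference to an end point. Their limit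
  is therefore the same function on every interval \<open>{0..t}\<close>, and no gluing of local
  solutions is required.\<close>

primrec picard :: "nat \<Rightarrow> (real \<Rightarrow> nat \<Rightarrow> nat \<Rightarrow> real) \<Rightarrow> (real \<Rightarrow> nat \<Rightarrow> real) \<Rightarrow> (nat \<Rightarrow> real) \<Rightarrow>
    nat \<Rightarrow> real \<Rightarrow> nat \<Rightarrow> real" where
  "picard N A b x0 0 = (\<lambda>t i. x0 i)"
| "picard N A b x0 (Suc n) = (\<lambda>t i. x0 i + itg t (\<lambda>s. (\<Sum>j<N. A s i j * picard N A b x0 n s j) + b s i))"

text \<open>By linearity the iteration converges on the whole interval, however long: with
  \<open>a\<close> the sum of the absolute coefficients, successive differences are at most
  \<open>K * itg t a ^ n / fact n\<close>. The inhomogeneity cancels in these differences.\<close>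

lemma linear_ode_local:
  fixes A :: "real \<Rightarrow> nat \<Rightarrow> nat \<Rightarrow> real" and b :: "real \<Rightarrow> nat \<Rightarrow> real" and x0 :: "nat \<Rightarrow> real"
  assumes A: "\<And>i j. i < N \<Longrightarrow> j < N \<Longrightarrow> integrable (lebesgue_on {0..T}) (\<lambda>s. A s i j)"
    and b: "\<And>i. i < N \<Longrightarrow> integrable (lebesgue_on {0..T}) (\<lambda>s. b s i)"
    and T: "0 \<le> T"
  defines "X \<equiv> picard N A b x0"
  defines "x \<equiv> \<lambda>t i. lim (\<lambda>n. X n t i)"
  shows "\<And>i. i < N \<Longrightarrow> integrable (lebesgue_on {0..T}) (\<lambda>s. (\<Sum>j<N. A s i j * x s j) + b s i)"
    and "\<And>i. i < N \<Longrightarrow> x T i = x0 i + itg T (\<lambda>s. (\<Sum>j<N. A s i j * x s j) + b s i)"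
proof -
  define a where "a = (\<lambda>s. \<Sum>i<N. \<Sum>j<N. \<bar>A s i j\<bar>)"
  have a: "integrable (lebesgue_on {0..T}) a" unfolding a_def
    by (intro Bochner_Integration.integrable_sum integrable_abs A) auto
  have a0: "0 \<le> a s" for s unfolding a_def by (intro sum_nonneg) auto
  have sub: "integrable (lebesgue_on {0..t}) f" if "integrable (lebesgue_on {0..T}) f" "t \<in> {0..T}" for f :: "real \<Rightarrow> real" and t
    using integrable_Icc_subset that by auto
  have X0: "X 0 t i = x0 i" for t i by (simp add: X_def)
  have XS: "X (Suc n) t i = x0 i + itg t (\<lambda>s. (\<Sum>j<N. A s i j * X n s j) + b s i)" for n t i by (simp add: X_def)
  have cX: "continuous_on {0..T} (\<lambda>s. X n s i)" and iX: "integrable (lebesgue_on {0..T}) (\<lambda>s. (\<Sum>j<N. A s i j * X n s j) + b s i)"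
    if "i < N" for n i
  proof -
    have "(\<forall>i<N. continuous_on {0..T} (\<lambda>s. X n s i)) \<and>
      (\<forall>i<N. integrable (lebesgue_on {0..T}) (\<lambda>s. (\<Sum>j<N. A s i j * X n s j) + b s i))"
    proof (induction n)
      case 0
      show ?case unfolding X0
        by (auto intro!: Bochner_Integration.integrable_add Bochner_Integration.integrable_sum A b)
    next
      case (Suc n)
      have c: "continuous_on {0..T} (\<lambda>s. X (Suc n) s i)" if "i < N" for i
        unfolding XS using Suc that by (intro continuous_intros itg_continuous) auto
      have "integrable (lebesgue_on {0..T}) (\<lambda>s. (\<Sum>j<N. A s i j * X (Suc n) s j) + b s i)" if "i < N" for i
        using A[OF that] b[OF that] c
        by (intro Bochner_Integration.integrable_add Bochner_Integration.integrable_sum integrable_mult_continuous) auto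
      with c show ?case by blast
    qed
    then show "continuous_on {0..T} (\<lambda>s. X n s i)" "integrable (lebesgue_on {0..T}) (\<lambda>s. (\<Sum>j<N. A s i j * X n s j) + b s i)"
      using that by auto
  qed
  \<comment> \<open>The size of the \<open>n\<close>-th increment in the sum norm; \<open>K\<close>
    below bounds the first increment on the whole interval.\<close>
  define D where "D = (\<lambda>n s. \<Sum>i<N. \<bar>X (Suc n) s i - X n s i\<bar>)"
  have cD: "continuous_on {0..T} (D n)" for n unfolding D_def using cX by (intro continuous_intros) auto
  obtain K where K: "\<And>s. s \<in> {0..T} \<Longrightarrow> norm (D 0 s) \<le> K"
    using continuous_on_compact_norm_bounded[OF compact_Icc cD] by blast
  have K0: "0 \<le> K" using K[of 0] T norm_ge_zero[of "D 0 0"] by auto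
  have D: "D n t \<le> K * itg t a ^ n / fact n" if "t \<in> {0..T}" for n t
    using that
  proof (induction n arbitrary: t)
    case 0
    then show ?case using K[of t] by simp
  next
    case (Suc n)
    have iA: "integrable (lebesgue_on {0..t}) (\<lambda>s. A s i j)" if "i < N" "j < N" for i j
      using sub[OF A[OF that] Suc.prems] .
    have iXt: "integrable (lebesgue_on {0..t}) (\<lambda>s. (\<Sum>j<N. A s i j * X m s j) + b s i)" if "i < N" for i m
      using sub[OF iX[OF that] Suc.prems] .
    have at: "integrable (lebesgue_on {0..t}) a" using sub[OF a Suc.prems] .
    have iAD: "integrable (lebesgue_on {0..t}) (\<lambda>s. (\<Sum>j<N. \<bar>A s i j\<bar>) * D n s)" if "i < N" for i
      by (rule integrable_mult_continuous) (use iA that in \<open>auto intro: continuous_on_subset[OF cD] Suc.prems\<close>, use Suc.prems in \<open>auto intro: continuous_on_subset[OF cD]\<close>)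
    have "\<bar>X (Suc (Suc n)) t i - X (Suc n) t i\<bar> \<le> itg t (\<lambda>s. (\<Sum>j<N. \<bar>A s i j\<bar>) * D n s)" if i: "i < N" for i
    proof -
      have i1: "integrable (lebesgue_on {0..t}) (\<lambda>s. ((\<Sum>j<N. A s i j * X (Suc n) s j) + b s i) - ((\<Sum>j<N. A s i j * X n s j) + b s i))"
        by (rule Bochner_Integration.integrable_diff[OF iXt[OF i, of "Suc n"] iXt[OF i, of n]])
      have e: "X (Suc (Suc n)) t i - X (Suc n) t i
          = itg t (\<lambda>s. ((\<Sum>j<N. A s i j * X (Suc n) s j) + b s i) - ((\<Sum>j<N. A s i j * X n s j) + b s i))"
        unfolding XS[of "Suc n"] XS[of n t] itg_def
        by (subst Bochner_Integration.integral_diff[OF iXt[OF i] iXt[OF i]]) simp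
      have "\<bar>X (Suc (Suc n)) t i - X (Suc n) t i\<bar> \<le> itg t (\<lambda>s. \<bar>((\<Sum>j<N. A s i j * X (Suc n) s j) + b s i) - ((\<Sum>j<N. A s i j * X n s j) + b s i)\<bar>)"
        unfolding e unfolding itg_def by (rule integral_abs_bound)
      also have "\<dots> \<le> itg t (\<lambda>s. (\<Sum>j<N. \<bar>A s i j\<bar>) * D n s)"
      proof (rule itg_mono[OF integrable_abs[OF i1] iAD[OF i]])
        show "AE s in lebesgue_on {0..t}. \<bar>((\<Sum>j<N. A s i j * X (Suc n) s j) + b s i) - ((\<Sum>j<N. A s i j * X n s j) + b s i)\<bar>
            \<le> (\<Sum>j<N. \<bar>A s i j\<bar>) * D n s"
        proof (intro AE_I2)
          fix s
          have "\<bar>((\<Sum>j<N. A s i j * X (Suc n) s j) + b s i) - ((\<Sum>j<N. A s i j * X n s j) + b s i)\<bar>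
              = \<bar>\<Sum>j<N. A s i j * (X (Suc n) s j - X n s j)\<bar>"
            unfolding right_diff_distrib sum_subtractf by simp
          also have "\<dots> \<le> (\<Sum>j<N. \<bar>A s i j\<bar> * \<bar>X (Suc n) s j - X n s j\<bar>)"
            unfolding abs_mult[symmetric] by (rule sum_abs)
          also have "\<dots> \<le> (\<Sum>j<N. \<bar>A s i j\<bar> * D n s)"
            unfolding D_def by (intro sum_mono mult_left_mono member_le_sum) auto
          finally show "\<bar>((\<Sum>j<N. A s i j * X (Suc n) s j) + b s i) - ((\<Sum>j<N. A s i j * X n s j) + b s i)\<bar>
            \<le> (\<Sum>j<N. \<bar>A s i j\<bar>) * D n s" by (simp add: sum_distrib_right)
        qed
      qed
      finally show ?thesis .
    qed
    then have "(\<Sum>i<N. \<bar>X (Suc (Suc n)) t i - X (Suc n) t i\<bar>) \<le> (\<Sum>i<N. itg t (\<lambda>s. (\<Sum>j<N. \<bar>A s i j\<bar>) * D n s))"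
      by (intro sum_mono) auto
    then have "D (Suc n) t \<le> (\<Sum>i<N. itg t (\<lambda>s. (\<Sum>j<N. \<bar>A s i j\<bar>) * D n s))"
      unfolding D_def .
    also have "\<dots> = itg t (\<lambda>s. a s * D n s)"
      unfolding itg_def a_def sum_distrib_right[of _ "{..<N}"]
      by (subst Bochner_Integration.integral_sum[symmetric]) (use iAD in \<open>auto simp: sum_distrib_right\<close>)
    also have "\<dots> \<le> itg t (\<lambda>s. K / fact (Suc n) * (real (Suc n) * (a s * itg s a ^ n)))"
    proof (rule itg_mono)
      have cDt: "continuous_on {0..t} (D n)" by (rule continuous_on_subset[OF cD]) (use Suc.prems in auto)
      show "integrable (lebesgue_on {0..t}) (\<lambda>s. a s * D n s)" by (rule integrable_mult_continuous[OF at cDt])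
      show "integrable (lebesgue_on {0..t}) (\<lambda>s. K / fact (Suc n) * (real (Suc n) * (a s * itg s a ^ n)))"
        using integrable_mult_continuous[OF at continuous_on_power[OF itg_continuous[OF at], of n]] by auto
      show "AE s in lebesgue_on {0..t}. a s * D n s \<le> K / fact (Suc n) * (real (Suc n) * (a s * itg s a ^ n))"
      proof (intro AE_I2)
        fix s assume "s \<in> space (lebesgue_on {0..t})"
        then have "D n s \<le> K * itg s a ^ n / fact n" using Suc.IH[of s] Suc.prems by auto
        then have "a s * D n s \<le> a s * (K * itg s a ^ n / fact n)" using a0 by (intro mult_left_mono) auto
        also have "\<dots> = K / fact (Suc n) * (real (Suc n) * (a s * itg s a ^ n))"
          by (simp add: field_simps del: of_nat_Suc)
        finally show "a s * D n s \<le> K / fact (Suc n) * (real (Suc n) * (a s * itg s a ^ n))" .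
      qed
    qed
    \<comment> \<open>The integrand is a multiple of the derivative of
      \<open>itg t a ^ Suc n\<close>, so that the integration raises the power by one and consumes
      the factor \<open>Suc n\<close>.\<close>
    also have "\<dots> = K / fact (Suc n) * itg t a ^ Suc n"
      unfolding itg_mult_left using itg_power[OF at, of n] Suc.prems by (simp add: itg_mult_left)
    finally show ?case by simp
  qed
  define R where "R = itg T a"
  have aR: "0 \<le> itg t a" "itg t a \<le> R" if "t \<in> {0..T}" for t
  proof -
    show "0 \<le> itg t a" using a0 by (intro itg_nonneg) auto
    have "itg t a = (\<integral>s. indicator {0..t} s *\<^sub>R a s \<partial>lebesgue)"
      unfolding itg_def by (rule integral_restrict_space) simp
    also have "\<dots> \<le> (\<integral>s. indicator {0..T} s *\<^sub>R a s \<partial>lebesgue)"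
    proof (rule integral_mono)
      show "integrable lebesgue (\<lambda>s. indicator {0..t} s *\<^sub>R a s)"
        using sub[OF a that] integrable_restrict_space[of "{0..t}" lebesgue a] by simp
      show "integrable lebesgue (\<lambda>s. indicator {0..T} s *\<^sub>R a s)"
        using a integrable_restrict_space[of "{0..T}" lebesgue a] by simp
      show "indicator {0..t} s *\<^sub>R a s \<le> indicator {0..T} s *\<^sub>R a s" for s
        using a0[of s] that by (auto simp: indicator_def)
    qed
    also have "\<dots> = R" unfolding itg_def R_def by (rule integral_restrict_space[symmetric]) simp
    finally show "itg t a \<le> R" .
  qed
  have sumR: "summable (\<lambda>n. K * R ^ n / fact n)"
    using summable_mult[OF summable_exp[of R], of K] by (simp add: field_simps)
  have D2: "\<bar>X (Suc n) t i - X n t i\<bar> \<le> K * R ^ n / fact n" if "t \<in> {0..T}" "i < N" for n t i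
  proof -
    have "\<bar>X (Suc n) t i - X n t i\<bar> \<le> D n t"
      unfolding D_def using that by (intro member_le_sum[of i "{..<N}" "\<lambda>i. \<bar>X (Suc n) t i - X n t i\<bar>"]) auto
    also have "\<dots> \<le> K * itg t a ^ n / fact n" by (rule D[OF that(1)])
    also have "\<dots> \<le> K * R ^ n / fact n"
      using aR[OF that(1)] K0 by (intro divide_right_mono mult_left_mono power_mono) auto
    finally show ?thesis .
  qed
  have tele: "X n t i = x0 i + (\<Sum>m<n. X (Suc m) t i - X m t i)" for n t i
    using sum_lessThan_telescope[of "\<lambda>m. X m t i" n] by (simp add: X0)
  have lim: "(\<lambda>n. X n t i) \<longlonglongrightarrow> x t i" if "t \<in> {0..T}" "i < N" for t i
  proof -
    have "summable (\<lambda>n. X (Suc n) t i - X n t i)"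
      by (rule summable_comparison_test'[OF sumR, of 0]) (use D2[OF that] in auto)
    then have "(\<lambda>n. x0 i + (\<Sum>m<n. X (Suc m) t i - X m t i)) \<longlonglongrightarrow> x0 i + (\<Sum>m. X (Suc m) t i - X m t i)"
      by (intro tendsto_intros summable_LIMSEQ)
    then have "convergent (\<lambda>n. X n t i)" unfolding tele[symmetric] by (auto simp: convergent_def)
    then show ?thesis unfolding x_def by (simp add: convergent_LIMSEQ_iff)
  qed
  \<comment> \<open>A common bound for all iterates; it provides the integrable majorant for the
    passage to the limit under the integral.\<close>
  define B where "B = (\<Sum>i<N. \<bar>x0 i\<bar>) + (\<Sum>n. K * R ^ n / fact n)"
  have XB: "\<bar>X n t i\<bar> \<le> B" if "t \<in> {0..T}" "i < N" for n t i
  proof -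
    have "\<bar>X n t i\<bar> \<le> \<bar>x0 i\<bar> + (\<Sum>m<n. \<bar>X (Suc m) t i - X m t i\<bar>)"
      unfolding tele[of n] using sum_abs[of "\<lambda>m. X (Suc m) t i - X m t i" "{..<n}"] by linarith
    also have "(\<Sum>m<n. \<bar>X (Suc m) t i - X m t i\<bar>) \<le> (\<Sum>m<n. K * R ^ m / fact m)"
      by (intro sum_mono D2 that)
    also have "\<dots> \<le> (\<Sum>n. K * R ^ n / fact n)"
      using K0 aR[of T] T by (intro sum_le_suminf sumR) auto
    also have "\<bar>x0 i\<bar> \<le> (\<Sum>i<N. \<bar>x0 i\<bar>)" using that by (intro member_le_sum[of i "{..<N}" "\<lambda>i. \<bar>x0 i\<bar>"]) auto
    finally show ?thesis by (simp add: B_def)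
  qed
  fix i assume i: "i < N"
  let ?g = "\<lambda>n s. (\<Sum>j<N. A s i j * X n s j) + b s i"
  let ?G = "\<lambda>s. (\<Sum>j<N. A s i j * x s j) + b s i"
  let ?w = "\<lambda>s. (\<Sum>j<N. \<bar>A s i j\<bar> * B) + \<bar>b s i\<bar>"
  have w: "integrable (lebesgue_on {0..T}) ?w"
    by (intro Bochner_Integration.integrable_add Bochner_Integration.integrable_sum integrable_mult_left integrable_abs)
      (use A[OF i] b[OF i] in auto)
  have conv: "AE s in lebesgue_on {0..T}. (\<lambda>n. ?g n s) \<longlonglongrightarrow> ?G s"
    using lim by (intro AE_I2 tendsto_intros) auto
  have Gm: "?G \<in> borel_measurable (lebesgue_on {0..T})"
    by (rule borel_measurable_LIMSEQ_real[where u="\<lambda>n s. ?g n s"])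
      (use lim borel_measurable_integrable[OF iX[OF i]] in \<open>auto intro!: tendsto_intros\<close>)
  have bound: "AE s in lebesgue_on {0..T}. norm (?g n s) \<le> ?w s" for n
  proof (intro AE_I2)
    fix s assume s: "s \<in> space (lebesgue_on {0..T})"
    have "\<bar>?g n s\<bar> \<le> (\<Sum>j<N. \<bar>A s i j * X n s j\<bar>) + \<bar>b s i\<bar>"
      using sum_abs[of "\<lambda>j. A s i j * X n s j" "{..<N}"] by linarith
    also have "(\<Sum>j<N. \<bar>A s i j * X n s j\<bar>) \<le> (\<Sum>j<N. \<bar>A s i j\<bar> * B)"
      unfolding abs_mult using s by (intro sum_mono mult_left_mono XB) auto
    finally show "norm (?g n s) \<le> ?w s" by simp
  qed
  show "integrable (lebesgue_on {0..T}) ?G"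
    by (rule integrable_dominated_convergence[OF Gm _ w conv bound])
      (use borel_measurable_integrable[OF iX[OF i]] in auto)
  have "(\<lambda>n. itg T (?g n)) \<longlonglongrightarrow> itg T ?G"
    unfolding itg_def
    by (rule integral_dominated_convergence[OF Gm _ w conv bound])
      (use borel_measurable_integrable[OF iX[OF i]] in auto)
  then have "(\<lambda>n. X (Suc n) T i) \<longlonglongrightarrow> x0 i + itg T ?G"
    unfolding XS by (intro tendsto_intros)
  moreover have "(\<lambda>n. X (Suc n) T i) \<longlonglongrightarrow> x T i"
    using lim[of T i] T i by (intro LIMSEQ_Suc) auto
  ultimately show "x T i = x0 i + itg T ?G" by (rule LIMSEQ_unique[rotated])
qed

lemma linear_ode_exists:
  fixes A :: "real \<Rightarrow> nat \<Rightarrow> nat \<Rightarrow> real" and b :: "real \<Rightarrow> nat \<Rightarrow> real" and x0 :: "nat \<Rightarrow> real"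
  assumes I: "\<And>t. t \<in> I \<Longrightarrow> 0 \<le> t"
    and A: "\<And>t i j. t \<in> I \<Longrightarrow> i < N \<Longrightarrow> j < N \<Longrightarrow> integrable (lebesgue_on {0..t}) (\<lambda>s. A s i j)"
    and b: "\<And>t i. t \<in> I \<Longrightarrow> i < N \<Longrightarrow> integrable (lebesgue_on {0..t}) (\<lambda>s. b s i)"
  shows "\<exists>x. \<forall>t\<in>I. \<forall>i<N. integrable (lebesgue_on {0..t}) (\<lambda>s. (\<Sum>j<N. A s i j * x s j) + b s i) \<and>
    x t i = x0 i + itg t (\<lambda>s. (\<Sum>j<N. A s i j * x s j) + b s i)"
  by (intro exI[of _ "\<lambda>t i. lim (\<lambda>n. picard N A b x0 n t i)"] ballI allI impI conjI
      linear_ode_local A b I) assumption+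

section \<open>Linear evolution equations in finite-dimensional subspaces\<close>

text \<open>The scalar counterpart of \<open>ae_linear\<close>. On a finite-dimensional space such a
  functional is determined by its values on an orthonormal basis, see
  \<open>ae_functional_onb\<close>.\<close>

definition ae_functional :: "'a::euclidean_space set \<Rightarrow> ('a \<Rightarrow> 'b::euclidean_space) set \<Rightarrow>
    (('a \<Rightarrow> 'b) \<Rightarrow> real) \<Rightarrow> bool" where
  "ae_functional \<Omega> W L \<longleftrightarrow>
     (\<forall>u\<in>W. \<forall>v\<in>W. \<forall>a b. L (\<lambda>x. a *\<^sub>R u x + b *\<^sub>R v x) = a * L u + b * L v) \<and>
     (\<forall>u\<in>W. \<forall>v\<in>W. l2_eq \<Omega> u v \<longrightarrow> L u = L v)"

lemma ae_functionalI:
  assumes "\<And>u v a b. u \<in> W \<Longrightarrow> v \<in> W \<Longrightarrow> L (\<lambda>x. a *\<^sub>R u x + b *\<^sub>R v x) = a * L u + b * L v"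
    and "\<And>u v. u \<in> W \<Longrightarrow> v \<in> W \<Longrightarrow> l2_eq \<Omega> u v \<Longrightarrow> L u = L v"
  shows "ae_functional \<Omega> W L"
  unfolding ae_functional_def by (intro conjI ballI allI impI assms)

lemma ae_functionalD:
  assumes "ae_functional \<Omega> W L"
  shows "\<And>u v a b. u \<in> W \<Longrightarrow> v \<in> W \<Longrightarrow> L (\<lambda>x. a *\<^sub>R u x + b *\<^sub>R v x) = a * L u + b * L v"
    and "\<And>u v. u \<in> W \<Longrightarrow> v \<in> W \<Longrightarrow> l2_eq \<Omega> u v \<Longrightarrow> L u = L v"
  using assms unfolding ae_functional_def by blast+

lemma ae_functional_subset: "ae_functional \<Omega> W L \<Longrightarrow> Z \<subseteq> W \<Longrightarrow> ae_functional \<Omega> Z L"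
  unfolding ae_functional_def by blast

lemma ae_functional_lincomb:
  assumes "ae_functional \<Omega> W L" "ae_functional \<Omega> W M"
  shows "ae_functional \<Omega> W (\<lambda>u. a * L u + b * M u)"
proof (rule ae_functionalI)
  show "a * L (\<lambda>x. s *\<^sub>R u x + t *\<^sub>R v x) + b * M (\<lambda>x. s *\<^sub>R u x + t *\<^sub>R v x)
      = s * (a * L u + b * M u) + t * (a * L v + b * M v)" if "u \<in> W" "v \<in> W" for u v s t
    using ae_functionalD(1)[OF assms(1) that] ae_functionalD(1)[OF assms(2) that] by (simp add: algebra_simps)
  show "a * L u + b * M u = a * L v + b * M v" if "u \<in> W" "v \<in> W" "l2_eq \<Omega> u v" for u v
    using ae_functionalD(2)[OF assms(1) that] ae_functionalD(2)[OF assms(2) that] by simp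
qed

lemma ae_functional_add:
  "ae_functional \<Omega> W L \<Longrightarrow> ae_functional \<Omega> W M \<Longrightarrow> ae_functional \<Omega> W (\<lambda>u. L u + M u)"
  using ae_functional_lincomb[of \<Omega> W L M 1 1] by simp

lemma ae_functional_diff:
  "ae_functional \<Omega> W L \<Longrightarrow> ae_functional \<Omega> W M \<Longrightarrow> ae_functional \<Omega> W (\<lambda>u. L u - M u)"
  using ae_functional_lincomb[of \<Omega> W L M 1 "-1"] by simp

lemma ae_functional_scale:
  "ae_functional \<Omega> W L \<Longrightarrow> ae_functional \<Omega> W (\<lambda>u. c * L u)"
  using ae_functional_lincomb[of \<Omega> W L L c 0] by simp

lemma ae_functional_inner_right:
  assumes A: "ae_linear \<Omega> W A" and z: "z \<in> L2 \<Omega>"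
  shows "ae_functional \<Omega> W (\<lambda>u. l2_inner \<Omega> z (A u))"
proof (rule ae_functionalI)
  show "l2_inner \<Omega> z (A (\<lambda>x. a *\<^sub>R u x + b *\<^sub>R v x)) = a * l2_inner \<Omega> z (A u) + b * l2_inner \<Omega> z (A v)"
    if "u \<in> W" "v \<in> W" for u v a b
  proof -
    have "l2_inner \<Omega> z (A (\<lambda>x. a *\<^sub>R u x + b *\<^sub>R v x)) = l2_inner \<Omega> z (\<lambda>x. a *\<^sub>R A u x + b *\<^sub>R A v x)"
      by (intro l2_inner_cong l2_eq_refl ae_linearD(4)[OF A that] z ae_linearD(3)[OF A] L2_lincomb
          lin_closed_lincomb[OF ae_linearD(2)[OF A]] that)
    then show ?thesis using ae_linearD(3)[OF A that(1)] ae_linearD(3)[OF A that(2)] z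
      by (simp add: l2_inner_lincomb_right)
  qed
  show "l2_inner \<Omega> z (A u) = l2_inner \<Omega> z (A v)" if "u \<in> W" "v \<in> W" "l2_eq \<Omega> u v" for u v
    by (intro l2_inner_cong l2_eq_refl ae_linearD(5)[OF A that] z ae_linearD(3)[OF A] that)
qed

lemma ae_functional_inner_left:
  "ae_linear \<Omega> W A \<Longrightarrow> z \<in> L2 \<Omega> \<Longrightarrow> ae_functional \<Omega> W (\<lambda>u. l2_inner \<Omega> (A u) z)"
  using ae_functional_inner_right[of \<Omega> W A z] by (simp add: l2_inner_commute)

lemma ae_linear_id: "W \<subseteq> L2 \<Omega> \<Longrightarrow> lin_closed W \<Longrightarrow> ae_linear \<Omega> W (\<lambda>u. u)"
  by (rule ae_linearI) auto

lemma ae_functional_compose: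
  assumes L: "ae_functional \<Omega> X L" and A: "ae_linear \<Omega> W A" and AX: "\<And>u. u \<in> W \<Longrightarrow> A u \<in> X" and X: "lin_closed X"
  shows "ae_functional \<Omega> W (\<lambda>u. L (A u))"
proof (rule ae_functionalI)
  show "L (A (\<lambda>x. a *\<^sub>R u x + b *\<^sub>R v x)) = a * L (A u) + b * L (A v)" if "u \<in> W" "v \<in> W" for u v a b
  proof -
    have "L (A (\<lambda>x. a *\<^sub>R u x + b *\<^sub>R v x)) = L (\<lambda>x. a *\<^sub>R A u x + b *\<^sub>R A v x)"
      by (intro ae_functionalD(2)[OF L] AX lin_closed_lincomb[OF X] lin_closed_lincomb[OF ae_linearD(2)[OF A]]
          that ae_linearD(4)[OF A])
    then show ?thesis using ae_functionalD(1)[OF L AX[OF that(1)] AX[OF that(2)]] by simp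
  qed
  show "L (A u) = L (A v)" if "u \<in> W" "v \<in> W" "l2_eq \<Omega> u v" for u v
    by (intro ae_functionalD(2)[OF L] AX that ae_linearD(5)[OF A])
qed

lemma ae_functional_sum:
  assumes L: "ae_functional \<Omega> W L" and W: "lin_closed W" and "finite I" "\<And>i. i \<in> I \<Longrightarrow> u i \<in> W"
  shows "L (\<lambda>x. \<Sum>i\<in>I. c i *\<^sub>R u i x) = (\<Sum>i\<in>I. c i * L (u i))"
  using assms(3,4)
proof (induction I)
  case empty
  have "L (\<lambda>x. 0 *\<^sub>R 0 + 0 *\<^sub>R 0) = 0 * L (\<lambda>x. 0) + 0 * L (\<lambda>x. 0)"
    by (rule ae_functionalD(1)[OF L]) (rule lin_closed_zero[OF W])+
  then show ?case by simp
next
  case (insert j I)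
  have "L (\<lambda>x. c j *\<^sub>R u j x + 1 *\<^sub>R (\<Sum>i\<in>I. c i *\<^sub>R u i x)) = c j * L (u j) + 1 * L (\<lambda>x. \<Sum>i\<in>I. c i *\<^sub>R u i x)"
    by (rule ae_functionalD(1)[OF L]) (use insert in \<open>auto intro!: lin_closed_sum[OF W]\<close>)
  then show ?case using insert by simp
qed

lemma ae_functional_onb:
  assumes L: "ae_functional \<Omega> W L" and W: "lin_closed W" and e: "l2_onb \<Omega> W N e" and w: "w \<in> W"
  shows "L w = (\<Sum>i<N. l2_inner \<Omega> w (e i) * L (e i))"
proof -
  have "L w = L (\<lambda>x. \<Sum>i<N. l2_inner \<Omega> w (e i) *\<^sub>R e i x)"
    by (rule ae_functionalD(2)[OF L w lin_closed_sum[OF W] l2_onbD(3)[OF e w]]) (simp add: l2_onbD(1)[OF e])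
  also have "\<dots> = (\<Sum>i<N. l2_inner \<Omega> w (e i) * L (e i))"
    by (rule ae_functional_sum[OF L W]) (auto simp: l2_onbD(1)[OF e])
  finally show ?thesis .
qed

lemma l2_parseval:
  assumes W: "W \<subseteq> L2 \<Omega>" "lin_closed W" and e: "l2_onb \<Omega> W N e" and "u \<in> W" "v \<in> W"
  shows "l2_inner \<Omega> u v = (\<Sum>i<N. l2_inner \<Omega> u (e i) * l2_inner \<Omega> v (e i))"
proof -
  have "ae_functional \<Omega> W (\<lambda>w. l2_inner \<Omega> w v)"
    using ae_functional_inner_left[OF ae_linear_id[OF W], of v] assms by auto
  from ae_functional_onb[OF this W(2) e assms(4)] show ?thesis
    by (simp add: l2_inner_commute[of \<Omega> _ v])
qed

text \<open>Represent \<open>L\<close> by some \<open>y\<close> in \<open>W\<close> and let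
  \<open>r\<close> be the projection of \<open>y\<close> to \<open>R\<close>. The remainder
  \<open>d\<close> is orthogonal to \<open>R\<close>, so \<open>L d = 0\<close>, which says that
  \<open>d\<close> is orthogonal to \<open>y\<close> too; hence \<open>d\<close> vanishes and
  \<open>r\<close> represents \<open>L\<close>. For \<open>R = W\<close> this is the Riesz
  representation.\<close>

lemma functional_in_complement:
  assumes W: "l2_fin_dim \<Omega> W" and R: "R \<subseteq> W" "lin_closed R" and L: "ae_functional \<Omega> W L"
    and L0: "\<And>z. z \<in> W \<Longrightarrow> (\<And>r. r \<in> R \<Longrightarrow> l2_inner \<Omega> r z = 0) \<Longrightarrow> L z = 0"
  shows "\<exists>r\<in>R. \<forall>w\<in>W. L w = l2_inner \<Omega> r w"
proof -
  have WL: "W \<subseteq> L2 \<Omega>" "lin_closed W" using l2_fin_dimD W by auto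
  obtain N e where e: "l2_onb \<Omega> W N e" using l2_onb_exists[OF W] by blast
  define y where "y = (\<lambda>x. \<Sum>i<N. L (e i) *\<^sub>R e i x)"
  have yW: "y \<in> W" unfolding y_def by (rule lin_closed_sum[OF WL(2)]) (simp add: l2_onbD(1)[OF e])
  have eL: "e i \<in> L2 \<Omega>" if "i < N" for i using l2_onbD(1)[OF e that] WL by auto
  have Ly: "L w = l2_inner \<Omega> y w" if w: "w \<in> W" for w
  proof -
    have "L w = (\<Sum>i<N. l2_inner \<Omega> w (e i) * L (e i))" by (rule ae_functional_onb[OF L WL(2) e w])
    also have "\<dots> = l2_inner \<Omega> y w"
      unfolding y_def using w WL eL
      by (subst l2_inner_sum_left) (auto simp: mult.commute l2_inner_commute[of \<Omega> w])
    finally show ?thesis .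
  qed
  have Rf: "l2_fin_dim \<Omega> R" by (rule l2_fin_dim_subset[OF W R])
  define r where "r = l2_proj \<Omega> R y"
  have yL: "y \<in> L2 \<Omega>" using yW WL by auto
  have rR: "r \<in> R" unfolding r_def by (rule l2_proj_mem[OF Rf yL])
  have rL: "r \<in> L2 \<Omega>" using rR R(1) WL(1) by auto
  define d where "d = (\<lambda>x. y x - r x)"
  have dW: "d \<in> W" unfolding d_def by (intro lin_closed_diff WL yW) (use rR R in auto)
  have dL: "d \<in> L2 \<Omega>" using dW WL by auto
  have dr: "l2_inner \<Omega> d s = 0" if "s \<in> R" for s
    using l2_proj_orth[OF Rf yL that] by (simp add: d_def r_def)
  have "L d = 0" by (rule L0[OF dW]) (use dr in \<open>simp add: l2_inner_commute\<close>)
  then have "l2_inner \<Omega> y d = 0" using Ly[OF dW] by simp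
  moreover have "l2_inner \<Omega> r d = 0" using dr[OF rR] by (simp add: l2_inner_commute)
  ultimately have "l2_inner \<Omega> d d = 0"
    using l2_inner_diff_left[OF yL rL dL] by (simp add: d_def[symmetric])
  then have "l2_eq \<Omega> d (\<lambda>x. 0)" using dL by (simp add: l2_inner_self_eq_0)
  then have "l2_eq \<Omega> y r" by (simp add: l2_eq_def d_def)
  then have "l2_inner \<Omega> y w = l2_inner \<Omega> r w" if "w \<in> W" for w
    using that WL yL rL by (intro l2_inner_cong_left) auto
  then show ?thesis using rR Ly by auto
qed

section \<open>Integration over a finite or infinite time interval\<close>

lemma time_interval_props:
  assumes "0 < T"
  shows "\<exists>\<tau>. (\<forall>n::nat. \<tau> n \<in> time_interval T) \<and> incseq \<tau> \<and> time_interval T = (\<Union>n. {0..\<tau> n})"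
    and "0 \<in> time_interval T" "time_interval T \<in> sets lebesgue"
    and "\<And>t. t \<in> time_interval T \<Longrightarrow> 0 \<le> t" "\<And>t. t \<in> time_interval T \<Longrightarrow> {0..t} \<subseteq> time_interval T"
proof -
  show "0 \<in> time_interval T" using assms by (simp add: time_interval_def zero_ereal_def less_imp_le)
  show "\<And>t. t \<in> time_interval T \<Longrightarrow> 0 \<le> t" by (simp add: time_interval_def)
  show "{0..t} \<subseteq> time_interval T" if "t \<in> time_interval T" for t
    using that by (auto simp: time_interval_def intro: order_trans[of "ereal _" "ereal t"])
  show "\<exists>\<tau>. (\<forall>n::nat. \<tau> n \<in> time_interval T) \<and> incseq \<tau> \<and> time_interval T = (\<Union>n. {0..\<tau> n})"
  proof (cases T)
    case (real r)
    then show ?thesis using assms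
      by (intro exI[of _ "\<lambda>n. r"]) (auto simp: time_interval_def incseq_def)
  next
    case PInf
    have "x \<in> (\<Union>n::nat. {0..real n})" if "0 \<le> x" for x :: real
      using real_arch_simple[of x] that by auto
    then show ?thesis using PInf
      by (intro exI[of _ real]) (auto simp: time_interval_def incseq_def)
  qed (use assms in simp)
  then obtain \<tau> :: "nat \<Rightarrow> real" where "time_interval T = (\<Union>n. {0..\<tau> n})" by blast
  then show "time_interval T \<in> sets lebesgue" by simp
qed

text \<open>The integrals over \<open>{0..t}\<close> determine those over all intervals, so the
  criterion with boxes applies on each member of the exhaustion by compact intervals.\<close>

lemma AE_zero_of_itg_zero:
  fixes h :: "real \<Rightarrow> real"
  assumes T: "0 < T" and I: "I = time_interval T"
    and h: "\<And>t. t \<in> I \<Longrightarrow> integrable (lebesgue_on {0..t}) h" "\<And>t. t \<in> I \<Longrightarrow> itg t h = 0"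
  shows "AE s in lebesgue_on I. h s = 0"
proof -
  obtain \<tau> :: "nat \<Rightarrow> real" where \<tau>: "\<And>n. \<tau> n \<in> I" "I = (\<Union>n. {0..\<tau> n})"
    using time_interval_props(1)[OF T] I by blast
  have "AE s in lebesgue. s \<in> {0..\<tau> n} \<longrightarrow> h s = 0" for n
  proof -
    let ?H = "\<lambda>s. indicator {0..\<tau> n} s * h s"
    have Hi: "integrable lebesgue ?H"
      using h(1)[OF \<tau>(1)[of n]] integrable_restrict_space[of "{0..\<tau> n}" lebesgue h] by simp
    have H0: "(\<integral>s. indicator {..c} s * ?H s \<partial>lebesgue) = 0" and Hc: "integrable lebesgue (\<lambda>s. indicator {..c} s * ?H s)" for c
    proof -
      show "integrable lebesgue (\<lambda>s. indicator {..c} s * ?H s)"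
        using integrable_mult_indicator[OF _ Hi, of "{..c}"] by simp
      show "(\<integral>s. indicator {..c} s * ?H s \<partial>lebesgue) = 0"
      proof (cases "c < 0")
        case True
        then have "(\<lambda>s. indicator {..c} s * ?H s) = (\<lambda>s. 0)" by (auto simp: fun_eq_iff indicator_def)
        then show ?thesis by simp
      next
        case False
        have mI: "min c (\<tau> n) \<in> I"
          using False time_interval_props(5)[OF T, of "\<tau> n"] time_interval_props(4)[OF T, of "\<tau> n"] \<tau>(1)[of n] I
          by (auto simp: min_def)
        have "itg (min c (\<tau> n)) h = (\<integral>s. indicator {0..min c (\<tau> n)} s *\<^sub>R h s \<partial>lebesgue)"
          unfolding itg_def by (rule integral_restrict_space) simp
        also have "(\<lambda>s. indicator {0..min c (\<tau> n)} s *\<^sub>R h s) = (\<lambda>s. indicator {..c} s * ?H s)"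
          by (auto simp: fun_eq_iff indicator_def)
        finally show ?thesis using h(2)[OF mI] by simp
      qed
    qed
    have "AE s in lebesgue. ?H s = 0"
    proof (rule AE_lebesgue_zeroI_box[OF Hi])
      fix a b :: real
      show "(\<integral>s. indicator (box a b) s * ?H s \<partial>lebesgue) = 0"
      proof (cases "a \<le> b")
        case True
        have "AE s in lebesgue. s \<notin> {b}"
          by (intro AE_not_in) (simp add: negligible_iff_null_sets[symmetric])
        \<comment> \<open>An open interval is the difference of two half-lines up to its right end
          point.\<close>
        then have "AE s in lebesgue. indicator (box a b) s * ?H s = indicator {..b} s * ?H s - indicator {..a} s * ?H s"
          by eventually_elim (use True in \<open>auto simp: indicator_def\<close>)
        moreover have "integrable lebesgue (\<lambda>s. indicator (box a b) s * ?H s)"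
          using integrable_mult_indicator[OF _ Hi, of "box a b"] by simp
        ultimately have "(\<integral>s. indicator (box a b) s * ?H s \<partial>lebesgue)
            = (\<integral>s. indicator {..b} s * ?H s - indicator {..a} s * ?H s \<partial>lebesgue)"
          using Hc by (intro integral_cong_AE borel_measurable_integrable Bochner_Integration.integrable_diff) auto
        also have "\<dots> = 0" using Bochner_Integration.integral_diff[OF Hc Hc, of b a] H0 by simp
        finally show ?thesis .
      qed simp
    qed
    then show ?thesis by eventually_elim auto
  qed
  then have "AE s in lebesgue. \<forall>n. s \<in> {0..\<tau> n} \<longrightarrow> h s = 0" by (subst AE_all_countable) blast
  then have "AE s in lebesgue. s \<in> I \<longrightarrow> h s = 0" by eventually_elim (use \<tau>(2) in auto)
  then show ?thesis using time_interval_props(3)[OF T] I by (simp add: AE_restrict_space_iff)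
qed

text \<open>Monotone convergence along the exhaustion. For infinite \<open>T\<close> it turns bounds
  that are uniform in \<open>t\<close> into a bound for the whole interval.\<close>

lemma nn_integral_time_interval_le:
  assumes T: "0 < T" and I: "I = time_interval T" and f: "f \<in> borel_measurable (lebesgue_on I)"
    and C: "\<And>t. t \<in> I \<Longrightarrow> (\<integral>\<^sup>+s. f s \<partial>lebesgue_on {0..t}) \<le> C"
  shows "(\<integral>\<^sup>+s. f s \<partial>lebesgue_on I) \<le> C"
proof -
  obtain \<tau> :: "nat \<Rightarrow> real" where \<tau>: "\<And>n. \<tau> n \<in> I" "incseq \<tau>" "I = (\<Union>n. {0..\<tau> n})"
    using time_interval_props(1)[OF T] I by blast
  have Is: "I \<inter> space lebesgue \<in> sets lebesgue" using time_interval_props(3)[OF T] I by simp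
  let ?g = "\<lambda>n s. f s * indicator {0..\<tau> n} s"
  have fm: "(\<lambda>s. f s * indicator I s) \<in> borel_measurable lebesgue"
    using f borel_measurable_restrict_space_iff_ennreal[OF Is, of f] by simp
  have gm: "?g n \<in> borel_measurable lebesgue" for n
  proof -
    have "?g n = (\<lambda>s. f s * indicator I s * indicator {0..\<tau> n} s)"
      using \<tau>(3) by (auto simp: fun_eq_iff indicator_def)
    moreover have "{0..\<tau> n} \<in> sets lebesgue" by simp
    ultimately show ?thesis using fm by (simp only: borel_measurable_times_ennreal borel_measurable_indicator)
  qed
  have "(\<integral>\<^sup>+s. f s \<partial>lebesgue_on I) = (\<integral>\<^sup>+s. f s * indicator I s \<partial>lebesgue)"
    by (rule nn_integral_restrict_space[OF Is])
  also have "\<dots> = (\<integral>\<^sup>+s. (SUP n. ?g n s) \<partial>lebesgue)"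
  proof (intro nn_integral_cong)
    fix s
    show "f s * indicator I s = (SUP n. ?g n s)"
    proof (cases "s \<in> I")
      case True
      then obtain n where "s \<in> {0..\<tau> n}" using \<tau>(3) by auto
      then have "f s \<le> (SUP n. ?g n s)" by (intro SUP_upper2[of n]) auto
      moreover have "(SUP n. ?g n s) \<le> f s" by (intro SUP_least) (auto simp: indicator_def)
      ultimately show ?thesis using True by simp
    next
      case False
      then have z: "?g n s = 0" for n using \<tau>(3) by auto
      show ?thesis unfolding z using False by simp
    qed
  qed
  also have "\<dots> = (SUP n. \<integral>\<^sup>+s. ?g n s \<partial>lebesgue)"
  proof (rule nn_integral_monotone_convergence_SUP[OF _ gm])
    show "incseq ?g"
    proof (intro incseq_SucI le_funI)
      fix n s
      have "\<tau> n \<le> \<tau> (Suc n)" using \<tau>(2) by (simp add: incseq_SucD)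
      then show "?g n s \<le> ?g (Suc n) s" by (auto simp: indicator_def)
    qed
  qed
  also have "\<dots> \<le> C"
  proof (intro SUP_least)
    fix n
    have "(\<integral>\<^sup>+s. ?g n s \<partial>lebesgue) = (\<integral>\<^sup>+s. f s \<partial>lebesgue_on {0..\<tau> n})"
      by (rule nn_integral_restrict_space[symmetric]) simp
    then show "(\<integral>\<^sup>+s. ?g n s \<partial>lebesgue) \<le> C" using C[OF \<tau>(1)] by simp
  qed
  finally show ?thesis .
qed

lemma continuous_measurable_time_interval:
  fixes f :: "real \<Rightarrow> real"
  assumes T: "0 < T" and I: "I = time_interval T" and c: "\<And>t. t \<in> I \<Longrightarrow> continuous_on {0..t} f"
  shows "f \<in> borel_measurable (lebesgue_on I)"
proof -
  obtain \<tau> :: "nat \<Rightarrow> real" where \<tau>: "\<And>n. \<tau> n \<in> I" "I = (\<Union>n. {0..\<tau> n})"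
    using time_interval_props(1)[OF T] I by blast
  show ?thesis
  proof (rule measurable_piecewise_restrict[of "range (\<lambda>n. {0..\<tau> n})"])
    show "countable (range (\<lambda>n. {0..\<tau> n}))" by simp
    show "A \<inter> space (lebesgue_on I) \<in> sets (lebesgue_on I)" if "A \<in> range (\<lambda>n. {0..\<tau> n})" for A
      using that by (auto simp: sets_restrict_space)
    show "space (lebesgue_on I) \<subseteq> \<Union>(range (\<lambda>n. {0..\<tau> n}))" using \<tau>(2) by simp
    show "f \<in> measurable (restrict_space (lebesgue_on I) A) borel" if A: "A \<in> range (\<lambda>n. {0..\<tau> n})" for A
    proof -
      obtain n where n: "A = {0..\<tau> n}" using A by blast
      have "restrict_space (lebesgue_on I) A = lebesgue_on (I \<inter> A)"
        using A time_interval_props(3)[OF T] I by (intro restrict_restrict_space) auto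
      also have "I \<inter> A = {0..\<tau> n}" using n \<tau>(2) by auto
      finally show ?thesis
        using continuous_imp_measurable_on_sets_lebesgue[OF c[OF \<tau>(1)[of n]]] by simp
    qed
  qed
qed

section \<open>The energy identity and linear evolution in a finite-dimensional space\<close>

lemma has_time_derivD:
  assumes "has_time_deriv \<Omega> I u u'" "w \<in> L2 \<Omega>" "t \<in> I"
  shows "integrable (lebesgue_on {0..t}) (\<lambda>s. l2_inner \<Omega> (u' s) w)"
    and "l2_inner \<Omega> (u t) w = l2_inner \<Omega> (u 0) w + itg t (\<lambda>s. l2_inner \<Omega> (u' s) w)"
  using assms by (auto simp: has_time_deriv_def itg_def)

text \<open>Parseval's identity reduces the norm to squares of coordinates, to each of which the
  product rule for absolutely continuous functions applies.\<close>

lemma energy_identity: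
  assumes T: "0 < T" and I: "I = time_interval T" and W: "l2_fin_dim \<Omega> W"
    and d: "has_time_deriv \<Omega> I U U'" and UW: "\<And>t. t \<in> I \<Longrightarrow> U t \<in> W \<and> U' t \<in> W" and t: "t \<in> I"
  shows "integrable (lebesgue_on {0..t}) (\<lambda>s. l2_inner \<Omega> (U' s) (U s))"
    and "l2_inner \<Omega> (U t) (U t) = l2_inner \<Omega> (U 0) (U 0) + 2 * itg t (\<lambda>s. l2_inner \<Omega> (U' s) (U s))"
proof -
  have WL: "W \<subseteq> L2 \<Omega>" "lin_closed W" using l2_fin_dimD W by auto
  obtain N e where e: "l2_onb \<Omega> W N e" using l2_onb_exists[OF W] by blast
  have eL: "e i \<in> L2 \<Omega>" if "i < N" for i using l2_onbD(1)[OF e that] WL by auto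
  have sI: "s \<in> I" if "s \<in> {0..t}" for s using time_interval_props(5)[OF T] t that I by blast
  have t0: "0 \<le> t" using time_interval_props(4)[OF T] t I by auto
  define c where "c = (\<lambda>i s. l2_inner \<Omega> (U s) (e i))"
  define c' where "c' = (\<lambda>i s. l2_inner \<Omega> (U' s) (e i))"
  have ci: "integrable (lebesgue_on {0..t}) (c' i)" if "i < N" for i
    unfolding c'_def by (rule has_time_derivD(1)[OF d eL[OF that] t])
  have ce: "c i s = c i 0 + itg s (c' i)" if "i < N" "s \<in> {0..t}" for i s
    unfolding c_def c'_def by (rule has_time_derivD(2)[OF d eL[OF that(1)] sI[OF that(2)]])
  have cc: "continuous_on {0..t} (c i)" if "i < N" for i
  proof (rule continuous_on_eq)
    show "continuous_on {0..t} (\<lambda>s. c i 0 + itg s (c' i))"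
      by (rule continuous_on_add[OF continuous_on_const itg_continuous[OF ci[OF that]]])
  qed (rule ce[OF that, symmetric])
  have par: "l2_inner \<Omega> (U s) (U s) = (\<Sum>i<N. c i s * c i s)" "l2_inner \<Omega> (U' s) (U s) = (\<Sum>i<N. c' i s * c i s)"
    if "s \<in> {0..t}" for s
    unfolding c_def c'_def using UW[OF sI[OF that]] by (auto intro!: l2_parseval[OF WL e])
  have icc: "integrable (lebesgue_on {0..t}) (\<lambda>s. c' i s * c i s)" if "i < N" for i
    by (rule integrable_mult_continuous[OF ci[OF that] cc[OF that]])
  have "integrable (lebesgue_on {0..t}) (\<lambda>s. l2_inner \<Omega> (U' s) (U s))
      = integrable (lebesgue_on {0..t}) (\<lambda>s. \<Sum>i<N. c' i s * c i s)"
    by (rule Bochner_Integration.integrable_cong) (auto simp: par)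
  then show "integrable (lebesgue_on {0..t}) (\<lambda>s. l2_inner \<Omega> (U' s) (U s))"
    using icc by auto
  have "itg t (\<lambda>s. l2_inner \<Omega> (U' s) (U s)) = itg t (\<lambda>s. \<Sum>i<N. c' i s * c i s)"
    by (rule itg_cong) (simp add: par)
  also have "\<dots> = (\<Sum>i<N. itg t (\<lambda>s. c' i s * c i s))"
    unfolding itg_def by (rule Bochner_Integration.integral_sum) (use icc in auto)
  finally have "l2_inner \<Omega> (U 0) (U 0) + 2 * itg t (\<lambda>s. l2_inner \<Omega> (U' s) (U s))
      = (\<Sum>i<N. c i 0 * c i 0 + 2 * itg t (\<lambda>s. c' i s * c i s))"
    using par(1)[of 0] t0 by (simp add: sum.distrib sum_distrib_left)
  also have "\<dots> = (\<Sum>i<N. c i t * c i t)"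
  proof (intro sum.cong refl)
    fix i assume "i \<in> {..<N}"
    then have i: "i < N" by simp
    have "c i t * c i t = c i 0 * c i 0 + itg t (\<lambda>s. c' i s * c i s + c i s * c' i s)"
      by (rule absolutely_continuous_product[OF ci[OF i] ci[OF i] t0 ce[OF i] ce[OF i]])
    also have "(\<lambda>s. c' i s * c i s + c i s * c' i s) = (\<lambda>s. 2 * (c' i s * c i s))" by (auto simp: fun_eq_iff)
    finally show "c i 0 * c i 0 + 2 * itg t (\<lambda>s. c' i s * c i s) = c i t * c i t" by (simp add: itg_mult_left)
  qed
  also have "\<dots> = l2_inner \<Omega> (U t) (U t)" using par(1)[of t] t0 by simp
  finally show "l2_inner \<Omega> (U t) (U t) = l2_inner \<Omega> (U 0) (U 0) + 2 * itg t (\<lambda>s. l2_inner \<Omega> (U' s) (U s))" by simp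
qed

text \<open>Made for the uniqueness of the pressure: when the difference of two solutions is zero,
  its time derivative also drops out of the equation at almost every time, and only the pressure is
  left.\<close>

lemma time_deriv_of_zero:
  assumes T: "0 < T" and I: "I = time_interval T" and W: "l2_fin_dim \<Omega> W"
    and d: "has_time_deriv \<Omega> I U U'" and UW: "\<And>t. t \<in> I \<Longrightarrow> U t \<in> W \<and> U' t \<in> W"
    and z: "\<And>t. t \<in> I \<Longrightarrow> l2_eq \<Omega> (U t) (\<lambda>x. 0)"
  shows "AE t in lebesgue_on I. l2_eq \<Omega> (U' t) (\<lambda>x. 0)"
proof -
  have WL: "W \<subseteq> L2 \<Omega>" "lin_closed W" using l2_fin_dimD W by auto
  obtain N e where e: "l2_onb \<Omega> W N e" using l2_onb_exists[OF W] by blast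
  have eL: "e i \<in> L2 \<Omega>" if "i < N" for i using l2_onbD(1)[OF e that] WL by auto
  have z': "l2_inner \<Omega> (U t) (e i) = 0" if "t \<in> I" "i < N" for t i
    using l2_inner_cong_left[OF z[OF that(1)] _ eL[OF that(2)]] UW[OF that(1)] WL by auto
  have "AE s in lebesgue_on I. l2_inner \<Omega> (U' s) (e i) = 0" if i: "i < N" for i
  proof (rule AE_zero_of_itg_zero[OF T I])
    show "integrable (lebesgue_on {0..t}) (\<lambda>s. l2_inner \<Omega> (U' s) (e i))" if "t \<in> I" for t
      by (rule has_time_derivD(1)[OF d eL[OF i] that])
    show "itg t (\<lambda>s. l2_inner \<Omega> (U' s) (e i)) = 0" if "t \<in> I" for t
      using has_time_derivD(2)[OF d eL[OF i] that] z'[OF that i] z'[OF _ i, of 0] time_interval_props(2)[OF T] I by simp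
  qed
  then have "AE s in lebesgue_on I. \<forall>i\<in>{..<N}. l2_inner \<Omega> (U' s) (e i) = 0"
    by (intro AE_finite_allI) auto
  moreover have "AE s in lebesgue_on I. s \<in> I" by (rule AE_I2) simp
  ultimately show ?thesis
  proof eventually_elim
    case (elim s)
    then show ?case using l2_onbD(3)[OF e, of "U' s"] UW by auto
  qed
qed

text \<open>The coordinates solve \<open>x' = A x + b\<close> with
  \<open>A i j = - a (e j) (e i)\<close>. The basis and the continuous coordinates are part of the
  conclusion because the measurability in time of everything built from the solution is read off
  from this expansion.\<close>

lemma linear_evolution_exists:
  fixes a :: "real \<Rightarrow> ('a::euclidean_space \<Rightarrow> 'b::euclidean_space) \<Rightarrow> ('a \<Rightarrow> 'b) \<Rightarrow> real"
  assumes T: "0 < T" and I: "I = time_interval T" and Z: "l2_fin_dim \<Omega> Z" and U0: "U0 \<in> Z"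
    and a1: "\<And>t V. t \<in> I \<Longrightarrow> V \<in> Z \<Longrightarrow> ae_functional \<Omega> Z (\<lambda>U. a t U V)"
    and a2: "\<And>t U. t \<in> I \<Longrightarrow> U \<in> Z \<Longrightarrow> ae_functional \<Omega> Z (a t U)"
    and ai: "\<And>t U V. t \<in> I \<Longrightarrow> U \<in> Z \<Longrightarrow> V \<in> Z \<Longrightarrow> integrable (lebesgue_on {0..t}) (\<lambda>s. a s U V)"
    and F: "AE t in lebesgue_on I. ae_functional \<Omega> Z (F t)"
    and Fi: "\<And>t V. t \<in> I \<Longrightarrow> V \<in> Z \<Longrightarrow> integrable (lebesgue_on {0..t}) (\<lambda>s. F s V)"
  shows "\<exists>N e x U'. l2_onb \<Omega> Z N e \<and> (\<forall>i<N. \<forall>t\<in>I. continuous_on {0..t} (\<lambda>s. x s i)) \<and>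
    (\<forall>t. U' t \<in> Z) \<and> has_time_deriv \<Omega> I (\<lambda>t y. \<Sum>i<N. x t i *\<^sub>R e i y) U' \<and>
    l2_eq \<Omega> (\<lambda>y. \<Sum>i<N. x 0 i *\<^sub>R e i y) U0 \<and>
    (AE t in lebesgue_on I. \<forall>V\<in>Z. l2_inner \<Omega> (U' t) V + a t (\<lambda>y. \<Sum>i<N. x t i *\<^sub>R e i y) V = F t V)"
proof -
  have ZL: "Z \<subseteq> L2 \<Omega>" "lin_closed Z" using l2_fin_dimD Z by auto
  obtain N e where e: "l2_onb \<Omega> Z N e" using l2_onb_exists[OF Z] by blast
  have eZ: "e i \<in> Z" if "i < N" for i using l2_onbD(1)[OF e that] .
  have eL: "e i \<in> L2 \<Omega>" if "i < N" for i using eZ[OF that] ZL by auto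
  define A where "A = (\<lambda>s i j. - a s (e j) (e i))"
  define b where "b = (\<lambda>s i. F s (e i))"
  define x0 where "x0 = (\<lambda>i. l2_inner \<Omega> U0 (e i))"
  have "\<exists>x. \<forall>t\<in>I. \<forall>i<N. integrable (lebesgue_on {0..t}) (\<lambda>s. (\<Sum>j<N. A s i j * x s j) + b s i) \<and>
    x t i = x0 i + itg t (\<lambda>s. (\<Sum>j<N. A s i j * x s j) + b s i)"
  proof (rule linear_ode_exists)
    show "0 \<le> t" if "t \<in> I" for t using time_interval_props(4)[OF T] that I by simp
    show "integrable (lebesgue_on {0..t}) (\<lambda>s. A s i j)" if "t \<in> I" "i < N" "j < N" for t i j
      unfolding A_def using ai[OF that(1) eZ[OF that(3)] eZ[OF that(2)]] by auto
    show "integrable (lebesgue_on {0..t}) (\<lambda>s. b s i)" if "t \<in> I" "i < N" for t i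
      unfolding b_def using Fi[OF that(1) eZ[OF that(2)]] .
  qed
  then obtain x where x: "\<And>t i. t \<in> I \<Longrightarrow> i < N \<Longrightarrow> integrable (lebesgue_on {0..t}) (\<lambda>s. (\<Sum>j<N. A s i j * x s j) + b s i)"
    "\<And>t i. t \<in> I \<Longrightarrow> i < N \<Longrightarrow> x t i = x0 i + itg t (\<lambda>s. (\<Sum>j<N. A s i j * x s j) + b s i)" by blast
  define x' where "x' = (\<lambda>s i. (\<Sum>j<N. A s i j * x s j) + b s i)"
  define U where "U = (\<lambda>t y. \<Sum>i<N. x t i *\<^sub>R e i y)"
  \<comment> \<open>Defined at all times through the right-hand side of the system, so that it lies
    in \<open>Z\<close> also at the exceptional times at which \<open>F t\<close> is not
    linear.\<close>
  define U' where "U' = (\<lambda>t y. \<Sum>i<N. x' t i *\<^sub>R e i y)"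
  have UZ: "U t \<in> Z" "U' t \<in> Z" for t
    unfolding U_def U'_def by (intro lin_closed_sum[OF ZL(2)] eZ, simp)+
  have I0: "0 \<in> I" using time_interval_props(2)[OF T] I by simp
  have x00: "x 0 i = x0 i" if "i < N" for i using x(2)[OF I0 that] by simp
  have cont: "continuous_on {0..t} (\<lambda>s. x s i)" if "t \<in> I" "i < N" for t i
  proof -
    have "s \<in> I" if "s \<in> {0..t}" for s using time_interval_props(5)[OF T] \<open>t \<in> I\<close> that I by blast
    then have "x0 i + itg s (\<lambda>s. (\<Sum>j<N. A s i j * x s j) + b s i) = x s i" if "s \<in> {0..t}" for s
      using x(2)[OF _ \<open>i < N\<close>, of s] that by simp
    then show ?thesis
      by (rule continuous_on_eq[OF continuous_on_add[OF continuous_on_const itg_continuous[OF x(1)[OF that]]]])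
  qed
  have inner: "l2_inner \<Omega> (U t) w = (\<Sum>i<N. x t i * l2_inner \<Omega> (e i) w)"
    "l2_inner \<Omega> (U' t) w = (\<Sum>i<N. x' t i * l2_inner \<Omega> (e i) w)" if "w \<in> L2 \<Omega>" for t w
    unfolding U_def U'_def using that eL by (auto intro!: l2_inner_sum_left)
  have deriv: "has_time_deriv \<Omega> I U U'"
    unfolding has_time_deriv_def
  proof (intro ballI conjI)
    fix w :: "'a \<Rightarrow> 'b" and t assume w: "w \<in> L2 \<Omega>" and t: "t \<in> I"
    have xi: "integrable (lebesgue_on {0..t}) (\<lambda>s. x' s i * l2_inner \<Omega> (e i) w)" if "i < N" for i
      unfolding x'_def using x(1)[OF t that] by auto
    then show "integrable (lebesgue_on {0..t}) (\<lambda>s. l2_inner \<Omega> (U' s) w)"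
      unfolding inner(2)[OF w] by auto
    have "itg t (\<lambda>s. l2_inner \<Omega> (U' s) w) = (\<Sum>i<N. itg t (\<lambda>s. x' s i) * l2_inner \<Omega> (e i) w)"
      unfolding inner(2)[OF w] itg_mult_right[symmetric] unfolding itg_def
      by (rule Bochner_Integration.integral_sum) (use xi in auto)
    moreover have "x t i = x 0 i + itg t (\<lambda>s. x' s i)" if "i < N" for i
      using x(2)[OF t that] x00[OF that] by (simp add: x'_def)
    ultimately show "l2_inner \<Omega> (U t) w = l2_inner \<Omega> (U 0) w + (\<integral>s. l2_inner \<Omega> (U' s) w \<partial>lebesgue_on {0..t})"
      unfolding inner(1)[OF w] itg_def[symmetric] by (simp add: distrib_right sum.distrib)
  qed
  have init: "l2_eq \<Omega> (U 0) U0"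
  proof -
    have "U 0 = (\<lambda>y. \<Sum>i<N. l2_inner \<Omega> U0 (e i) *\<^sub>R e i y)"
      unfolding U_def using x00 by (auto simp: fun_eq_iff x0_def intro!: sum.cong)
    then show ?thesis using l2_onbD(3)[OF e U0] by (simp add: l2_eq_sym)
  qed
  have eqn: "AE t in lebesgue_on I. \<forall>V\<in>Z. l2_inner \<Omega> (U' t) V + a t (U t) V = F t V"
  proof -
    have "AE t in lebesgue_on I. t \<in> I" by (rule AE_I2) simp
    with F show ?thesis
    proof eventually_elim
      case (elim t)
      show ?case
      proof
        fix V assume V: "V \<in> Z"
        have ei: "l2_inner \<Omega> (U' t) (e i) + a t (U t) (e i) = F t (e i)" if i: "i < N" for i
        proof -
          have "l2_inner \<Omega> (U' t) (e i) = x' t i"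
            unfolding U'_def by (rule orthonormal_coeff[OF eL i l2_onbD(2)[OF e]]) auto
          moreover have "a t (U t) (e i) = (\<Sum>j<N. x t j * a t (e j) (e i))"
            unfolding U_def by (rule ae_functional_sum[OF a1[OF elim(2) eZ[OF i]] ZL(2)]) (auto intro: eZ)
          ultimately show ?thesis
            by (simp add: x'_def A_def b_def sum_negf mult.commute)
        qed
        have VL: "V \<in> L2 \<Omega>" "U' t \<in> L2 \<Omega>" using V UZ ZL by auto
        \<comment> \<open>The residual is linear in \<open>V\<close>, so it is enough that it
          vanishes on the basis.\<close>
        have "l2_inner \<Omega> (U' t) V + a t (U t) V - F t V
            = (\<Sum>i<N. l2_inner \<Omega> V (e i) * (l2_inner \<Omega> (U' t) (e i) + a t (U t) (e i) - F t (e i)))"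
          using ae_functional_onb[OF ae_functional_diff[OF ae_functional_add[OF
                ae_functional_inner_right[OF ae_linear_id[OF ZL] VL(2)] a2[OF elim(2) UZ(1)]] elim(1)] ZL(2) e V]
          by simp
        also have "\<dots> = 0" using ei by simp
        finally show "l2_inner \<Omega> (U' t) V + a t (U t) V = F t V" by simp
      qed
    qed
  qed
  show ?thesis
    using e cont UZ(2) deriv init eqn unfolding U_def by blast
qed

section \<open>The discrete spaces and the pressure\<close>

text \<open>Several fields are packed into one function with values in a product type, whose inner
  product is the sum of the inner products. One \<open>L2\<close> space and one orthonormal basis
  then handle the whole system.\<close>

definition prod_space :: "('a \<Rightarrow> 'b) set \<Rightarrow> ('a \<Rightarrow> 'c) set \<Rightarrow> ('a \<Rightarrow> 'b \<times> 'c) set" where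
  "prod_space X Y = {U. (\<lambda>x. fst (U x)) \<in> X \<and> (\<lambda>x. snd (U x)) \<in> Y}"

lemma L2_PairI:
  assumes "u \<in> L2 \<Omega>" "v \<in> L2 \<Omega>" shows "(\<lambda>x. (u x, v x)) \<in> L2 \<Omega>"
proof -
  have "(\<lambda>x. (u x, v x)) \<in> borel_measurable (lebesgue_on \<Omega>)"
    using L2_measurable[OF assms(1)] L2_measurable[OF assms(2)] by (rule borel_measurable_Pair)
  moreover have "(norm (u x, v x))\<^sup>2 = (norm (u x))\<^sup>2 + (norm (v x))\<^sup>2" for x
    by (simp add: norm_Pair)
  then have "integrable (lebesgue_on \<Omega>) (\<lambda>x. (norm (u x, v x))\<^sup>2)" using assms by (simp add: L2_def)
  ultimately show ?thesis unfolding L2_def by blast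
qed

lemma ae_linear_fst: "X \<subseteq> L2 \<Omega> \<Longrightarrow> lin_closed X \<Longrightarrow> ae_linear \<Omega> X (\<lambda>U x. fst (U x))"
  by (rule ae_linear_bounded_linear[OF ae_linear_id bounded_linear_fst])

lemma ae_linear_snd: "X \<subseteq> L2 \<Omega> \<Longrightarrow> lin_closed X \<Longrightarrow> ae_linear \<Omega> X (\<lambda>U x. snd (U x))"
  by (rule ae_linear_bounded_linear[OF ae_linear_id bounded_linear_snd])

lemma L2_fst_snd:
  assumes "U \<in> L2 \<Omega>" shows "(\<lambda>x. fst (U x)) \<in> L2 \<Omega>" "(\<lambda>x. snd (U x)) \<in> L2 \<Omega>"
  using ae_linearD(3)[OF ae_linear_fst[OF order_refl lin_closed_L2] assms]
    ae_linearD(3)[OF ae_linear_snd[OF order_refl lin_closed_L2] assms] by auto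

lemma prod_space_L2: "X \<subseteq> L2 \<Omega> \<Longrightarrow> Y \<subseteq> L2 \<Omega> \<Longrightarrow> prod_space X Y \<subseteq> L2 \<Omega>"
proof
  fix U assume "X \<subseteq> L2 \<Omega>" "Y \<subseteq> L2 \<Omega>" "U \<in> prod_space X Y"
  then have "(\<lambda>x. (fst (U x), snd (U x))) \<in> L2 \<Omega>" by (intro L2_PairI) (auto simp: prod_space_def)
  then show "U \<in> L2 \<Omega>" by simp
qed

lemma lin_closed_prod_space: "lin_closed X \<Longrightarrow> lin_closed Y \<Longrightarrow> lin_closed (prod_space X Y)"
  unfolding lin_closed_def prod_space_def by simp

lemma l2_inner_prod:
  assumes "U \<in> L2 \<Omega>" "V \<in> L2 \<Omega>"
  shows "l2_inner \<Omega> U V = l2_inner \<Omega> (\<lambda>x. fst (U x)) (\<lambda>x. fst (V x)) + l2_inner \<Omega> (\<lambda>x. snd (U x)) (\<lambda>x. snd (V x))"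
  using L2_integrable_inner[OF L2_fst_snd(1)[OF assms(1)] L2_fst_snd(1)[OF assms(2)]]
    L2_integrable_inner[OF L2_fst_snd(2)[OF assms(1)] L2_fst_snd(2)[OF assms(2)]]
  by (simp add: l2_inner_def inner_prod_def)

lemma l2_fin_dim_prod_space:
  assumes X: "l2_fin_dim \<Omega> X" and Y: "l2_fin_dim \<Omega> Y"
  shows "l2_fin_dim \<Omega> (prod_space X Y)"
proof -
  obtain n :: nat and b where b: "\<And>i. i < n \<Longrightarrow> b i \<in> L2 \<Omega>"
    "\<And>w. w \<in> X \<Longrightarrow> \<exists>c. l2_eq \<Omega> w (\<lambda>x. \<Sum>i<n. c i *\<^sub>R b i x)" using l2_fin_dimE[OF X] by blast
  obtain m :: nat and d where d: "\<And>i. i < m \<Longrightarrow> d i \<in> L2 \<Omega>"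
    "\<And>w. w \<in> Y \<Longrightarrow> \<exists>c. l2_eq \<Omega> w (\<lambda>x. \<Sum>i<m. c i *\<^sub>R d i x)" using l2_fin_dimE[OF Y] by blast
  let ?A = "{..<n} <+> {..<m}"
  let ?g = "\<lambda>s x. case s of Inl i \<Rightarrow> (b i x, 0) | Inr i \<Rightarrow> (0, d i x)"
  show ?thesis
  proof (rule l2_fin_dimI[of ?A ?g])
    fix a assume "a \<in> ?A"
    then show "?g a \<in> L2 \<Omega>" using b(1) d(1) L2_zero by (auto intro!: L2_PairI)
  next
    show "prod_space X Y \<subseteq> L2 \<Omega>" by (rule prod_space_L2[OF l2_fin_dimD(1)[OF X] l2_fin_dimD(1)[OF Y]])
    show "lin_closed (prod_space X Y)" by (rule lin_closed_prod_space[OF l2_fin_dimD(2)[OF X] l2_fin_dimD(2)[OF Y]])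
    fix U assume "U \<in> prod_space X Y"
    then obtain c c' where c: "l2_eq \<Omega> (\<lambda>x. fst (U x)) (\<lambda>x. \<Sum>i<n. c i *\<^sub>R b i x)"
      "l2_eq \<Omega> (\<lambda>x. snd (U x)) (\<lambda>x. \<Sum>i<m. c' i *\<^sub>R d i x)"
      using b(2)[of "\<lambda>x. fst (U x)"] d(2)[of "\<lambda>x. snd (U x)"] by (auto simp: prod_space_def)
    have "l2_eq \<Omega> U (\<lambda>x. \<Sum>a\<in>?A. (case a of Inl i \<Rightarrow> c i | Inr i \<Rightarrow> c' i) *\<^sub>R ?g a x)"
      using c unfolding l2_eq_def
    proof eventually_elim
      case (elim x)
      have "(\<Sum>a\<in>?A. (case a of Inl i \<Rightarrow> c i | Inr i \<Rightarrow> c' i) *\<^sub>R ?g a x)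
          = (\<Sum>i<n. c i *\<^sub>R (b i x, 0)) + (\<Sum>i<m. c' i *\<^sub>R (0, d i x))"
        by (simp add: sum.Plus)
      also have "\<dots> = (fst (U x), snd (U x))" using elim by (simp add: prod_eq_iff fst_sum snd_sum)
      finally show ?case by simp
    qed
    then show "\<exists>c. l2_eq \<Omega> U (\<lambda>x. \<Sum>a\<in>?A. c a *\<^sub>R ?g a x)" by blast
  qed auto
qed

text \<open>Rounding \<open>g\<close> down to multiples of \<open>1 / Suc n\<close> leaves countably
  many values, for which measurability in \<open>z\<close> is enough; continuity in the second
  argument gives the limit.\<close>

lemma borel_measurable_Caratheodory:
  fixes h :: "'z \<Rightarrow> real \<Rightarrow> real"
  assumes h: "\<And>r. (\<lambda>z. h z r) \<in> borel_measurable M" and c: "\<And>z. z \<in> space M \<Longrightarrow> continuous_on UNIV (h z)"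
    and g: "g \<in> borel_measurable M"
  shows "(\<lambda>z. h z (g z)) \<in> borel_measurable M"
proof (rule borel_measurable_LIMSEQ_real)
  let ?G = "\<lambda>n z. of_int \<lfloor>real (Suc n) * g z\<rfloor> / real (Suc n)"
  show "(\<lambda>n. h z (?G n z)) \<longlonglongrightarrow> h z (g z)" if z: "z \<in> space M" for z
  proof -
    have lim: "(\<lambda>n. ?G n z) \<longlonglongrightarrow> g z"
    proof (rule tendsto_sandwich[of "\<lambda>n. g z - inverse (real (Suc n))" _ _ "\<lambda>n. g z"])
      have "g z - inverse (real (Suc n)) \<le> ?G n z \<and> ?G n z \<le> g z" for n
      proof -
        have "real (Suc n) * g z - 1 \<le> of_int \<lfloor>real (Suc n) * g z\<rfloor>" "of_int \<lfloor>real (Suc n) * g z\<rfloor> \<le> real (Suc n) * g z"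
          by linarith+
        then have "(real (Suc n) * g z - 1) / real (Suc n) \<le> ?G n z" "?G n z \<le> (real (Suc n) * g z) / real (Suc n)"
          by (intro divide_right_mono; simp)+
        then show ?thesis by (simp add: diff_divide_distrib inverse_eq_divide)
      qed
      then show "\<forall>\<^sub>F n in sequentially. g z - inverse (real (Suc n)) \<le> ?G n z" "\<forall>\<^sub>F n in sequentially. ?G n z \<le> g z"
        by auto
      show "(\<lambda>n. g z - inverse (real (Suc n))) \<longlonglongrightarrow> g z"
        using tendsto_diff[OF tendsto_const LIMSEQ_inverse_real_of_nat, of "g z"] by simp
    qed simp
    have "isCont (h z) (g z)" using c[OF z] by (simp add: continuous_on_eq_continuous_at)
    then show ?thesis by (rule isCont_tendsto_compose[OF _ lim])
  qed
  show "(\<lambda>z. h z (?G n z)) \<in> borel_measurable M" for n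
  proof (rule measurable_compose_countable[where f="\<lambda>i z. h z (of_int i / real (Suc n))" and g="\<lambda>z. \<lfloor>real (Suc n) * g z\<rfloor>"])
    show "(\<lambda>z. h z (of_int i / real (Suc n))) \<in> borel_measurable M" for i :: int by (rule h)
    show "(\<lambda>z. \<lfloor>real (Suc n) * g z\<rfloor>) \<in> measurable M (count_space UNIV)"
      using g by measurable
  qed
qed

text \<open>Designed for \<open>linf_norm\<close>: as a function of finitely many coefficients a
  norm is Lipschitz, hence continuous, and its composition with measurable coefficients is
  measurable.\<close>

lemma borel_measurable_lipschitz_coeffs:
  fixes G :: "(nat \<Rightarrow> real) \<Rightarrow> real"
  assumes G: "\<And>c d. \<bar>G c - G d\<bar> \<le> (\<Sum>i<N. \<bar>c i - d i\<bar> * g i)"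
    and c: "\<And>i. i < N \<Longrightarrow> (\<lambda>s. c s i) \<in> borel_measurable M"
  shows "(\<lambda>s. G (c s)) \<in> borel_measurable M"
proof -
  \<comment> \<open>Only the first \<open>N\<close> coordinates are known to be measurable; the
    others are set to 0, which by the Lipschitz bound leaves the value of \<open>G\<close>
    unchanged.\<close>
  define c' where "c' = (\<lambda>s i. if i < N then c s i else 0)"
  have "\<bar>G (c s) - G (c' s)\<bar> \<le> 0" for s
    using G[of "c s" "c' s"] by (simp add: c'_def)
  then have eq: "G (c s) = G (c' s)" for s by simp
  have "c' \<in> borel_measurable M"
  proof (rule measurable_coordinatewise_then_product)
    show "(\<lambda>s. c' s i) \<in> borel_measurable M" for i
      using c[of i] by (cases "i < N") (simp_all add: c'_def)
  qed
  moreover have "G \<in> borel_measurable borel"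
  proof (rule borel_measurable_continuous_onI)
    have "isCont G x" for x
    proof -
      have "((\<lambda>y. \<Sum>i<N. \<bar>y i - x i\<bar> * g i) \<longlongrightarrow> (\<Sum>i<N. \<bar>x i - x i\<bar> * g i)) (at x)"
      proof (intro tendsto_intros)
        fix i
        have "continuous_on UNIV (\<lambda>y::nat \<Rightarrow> real. y i)" by (rule continuous_on_product_coordinates)
        then show "((\<lambda>y. y i) \<longlongrightarrow> x i) (at x)"
          by (simp add: continuous_on_def)
      qed
      then have l: "((\<lambda>y. \<Sum>i<N. \<bar>y i - x i\<bar> * g i) \<longlongrightarrow> 0) (at x)" by simp
      have "\<forall>\<^sub>F y in at x. norm (G y - G x) \<le> (\<Sum>i<N. \<bar>y i - x i\<bar> * g i)"
        unfolding real_norm_def by (intro always_eventually allI G)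
      then have "((\<lambda>y. G y - G x) \<longlongrightarrow> 0) (at x)" by (rule Lim_null_comparison[OF _ l])
      then show ?thesis unfolding isCont_def by (simp add: LIM_zero_iff)
    qed
    then show "continuous_on UNIV G" by (simp add: continuous_at_imp_continuous_on)
  qed
  ultimately have "(\<lambda>s. G (c' s)) \<in> borel_measurable M" by (rule measurable_compose)
  then show ?thesis by (simp add: eq)
qed

context fe_space begin

lemma emeasure_\<Omega>_pos: "emeasure (lebesgue_on \<Omega>) (space (lebesgue_on \<Omega>)) \<noteq> 0"
proof
  assume "emeasure (lebesgue_on \<Omega>) (space (lebesgue_on \<Omega>)) = 0"
  then have "emeasure lebesgue \<Omega> = 0" using open_\<Omega> by (simp add: emeasure_restrict_space)
  then have "negligible \<Omega>" using open_\<Omega> by (simp add: negligible_iff_null_sets null_sets_def)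
  then show False using open_not_negligible[OF open_\<Omega>] domain by (simp add: polyhedral_domain_def)
qed

text \<open>\<open>linf_norm\<close> converts an extended real to a real, which is faithful only for
  finite values. Boundedness of discrete fields gives the upper bound, and the positive measure of
  \<open>\<Omega>\<close> keeps the essential supremum of a nonnegative function from dropping below
  0.\<close>

lemma linf_norm_V_h:
  assumes v: "v \<in> V_h \<Omega> \<T> k"
  shows linf_norm_ge_0: "0 \<le> linf_norm \<Omega> v"
    and linf_norm_AE: "AE x in lebesgue_on \<Omega>. norm (v x) \<le> linf_norm \<Omega> v"
    and linf_norm_le: "\<And>M. AE x in lebesgue_on \<Omega>. norm (v x) \<le> M \<Longrightarrow> linf_norm \<Omega> v \<le> M"
proof -
  let ?M = "lebesgue_on \<Omega>"
  let ?e = "esssup ?M (\<lambda>x. ereal (norm (v x)))"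
  have vm: "(\<lambda>x. ereal (norm (v x))) \<in> borel_measurable ?M"
    using L2_measurable[of v \<Omega>] v V_h_sub(3) by auto
  have ge: "0 \<le> ?e"
    using esssup_mono[of "\<lambda>x. 0::ereal" ?M "\<lambda>x. ereal (norm (v x))"]
      esssup_const[OF emeasure_\<Omega>_pos, of "0::ereal"] by simp
  have le: "?e \<le> ereal M" if "AE x in ?M. norm (v x) \<le> M" for M
    by (rule esssup_I[OF vm]) (use that in simp)
  obtain M where "\<And>x. x \<in> \<Omega> \<Longrightarrow> norm (v x) \<le> M" using V_h_bounded[OF v] by blast
  then have "?e \<le> ereal M" by (intro le AE_I2) auto
  then have fin: "ereal (linf_norm \<Omega> v) = ?e"
    unfolding linf_norm_def using ge by (intro ereal_real') auto
  show "0 \<le> linf_norm \<Omega> v" unfolding linf_norm_def using ge by (simp add: real_of_ereal_pos)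
  have "AE x in ?M. ereal (norm (v x)) \<le> ?e" by (rule esssup_AE)
  then show "AE x in ?M. norm (v x) \<le> linf_norm \<Omega> v" unfolding fin[symmetric] by simp
  show "linf_norm \<Omega> v \<le> M" if "AE x in ?M. norm (v x) \<le> M" for M
    using le[OF that] unfolding fin[symmetric] by simp
qed

lemma linf_norm_cong:
  assumes "u \<in> V_h \<Omega> \<T> k" "v \<in> V_h \<Omega> \<T> k" "l2_eq \<Omega> u v"
  shows "linf_norm \<Omega> u = linf_norm \<Omega> v"
proof (rule antisym)
  have "AE x in lebesgue_on \<Omega>. norm (u x) \<le> linf_norm \<Omega> v"
    using assms(3) linf_norm_AE[OF assms(2)] unfolding l2_eq_def by eventually_elim simp
  then show "linf_norm \<Omega> u \<le> linf_norm \<Omega> v" by (rule linf_norm_le[OF assms(1)])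
  have "AE x in lebesgue_on \<Omega>. norm (v x) \<le> linf_norm \<Omega> u"
    using assms(3) linf_norm_AE[OF assms(1)] unfolding l2_eq_def by eventually_elim simp
  then show "linf_norm \<Omega> v \<le> linf_norm \<Omega> u" by (rule linf_norm_le[OF assms(2)])
qed

end

section \<open>Finite dimension of the discrete spaces and of the subscale spaces\<close>

locale fe_system = fe_space \<Omega> \<T> k
  for \<Omega> :: "(real^'d::finite) set" and \<T> k +
  fixes n\<^sub>u :: nat and \<phi> :: "nat \<Rightarrow> real^'d \<Rightarrow> real^'d" and n\<^sub>p :: nat and \<psi> :: "nat \<Rightarrow> real^'d \<Rightarrow> real"
  assumes basis_u: "is_basis \<Omega> (V_h \<Omega> \<T> k) n\<^sub>u \<phi>"
    and basis_p: "is_basis_mod_const \<Omega> (S_h \<Omega> \<T> k) n\<^sub>p \<psi>"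
begin

abbreviation "V \<equiv> V_h \<Omega> \<T> k"
abbreviation "S \<equiv> S_h \<Omega> \<T> k"
abbreviation "V\<^sub>1 \<equiv> subscales1 \<Omega> \<T> k n\<^sub>u \<phi>"
abbreviation "V\<^sub>2 \<equiv> subscales2 \<Omega> \<T> k n\<^sub>p \<psi>"

lemma V_fin: "l2_fin_dim \<Omega> V"
proof (rule l2_fin_dimI[of "{..<n\<^sub>u}" \<phi>])
  show "\<phi> i \<in> L2 \<Omega>" if "i \<in> {..<n\<^sub>u}" for i
    using basis_u that V_h_sub(3) by (auto simp: is_basis_def)
  fix v assume "v \<in> V"
  then obtain c where "\<forall>x\<in>\<Omega>. v x = (\<Sum>i<n\<^sub>u. c i *\<^sub>R \<phi> i x)" using basis_u unfolding is_basis_def by blast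
  then show "\<exists>c. l2_eq \<Omega> v (\<lambda>x. \<Sum>i<n\<^sub>u. c i *\<^sub>R \<phi> i x)"
    unfolding l2_eq_def by (intro exI[of _ c] AE_I2) auto
qed (auto simp: V_h_sub(3) lin_closed_V_h)

lemma pressure_basis_S: "i < n\<^sub>p \<Longrightarrow> \<psi> i \<in> S" using basis_p by (simp add: is_basis_mod_const_def)

lemma S_expansion:
  assumes "q \<in> S" obtains c a where "\<And>x. x \<in> \<Omega> \<Longrightarrow> q x = (\<Sum>i<n\<^sub>p. c i * \<psi> i x) + a"
  using basis_p assms unfolding is_basis_mod_const_def eq_mod_const_def by blast

lemma S_L2: "S \<subseteq> L2 \<Omega>" using S_h_H1 H1_L2 by blast

text \<open>\<open>\<psi>\<close> is a basis only modulo constants, so the constant function 1 joins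
  it as the last member of the spanning family.\<close>

lemma S_fin: "l2_fin_dim \<Omega> S"
proof (rule l2_fin_dimI[of "{..<Suc n\<^sub>p}" "\<lambda>i x. if i < n\<^sub>p then \<psi> i x else 1"])
  show "(\<lambda>x. if i < n\<^sub>p then \<psi> i x else 1) \<in> L2 \<Omega>" for i
    using pressure_basis_S S_L2 L2_one by (cases "i < n\<^sub>p") auto
  fix q assume "q \<in> S"
  then obtain c a where "\<And>x. x \<in> \<Omega> \<Longrightarrow> q x = (\<Sum>i<n\<^sub>p. c i * \<psi> i x) + a" using S_expansion by blast
  then have "l2_eq \<Omega> q (\<lambda>x. \<Sum>i<Suc n\<^sub>p. (if i < n\<^sub>p then c i else a) *\<^sub>R (if i < n\<^sub>p then \<psi> i x else 1))"
    unfolding l2_eq_def by (intro AE_I2) auto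
  then show "\<exists>c. l2_eq \<Omega> q (\<lambda>x. \<Sum>i<Suc n\<^sub>p. c i *\<^sub>R (if i < n\<^sub>p then \<psi> i x else 1))"
    by (rule exI[of _ "\<lambda>i. if i < n\<^sub>p then c i else a"])
qed (auto simp: S_L2 lin_closed_S_h)

lemma vec_S_fin: "l2_fin_dim \<Omega> (vec_fields S)"
  by (rule l2_fin_dim_vec_fields[OF S_fin])

lemma V1_fin: "l2_fin_dim \<Omega> V\<^sub>1"
  unfolding subscales1_def
proof (rule l2_fin_dim_l2_span)
  fix a assume "a \<in> {..<n\<^sub>u} \<times> {..<n\<^sub>u}"
  then obtain i j where a: "a = (i, j)" "i < n\<^sub>u" "j < n\<^sub>u" by auto
  then have "\<phi> i \<in> V" "\<phi> j \<in> V" using basis_u by (auto simp: is_basis_def)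
  then show "(case a of (i, j) \<Rightarrow> l2_perp \<Omega> (vec_fields S) (conv \<Omega> (\<phi> i) (\<phi> j))) \<in> L2 \<Omega>"
    unfolding a prod.case by (intro l2_perp_L2[OF vec_S_fin] ae_linearD(3)[OF ae_linear_conv_right])
qed simp

lemma grad_psi_L2: "i < n\<^sub>p \<Longrightarrow> grad \<Omega> (\<psi> i) \<in> L2 \<Omega>"
  using grad_L2 pressure_basis_S S_h_H1 by blast

lemma V2_fin: "l2_fin_dim \<Omega> V\<^sub>2"
  unfolding subscales2_def
  by (rule l2_fin_dim_l2_span) (auto intro!: l2_perp_L2[OF vec_S_fin] grad_psi_L2)

text \<open>The constant in the expansion of \<open>q\<close> disappears in the gradient, so the
  gradients of the \<open>\<psi> i\<close> span all discrete pressure gradients.\<close>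

lemma perp_grad_V2:
  assumes q: "q \<in> S" shows "l2_perp \<Omega> (vec_fields S) (grad \<Omega> q) \<in> V\<^sub>2"
proof -
  obtain c a where ca: "\<And>x. x \<in> \<Omega> \<Longrightarrow> q x = (\<Sum>i<n\<^sub>p. c i * \<psi> i x) + a" using S_expansion[OF q] by blast
  have psiH: "\<psi> i \<in> H1 \<Omega>" if "i < n\<^sub>p" for i using pressure_basis_S[OF that] S_h_H1 by blast
  let ?s = "\<lambda>x. \<Sum>i<n\<^sub>p. c i *\<^sub>R \<psi> i x"
  have sH: "?s \<in> H1 \<Omega>" by (rule lin_closed_sum[OF lin_closed_H1]) (simp add: psiH)
  have qH: "q \<in> H1 \<Omega>" using q S_h_H1 by blast
  have e1: "l2_eq \<Omega> q (\<lambda>x. 1 *\<^sub>R ?s x + 1 *\<^sub>R a)" unfolding l2_eq_def using ca by (intro AE_I2) auto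
  have "l2_eq \<Omega> (grad \<Omega> q) (grad \<Omega> (\<lambda>x. 1 *\<^sub>R ?s x + 1 *\<^sub>R a))"
    by (rule grad_cong[OF qH H1_lincomb[OF sH H1_const(1)] e1])
  also have "l2_eq \<Omega> \<dots> (\<lambda>x. 1 *\<^sub>R grad \<Omega> ?s x + 1 *\<^sub>R grad \<Omega> (\<lambda>x. a) x)" by (rule grad_lincomb[OF sH H1_const(1)])
  also have "l2_eq \<Omega> \<dots> (\<lambda>x. 1 *\<^sub>R (\<Sum>i<n\<^sub>p. c i *\<^sub>R grad \<Omega> (\<psi> i) x) + 1 *\<^sub>R 0)"
    by (rule l2_eq_lincomb[OF grad_sum H1_const(2)]) (auto simp: psiH)
  finally have g: "l2_eq \<Omega> (grad \<Omega> q) (\<lambda>x. \<Sum>i<n\<^sub>p. c i *\<^sub>R grad \<Omega> (\<psi> i) x)" by simp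
  note P = ae_linear_l2_perp[OF vec_S_fin]
  have "l2_eq \<Omega> (l2_perp \<Omega> (vec_fields S) (grad \<Omega> q)) (l2_perp \<Omega> (vec_fields S) (\<lambda>x. \<Sum>i<n\<^sub>p. c i *\<^sub>R grad \<Omega> (\<psi> i) x))"
    by (rule ae_linearD(5)[OF P grad_L2[OF qH] L2_sum g]) (simp add: grad_psi_L2)
  also have "l2_eq \<Omega> \<dots> (\<lambda>x. \<Sum>i<n\<^sub>p. c i *\<^sub>R l2_perp \<Omega> (vec_fields S) (grad \<Omega> (\<psi> i)) x)"
    by (rule ae_linear_sum[OF P]) (auto simp: grad_psi_L2)
  finally show ?thesis
    unfolding subscales2_def l2_span_def using l2_perp_L2[OF vec_S_fin grad_L2[OF qH]] by auto
qed

text \<open>Integration by parts component by component, without boundary term since discrete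
  velocities lie in \<open>H10\<close>.\<close>

lemma inner_vdiv:
  assumes q: "q \<in> H1 \<Omega>" and v: "v \<in> V" shows "l2_inner \<Omega> q (vdiv \<Omega> v) = - l2_inner \<Omega> (grad \<Omega> q) v"
proof -
  have vi: "(\<lambda>x. v x $ i) \<in> H10 \<Omega>" "(\<lambda>x. v x $ i) \<in> H1 \<Omega>" for i using V_h_nth[OF v] H10_H1 by blast+
  have "vdiv \<Omega> v = (\<lambda>x. \<Sum>i\<in>UNIV. 1 *\<^sub>R grad \<Omega> (\<lambda>y. v y $ i) x $ i)" by (simp add: vdiv_def vgrad_def fun_eq_iff)
  then have "l2_inner \<Omega> q (vdiv \<Omega> v) = (\<Sum>i\<in>UNIV. 1 * l2_inner \<Omega> q (\<lambda>x. grad \<Omega> (\<lambda>y. v y $ i) x $ i))"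
    using l2_inner_sum_right[of UNIV "\<lambda>i x. grad \<Omega> (\<lambda>y. v y $ i) x $ i" \<Omega> q "\<lambda>i. 1"] H1_L2[OF q] L2_nth[OF grad_L2[OF vi(2)]]
    by simp
  also have "\<dots> = - (\<Sum>i\<in>UNIV. l2_inner \<Omega> (\<lambda>x. grad \<Omega> q x $ i) (\<lambda>x. v x $ i))"
    by (simp add: H10_integration_by_parts[OF q vi(1)] sum_negf)
  also have "\<dots> = - l2_inner \<Omega> (grad \<Omega> q) v"
    using l2_inner_vec[OF grad_L2[OF q], of v] V_h_sub(3) v by auto
  finally show ?thesis .
qed

section \<open>Triples of fields, the continuity constraint and its multiplier\<close>

definition W :: "(real^'d \<Rightarrow> (real^'d) \<times> (real^'d) \<times> (real^'d)) set" where
  "W = prod_space V (prod_space V\<^sub>1 V\<^sub>2)"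

definition pr1 :: "(real^'d \<Rightarrow> (real^'d) \<times> (real^'d) \<times> (real^'d)) \<Rightarrow> real^'d \<Rightarrow> real^'d" where
  "pr1 U = (\<lambda>x. fst (U x))"
definition pr2 :: "(real^'d \<Rightarrow> (real^'d) \<times> (real^'d) \<times> (real^'d)) \<Rightarrow> real^'d \<Rightarrow> real^'d" where
  "pr2 U = (\<lambda>x. fst (snd (U x)))"
definition pr3 :: "(real^'d \<Rightarrow> (real^'d) \<times> (real^'d) \<times> (real^'d)) \<Rightarrow> real^'d \<Rightarrow> real^'d" where
  "pr3 U = (\<lambda>x. snd (snd (U x)))"
definition triple :: "(real^'d \<Rightarrow> real^'d) \<Rightarrow> (real^'d \<Rightarrow> real^'d) \<Rightarrow> (real^'d \<Rightarrow> real^'d) \<Rightarrow>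
    real^'d \<Rightarrow> (real^'d) \<times> (real^'d) \<times> (real^'d)" where
  "triple u v w = (\<lambda>x. (u x, v x, w x))"

lemma pr_triple[simp]: "pr1 (triple u v w) = u" "pr2 (triple u v w) = v" "pr3 (triple u v w) = w"
  by (simp_all add: pr1_def pr2_def pr3_def triple_def)

lemma W_iff: "U \<in> W \<longleftrightarrow> pr1 U \<in> V \<and> pr2 U \<in> V\<^sub>1 \<and> pr3 U \<in> V\<^sub>2"
  by (simp add: W_def prod_space_def pr1_def pr2_def pr3_def)

lemma W_fin: "l2_fin_dim \<Omega> W"
  unfolding W_def by (intro l2_fin_dim_prod_space V_fin V1_fin V2_fin)

lemmas W_L2 = l2_fin_dimD(1)[OF W_fin] and W_lin = l2_fin_dimD(2)[OF W_fin]
lemmas V1_L2 = l2_fin_dimD(1)[OF V1_fin] and V2_L2 = l2_fin_dimD(1)[OF V2_fin]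

lemma zero_mem: "(\<lambda>x. 0) \<in> V" "(\<lambda>x. 0) \<in> V\<^sub>1" "(\<lambda>x. 0) \<in> V\<^sub>2"
  using lin_closed_zero l2_fin_dimD(2) V_fin V1_fin V2_fin by blast+

lemma ae_linear_pr: "ae_linear \<Omega> W pr1" "ae_linear \<Omega> W pr2" "ae_linear \<Omega> W pr3"
proof -
  note i = ae_linear_id[OF W_L2 W_lin]
  show "ae_linear \<Omega> W pr1"
    using ae_linear_bounded_linear[OF i bounded_linear_fst] by (simp add: pr1_def[abs_def])
  show "ae_linear \<Omega> W pr2"
    using ae_linear_bounded_linear[OF ae_linear_bounded_linear[OF i bounded_linear_snd] bounded_linear_fst]
    by (simp add: pr2_def[abs_def])
  show "ae_linear \<Omega> W pr3"
    using ae_linear_bounded_linear[OF ae_linear_bounded_linear[OF i bounded_linear_snd] bounded_linear_snd]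
    by (simp add: pr3_def[abs_def])
qed

lemma inner_W:
  assumes "U \<in> L2 \<Omega>" "U' \<in> L2 \<Omega>"
  shows "l2_inner \<Omega> U U' = l2_inner \<Omega> (pr1 U) (pr1 U') + l2_inner \<Omega> (pr2 U) (pr2 U') + l2_inner \<Omega> (pr3 U) (pr3 U')"
  using l2_inner_prod[OF assms] l2_inner_prod[OF L2_fst_snd(2)[OF assms(1)] L2_fst_snd(2)[OF assms(2)]]
  by (simp add: pr1_def pr2_def pr3_def)

text \<open>Serves twice: \<open>B q U = 0\<close> for all \<open>q\<close> is the discrete
  continuity equation, and \<open>- B p X\<close> is the pressure contribution to the sum of the
  momentum equation and the second subscale equation.\<close>

definition B :: "(real^'d \<Rightarrow> real) \<Rightarrow> (real^'d \<Rightarrow> (real^'d) \<times> (real^'d) \<times> (real^'d)) \<Rightarrow> real" where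
  "B q U = l2_inner \<Omega> q (vdiv \<Omega> (pr1 U)) - l2_inner \<Omega> (grad \<Omega> q) (pr3 U)"

lemma ae_linear_W: "ae_linear \<Omega> V A \<Longrightarrow> ae_linear \<Omega> W (\<lambda>U. A (pr1 U))"
  by (erule ae_linear_compose[OF ae_linear_pr(1)]) (simp add: W_iff)

lemmas ae_linear_V_vdiv = ae_linear_V_h[OF ae_linear_vdiv]
  and ae_linear_V_sym_grad = ae_linear_V_h[OF ae_linear_sym_grad]
  and ae_linear_V_vgrad = ae_linear_V_h[OF ae_linear_vgrad]

lemma B_functional: "q \<in> S \<Longrightarrow> ae_functional \<Omega> W (B q)"
  unfolding B_def[abs_def]
  by (intro ae_functional_diff ae_functional_inner_right ae_linear_W ae_linear_V_vdiv ae_linear_pr)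
    (use S_L2 S_h_H1 grad_L2 in blast)+

lemma B_lincomb:
  assumes q: "q \<in> S" "q' \<in> S" and U: "U \<in> W"
  shows "B (\<lambda>x. a *\<^sub>R q x + b *\<^sub>R q' x) U = a * B q U + b * B q' U"
proof -
  have gl: "ae_linear \<Omega> S (grad \<Omega>)" by (rule ae_linear_subset[OF ae_linear_grad S_h_H1 lin_closed_S_h])
  have d: "vdiv \<Omega> (pr1 U) \<in> L2 \<Omega>" "pr3 U \<in> L2 \<Omega>"
    using ae_linearD(3)[OF ae_linear_W[OF ae_linear_V_vdiv] U] ae_linearD(3)[OF ae_linear_pr(3) U] by auto
  have "ae_functional \<Omega> S (\<lambda>q. B q U)"
    unfolding B_def
    by (intro ae_functional_diff ae_functional_inner_left ae_linear_id gl d S_L2 lin_closed_S_h)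
  from ae_functionalD(1)[OF this q] show ?thesis by simp
qed

text \<open>
  \<open>R\<close> is the range of the adjoint of the constraint, represented in \<open>W\<close>, and \<open>Z\<close> is its orthogonal
  complement in \<open>W\<close>.
\<close>

definition R :: "(real^'d \<Rightarrow> (real^'d) \<times> (real^'d) \<times> (real^'d)) set" where
  "R = {r \<in> W. \<exists>q\<in>S. \<forall>U\<in>W. l2_inner \<Omega> r U = B q U}"

definition Z :: "(real^'d \<Rightarrow> (real^'d) \<times> (real^'d) \<times> (real^'d)) set" where
  "Z = {U \<in> W. \<forall>q\<in>S. B q U = 0}"

lemma lin_closed_R: "lin_closed R"
  unfolding lin_closed_def
proof (intro conjI ballI allI)
  have "B (\<lambda>x. 0) U = 0" if "U \<in> W" for U
    using B_lincomb[OF lin_closed_zero lin_closed_zero that, of 0 0] lin_closed_S_h by simp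
  then show "(\<lambda>x. 0) \<in> R"
    using lin_closed_zero[OF W_lin] lin_closed_zero[OF lin_closed_S_h] by (auto simp: R_def)
  fix r s a b assume "r \<in> R" "s \<in> R"
  then obtain q q' where rs: "r \<in> W" "s \<in> W" and q: "q \<in> S" "\<And>U. U \<in> W \<Longrightarrow> l2_inner \<Omega> r U = B q U"
    and q': "q' \<in> S" "\<And>U. U \<in> W \<Longrightarrow> l2_inner \<Omega> s U = B q' U" unfolding R_def by blast
  have "l2_inner \<Omega> (\<lambda>x. a *\<^sub>R r x + b *\<^sub>R s x) U = B (\<lambda>x. a *\<^sub>R q x + b *\<^sub>R q' x) U" if "U \<in> W" for U
    using B_lincomb[OF q(1) q'(1) that, of a b] q(2)[OF that] q'(2)[OF that] rs that W_L2
    by (subst l2_inner_lincomb_left) auto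
  moreover have "(\<lambda>x. a *\<^sub>R q x + b *\<^sub>R q' x) \<in> S" by (rule lin_closed_lincomb[OF lin_closed_S_h q(1) q'(1)])
  moreover have "(\<lambda>x. a *\<^sub>R r x + b *\<^sub>R s x) \<in> W" by (rule lin_closed_lincomb[OF W_lin rs])
  ultimately show "(\<lambda>x. a *\<^sub>R r x + b *\<^sub>R s x) \<in> R" unfolding R_def by blast
qed

text \<open>Riesz representation, obtained from \<open>functional_in_complement\<close> with the
  full space in place of the subspace.\<close>

lemma constraint_represented:
  assumes q: "q \<in> S" shows "\<exists>r\<in>R. \<forall>U\<in>W. l2_inner \<Omega> r U = B q U"
proof -
  have "\<exists>r\<in>W. \<forall>w\<in>W. B q w = l2_inner \<Omega> r w"
  proof (rule functional_in_complement[OF W_fin order_refl W_lin B_functional[OF q]])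
    fix z assume z: "z \<in> W" "\<And>r. r \<in> W \<Longrightarrow> l2_inner \<Omega> r z = 0"
    then have "l2_eq \<Omega> z (\<lambda>x. 0)" using W_L2 l2_inner_self_eq_0 by blast
    then have "B q z = B q (\<lambda>x. 0)" using ae_functionalD(2)[OF B_functional[OF q] z(1) lin_closed_zero[OF W_lin]] by blast
    also have "\<dots> = 0" using ae_functional_sum[OF B_functional[OF q] W_lin, of "{}"] by simp
    finally show "B q z = 0" .
  qed
  then obtain r where r: "r \<in> W" "\<And>U. U \<in> W \<Longrightarrow> l2_inner \<Omega> r U = B q U" by metis
  then have "r \<in> R" unfolding R_def using q by blast
  with r(2) show ?thesis by blast
qed

lemma lin_closed_Z: "lin_closed Z"
proof -
  have "B q (\<lambda>x. 0) = 0" if "q \<in> S" for q using ae_functional_sum[OF B_functional[OF that] W_lin, of "{}"] by simp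
  moreover have "B q (\<lambda>x. a *\<^sub>R u x + b *\<^sub>R v x) = 0" if "q \<in> S" "u \<in> Z" "v \<in> Z" for q u v a b
    using ae_functionalD(1)[OF B_functional[OF that(1)], of u v a b] that by (auto simp: Z_def)
  ultimately show ?thesis
    using lin_closed_zero[OF W_lin] lin_closed_lincomb[OF W_lin] unfolding lin_closed_def Z_def by auto
qed

lemma Z_fin: "l2_fin_dim \<Omega> Z"
  by (rule l2_fin_dim_subset[OF W_fin _ lin_closed_Z]) (auto simp: Z_def)

text \<open>By \<open>constraint_represented\<close> every element of \<open>W\<close> orthogonal to
  \<open>R\<close> lies in \<open>Z\<close>. A functional that vanishes on \<open>Z\<close> is
  therefore represented in \<open>R\<close>, and membership in \<open>R\<close> supplies the
  multiplier.\<close>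

lemma pressure_exists:
  assumes L: "ae_functional \<Omega> W L" and L0: "\<And>z. z \<in> Z \<Longrightarrow> L z = 0"
  shows "\<exists>q\<in>S. \<forall>U\<in>W. L U = B q U"
proof -
  have "\<exists>r\<in>R. \<forall>w\<in>W. L w = l2_inner \<Omega> r w"
  proof (rule functional_in_complement[OF W_fin _ lin_closed_R L])
    show "R \<subseteq> W" by (auto simp: R_def)
    fix z assume z: "z \<in> W" "\<And>r. r \<in> R \<Longrightarrow> l2_inner \<Omega> r z = 0"
    have "B q z = 0" if q: "q \<in> S" for q
      using constraint_represented[OF q] z by fastforce
    then show "L z = 0" using L0 z(1) by (simp add: Z_def)
  qed
  then show ?thesis unfolding R_def by fastforce
qed

lemma pressure_unique:
  assumes r: "r \<in> S" and B0: "\<And>U. U \<in> W \<Longrightarrow> B r U = 0"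
    and stab: "\<beta>\<^sub>0 > 0" "projection_stability \<Omega> \<T> k \<beta>\<^sub>0"
  shows "\<exists>c. \<forall>x\<in>\<Omega>. r x = c"
proof -
  define z where "z = grad \<Omega> r"
  define a where "a = l2_proj \<Omega> V z"
  define b where "b = l2_perp \<Omega> (vec_fields S) z"
  have rH: "r \<in> H1 \<Omega>" using r S_h_H1 by blast
  have zL: "z \<in> L2 \<Omega>" unfolding z_def by (rule grad_L2[OF rH])
  have vdiv0: "l2_inner \<Omega> r (vdiv \<Omega> (\<lambda>x. 0)) = 0"
    using inner_vdiv[OF rH zero_mem(1)] by simp
  have zv: "l2_inner \<Omega> z v = 0" if v: "v \<in> V" for v
    using B0[of "triple v (\<lambda>x. 0) (\<lambda>x. 0)"] v zero_mem inner_vdiv[OF rH v] by (simp add: W_iff B_def z_def)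
  have aV: "a \<in> V" unfolding a_def by (rule l2_proj_mem[OF V_fin zL])
  have aL: "a \<in> L2 \<Omega>" using aV V_h_sub(3) by blast
  have "l2_inner \<Omega> a a = 0" using l2_inner_proj[OF V_fin zL aV] zv[OF aV] by (simp add: a_def)
  then have a0: "l2_eq \<Omega> a (\<lambda>x. 0)" using aL by (simp add: l2_inner_self_eq_0)
  \<comment> \<open>The part of the gradient orthogonal to \<open>vec_fields S\<close> is itself a
    second subscale, so it may serve as a test function.\<close>
  have bV: "b \<in> V\<^sub>2" unfolding b_def z_def by (rule perp_grad_V2[OF r])
  have bL: "b \<in> L2 \<Omega>" using bV V2_L2 by blast
  have zb: "l2_inner \<Omega> z b = 0"
    using B0[of "triple (\<lambda>x. 0) (\<lambda>x. 0) b"] bV zero_mem vdiv0 by (simp add: W_iff B_def z_def)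
  have pL: "l2_proj \<Omega> (vec_fields S) z \<in> L2 \<Omega>" by (rule l2_proj_L2[OF vec_S_fin zL])
  \<comment> \<open>As \<open>b\<close> is orthogonal to the projection of \<open>z\<close>, its
    product with \<open>z\<close> equals its squared norm.\<close>
  have "l2_inner \<Omega> b (l2_proj \<Omega> (vec_fields S) z) = 0"
    unfolding b_def by (rule l2_inner_perp[OF vec_S_fin zL l2_proj_mem[OF vec_S_fin zL]])
  then have "l2_inner \<Omega> b b = 0"
    using l2_inner_diff_left[OF zL pL bL] zb by (simp add: b_def l2_perp_def[abs_def] l2_inner_commute)
  then have b0: "l2_eq \<Omega> b (\<lambda>x. 0)" using bL by (simp add: l2_inner_self_eq_0)
  have "l2_eq \<Omega> (\<lambda>x. a x + b x) (\<lambda>x. 0)" using a0 b0 unfolding l2_eq_def by eventually_elim simp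
  then have ab: "l2_norm \<Omega> (\<lambda>x. a x + b x) = 0" using l2_norm_eq_0[OF L2_add[OF aL bL]] by blast
  have "l2_norm \<Omega> z \<le> 1 / \<beta>\<^sub>0 * l2_norm \<Omega> (\<lambda>x. a x + b x)"
    using bspec[OF stab(2)[unfolded projection_stability_def Let_def] r] unfolding z_def a_def b_def by (rule conjunct1)
  then have "l2_norm \<Omega> z = 0" using ab l2_norm_ge_0[of \<Omega> z] by simp
  then have "l2_eq \<Omega> (grad \<Omega> r) (\<lambda>x. 0)" using l2_norm_eq_0[OF zL] by (simp add: z_def)
  then show ?thesis using zero_grad_const r S_h_pc1 by blast
qed

end

lemma ae_functional_zero: "ae_functional \<Omega> W L \<Longrightarrow> lin_closed W \<Longrightarrow> L (\<lambda>x. 0) = 0"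
  using ae_functional_sum[of \<Omega> W L "{}"] by simp

lemma conv_form_inner: "conv_form \<Omega> u v z = l2_inner \<Omega> (conv \<Omega> u v) z"
  by (simp add: conv_form_def l2_inner_def)

lemma itg_le_integral:
  fixes g :: "real \<Rightarrow> real"
  assumes T: "0 < T" and I: "I = time_interval T" and g: "integrable (lebesgue_on I) g" and g0: "\<And>s. 0 \<le> g s" and t: "t \<in> I"
  shows "integrable (lebesgue_on {0..t}) g" "itg t g \<le> (\<integral>s. g s \<partial>lebesgue_on I)"
proof -
  have sub: "{0..t} \<subseteq> I" using time_interval_props(5)[OF T] t I by blast
  have Is: "I \<inter> space lebesgue \<in> sets lebesgue" using time_interval_props(3)[OF T] I by simp
  have gi: "integrable lebesgue (\<lambda>s. indicator I s *\<^sub>R g s)"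
    using g integrable_restrict_space[OF Is, of g] by simp
  have "integrable lebesgue (\<lambda>s. indicator {0..t} s *\<^sub>R (indicator I s *\<^sub>R g s))"
    by (rule integrable_mult_indicator[OF _ gi]) simp
  also have "(\<lambda>s. indicator {0..t} s *\<^sub>R (indicator I s *\<^sub>R g s)) = (\<lambda>s. indicator {0..t} s *\<^sub>R g s)"
    using sub by (auto simp: fun_eq_iff indicator_def)
  finally have gt: "integrable lebesgue (\<lambda>s. indicator {0..t} s *\<^sub>R g s)" .
  then show "integrable (lebesgue_on {0..t}) g"
    using integrable_restrict_space[of "{0..t}" lebesgue g] by simp
  have "itg t g = (\<integral>s. indicator {0..t} s *\<^sub>R g s \<partial>lebesgue)"
    unfolding itg_def by (rule integral_restrict_space) simp
  also have "\<dots> \<le> (\<integral>s. indicator I s *\<^sub>R g s \<partial>lebesgue)"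
    by (rule integral_mono[OF gt gi]) (use g0 sub in \<open>auto simp: indicator_def\<close>)
  also have "\<dots> = (\<integral>s. g s \<partial>lebesgue_on I)" by (rule integral_restrict_space[OF Is, symmetric])
  finally show "itg t g \<le> (\<integral>s. g s \<partial>lebesgue_on I)" .
qed

text \<open>In coordinates each product is a finite sum of continuous coefficients with constant
  factors. The operator \<open>A\<close> will be a projection to one field, the gradient or the
  symmetric gradient of the velocity.\<close>

lemma continuous_l2_inner_expansion:
  assumes A: "ae_linear \<Omega> W A" and e: "\<And>i. i < N \<Longrightarrow> e i \<in> W"
    and x: "\<And>i. i < N \<Longrightarrow> continuous_on J (\<lambda>s. x s i)"
  defines "U \<equiv> \<lambda>s y. \<Sum>i<(N::nat). x s i *\<^sub>R e i y"
  shows "\<And>z. z \<in> L2 \<Omega> \<Longrightarrow> continuous_on J (\<lambda>s::real. l2_inner \<Omega> (A (U s)) z)"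
    and "continuous_on J (\<lambda>s. l2_inner \<Omega> (A (U s)) (A (U s)))"
proof -
  have lin: "l2_inner \<Omega> (A (U s)) z = (\<Sum>i<N. x s i * l2_inner \<Omega> (A (e i)) z)" if "z \<in> L2 \<Omega>" for s z
    unfolding U_def
    by (rule ae_functional_sum[OF ae_functional_inner_left[OF A that] ae_linearD(2)[OF A]]) (auto intro: e)
  then show c: "continuous_on J (\<lambda>s. l2_inner \<Omega> (A (U s)) z)" if "z \<in> L2 \<Omega>" for z
    using that x by (auto intro!: continuous_intros)
  have UL: "A (U s) \<in> L2 \<Omega>" for s
    unfolding U_def by (intro ae_linearD(3)[OF A] lin_closed_sum[OF ae_linearD(2)[OF A]] e) simp
  have "continuous_on J (\<lambda>s. \<Sum>i<N. x s i * l2_inner \<Omega> (A (U s)) (A (e i)))"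
    using x c ae_linearD(3)[OF A e] by (auto intro!: continuous_intros)
  then show "continuous_on J (\<lambda>s. l2_inner \<Omega> (A (U s)) (A (U s)))"
    using lin[OF UL] by (simp add: l2_inner_commute)
qed

section \<open>The linearised problem\<close>

locale linearised_problem = fe_system \<Omega> \<T> k n\<^sub>u \<phi> n\<^sub>p \<psi>
  for \<Omega> :: "(real^'d::finite) set" and \<T> k n\<^sub>u \<phi> n\<^sub>p \<psi> +
  fixes T :: ereal and I :: "real set" and C\<^sub>\<mu> \<mu>inf \<mu>\<^sub>0 c\<^sub>1 c\<^sub>2 c\<^sub>K \<beta>\<^sub>0 :: real
    and \<mu> :: "real^'d \<Rightarrow> real \<Rightarrow> real" and m :: "real \<Rightarrow> real"
    and f :: "real \<Rightarrow> 'd \<Rightarrow> (real^'d \<Rightarrow> real) \<Rightarrow> real" and u\<^sub>0 :: "real^'d \<Rightarrow> real^'d"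
    and w :: "real \<Rightarrow> real^'d \<Rightarrow> real^'d"
  assumes T: "0 < T" and I: "I = time_interval T"
    and alg: "c\<^sub>1 > 0" "c\<^sub>2 > 0"
    and korn: "\<And>v. v \<in> vec_fields (H10 \<Omega>) \<Longrightarrow> vh1_norm \<Omega> v \<le> c\<^sub>K * l2_norm \<Omega> (sym_grad \<Omega> v)"
    and stab: "\<beta>\<^sub>0 > 0" "projection_stability \<Omega> \<T> k \<beta>\<^sub>0"
    and visc: "viscosity \<Omega> C\<^sub>\<mu> \<mu>inf \<mu>\<^sub>0 \<mu>"
    and m_meas: "m \<in> borel_measurable (lebesgue_on I)" and m_bd: "\<And>t. t \<in> I \<Longrightarrow> \<mu>inf \<le> m t \<and> m t \<le> \<mu>\<^sub>0"
    and f: "f \<in> L2_Hm1 \<Omega> I" and u0: "u\<^sub>0 \<in> L2 \<Omega>"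
    and compat: "compatible_initial_data \<Omega> \<T> k V\<^sub>2 u\<^sub>0"
    and wV: "\<And>t. t \<in> I \<Longrightarrow> w t \<in> V" and w_meas: "l2_measurable \<Omega> I w"
    and w_int: "\<And>t. t \<in> I \<Longrightarrow> integrable (lebesgue_on {0..t}) (\<lambda>s. l2_norm \<Omega> (w s))"
begin

section \<open>The viscosity, and restriction to bounded time intervals\<close>

lemma mu_pos: "\<mu>inf > 0" "\<mu>\<^sub>0 > 0" using visc by (auto simp: viscosity_def)

lemma mu_bd: "x \<in> \<Omega> \<Longrightarrow> 0 \<le> r \<Longrightarrow> \<mu>inf \<le> \<mu> x r \<and> \<mu> x r \<le> \<mu>\<^sub>0"
  using visc closure_subset[of \<Omega>] unfolding viscosity_def by blast

text \<open>The absolute value extends \<open>\<mu> x\<close> from nonnegative arguments to the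
  whole line, where \<open>borel_measurable_Caratheodory\<close> asks for continuity; on norms the
  two agree.\<close>

lemma mu_cont: "x \<in> \<Omega> \<Longrightarrow> continuous_on UNIV (\<lambda>r. \<mu> x \<bar>r\<bar>)"
proof -
  assume x: "x \<in> \<Omega>"
  have "lipschitz_on C\<^sub>\<mu> UNIV (\<lambda>r. \<mu> x \<bar>r\<bar>)"
  proof (rule lipschitz_onI)
    fix r s :: real
    have "\<bar>\<mu> x \<bar>r\<bar> - \<mu> x \<bar>s\<bar>\<bar> \<le> C\<^sub>\<mu> * \<bar>\<bar>r\<bar> - \<bar>s\<bar>\<bar>"
      using visc x closure_subset[of \<Omega>] unfolding viscosity_def by auto
    also have "\<dots> \<le> C\<^sub>\<mu> * \<bar>r - s\<bar>"
      using visc unfolding viscosity_def by (intro mult_left_mono) auto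
    finally show "dist (\<mu> x \<bar>r\<bar>) (\<mu> x \<bar>s\<bar>) \<le> C\<^sub>\<mu> * dist r s" by (simp add: dist_real_def)
  qed (use visc in \<open>simp add: viscosity_def\<close>)
  then show ?thesis by (rule lipschitz_on_continuous_on)
qed

lemma mu_meas: "(\<lambda>x. \<mu> x \<bar>r\<bar>) \<in> borel_measurable (lebesgue_on \<Omega>)"
  using visc unfolding viscosity_def by auto

lemma mu_compose_meas:
  "g \<in> borel_measurable (lebesgue_on \<Omega>) \<Longrightarrow> (\<lambda>x. \<mu> x (norm (g x))) \<in> borel_measurable (lebesgue_on \<Omega>)"
  for g :: "real^'d \<Rightarrow> real^'d^'d"
  using borel_measurable_Caratheodory[of "\<lambda>x r. \<mu> x \<bar>r\<bar>" "lebesgue_on \<Omega>" "\<lambda>x. norm (g x)"] mu_meas mu_cont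
  by simp

lemma interval_I: "0 \<in> I" "I \<in> sets lebesgue" "\<And>t. t \<in> I \<Longrightarrow> 0 \<le> t" "\<And>t s. t \<in> I \<Longrightarrow> s \<in> {0..t} \<Longrightarrow> s \<in> I"
  using time_interval_props(2-5)[OF T] unfolding I by blast+

lemma AE_I: "AE t in lebesgue_on I. t \<in> I" by (rule AE_I2) simp

lemma meas_sub: "t \<in> I \<Longrightarrow> g \<in> borel_measurable (lebesgue_on I) \<Longrightarrow> g \<in> borel_measurable (lebesgue_on {0..t})"
  by (rule measurable_restrict_mono) (auto intro: interval_I(4))

lemma AE_sub:
  assumes "t \<in> I" "AE s in lebesgue_on I. P s" shows "AE s in lebesgue_on {0..t}. P s"
proof -
  have "AE s in lebesgue. s \<in> I \<longrightarrow> P s" using assms(2) interval_I(2) by (simp add: AE_restrict_space_iff)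
  then have "AE s in lebesgue. s \<in> {0..t} \<longrightarrow> P s" by eventually_elim (use interval_I(4)[OF assms(1)] in blast)
  then show ?thesis by (simp add: AE_restrict_space_iff)
qed

lemma bounded_integrable:
  fixes g :: "real \<Rightarrow> real"
  assumes t: "t \<in> I" and g: "g \<in> borel_measurable (lebesgue_on I)" and C: "\<And>s. s \<in> I \<Longrightarrow> \<bar>g s\<bar> \<le> C"
  shows "integrable (lebesgue_on {0..t}) g"
proof -
  interpret J: finite_measure "lebesgue_on {0..t}" by (rule finite_measure_lebesgue_on) simp
  show ?thesis
    by (rule J.integrable_const_bound[of _ C]) (use C interval_I(4)[OF t] meas_sub[OF t g] in auto)
qed

section \<open>The bilinear form of the summed equations\<close>

definition visc_form :: "real \<Rightarrow> (real^'d \<Rightarrow> real^'d) \<Rightarrow> (real^'d \<Rightarrow> real^'d) \<Rightarrow> real" where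
  "visc_form s u v = l2_inner \<Omega> (\<lambda>x. (2 * \<mu> x (norm (sym_grad \<Omega> (w s) x))) *\<^sub>R sym_grad \<Omega> u x) (sym_grad \<Omega> v)"

definition inv_tau1_at :: "real \<Rightarrow> real" where "inv_tau1_at s = inverse (tau1 \<Omega> (mesh_size \<T>) c\<^sub>1 c\<^sub>2 (m s) (w s))"
definition tau2_at :: "real \<Rightarrow> real" where "tau2_at s = tau2 \<Omega> (mesh_size \<T>) c\<^sub>1 c\<^sub>2 (m s) (w s)"

text \<open>The equations for the velocity and the two subscales added up for one test triple,
  without time derivatives, pressure and force. Test triples with a single nonzero field recover
  each equation.\<close>

definition a :: "real \<Rightarrow> (real^'d \<Rightarrow> (real^'d) \<times> (real^'d) \<times> (real^'d)) \<Rightarrow>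
    (real^'d \<Rightarrow> (real^'d) \<times> (real^'d) \<times> (real^'d)) \<Rightarrow> real" where
  "a s U X = visc_form s (pr1 U) (pr1 X) + conv_form \<Omega> (w s) (pr1 U) (pr1 X)
     + tau2_at s * l2_inner \<Omega> (vdiv \<Omega> (pr1 X)) (l2_perp \<Omega> S (vdiv \<Omega> (pr1 U)))
     - conv_form \<Omega> (w s) (pr1 X) (pr2 U) + inv_tau1_at s * l2_inner \<Omega> (pr2 U) (pr2 X)
     + conv_form \<Omega> (w s) (pr1 U) (pr2 X) + inv_tau1_at s * l2_inner \<Omega> (pr3 U) (pr3 X)"

definition F :: "real \<Rightarrow> (real^'d \<Rightarrow> (real^'d) \<times> (real^'d) \<times> (real^'d)) \<Rightarrow> real" where
  "F s X = pairing (f s) (pr1 X)"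

lemma sym_grad_V_L2: "v \<in> V \<Longrightarrow> sym_grad \<Omega> v \<in> L2 \<Omega>" by (rule ae_linearD(3)[OF ae_linear_V_sym_grad])
lemma vdiv_V_L2: "v \<in> V \<Longrightarrow> vdiv \<Omega> v \<in> L2 \<Omega>" by (rule ae_linearD(3)[OF ae_linear_V_vdiv])

lemma ae_linear_visc:
  assumes "s \<in> I"
  shows "ae_linear \<Omega> V (\<lambda>u x. (2 * \<mu> x (norm (sym_grad \<Omega> (w s) x))) *\<^sub>R sym_grad \<Omega> u x)"
proof (rule ae_linear_bounded_mult[OF ae_linear_V_sym_grad bounded_bilinear_scaleR])
  show "(\<lambda>x. 2 * \<mu> x (norm (sym_grad \<Omega> (w s) x))) \<in> borel_measurable (lebesgue_on \<Omega>)"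
    using mu_compose_meas[OF L2_measurable[OF sym_grad_V_L2[OF wV[OF assms]]]] by simp
  show "norm (2 * \<mu> x (norm (sym_grad \<Omega> (w s) x))) \<le> 2 * \<mu>\<^sub>0" if "x \<in> \<Omega>" for x
    using mu_bd[OF that, of "norm (sym_grad \<Omega> (w s) x)"] mu_pos by auto
qed

lemma visc_left: "s \<in> I \<Longrightarrow> v \<in> V \<Longrightarrow> ae_functional \<Omega> V (\<lambda>u. visc_form s u v)"
  unfolding visc_form_def by (intro ae_functional_inner_left ae_linear_visc sym_grad_V_L2)

lemma visc_right: "s \<in> I \<Longrightarrow> u \<in> V \<Longrightarrow> ae_functional \<Omega> V (visc_form s u)"
  unfolding visc_form_def[abs_def]
  by (intro ae_functional_inner_right ae_linear_V_sym_grad ae_linearD(3)[OF ae_linear_visc])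

lemma conv_L2: "s \<in> I \<Longrightarrow> u \<in> V \<Longrightarrow> conv \<Omega> (w s) u \<in> L2 \<Omega>"
  using ae_linearD(3)[OF ae_linear_conv_right] wV by blast

lemma conv_mid: "s \<in> I \<Longrightarrow> z \<in> L2 \<Omega> \<Longrightarrow> ae_functional \<Omega> V (\<lambda>v. conv_form \<Omega> (w s) v z)"
  unfolding conv_form_inner by (intro ae_functional_inner_left ae_linear_conv_right wV)

lemma W_pr: "U \<in> W \<Longrightarrow> pr1 U \<in> V" "U \<in> W \<Longrightarrow> pr2 U \<in> V\<^sub>1" "U \<in> W \<Longrightarrow> pr3 U \<in> V\<^sub>2"
  "U \<in> W \<Longrightarrow> pr1 U \<in> L2 \<Omega>" "U \<in> W \<Longrightarrow> pr2 U \<in> L2 \<Omega>" "U \<in> W \<Longrightarrow> pr3 U \<in> L2 \<Omega>"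
  using V_h_sub(3) V1_L2 V2_L2 by (auto simp: W_iff)

lemma functional_pr1: "ae_functional \<Omega> V L \<Longrightarrow> ae_functional \<Omega> W (\<lambda>U. L (pr1 U))"
  by (erule ae_functional_compose[OF _ ae_linear_pr(1) W_pr(1) lin_closed_V_h])

lemma div_right: "y \<in> L2 \<Omega> \<Longrightarrow> ae_functional \<Omega> V (\<lambda>v. l2_inner \<Omega> (vdiv \<Omega> v) y)"
  by (intro ae_functional_inner_left ae_linear_V_vdiv)

lemma ae_linear_perp_vdiv: "ae_linear \<Omega> V (\<lambda>u. l2_perp \<Omega> S (vdiv \<Omega> u))"
  by (rule ae_linear_compose[OF ae_linear_V_vdiv ae_linear_l2_perp[OF S_fin] vdiv_V_L2])

lemma a_left: assumes s: "s \<in> I" and X: "X \<in> W" shows "ae_functional \<Omega> W (\<lambda>U. a s U X)"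
  unfolding a_def
  by (intro ae_functional_add ae_functional_diff ae_functional_scale)
    (intro functional_pr1 visc_left conv_mid s W_pr X
      ae_functional_inner_right ae_functional_inner_left ae_linear_perp_vdiv ae_linear_pr vdiv_V_L2
      | simp only: conv_form_inner, intro ae_functional_inner_right ae_linear_pr conv_L2 s W_pr X)+

lemma a_right: assumes s: "s \<in> I" and U: "U \<in> W" shows "ae_functional \<Omega> W (a s U)"
proof -
  have "ae_functional \<Omega> W (\<lambda>X. conv_form \<Omega> (w s) (pr1 U) (pr1 X))"
    "ae_functional \<Omega> W (\<lambda>X. conv_form \<Omega> (w s) (pr1 U) (pr2 X))"
    unfolding conv_form_inner
    by (intro ae_functional_inner_right ae_linear_pr conv_L2[OF s] W_pr(1)[OF U])+
  moreover have "ae_functional \<Omega> W (\<lambda>X. visc_form s (pr1 U) (pr1 X))"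
    by (rule functional_pr1[OF visc_right[OF s W_pr(1)[OF U]]])
  moreover have "ae_functional \<Omega> W (\<lambda>X. conv_form \<Omega> (w s) (pr1 X) (pr2 U))"
    by (rule functional_pr1[OF conv_mid[OF s W_pr(5)[OF U]]])
  moreover have "ae_functional \<Omega> W (\<lambda>X. l2_inner \<Omega> (vdiv \<Omega> (pr1 X)) (l2_perp \<Omega> S (vdiv \<Omega> (pr1 U))))"
    by (rule functional_pr1[OF div_right[OF ae_linearD(3)[OF ae_linear_perp_vdiv W_pr(1)[OF U]]]])
  moreover have "ae_functional \<Omega> W (\<lambda>X. l2_inner \<Omega> (pr2 U) (pr2 X))" "ae_functional \<Omega> W (\<lambda>X. l2_inner \<Omega> (pr3 U) (pr3 X))"
    by (intro ae_functional_inner_right ae_linear_pr W_pr(5,6)[OF U])+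
  ultimately show ?thesis
    unfolding a_def[abs_def] by (intro ae_functional_add ae_functional_diff ae_functional_scale)
qed

lemma h_ge_0: "0 \<le> mesh_size \<T>"
proof -
  have "\<T> \<noteq> {}" using finite_convex_cells(3) domain closure_subset[of \<Omega>] by (auto simp: polyhedral_domain_def)
  then have "Max (diameter ` \<T>) \<in> diameter ` \<T>" using finite_convex_cells(1) by (intro Max_in) auto
  then obtain K where K: "K \<in> \<T>" "Max (diameter ` \<T>) = diameter K" by blast
  have "bounded K" using finite_convex_cells(2)[OF K(1)] compact_imp_bounded by blast
  then show ?thesis unfolding mesh_size_def K(2) by (rule diameter_ge_0)
qed

lemma inv_tau1_at_eq: "inv_tau1_at s = c\<^sub>1 * m s / (mesh_size \<T>)\<^sup>2 + c\<^sub>2 * linf_norm \<Omega> (w s) / mesh_size \<T>"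
  by (simp add: inv_tau1_at_def tau1_def)

lemma tau2_at_eq: "tau2_at s = (mesh_size \<T>)\<^sup>2 / c\<^sub>1 * inv_tau1_at s"
  by (simp add: tau2_at_def tau2_def inv_tau1_at_def divide_inverse)

lemma stab_params_ge_0: assumes "s \<in> I" shows "0 \<le> inv_tau1_at s" "0 \<le> tau2_at s"
proof -
  show "0 \<le> inv_tau1_at s" unfolding inv_tau1_at_eq
    using alg h_ge_0 m_bd[OF assms] mu_pos linf_norm_ge_0[OF wV[OF assms]]
    by (intro add_nonneg_nonneg divide_nonneg_nonneg mult_nonneg_nonneg) auto
  then show "0 \<le> tau2_at s" unfolding tau2_at_eq using alg by simp
qed

text \<open>The factor 2 stems from the viscous term; half of the constant will be spent on
  absorbing the force. The divergence term is nonnegative because the product of a function with its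
  orthogonal part is the squared norm of that part.\<close>

lemma coercive:
  assumes s: "s \<in> I" and U: "U \<in> W"
  shows "2 * \<mu>inf * l2_inner \<Omega> (sym_grad \<Omega> (pr1 U)) (sym_grad \<Omega> (pr1 U)) \<le> a s U U"
proof -
  let ?u = "pr1 U" let ?g = "sym_grad \<Omega> ?u"
  have u: "?u \<in> V" by (rule W_pr(1)[OF U])
  have gL: "?g \<in> L2 \<Omega>" by (rule sym_grad_V_L2[OF u])
  have "2 * \<mu>inf * l2_inner \<Omega> ?g ?g = (\<integral>x. 2 * \<mu>inf * (?g x \<bullet> ?g x) \<partial>lebesgue_on \<Omega>)"
    by (simp add: l2_inner_def)
  also have "\<dots> \<le> visc_form s ?u ?u"
    unfolding visc_form_def l2_inner_def
  proof (rule integral_mono)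
    show "integrable (lebesgue_on \<Omega>) (\<lambda>x. 2 * \<mu>inf * (?g x \<bullet> ?g x))"
      using L2_integrable_inner[OF gL gL] by auto
    show "integrable (lebesgue_on \<Omega>) (\<lambda>x. (2 * \<mu> x (norm (sym_grad \<Omega> (w s) x))) *\<^sub>R ?g x \<bullet> ?g x)"
      by (rule L2_integrable_inner[OF ae_linearD(3)[OF ae_linear_visc[OF s] u] gL])
    fix x assume "x \<in> space (lebesgue_on \<Omega>)"
    then have "\<mu>inf \<le> \<mu> x (norm (sym_grad \<Omega> (w s) x))" using mu_bd[of x] by simp
    then show "2 * \<mu>inf * (?g x \<bullet> ?g x) \<le> (2 * \<mu> x (norm (sym_grad \<Omega> (w s) x))) *\<^sub>R ?g x \<bullet> ?g x"
      by (simp add: mult_right_mono)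
  qed
  finally have 1: "2 * \<mu>inf * l2_inner \<Omega> ?g ?g \<le> visc_form s ?u ?u" .
  let ?z = "vdiv \<Omega> ?u" let ?p = "l2_perp \<Omega> S ?z"
  have zL: "?z \<in> L2 \<Omega>" by (rule vdiv_V_L2[OF u])
  have pL: "?p \<in> L2 \<Omega>" by (rule l2_perp_L2[OF S_fin zL])
  have "l2_inner \<Omega> ?p ?p = l2_inner \<Omega> ?z ?p - l2_inner \<Omega> (l2_proj \<Omega> S ?z) ?p"
    using l2_inner_diff_left[OF zL l2_proj_L2[OF S_fin zL] pL] by (simp add: l2_perp_def[abs_def])
  also have "l2_inner \<Omega> (l2_proj \<Omega> S ?z) ?p = 0"
    using l2_inner_perp[OF S_fin zL l2_proj_mem[OF S_fin zL]] by (simp add: l2_inner_commute)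
  finally have "0 \<le> l2_inner \<Omega> ?z ?p" using l2_inner_ge_0[of \<Omega> ?p] by simp
  then have 2: "0 \<le> tau2_at s * l2_inner \<Omega> ?z ?p" using stab_params_ge_0(2)[OF s] by simp
  have 3: "0 \<le> inv_tau1_at s * l2_inner \<Omega> (pr2 U) (pr2 U)" "0 \<le> inv_tau1_at s * l2_inner \<Omega> (pr3 U) (pr3 U)"
    by (simp_all add: l2_inner_ge_0 stab_params_ge_0(1)[OF s])
  show ?thesis unfolding a_def conv_form_skew[OF wV[OF s] u] using 1 2 3 by linarith
qed

section \<open>Integrability in time of the coefficients\<close>

lemma inner_w_integrable:
  assumes t: "t \<in> I" and z: "z \<in> L2 \<Omega>" shows "integrable (lebesgue_on {0..t}) (\<lambda>s. l2_inner \<Omega> (w s) z)"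
proof (rule Bochner_Integration.integrable_bound)
  show "integrable (lebesgue_on {0..t}) (\<lambda>s. l2_norm \<Omega> (w s) * l2_norm \<Omega> z)" using w_int[OF t] by auto
  show "(\<lambda>s. l2_inner \<Omega> (w s) z) \<in> borel_measurable (lebesgue_on {0..t})"
    using w_meas z unfolding l2_measurable_def by (intro meas_sub[OF t]) blast
  show "AE s in lebesgue_on {0..t}. norm (l2_inner \<Omega> (w s) z) \<le> norm (l2_norm \<Omega> (w s) * l2_norm \<Omega> z)"
  proof (intro AE_I2)
    fix s assume "s \<in> space (lebesgue_on {0..t})"
    then have "w s \<in> L2 \<Omega>" using wV interval_I(4)[OF t] V_h_sub(3) by auto
    then show "norm (l2_inner \<Omega> (w s) z) \<le> norm (l2_norm \<Omega> (w s) * l2_norm \<Omega> z)"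
      using l2_Cauchy_Schwarz[of "w s" \<Omega> z] z by simp
  qed
qed

text \<open>Expanding \<open>w s\<close> in a basis leaves the time dependence only in the scalar
  coefficients \<open>l2_inner \<Omega> (w s) (e i)\<close>, which are integrable.\<close>

lemma conv_form_integrable:
  assumes t: "t \<in> I" and u: "u \<in> V" and z: "z \<in> L2 \<Omega>"
  shows "integrable (lebesgue_on {0..t}) (\<lambda>s. conv_form \<Omega> (w s) u z)"
proof -
  obtain N e where e: "l2_onb \<Omega> V N e" using l2_onb_exists[OF V_fin] by blast
  have L: "ae_functional \<Omega> V (\<lambda>w. conv_form \<Omega> w u z)"
    unfolding conv_form_inner by (intro ae_functional_inner_left ae_linear_conv_left u z)
  have "integrable (lebesgue_on {0..t}) (\<lambda>s. \<Sum>i<N. l2_inner \<Omega> (w s) (e i) * conv_form \<Omega> (e i) u z)"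
    using l2_onbD(1)[OF e] V_h_sub(3) by (intro Bochner_Integration.integrable_sum integrable_mult_left inner_w_integrable t) auto
  moreover have "conv_form \<Omega> (w s) u z = (\<Sum>i<N. l2_inner \<Omega> (w s) (e i) * conv_form \<Omega> (e i) u z)" if "s \<in> {0..t}" for s
    by (rule ae_functional_onb[OF L lin_closed_V_h e wV[OF interval_I(4)[OF t that]]])
  ultimately show ?thesis
    by (subst Bochner_Integration.integrable_cong[OF refl, of _ _ "\<lambda>s. \<Sum>i<N. l2_inner \<Omega> (w s) (e i) * conv_form \<Omega> (e i) u z"]) auto
qed

text \<open>Weak measurability of \<open>w\<close> says nothing directly about a supremum norm. As a
  Lipschitz function \<open>G\<close> of the coefficients of \<open>w\<close> the norm becomes
  measurable, and the same Lipschitz bound dominates it.\<close>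

lemma linf_norm_w_integrable:
  assumes t: "t \<in> I" shows "integrable (lebesgue_on {0..t}) (\<lambda>s. linf_norm \<Omega> (w s))"
proof -
  obtain N e where e: "l2_onb \<Omega> V N e" using l2_onb_exists[OF V_fin] by blast
  have eV: "e i \<in> V" if "i < N" for i by (rule l2_onbD(1)[OF e that])
  define s where "s = (\<lambda>c x. \<Sum>i<N. c i *\<^sub>R e i x)"
  have sV: "s c \<in> V" for c unfolding s_def by (rule lin_closed_sum[OF lin_closed_V_h]) (simp add: eV)
  define G where "G = (\<lambda>c. linf_norm \<Omega> (s c))"
  have one: "G c \<le> G d + (\<Sum>i<N. \<bar>c i - d i\<bar> * linf_norm \<Omega> (e i))" for c d
    unfolding G_def
  proof (rule linf_norm_le[OF sV])
    have "AE x in lebesgue_on \<Omega>. \<forall>i\<in>{..<N}. norm (e i x) \<le> linf_norm \<Omega> (e i)"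
      by (intro AE_finite_allI) (auto intro: linf_norm_AE eV)
    with linf_norm_AE[OF sV[of d]]
    show "AE x in lebesgue_on \<Omega>. norm (s c x) \<le> linf_norm \<Omega> (s d) + (\<Sum>i<N. \<bar>c i - d i\<bar> * linf_norm \<Omega> (e i))"
    proof eventually_elim
      case (elim x)
      have "s c x = s d x + (\<Sum>i<N. (c i - d i) *\<^sub>R e i x)"
        by (simp add: s_def scaleR_diff_left sum_subtractf)
      then have "norm (s c x) \<le> norm (s d x) + norm (\<Sum>i<N. (c i - d i) *\<^sub>R e i x)" by (simp add: norm_triangle_ineq)
      also have "norm (\<Sum>i<N. (c i - d i) *\<^sub>R e i x) \<le> (\<Sum>i<N. norm ((c i - d i) *\<^sub>R e i x))" by (rule norm_sum)
      also have "\<dots> \<le> (\<Sum>i<N. \<bar>c i - d i\<bar> * linf_norm \<Omega> (e i))"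
        using elim(2) by (intro sum_mono) (auto intro!: mult_left_mono)
      finally show ?case using elim(1) by linarith
    qed
  qed
  have lip: "\<bar>G c - G d\<bar> \<le> (\<Sum>i<N. \<bar>c i - d i\<bar> * linf_norm \<Omega> (e i))" for c d
    using one[of c d] one[of d c] by (simp add: abs_minus_commute abs_le_iff)
  define c where "c = (\<lambda>s i. l2_inner \<Omega> (w s) (e i))"
  have ci: "integrable (lebesgue_on {0..t}) (\<lambda>s. c s i)" if "i < N" for i
    unfolding c_def using eV[OF that] V_h_sub(3) by (intro inner_w_integrable t) auto
  have Gm: "(\<lambda>r. G (c r)) \<in> borel_measurable (lebesgue_on {0..t})"
    by (rule borel_measurable_lipschitz_coeffs[OF lip]) (rule borel_measurable_integrable[OF ci])
  have Geq: "linf_norm \<Omega> (w r) = G (c r)" if "r \<in> {0..t}" for r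
    unfolding G_def
    by (rule linf_norm_cong[OF wV[OF interval_I(4)[OF t that]] sV])
      (use l2_onbD(3)[OF e wV[OF interval_I(4)[OF t that]]] in \<open>simp add: s_def c_def\<close>)
  have "integrable (lebesgue_on {0..t}) (\<lambda>r. G (c r))"
  proof (rule Bochner_Integration.integrable_bound[OF _ Gm])
    show "integrable (lebesgue_on {0..t}) (\<lambda>r. \<bar>G (\<lambda>i. 0)\<bar> + (\<Sum>i<N. \<bar>c r i\<bar> * linf_norm \<Omega> (e i)))"
    proof (intro Bochner_Integration.integrable_add Bochner_Integration.integrable_sum integrable_mult_left integrable_abs)
      show "integrable (lebesgue_on {0..t}) (\<lambda>r. G (\<lambda>i. 0))"
        by (rule continuous_integrable[OF continuous_on_const])
    qed (use ci in auto)
    show "AE r in lebesgue_on {0..t}. norm (G (c r)) \<le> norm (\<bar>G (\<lambda>i. 0)\<bar> + (\<Sum>i<N. \<bar>c r i\<bar> * linf_norm \<Omega> (e i)))"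
    proof (intro AE_I2)
      fix r
      have "\<bar>G (c r) - G (\<lambda>i. 0)\<bar> \<le> (\<Sum>i<N. \<bar>c r i\<bar> * linf_norm \<Omega> (e i))"
        using lip[of "c r" "\<lambda>i. 0"] by simp
      then have "\<bar>G (c r)\<bar> \<le> \<bar>G (\<lambda>i. 0)\<bar> + (\<Sum>i<N. \<bar>c r i\<bar> * linf_norm \<Omega> (e i))" by linarith
      then show "norm (G (c r)) \<le> norm (\<bar>G (\<lambda>i. 0)\<bar> + (\<Sum>i<N. \<bar>c r i\<bar> * linf_norm \<Omega> (e i)))" by simp
    qed
  qed
  then show ?thesis
    by (subst Bochner_Integration.integrable_cong[OF refl, of _ _ "\<lambda>r. G (c r)"]) (auto simp: Geq)
qed

lemma inv_tau1_at_integrable: assumes t: "t \<in> I" shows "integrable (lebesgue_on {0..t}) inv_tau1_at" "integrable (lebesgue_on {0..t}) tau2_at"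
proof -
  have "integrable (lebesgue_on {0..t}) m"
    by (rule bounded_integrable[OF t m_meas, of \<mu>\<^sub>0]) (use m_bd mu_pos in fastforce)
  then show "integrable (lebesgue_on {0..t}) inv_tau1_at"
    unfolding inv_tau1_at_eq[abs_def] using linf_norm_w_integrable[OF t] by auto
  then show "integrable (lebesgue_on {0..t}) tau2_at" unfolding tau2_at_eq[abs_def] by auto
qed

text \<open>Measurability in time of an integral over space is obtained from a jointly measurable
  integrand, whereas \<open>sym_grad \<Omega> (w s)\<close> is an independent choice for each
  \<open>s\<close>. It is replaced by \<open>g s\<close>, a combination of fixed gradients with
  measurable coefficients, which changes the integral at no time.\<close>

lemma visc_form_integrable:
  assumes t: "t \<in> I" and u: "u \<in> V" and v: "v \<in> V"
  shows "integrable (lebesgue_on {0..t}) (\<lambda>s. visc_form s u v)"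
proof -
  obtain N e where e: "l2_onb \<Omega> V N e" using l2_onb_exists[OF V_fin] by blast
  have eV: "e i \<in> V" if "i < N" for i by (rule l2_onbD(1)[OF e that])
  define E where "E = (\<lambda>i. sym_grad \<Omega> (e i))"
  have EL: "E i \<in> L2 \<Omega>" if "i < N" for i unfolding E_def by (rule sym_grad_V_L2[OF eV[OF that]])
  define g where "g = (\<lambda>s x. \<Sum>i<N. l2_inner \<Omega> (w s) (e i) *\<^sub>R E i x)"
  define D where "D = (\<lambda>x. sym_grad \<Omega> u x \<bullet> sym_grad \<Omega> v x)"
  have Di: "integrable (lebesgue_on \<Omega>) D" unfolding D_def by (rule L2_integrable_inner[OF sym_grad_V_L2[OF u] sym_grad_V_L2[OF v]])
  have gL: "g s \<in> L2 \<Omega>" for s unfolding g_def by (rule L2_sum) (simp add: EL)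
  have eq: "visc_form s u v = (\<integral>x. 2 * \<mu> x (norm (g s x)) * D x \<partial>lebesgue_on \<Omega>)" if s: "s \<in> I" for s
  proof -
    have "l2_eq \<Omega> (sym_grad \<Omega> (w s)) (sym_grad \<Omega> (\<lambda>x. \<Sum>i<N. l2_inner \<Omega> (w s) (e i) *\<^sub>R e i x))"
      by (rule ae_linearD(5)[OF ae_linear_V_sym_grad wV[OF s] lin_closed_sum[OF lin_closed_V_h] l2_onbD(3)[OF e wV[OF s]]])
        (simp add: eV)
    also have "l2_eq \<Omega> \<dots> (g s)"
      unfolding g_def E_def by (rule ae_linear_sum[OF ae_linear_V_sym_grad]) (auto simp: eV)
    finally have ge: "l2_eq \<Omega> (sym_grad \<Omega> (w s)) (g s)" .
    show ?thesis
      unfolding visc_form_def l2_inner_def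
    proof (rule integral_cong_AE)
      show "(\<lambda>x. (2 * \<mu> x (norm (sym_grad \<Omega> (w s) x))) *\<^sub>R sym_grad \<Omega> u x \<bullet> sym_grad \<Omega> v x) \<in> borel_measurable (lebesgue_on \<Omega>)"
        by (rule borel_measurable_integrable[OF L2_integrable_inner[OF ae_linearD(3)[OF ae_linear_visc[OF s] u] sym_grad_V_L2[OF v]]])
      show "(\<lambda>x. 2 * \<mu> x (norm (g s x)) * D x) \<in> borel_measurable (lebesgue_on \<Omega>)"
        using mu_compose_meas[OF L2_measurable[OF gL]] borel_measurable_integrable[OF Di] by auto
      show "AE x in lebesgue_on \<Omega>. (2 * \<mu> x (norm (sym_grad \<Omega> (w s) x))) *\<^sub>R sym_grad \<Omega> u x \<bullet> sym_grad \<Omega> v x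
          = 2 * \<mu> x (norm (g s x)) * D x"
        using ge unfolding l2_eq_def by eventually_elim (simp add: D_def)
    qed
  qed
  let ?P = "lebesgue_on I \<Otimes>\<^sub>M lebesgue_on \<Omega>"
  \<comment> \<open>The parameter of the Caratheodory function is the pair of time and point. Time
    enters only through the argument at which the viscosity is evaluated.\<close>
  have "(\<lambda>p. \<mu> (snd p) \<bar>norm (g (fst p) (snd p))\<bar>) \<in> borel_measurable ?P"
  proof (rule borel_measurable_Caratheodory[where h="\<lambda>p r. \<mu> (snd p) \<bar>r\<bar>" and g="\<lambda>p. norm (g (fst p) (snd p))"])
    show "(\<lambda>p. \<mu> (snd p) \<bar>r\<bar>) \<in> borel_measurable ?P" for r
      by (rule measurable_compose[OF measurable_snd mu_meas])
    show "continuous_on UNIV (\<lambda>r. \<mu> (snd p) \<bar>r\<bar>)" if "p \<in> space ?P" for p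
      using that by (intro mu_cont) (auto simp: space_pair_measure)
    have "(\<lambda>p. l2_inner \<Omega> (w (fst p)) (e i) *\<^sub>R E i (snd p)) \<in> borel_measurable ?P" if "i < N" for i
    proof (intro borel_measurable_scaleR measurable_compose[OF measurable_snd L2_measurable[OF EL[OF that]]])
      show "(\<lambda>p. l2_inner \<Omega> (w (fst p)) (e i)) \<in> borel_measurable ?P"
        using w_meas eV[OF that] V_h_sub(3) unfolding l2_measurable_def
        by (intro measurable_compose[OF measurable_fst, where g="\<lambda>s. l2_inner \<Omega> (w s) (e i)"]) blast
    qed
    then have "(\<lambda>p. g (fst p) (snd p)) \<in> borel_measurable ?P"
      unfolding g_def by (intro borel_measurable_sum) simp
    then show "(\<lambda>p. norm (g (fst p) (snd p))) \<in> borel_measurable ?P"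
      by (rule measurable_compose[OF _ borel_measurable_norm])
  qed
  then have mu2: "(\<lambda>p. 2 * \<mu> (snd p) (norm (g (fst p) (snd p)))) \<in> borel_measurable ?P" by simp
  have "(\<lambda>p. 2 * \<mu> (snd p) (norm (g (fst p) (snd p))) * D (snd p)) \<in> borel_measurable ?P"
    by (rule borel_measurable_times[OF mu2 measurable_compose[OF measurable_snd borel_measurable_integrable[OF Di]]])
  then have "(\<lambda>(s, x). 2 * \<mu> x (norm (g s x)) * D x) \<in> borel_measurable ?P"
    by (simp add: case_prod_beta')
  from fm.borel_measurable_lebesgue_integral[OF this]
  have meas: "(\<lambda>s. \<integral>x. 2 * \<mu> x (norm (g s x)) * D x \<partial>lebesgue_on \<Omega>) \<in> borel_measurable (lebesgue_on I)" .
  \<comment> \<open>A bound independent of time: measurability then gives integrability over every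
    bounded interval.\<close>
  have bd: "\<bar>\<integral>x. 2 * \<mu> x (norm (g s x)) * D x \<partial>lebesgue_on \<Omega>\<bar> \<le> (\<integral>x. 2 * \<mu>\<^sub>0 * \<bar>D x\<bar> \<partial>lebesgue_on \<Omega>)" for s
  proof (rule order_trans[OF integral_abs_bound integral_mono])
    have mm: "(\<lambda>x. 2 * \<mu> x (norm (g s x)) * D x) \<in> borel_measurable (lebesgue_on \<Omega>)"
      using mu_compose_meas[OF L2_measurable[OF gL]] borel_measurable_integrable[OF Di] by auto
    show i2: "integrable (lebesgue_on \<Omega>) (\<lambda>x. 2 * \<mu>\<^sub>0 * \<bar>D x\<bar>)" using Di by auto
    show b: "\<bar>2 * \<mu> x (norm (g s x)) * D x\<bar> \<le> 2 * \<mu>\<^sub>0 * \<bar>D x\<bar>" if "x \<in> space (lebesgue_on \<Omega>)" for x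
      using mu_bd[of x "norm (g s x)"] mu_pos that by (auto simp: abs_mult intro!: mult_right_mono)
    have "integrable (lebesgue_on \<Omega>) (\<lambda>x. 2 * \<mu> x (norm (g s x)) * D x)"
    proof (rule Bochner_Integration.integrable_bound[OF i2 mm], intro AE_I2)
      fix x assume "x \<in> space (lebesgue_on \<Omega>)"
      from b[OF this] show "norm (2 * \<mu> x (norm (g s x)) * D x) \<le> norm (2 * \<mu>\<^sub>0 * \<bar>D x\<bar>)" by simp
    qed
    then show "integrable (lebesgue_on \<Omega>) (\<lambda>x. \<bar>2 * \<mu> x (norm (g s x)) * D x\<bar>)" by (rule integrable_abs)
  qed
  have "integrable (lebesgue_on {0..t}) (\<lambda>s. \<integral>x. 2 * \<mu> x (norm (g s x)) * D x \<partial>lebesgue_on \<Omega>)"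
    by (rule bounded_integrable[OF t meas bd])
  then show ?thesis
    by (subst Bochner_Integration.integrable_cong[OF refl, of _ _ "\<lambda>s. \<integral>x. 2 * \<mu> x (norm (g s x)) * D x \<partial>lebesgue_on \<Omega>"])
      (use eq interval_I(4)[OF t] in auto)
qed

lemma a_integrable:
  assumes t: "t \<in> I" and U: "U \<in> W" and X: "X \<in> W"
  shows "integrable (lebesgue_on {0..t}) (\<lambda>s. a s U X)"
  unfolding a_def
  by (intro Bochner_Integration.integrable_add Bochner_Integration.integrable_diff integrable_mult_left
      visc_form_integrable conv_form_integrable inv_tau1_at_integrable t W_pr U X)

section \<open>The force and the initial value\<close>

lemma f_AE: "AE t in lebesgue_on I. \<forall>i. f t i \<in> Hm1 \<Omega>"
  and f_meas: "\<And>i v. v \<in> H10 \<Omega> \<Longrightarrow> (\<lambda>t. f t i v) \<in> borel_measurable (lebesgue_on I)"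
  and f_int: "integrable (lebesgue_on I) (\<lambda>t. (vhm1_norm \<Omega> (f t))\<^sup>2)"
  using f by (auto simp: L2_Hm1_def)

lemma pairing_functional: "(\<And>i. f t i \<in> Hm1 \<Omega>) \<Longrightarrow> ae_functional \<Omega> V (pairing (f t))"
  by (rule ae_functionalI) (use V_h_sub(2) in \<open>auto intro!: pairing_lincomb pairing_cong\<close>)

lemma F_AE: "AE t in lebesgue_on I. ae_functional \<Omega> W (F t)"
  using f_AE by eventually_elim (simp add: F_def[abs_def] functional_pr1 pairing_functional)

lemma F_integrable:
  assumes t: "t \<in> I" and X: "X \<in> W" shows "integrable (lebesgue_on {0..t}) (\<lambda>s. F s X)"
proof (rule Bochner_Integration.integrable_bound)
  let ?c = "vh1_norm \<Omega> (pr1 X)"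
  have v: "pr1 X \<in> vec_fields (H10 \<Omega>)" using W_pr(1)[OF X] V_h_sub(2) by blast
  show "integrable (lebesgue_on {0..t}) (\<lambda>s. ?c * (1 + (vhm1_norm \<Omega> (f s))\<^sup>2))"
    using itg_le_integral(1)[OF T I f_int _ t] by (auto intro!: continuous_integrable)
  have "(\<lambda>s. F s X) \<in> borel_measurable (lebesgue_on I)"
    unfolding F_def pairing_def using v by (intro borel_measurable_sum f_meas) (auto simp: vec_fields_def)
  then show "(\<lambda>s. F s X) \<in> borel_measurable (lebesgue_on {0..t})" by (rule meas_sub[OF t])
  show "AE s in lebesgue_on {0..t}. norm (F s X) \<le> norm (?c * (1 + (vhm1_norm \<Omega> (f s))\<^sup>2))"
    using AE_sub[OF t f_AE]
  proof eventually_elim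
    case (elim s)
    have "\<bar>F s X\<bar> \<le> vhm1_norm \<Omega> (f s) * ?c" unfolding F_def by (rule pairing_bound[OF _ v]) (use elim in blast)
    \<comment> \<open>Square integrability gives integrability over bounded intervals through
      \<open>y \<le> 1 + y^2\<close>.\<close>
    also have "\<dots> \<le> (1 + (vhm1_norm \<Omega> (f s))\<^sup>2) * ?c"
    proof (intro mult_right_mono vh1_norm_ge_0)
      have "0 \<le> (vhm1_norm \<Omega> (f s) - 1)\<^sup>2" by simp
      then have "2 * vhm1_norm \<Omega> (f s) \<le> 1 + (vhm1_norm \<Omega> (f s))\<^sup>2" unfolding power2_diff by simp
      moreover have "0 \<le> vhm1_norm \<Omega> (f s)" by (simp add: vhm1_norm_def sum_nonneg)
      ultimately show "vhm1_norm \<Omega> (f s) \<le> 1 + (vhm1_norm \<Omega> (f s))\<^sup>2" by linarith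
    qed
    finally show ?case by (simp add: mult.commute)
  qed
qed

text \<open>Duality and Korn's inequality, then Young's inequality weighted so that exactly half of
  the coercivity constant \<open>2 * \<mu>inf\<close> is used up; this weight produces
  \<open>c\<^sub>K\<^sup>2 / (4 * \<mu>inf)\<close>.\<close>

lemma F_bound:
  assumes "\<forall>i. f t i \<in> Hm1 \<Omega>" and X: "X \<in> W"
  shows "F t X \<le> \<mu>inf * l2_inner \<Omega> (sym_grad \<Omega> (pr1 X)) (sym_grad \<Omega> (pr1 X))
    + c\<^sub>K\<^sup>2 / (4 * \<mu>inf) * (vhm1_norm \<Omega> (f t))\<^sup>2"
proof -
  let ?y = "vhm1_norm \<Omega> (f t)" let ?x = "l2_norm \<Omega> (sym_grad \<Omega> (pr1 X))"
  have v: "pr1 X \<in> vec_fields (H10 \<Omega>)" using W_pr(1)[OF X] V_h_sub(2) by blast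
  have "F t X \<le> ?y * vh1_norm \<Omega> (pr1 X)"
    unfolding F_def using pairing_bound[OF _ v, of "f t"] assms(1) by fastforce
  also have "\<dots> \<le> ?y * (c\<^sub>K * ?x)"
    by (intro mult_left_mono korn v) (simp add: vhm1_norm_def sum_nonneg)
  also have "\<dots> \<le> \<mu>inf * ?x\<^sup>2 + c\<^sub>K\<^sup>2 / (4 * \<mu>inf) * ?y\<^sup>2"
  proof -
    have "0 \<le> (2 * \<mu>inf * ?x - c\<^sub>K * ?y)\<^sup>2 / (4 * \<mu>inf)" using mu_pos by simp
    also have "\<dots> = \<mu>inf * ?x\<^sup>2 + c\<^sub>K\<^sup>2 / (4 * \<mu>inf) * ?y\<^sup>2 - ?y * (c\<^sub>K * ?x)"
      using mu_pos by (simp add: field_simps power2_eq_square)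
    finally show ?thesis by simp
  qed
  finally show ?thesis by (simp add: l2_norm_power2)
qed

definition U0 :: "real^'d \<Rightarrow> (real^'d) \<times> (real^'d) \<times> (real^'d)" where
  "U0 = triple (l2_proj \<Omega> V u\<^sub>0) (l2_proj \<Omega> V\<^sub>1 u\<^sub>0) (l2_proj \<Omega> V\<^sub>2 u\<^sub>0)"

text \<open>With \<open>B\<close> unfolded this is literally the compatibility of the initial data;
  it lets the evolution start in \<open>Z\<close>.\<close>

lemma U0_Z: "U0 \<in> Z"
  using compat l2_proj_mem[OF V_fin u0] l2_proj_mem[OF V1_fin u0] l2_proj_mem[OF V2_fin u0]
  by (simp add: Z_def W_iff U0_def B_def compatible_initial_data_def)

text \<open>Three projections of the same function, none of which increases the norm.\<close>

lemma U0_norm: "l2_inner \<Omega> U0 U0 \<le> 3 * (l2_norm \<Omega> u\<^sub>0)\<^sup>2"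
proof -
  have "U0 \<in> L2 \<Omega>" using U0_Z W_L2 by (auto simp: Z_def)
  then show ?thesis
    using l2_proj_norm_le[OF V_fin u0] l2_proj_norm_le[OF V1_fin u0] l2_proj_norm_le[OF V2_fin u0]
    by (simp add: inner_W U0_def l2_norm_power2)
qed

section \<open>The problem as one evolution equation for triples\<close>

abbreviation "is_solution \<equiv> linearised_solution \<Omega> \<T> k V\<^sub>1 V\<^sub>2 c\<^sub>1 c\<^sub>2 \<mu> m w f u\<^sub>0 I"

lemma inner_triple:
  assumes "u \<in> L2 \<Omega>" "v \<in> L2 \<Omega>" "z \<in> L2 \<Omega>" "X \<in> L2 \<Omega>"
  shows "l2_inner \<Omega> (triple u v z) X = l2_inner \<Omega> u (pr1 X) + l2_inner \<Omega> v (pr2 X) + l2_inner \<Omega> z (pr3 X)"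
  using inner_W[of "triple u v z" X] L2_PairI[OF assms(1) L2_PairI[OF assms(2,3)]] assms(4) by (simp add: triple_def[symmetric] flip: triple_def)

lemma pr_L2: "X \<in> L2 \<Omega> \<Longrightarrow> pr1 X \<in> L2 \<Omega> \<and> pr2 X \<in> L2 \<Omega> \<and> pr3 X \<in> L2 \<Omega>"
  using L2_fst_snd[of X \<Omega>] L2_fst_snd[of "\<lambda>x. snd (X x)" \<Omega>] by (simp add: pr1_def pr2_def pr3_def)

lemma time_deriv_triple:
  assumes L: "\<And>t. t \<in> I \<Longrightarrow> u t \<in> L2 \<Omega> \<and> v t \<in> L2 \<Omega> \<and> z t \<in> L2 \<Omega>"
    and L': "\<And>t. t \<in> I \<Longrightarrow> u' t \<in> L2 \<Omega> \<and> v' t \<in> L2 \<Omega> \<and> z' t \<in> L2 \<Omega>"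
    and d: "has_time_deriv \<Omega> I u u'" "has_time_deriv \<Omega> I v v'" "has_time_deriv \<Omega> I z z'"
  shows "has_time_deriv \<Omega> I (\<lambda>t. triple (u t) (v t) (z t)) (\<lambda>t. triple (u' t) (v' t) (z' t))"
  unfolding has_time_deriv_def
proof (intro ballI conjI)
  fix X :: "real^'d \<Rightarrow> (real^'d) \<times> (real^'d) \<times> (real^'d)" and t assume X: "X \<in> L2 \<Omega>" and t: "t \<in> I"
  have p: "pr1 X \<in> L2 \<Omega>" "pr2 X \<in> L2 \<Omega>" "pr3 X \<in> L2 \<Omega>" using pr_L2[OF X] by auto
  note i = has_time_derivD(1)[OF d(1) p(1) t] has_time_derivD(1)[OF d(2) p(2) t] has_time_derivD(1)[OF d(3) p(3) t]
  let ?s = "\<lambda>s. l2_inner \<Omega> (u' s) (pr1 X) + l2_inner \<Omega> (v' s) (pr2 X) + l2_inner \<Omega> (z' s) (pr3 X)"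
  have eq: "l2_inner \<Omega> (triple (u' s) (v' s) (z' s)) X = ?s s" if "s \<in> {0..t}" for s
    using L'[OF interval_I(4)[OF t that]] by (intro inner_triple X) auto
  have "integrable (lebesgue_on {0..t}) ?s" using i by auto
  then show "integrable (lebesgue_on {0..t}) (\<lambda>s. l2_inner \<Omega> (triple (u' s) (v' s) (z' s)) X)"
    by (subst Bochner_Integration.integrable_cong[OF refl, of _ _ ?s]) (auto simp: eq)
  have "itg t (\<lambda>s. l2_inner \<Omega> (triple (u' s) (v' s) (z' s)) X) = itg t ?s" by (rule itg_cong[OF eq])
  also have "\<dots> = itg t (\<lambda>s. l2_inner \<Omega> (u' s) (pr1 X)) + itg t (\<lambda>s. l2_inner \<Omega> (v' s) (pr2 X)) + itg t (\<lambda>s. l2_inner \<Omega> (z' s) (pr3 X))"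
    using i by (simp add: itg_add)
  finally show "l2_inner \<Omega> (triple (u t) (v t) (z t)) X
      = l2_inner \<Omega> (triple (u 0) (v 0) (z 0)) X + (\<integral>s. l2_inner \<Omega> (triple (u' s) (v' s) (z' s)) X \<partial>lebesgue_on {0..t})"
    using has_time_derivD(2)[OF d(1) p(1) t] has_time_derivD(2)[OF d(2) p(2) t] has_time_derivD(2)[OF d(3) p(3) t]
      L[OF t] L[OF interval_I(1)] X by (simp add: inner_triple itg_def[symmetric])
qed

lemma time_deriv_pr:
  assumes L: "\<And>t. t \<in> I \<Longrightarrow> U t \<in> L2 \<Omega>" "\<And>t. t \<in> I \<Longrightarrow> U' t \<in> L2 \<Omega>" and d: "has_time_deriv \<Omega> I U U'"
  shows "has_time_deriv \<Omega> I (\<lambda>t. pr1 (U t)) (\<lambda>t. pr1 (U' t))"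
    and "has_time_deriv \<Omega> I (\<lambda>t. pr2 (U t)) (\<lambda>t. pr2 (U' t))"
    and "has_time_deriv \<Omega> I (\<lambda>t. pr3 (U t)) (\<lambda>t. pr3 (U' t))"
proof -
  \<comment> \<open>Each projection is adjoint to the embedding \<open>J\<close> that fills up with
    zero fields, so the weak formulation passes to a component by testing with
    \<open>J z\<close>.\<close>
  have gen: "has_time_deriv \<Omega> I (\<lambda>t. P (U t)) (\<lambda>t. P (U' t))"
    if P: "\<And>z X. z \<in> L2 \<Omega> \<Longrightarrow> X \<in> L2 \<Omega> \<Longrightarrow> l2_inner \<Omega> (P X) z = l2_inner \<Omega> X (J z)" and J: "\<And>z. z \<in> L2 \<Omega> \<Longrightarrow> J z \<in> L2 \<Omega>"
    for P :: "(real^'d \<Rightarrow> (real^'d) \<times> (real^'d) \<times> (real^'d)) \<Rightarrow> real^'d \<Rightarrow> real^'d" and J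
    unfolding has_time_deriv_def
  proof (intro ballI conjI)
    fix z :: "real^'d \<Rightarrow> real^'d" and t assume z: "z \<in> L2 \<Omega>" and t: "t \<in> I"
    have eq: "l2_inner \<Omega> (P (U' s)) z = l2_inner \<Omega> (U' s) (J z)" if "s \<in> {0..t}" for s
      by (rule P[OF z L(2)[OF interval_I(4)[OF t that]]])
    show "integrable (lebesgue_on {0..t}) (\<lambda>s. l2_inner \<Omega> (P (U' s)) z)"
      using has_time_derivD(1)[OF d J[OF z] t]
      by (subst Bochner_Integration.integrable_cong[OF refl, of _ _ "\<lambda>s. l2_inner \<Omega> (U' s) (J z)"]) (auto simp: eq)
    have "itg t (\<lambda>s. l2_inner \<Omega> (P (U' s)) z) = itg t (\<lambda>s. l2_inner \<Omega> (U' s) (J z))" by (rule itg_cong[OF eq])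
    then show "l2_inner \<Omega> (P (U t)) z = l2_inner \<Omega> (P (U 0)) z + (\<integral>s. l2_inner \<Omega> (P (U' s)) z \<partial>lebesgue_on {0..t})"
      using has_time_derivD(2)[OF d J[OF z] t] P[OF z L(1)[OF t]] P[OF z L(1)[OF interval_I(1)]] by (simp add: itg_def)
  qed
  have mkL: "triple u v z \<in> L2 \<Omega>" if "u \<in> L2 \<Omega>" "v \<in> L2 \<Omega>" "z \<in> L2 \<Omega>" for u v z
    unfolding triple_def by (intro L2_PairI that)
  show "has_time_deriv \<Omega> I (\<lambda>t. pr1 (U t)) (\<lambda>t. pr1 (U' t))"
    by (rule gen[of pr1 "\<lambda>z. triple z (\<lambda>x. 0) (\<lambda>x. 0)"]) (simp_all add: mkL inner_W)
  show "has_time_deriv \<Omega> I (\<lambda>t. pr2 (U t)) (\<lambda>t. pr2 (U' t))"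
    by (rule gen[of pr2 "\<lambda>z. triple (\<lambda>x. 0) z (\<lambda>x. 0)"]) (simp_all add: mkL inner_W)
  show "has_time_deriv \<Omega> I (\<lambda>t. pr3 (U t)) (\<lambda>t. pr3 (U' t))"
    by (rule gen[of pr3 "\<lambda>z. triple (\<lambda>x. 0) (\<lambda>x. 0) z"]) (simp_all add: mkL inner_W)
qed

lemma l2_eq_triple: "l2_eq \<Omega> (triple u v z) (triple u' v' z') \<longleftrightarrow> l2_eq \<Omega> u u' \<and> l2_eq \<Omega> v v' \<and> l2_eq \<Omega> z z'"
  by (auto simp: l2_eq_def triple_def)

text \<open>Adds the tested equations. Together with the converse \<open>system_solution\<close> it
  lets existence and uniqueness be treated for the single unknown \<open>U\<close>.\<close>

lemma solution_system:
  assumes "is_solution u p u\<^sub>1 u\<^sub>2"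
  defines "U \<equiv> \<lambda>t. triple (u t) (u\<^sub>1 t) (u\<^sub>2 t)"
  shows "\<exists>U'. (\<forall>t\<in>I. U t \<in> W \<and> U' t \<in> W \<and> p t \<in> S) \<and> has_time_deriv \<Omega> I U U' \<and>
    (AE t in lebesgue_on I. (\<forall>q\<in>S. B q (U t) = 0) \<and>
      (\<forall>X\<in>W. l2_inner \<Omega> (U' t) X + a t (U t) X - B (p t) X = F t X)) \<and> l2_eq \<Omega> (U 0) U0"
proof -
  from assms(1) obtain u' u\<^sub>1' u\<^sub>2' where
    mem: "\<forall>t\<in>I. u t \<in> V \<and> p t \<in> S \<and> u\<^sub>1 t \<in> V\<^sub>1 \<and> u\<^sub>2 t \<in> V\<^sub>2" and
    mem': "\<forall>t\<in>I. u' t \<in> V \<and> u\<^sub>1' t \<in> V\<^sub>1 \<and> u\<^sub>2' t \<in> V\<^sub>2" and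
    d: "has_time_deriv \<Omega> I u u'" "has_time_deriv \<Omega> I u\<^sub>1 u\<^sub>1'" "has_time_deriv \<Omega> I u\<^sub>2 u\<^sub>2'" and
    eqs: "AE t in lebesgue_on I. (\<forall>v\<in>V. l2_inner \<Omega> (u' t) v + visc_form t (u t) v
        + conv_form \<Omega> (w t) (u t) v - l2_inner \<Omega> (p t) (vdiv \<Omega> v)
        + l2_inner \<Omega> (\<lambda>x. tau2_at t * vdiv \<Omega> v x) (l2_perp \<Omega> S (vdiv \<Omega> (u t))) - conv_form \<Omega> (w t) v (u\<^sub>1 t) = pairing (f t) v) \<and>
      (\<forall>q\<in>S. l2_inner \<Omega> q (vdiv \<Omega> (u t)) - l2_inner \<Omega> (grad \<Omega> q) (u\<^sub>2 t) = 0) \<and>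
      (\<forall>v\<in>V\<^sub>1. l2_inner \<Omega> (u\<^sub>1' t) v + inv_tau1_at t * l2_inner \<Omega> (u\<^sub>1 t) v + conv_form \<Omega> (w t) (u t) v = 0) \<and>
      (\<forall>v\<in>V\<^sub>2. l2_inner \<Omega> (u\<^sub>2' t) v + inv_tau1_at t * l2_inner \<Omega> (u\<^sub>2 t) v + l2_inner \<Omega> (grad \<Omega> (p t)) v = 0)" and
    init: "l2_eq \<Omega> (u 0) (l2_proj \<Omega> V u\<^sub>0)" "l2_eq \<Omega> (u\<^sub>1 0) (l2_proj \<Omega> V\<^sub>1 u\<^sub>0)" "l2_eq \<Omega> (u\<^sub>2 0) (l2_proj \<Omega> V\<^sub>2 u\<^sub>0)"
    unfolding linearised_solution_def Let_def visc_form_def[symmetric] inv_tau1_at_def[symmetric] tau2_at_def[symmetric] by blast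
  define U' where "U' = (\<lambda>t. triple (u' t) (u\<^sub>1' t) (u\<^sub>2' t))"
  have UW: "\<forall>t\<in>I. U t \<in> W \<and> U' t \<in> W \<and> p t \<in> S" using mem mem' by (simp add: U_def U'_def W_iff)
  have dU: "has_time_deriv \<Omega> I U U'"
    unfolding U_def U'_def by (rule time_deriv_triple[OF _ _ d]) (use mem mem' V_h_sub(3) V1_L2 V2_L2 in blast)+
  have "AE t in lebesgue_on I. (\<forall>q\<in>S. B q (U t) = 0) \<and>
      (\<forall>X\<in>W. l2_inner \<Omega> (U' t) X + a t (U t) X - B (p t) X = F t X)"
    using eqs AE_I
  proof eventually_elim
    case (elim t)
    show ?case
    proof (intro conjI ballI)
      show "B q (U t) = 0" if "q \<in> S" for q using elim(1) that by (simp add: B_def U_def)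
      fix X assume X: "X \<in> W"
      have L: "u' t \<in> L2 \<Omega>" "u\<^sub>1' t \<in> L2 \<Omega>" "u\<^sub>2' t \<in> L2 \<Omega>" "X \<in> L2 \<Omega>"
        using mem' elim(2) V_h_sub(3) V1_L2 V2_L2 W_L2 X by blast+
      have "l2_inner \<Omega> (\<lambda>x. tau2_at t * vdiv \<Omega> (pr1 X) x) y = tau2_at t * l2_inner \<Omega> (vdiv \<Omega> (pr1 X)) y" for y
        using l2_inner_scale_left[of \<Omega> "tau2_at t" "vdiv \<Omega> (pr1 X)" y] by simp
      moreover have "pr1 X \<in> V" "pr2 X \<in> V\<^sub>1" "pr3 X \<in> V\<^sub>2" using W_pr X by auto
      ultimately show "l2_inner \<Omega> (U' t) X + a t (U t) X - B (p t) X = F t X"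
        using elim(1) unfolding U'_def inner_triple[OF L] a_def B_def F_def U_def by fastforce
    qed
  qed
  moreover have "l2_eq \<Omega> (U 0) U0" unfolding U_def U0_def l2_eq_triple using init by blast
  ultimately show ?thesis using UW dU by blast
qed

text \<open>The single equation splits again when the test triple has only one nonzero
  field.\<close>

lemma system_solution:
  assumes UW: "\<And>t. t \<in> I \<Longrightarrow> U t \<in> W \<and> U' t \<in> W \<and> p t \<in> S" and d: "has_time_deriv \<Omega> I U U'"
    and eqs: "AE t in lebesgue_on I. (\<forall>q\<in>S. B q (U t) = 0) \<and>
      (\<forall>X\<in>W. l2_inner \<Omega> (U' t) X + a t (U t) X - B (p t) X = F t X)" and init: "l2_eq \<Omega> (U 0) U0"
  shows "is_solution (\<lambda>t. pr1 (U t)) p (\<lambda>t. pr2 (U t)) (\<lambda>t. pr3 (U t))"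
proof -
  have mem: "\<forall>t\<in>I. pr1 (U t) \<in> V \<and> p t \<in> S \<and> pr2 (U t) \<in> V\<^sub>1 \<and> pr3 (U t) \<in> V\<^sub>2"
    "\<forall>t\<in>I. pr1 (U' t) \<in> V \<and> pr2 (U' t) \<in> V\<^sub>1 \<and> pr3 (U' t) \<in> V\<^sub>2"
    using UW W_pr by blast+
  have L: "U t \<in> L2 \<Omega>" "U' t \<in> L2 \<Omega>" if "t \<in> I" for t using UW[OF that] W_L2 by auto
  have "triple (pr1 U) (pr2 U) (pr3 U) = U" for U by (simp add: triple_def pr1_def pr2_def pr3_def)
  then have init': "l2_eq \<Omega> (pr1 (U 0)) (l2_proj \<Omega> V u\<^sub>0)" "l2_eq \<Omega> (pr2 (U 0)) (l2_proj \<Omega> V\<^sub>1 u\<^sub>0)"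
    "l2_eq \<Omega> (pr3 (U 0)) (l2_proj \<Omega> V\<^sub>2 u\<^sub>0)"
    using init l2_eq_triple[of "pr1 (U 0)" "pr2 (U 0)" "pr3 (U 0)"] unfolding U0_def by simp_all
  have "AE t in lebesgue_on I. (\<forall>v\<in>V. l2_inner \<Omega> (pr1 (U' t)) v + visc_form t (pr1 (U t)) v
        + conv_form \<Omega> (w t) (pr1 (U t)) v - l2_inner \<Omega> (p t) (vdiv \<Omega> v)
        + l2_inner \<Omega> (\<lambda>x. tau2_at t * vdiv \<Omega> v x) (l2_perp \<Omega> S (vdiv \<Omega> (pr1 (U t)))) - conv_form \<Omega> (w t) v (pr2 (U t)) = pairing (f t) v) \<and>
      (\<forall>q\<in>S. l2_inner \<Omega> q (vdiv \<Omega> (pr1 (U t))) - l2_inner \<Omega> (grad \<Omega> q) (pr3 (U t)) = 0) \<and>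
      (\<forall>v\<in>V\<^sub>1. l2_inner \<Omega> (pr2 (U' t)) v + inv_tau1_at t * l2_inner \<Omega> (pr2 (U t)) v + conv_form \<Omega> (w t) (pr1 (U t)) v = 0) \<and>
      (\<forall>v\<in>V\<^sub>2. l2_inner \<Omega> (pr3 (U' t)) v + inv_tau1_at t * l2_inner \<Omega> (pr3 (U t)) v + l2_inner \<Omega> (grad \<Omega> (p t)) v = 0)"
    using eqs AE_I f_AE
  proof eventually_elim
    case (elim t)
    have UWt: "U t \<in> W" "U' t \<in> W" "p t \<in> S" using UW[OF elim(2)] by auto
    have pH: "p t \<in> L2 \<Omega>" using UWt(3) S_L2 by blast
    have E: "l2_inner \<Omega> (U' t) X + a t (U t) X - B (p t) X = F t X" if "X \<in> W" for X using elim(1) that by blast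
    \<comment> \<open>Not all of these zeros hold by unfolding:
      \<open>vdiv \<Omega> (\<lambda>x. 0)\<close> is a chosen representative that vanishes only up
      to null sets, and \<open>pairing (f t)\<close> is linear only for almost every time. Linearity
      of the functionals supplies them.\<close>
    have z: "visc_form t (pr1 (U t)) (\<lambda>x. 0) = 0" "conv_form \<Omega> (w t) (\<lambda>x. 0) (pr2 (U t)) = 0"
      "l2_inner \<Omega> (vdiv \<Omega> (\<lambda>x. 0)) y = 0" "l2_inner \<Omega> y (vdiv \<Omega> (\<lambda>x. 0)) = 0" "pairing (f t) (\<lambda>x. 0) = 0" if "y \<in> L2 \<Omega>" for y
    proof -
      show "visc_form t (pr1 (U t)) (\<lambda>x. 0) = 0"
        by (rule ae_functional_zero[OF visc_right[OF elim(2) W_pr(1)[OF UWt(1)]] lin_closed_V_h])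
      show "conv_form \<Omega> (w t) (\<lambda>x. 0) (pr2 (U t)) = 0"
        by (rule ae_functional_zero[OF conv_mid[OF elim(2) W_pr(5)[OF UWt(1)]] lin_closed_V_h])
      show a: "l2_inner \<Omega> (vdiv \<Omega> (\<lambda>x. 0)) y = 0"
        by (rule ae_functional_zero[OF div_right[OF that] lin_closed_V_h])
      then show "l2_inner \<Omega> y (vdiv \<Omega> (\<lambda>x. 0)) = 0" by (simp add: l2_inner_commute)
      show "pairing (f t) (\<lambda>x. 0) = 0"
        by (rule ae_functional_zero[OF pairing_functional lin_closed_V_h]) (use elim(3) in blast)
    qed
    have cz: "conv_form \<Omega> (w t) (pr1 (U t)) (\<lambda>x. 0) = 0" by (simp add: conv_form_inner)
    have pL: "l2_perp \<Omega> S (vdiv \<Omega> (pr1 (U t))) \<in> L2 \<Omega>"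
      by (rule ae_linearD(3)[OF ae_linear_perp_vdiv W_pr(1)[OF UWt(1)]])
    note zz = z(1,2,5)[OF L2_zero] z(3)[OF pL] z(4)[OF pH] cz
    have iU: "l2_inner \<Omega> (U' t) X = l2_inner \<Omega> (pr1 (U' t)) (pr1 X) + l2_inner \<Omega> (pr2 (U' t)) (pr2 X) + l2_inner \<Omega> (pr3 (U' t)) (pr3 X)"
      if "X \<in> W" for X using that UWt W_L2 by (intro inner_W) auto
    have sc: "l2_inner \<Omega> (\<lambda>x. tau2_at t * vdiv \<Omega> v x) y = tau2_at t * l2_inner \<Omega> (vdiv \<Omega> v) y" for v y
      using l2_inner_scale_left[of \<Omega> "tau2_at t" "vdiv \<Omega> v" y] by simp
    show ?case
    proof (intro conjI ballI)
      fix v assume v: "v \<in> V"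
      have m: "triple v (\<lambda>x. 0) (\<lambda>x. 0) \<in> W" using v zero_mem by (simp add: W_iff)
      show "l2_inner \<Omega> (pr1 (U' t)) v + visc_form t (pr1 (U t)) v
        + conv_form \<Omega> (w t) (pr1 (U t)) v - l2_inner \<Omega> (p t) (vdiv \<Omega> v)
        + l2_inner \<Omega> (\<lambda>x. tau2_at t * vdiv \<Omega> v x) (l2_perp \<Omega> S (vdiv \<Omega> (pr1 (U t)))) - conv_form \<Omega> (w t) v (pr2 (U t)) = pairing (f t) v"
        using E[OF m] zz unfolding sc iU[OF m] a_def B_def F_def by simp
    next
      fix v assume v: "v \<in> V\<^sub>1"
      have m: "triple (\<lambda>x. 0) v (\<lambda>x. 0) \<in> W" using v zero_mem by (simp add: W_iff)
      show "l2_inner \<Omega> (pr2 (U' t)) v + inv_tau1_at t * l2_inner \<Omega> (pr2 (U t)) v + conv_form \<Omega> (w t) (pr1 (U t)) v = 0"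
        using E[OF m] zz unfolding iU[OF m] a_def B_def F_def by simp
    next
      fix v assume v: "v \<in> V\<^sub>2"
      have m: "triple (\<lambda>x. 0) (\<lambda>x. 0) v \<in> W" using v zero_mem by (simp add: W_iff)
      show "l2_inner \<Omega> (pr3 (U' t)) v + inv_tau1_at t * l2_inner \<Omega> (pr3 (U t)) v + l2_inner \<Omega> (grad \<Omega> (p t)) v = 0"
        using E[OF m] zz unfolding iU[OF m] a_def B_def F_def by simp
    next
      fix q assume "q \<in> S"
      then show "l2_inner \<Omega> q (vdiv \<Omega> (pr1 (U t))) - l2_inner \<Omega> (grad \<Omega> q) (pr3 (U t)) = 0"
        using elim(1) by (simp add: B_def)
    qed
  qed
  then show ?thesis
    unfolding linearised_solution_def Let_def visc_form_def[symmetric] inv_tau1_at_def[symmetric] tau2_at_def[symmetric]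
    by - (intro conjI exI[of _ "\<lambda>t. pr1 (U' t)"] exI[of _ "\<lambda>t. pr2 (U' t)"] exI[of _ "\<lambda>t. pr3 (U' t)"]
        mem time_deriv_pr[OF L d] init')
qed

section \<open>Uniqueness\<close>

lemma solution_unique:
  assumes s: "is_solution u p u\<^sub>1 u\<^sub>2" and s': "is_solution v q v\<^sub>1 v\<^sub>2"
  shows "(\<forall>t\<in>I. l2_eq \<Omega> (v t) (u t) \<and> l2_eq \<Omega> (v\<^sub>1 t) (u\<^sub>1 t) \<and> l2_eq \<Omega> (v\<^sub>2 t) (u\<^sub>2 t)) \<and>
    (AE t in lebesgue_on I. eq_mod_const \<Omega> (q t) (p t))"
proof -
  define U where "U = (\<lambda>t. triple (u t) (u\<^sub>1 t) (u\<^sub>2 t))"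
  define Y where "Y = (\<lambda>t. triple (v t) (v\<^sub>1 t) (v\<^sub>2 t))"
  obtain U' where U: "\<forall>t\<in>I. U t \<in> W \<and> U' t \<in> W \<and> p t \<in> S" "has_time_deriv \<Omega> I U U'"
    "AE t in lebesgue_on I. (\<forall>q\<in>S. B q (U t) = 0) \<and> (\<forall>X\<in>W. l2_inner \<Omega> (U' t) X + a t (U t) X - B (p t) X = F t X)"
    "l2_eq \<Omega> (U 0) U0" using solution_system[OF s] unfolding U_def by blast
  obtain Y' where Y: "\<forall>t\<in>I. Y t \<in> W \<and> Y' t \<in> W \<and> q t \<in> S" "has_time_deriv \<Omega> I Y Y'"
    "AE t in lebesgue_on I. (\<forall>r\<in>S. B r (Y t) = 0) \<and> (\<forall>X\<in>W. l2_inner \<Omega> (Y' t) X + a t (Y t) X - B (q t) X = F t X)"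
    "l2_eq \<Omega> (Y 0) U0" using solution_system[OF s'] unfolding Y_def by blast
  define D where "D = (\<lambda>t x. 1 *\<^sub>R Y t x + (-1) *\<^sub>R U t x)"
  define D' where "D' = (\<lambda>t x. 1 *\<^sub>R Y' t x + (-1) *\<^sub>R U' t x)"
  define r where "r = (\<lambda>t x. 1 *\<^sub>R q t x + (-1) *\<^sub>R p t x)"
  have DW: "D t \<in> W \<and> D' t \<in> W" if "t \<in> I" for t
    unfolding D_def D'_def
    by (intro conjI lin_closed_lincomb[OF W_lin]) (use U(1) Y(1) that in blast)+
  have rS: "r t \<in> S" if "t \<in> I" for t
    unfolding r_def by (rule lin_closed_lincomb[OF lin_closed_S_h]) (use U(1) Y(1) that in blast)+
  have iD: "l2_inner \<Omega> (D t) X = l2_inner \<Omega> (Y t) X - l2_inner \<Omega> (U t) X"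
    "l2_inner \<Omega> (D' t) X = l2_inner \<Omega> (Y' t) X - l2_inner \<Omega> (U' t) X" if "t \<in> I" "X \<in> L2 \<Omega>" for t X
  proof -
    have L: "Y t \<in> L2 \<Omega>" "U t \<in> L2 \<Omega>" "Y' t \<in> L2 \<Omega>" "U' t \<in> L2 \<Omega>" using U(1) Y(1) that(1) W_L2 by blast+
    show "l2_inner \<Omega> (D t) X = l2_inner \<Omega> (Y t) X - l2_inner \<Omega> (U t) X"
      "l2_inner \<Omega> (D' t) X = l2_inner \<Omega> (Y' t) X - l2_inner \<Omega> (U' t) X"
      unfolding D_def D'_def l2_inner_lincomb_left[OF L(1,2) that(2)] l2_inner_lincomb_left[OF L(3,4) that(2)] by simp_all
  qed
  have dD: "has_time_deriv \<Omega> I D D'"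
    unfolding has_time_deriv_def
  proof (intro ballI conjI)
    fix X :: "real^'d \<Rightarrow> (real^'d) \<times> (real^'d) \<times> (real^'d)" and t assume X: "X \<in> L2 \<Omega>" and t: "t \<in> I"
    note i = has_time_derivD(1)[OF Y(2) X t] has_time_derivD(1)[OF U(2) X t]
    let ?s = "\<lambda>s. l2_inner \<Omega> (Y' s) X - l2_inner \<Omega> (U' s) X"
    have eq: "l2_inner \<Omega> (D' s) X = ?s s" if "s \<in> {0..t}" for s by (rule iD(2)[OF interval_I(4)[OF t that] X])
    have "integrable (lebesgue_on {0..t}) ?s" using i by auto
    then show "integrable (lebesgue_on {0..t}) (\<lambda>s. l2_inner \<Omega> (D' s) X)"
      by (subst Bochner_Integration.integrable_cong[OF refl, of _ _ ?s]) (auto simp: eq)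
    have "itg t (\<lambda>s. l2_inner \<Omega> (D' s) X) = itg t ?s" by (rule itg_cong[OF eq])
    also have "\<dots> = itg t (\<lambda>s. l2_inner \<Omega> (Y' s) X) - itg t (\<lambda>s. l2_inner \<Omega> (U' s) X)"
      unfolding itg_def by (rule Bochner_Integration.integral_diff[OF i])
    finally show "l2_inner \<Omega> (D t) X = l2_inner \<Omega> (D 0) X + (\<integral>s. l2_inner \<Omega> (D' s) X \<partial>lebesgue_on {0..t})"
      using has_time_derivD(2)[OF Y(2) X t] has_time_derivD(2)[OF U(2) X t]
      by (simp add: iD[OF t X] iD[OF interval_I(1) X] itg_def[symmetric])
  qed
  have ae: "AE t in lebesgue_on I. (\<forall>q\<in>S. B q (D t) = 0) \<and> (\<forall>X\<in>W. l2_inner \<Omega> (D' t) X + a t (D t) X - B (r t) X = 0)"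
    using U(3) Y(3) AE_I
  proof eventually_elim
    case (elim t)
    have mem: "Y t \<in> W" "U t \<in> W" "p t \<in> S" "q t \<in> S" using U(1) Y(1) elim(3) by auto
    show ?case
    proof (intro conjI ballI)
      fix y assume "y \<in> S"
      then show "B y (D t) = 0"
        unfolding D_def using ae_functionalD(1)[OF B_functional mem(1,2), of y 1 "-1"] elim(1,2) by simp
    next
      fix X assume X: "X \<in> W"
      have "a t (D t) X = 1 * a t (Y t) X + (-1) * a t (U t) X"
        unfolding D_def by (rule ae_functionalD(1)[OF a_left[OF elim(3) X] mem(1,2)])
      moreover have "B (r t) X = 1 * B (q t) X + (-1) * B (p t) X"
        unfolding r_def by (rule B_lincomb[OF mem(4,3) X])
      moreover have "l2_inner \<Omega> (D' t) X = l2_inner \<Omega> (Y' t) X - l2_inner \<Omega> (U' t) X"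
        using iD(2)[OF elim(3), of X] X W_L2 by blast
      moreover have "l2_inner \<Omega> (U' t) X + a t (U t) X - B (p t) X = F t X"
        "l2_inner \<Omega> (Y' t) X + a t (Y t) X - B (q t) X = F t X" using elim(1,2) X by blast+
      ultimately show "l2_inner \<Omega> (D' t) X + a t (D t) X - B (r t) X = 0" by linarith
    qed
  qed
  \<comment> \<open>The difference satisfies the constraint, so its pressure \<open>r\<close> does
    no work on it; its energy starts from 0 and has a nonpositive derivative.\<close>
  have D0: "l2_eq \<Omega> (D t) (\<lambda>x. 0)" if t: "t \<in> I" for t
  proof -
    have "l2_eq \<Omega> (D 0) (\<lambda>x. 0)"
      using U(4) Y(4) unfolding l2_eq_def D_def by eventually_elim simp
    then have z: "l2_inner \<Omega> (D 0) (D 0) = 0" using DW[OF interval_I(1)] W_L2 l2_inner_self_eq_0 by blast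
    have "itg t (\<lambda>s. l2_inner \<Omega> (D' s) (D s)) \<le> itg t (\<lambda>s. 0)"
    proof (rule itg_mono)
      show "integrable (lebesgue_on {0..t}) (\<lambda>s. l2_inner \<Omega> (D' s) (D s))"
        by (rule energy_identity(1)[OF T I W_fin dD DW t])
      show "AE s in lebesgue_on {0..t}. l2_inner \<Omega> (D' s) (D s) \<le> 0"
        using AE_sub[OF t ae] AE_sub[OF t AE_I]
      proof eventually_elim
        case (elim s)
        have "B (r s) (D s) = 0" using elim rS by blast
        moreover have "l2_inner \<Omega> (D' s) (D s) + a s (D s) (D s) - B (r s) (D s) = 0" using elim DW by blast
        moreover have "0 \<le> a s (D s) (D s)"
          using coercive[of s "D s"] elim(2) DW mu_pos l2_inner_ge_0[of \<Omega> "sym_grad \<Omega> (pr1 (D s))"]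
          by (meson mult_nonneg_nonneg order_trans less_imp_le zero_le_numeral)
        ultimately show ?case by linarith
      qed
    qed simp
    then have "l2_inner \<Omega> (D t) (D t) \<le> 0"
      using energy_identity(2)[OF T I W_fin dD DW t] z by (simp add: itg_def)
    then have "l2_inner \<Omega> (D t) (D t) = 0" using l2_inner_ge_0[of \<Omega> "D t"] by linarith
    then show ?thesis using DW[OF t] W_L2 l2_inner_self_eq_0 by blast
  qed
  have "l2_eq \<Omega> (v t) (u t) \<and> l2_eq \<Omega> (v\<^sub>1 t) (u\<^sub>1 t) \<and> l2_eq \<Omega> (v\<^sub>2 t) (u\<^sub>2 t)" if t: "t \<in> I" for t
  proof -
    have "l2_eq \<Omega> (Y t) (U t)" using D0[OF t] unfolding l2_eq_def D_def by eventually_elim simp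
    then show ?thesis unfolding Y_def U_def l2_eq_triple .
  qed
  \<comment> \<open>The pressure is read off from the equation, which holds almost everywhere and
    contains the time derivative; hence its uniqueness is obtained for almost every time, that of
    the fields for every time.\<close>
  moreover have Dz: "AE t in lebesgue_on I. l2_eq \<Omega> (D' t) (\<lambda>x. 0)"
    by (rule time_deriv_of_zero[OF T I W_fin dD DW D0])
  have "AE t in lebesgue_on I. eq_mod_const \<Omega> (q t) (p t)"
    using Dz ae AE_I
  proof eventually_elim
    case (elim t)
    have "B (r t) X = 0" if X: "X \<in> W" for X
    proof -
      have XL: "X \<in> L2 \<Omega>" "D' t \<in> L2 \<Omega>" "D t \<in> W" using X W_L2 DW[OF elim(3)] by auto
      have "l2_inner \<Omega> (D' t) X = 0" using l2_inner_cong_left[OF elim(1) XL(2,1)] by simp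
      moreover have "a t (D t) X = 0"
        using ae_functionalD(2)[OF a_left[OF elim(3) X] XL(3) lin_closed_zero[OF W_lin] D0[OF elim(3)]]
          ae_functional_zero[OF a_left[OF elim(3) X] W_lin] by simp
      moreover have "l2_inner \<Omega> (D' t) X + a t (D t) X - B (r t) X = 0" using elim(2) X by blast
      ultimately show ?thesis by linarith
    qed
    from pressure_unique[OF rS[OF elim(3)] this stab] obtain c where c: "\<forall>x\<in>\<Omega>. r t x = c" by blast
    then have "\<forall>x\<in>\<Omega>. q t x = p t x + c" by (auto simp: r_def)
    then show ?case unfolding eq_mod_const_def by blast
  qed
  ultimately show ?thesis by blast
qed

section \<open>Existence and the energy estimate\<close>

lemma l2_measurable_continuous:
  assumes "\<And>z t. z \<in> L2 \<Omega> \<Longrightarrow> t \<in> I \<Longrightarrow> continuous_on {0..t} (\<lambda>s. l2_inner \<Omega> (u s) z)"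
  shows "l2_measurable \<Omega> I u"
  unfolding l2_measurable_def by (intro ballI continuous_measurable_time_interval[OF T I] assms)

lemma solution_exists:
  shows "\<exists>u p u\<^sub>1 u\<^sub>2. is_solution u p u\<^sub>1 u\<^sub>2 \<and>
    u \<in> Linf_L2 \<Omega> I \<and> u\<^sub>1 \<in> Linf_L2 \<Omega> I \<and> u\<^sub>2 \<in> Linf_L2 \<Omega> I \<and> u \<in> L2_H1 \<Omega> I \<and>
    (SUP t\<in>I. ennreal ((l2_norm \<Omega> (u t))\<^sup>2)) + (SUP t\<in>I. ennreal ((l2_norm \<Omega> (u\<^sub>1 t))\<^sup>2))
      + (SUP t\<in>I. ennreal ((l2_norm \<Omega> (u\<^sub>2 t))\<^sup>2))
      + ennreal \<mu>inf * (\<integral>\<^sup>+t. ennreal ((l2_norm \<Omega> (sym_grad \<Omega> (u t)))\<^sup>2) \<partial>lebesgue_on I)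
    \<le> ennreal 12 * (ennreal (c\<^sub>K\<^sup>2 / \<mu>inf) * (\<integral>\<^sup>+t. ennreal ((vhm1_norm \<Omega> (f t))\<^sup>2) \<partial>lebesgue_on I)
        + ennreal ((l2_norm \<Omega> u\<^sub>0)\<^sup>2))"
proof -
  have ZW: "Z \<subseteq> W" by (auto simp: Z_def)
  have "\<exists>N e x U'. l2_onb \<Omega> Z N e \<and> (\<forall>i<N. \<forall>t\<in>I. continuous_on {0..t} (\<lambda>s. x s i)) \<and>
    (\<forall>t. U' t \<in> Z) \<and> has_time_deriv \<Omega> I (\<lambda>t y. \<Sum>i<N. x t i *\<^sub>R e i y) U' \<and>
    l2_eq \<Omega> (\<lambda>y. \<Sum>i<N. x 0 i *\<^sub>R e i y) U0 \<and>
    (AE t in lebesgue_on I. \<forall>X\<in>Z. l2_inner \<Omega> (U' t) X + a t (\<lambda>y. \<Sum>i<N. x t i *\<^sub>R e i y) X = F t X)"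
  proof (rule linear_evolution_exists[OF T I Z_fin U0_Z])
    show "ae_functional \<Omega> Z (\<lambda>U. a t U X)" if "t \<in> I" "X \<in> Z" for t X
      by (rule ae_functional_subset[OF a_left ZW]) (use that ZW in auto)
    show "ae_functional \<Omega> Z (a t U)" if "t \<in> I" "U \<in> Z" for t U
      by (rule ae_functional_subset[OF a_right ZW]) (use that ZW in auto)
    show "integrable (lebesgue_on {0..t}) (\<lambda>s. a s U X)" if "t \<in> I" "U \<in> Z" "X \<in> Z" for t U X
      by (rule a_integrable) (use that ZW in auto)
    show "AE t in lebesgue_on I. ae_functional \<Omega> Z (F t)"
      using F_AE by eventually_elim (rule ae_functional_subset[OF _ ZW])
    show "integrable (lebesgue_on {0..t}) (\<lambda>s. F s X)" if "t \<in> I" "X \<in> Z" for t X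
      by (rule F_integrable) (use that ZW in auto)
  qed
  then obtain N e x U' where e: "l2_onb \<Omega> Z N e" and x: "\<And>i t. i < N \<Longrightarrow> t \<in> I \<Longrightarrow> continuous_on {0..t} (\<lambda>s. x s i)"
    and U'Z: "\<And>t. U' t \<in> Z" and d: "has_time_deriv \<Omega> I (\<lambda>t y. \<Sum>i<N. x t i *\<^sub>R e i y) U'"
    and init: "l2_eq \<Omega> (\<lambda>y. \<Sum>i<N. x 0 i *\<^sub>R e i y) U0"
    and eqn: "AE t in lebesgue_on I. \<forall>X\<in>Z. l2_inner \<Omega> (U' t) X + a t (\<lambda>y. \<Sum>i<N. x t i *\<^sub>R e i y) X = F t X"
    by blast
  define U where "U = (\<lambda>t y. \<Sum>i<N. x t i *\<^sub>R e i y)"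
  have d: "has_time_deriv \<Omega> I U U'" and init: "l2_eq \<Omega> (U 0) U0"
    and eqn: "AE t in lebesgue_on I. \<forall>X\<in>Z. l2_inner \<Omega> (U' t) X + a t (U t) X = F t X"
    unfolding U_def by (rule d init eqn)+
  have eZ: "e i \<in> Z" if "i < N" for i by (rule l2_onbD(1)[OF e that])
  have eW: "e i \<in> W" if "i < N" for i using eZ[OF that] ZW by blast
  have UZ: "U t \<in> Z" for t unfolding U_def by (rule lin_closed_sum[OF lin_closed_Z]) (simp add: eZ)
  have UW: "U t \<in> W" "U' t \<in> W" for t using UZ U'Z ZW by blast+
  \<comment> \<open>\<open>Q t q\<close> says that \<open>q\<close> is a pressure at time
    \<open>t\<close>. The problem asks for \<open>p t\<close> in \<open>S\<close> at every time, so
    the default value 0 is used where there is none, and elsewhere a choice for each time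
    separately.\<close>
  define Q where "Q = (\<lambda>t q. q \<in> S \<and> (\<forall>X\<in>W. l2_inner \<Omega> (U' t) X + a t (U t) X - F t X = B q X))"
  define p where "p = (\<lambda>t. if \<exists>q. Q t q then SOME q. Q t q else (\<lambda>x. 0))"
  have p_ex: "Q t (p t)" if "\<exists>q. Q t q" for t
    unfolding p_def if_P[OF that] using that by (rule someI_ex)
  have pS: "p t \<in> S" for t
    using p_ex[of t] lin_closed_zero[OF lin_closed_S_h] by (cases "\<exists>q. Q t q") (auto simp: p_def Q_def)
  have sys: "AE t in lebesgue_on I. (\<forall>q\<in>S. B q (U t) = 0) \<and>
      (\<forall>X\<in>W. l2_inner \<Omega> (U' t) X + a t (U t) X - B (p t) X = F t X)"
    using eqn F_AE AE_I
  proof eventually_elim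
    case (elim t)
    have U'L: "U' t \<in> L2 \<Omega>" using UW W_L2 by blast
    have "ae_functional \<Omega> W (\<lambda>X. l2_inner \<Omega> (U' t) X + a t (U t) X - F t X)"
      by (intro ae_functional_diff ae_functional_add ae_functional_inner_right[OF ae_linear_id[OF W_L2 W_lin] U'L]
          a_right elim UW)
    \<comment> \<open>The equation for \<open>U\<close> was solved for test triples in
      \<open>Z\<close> only; on the rest of \<open>W\<close> the residual is made up for by the
      pressure.\<close>
    then have "\<exists>q\<in>S. \<forall>X\<in>W. l2_inner \<Omega> (U' t) X + a t (U t) X - F t X = B q X"
      by (rule pressure_exists) (use elim(1) in simp)
    then have "Q t (p t)" by (intro p_ex) (auto simp: Q_def)
    then have "l2_inner \<Omega> (U' t) X + a t (U t) X - B (p t) X = F t X" if "X \<in> W" for X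
      unfolding Q_def using that by fastforce
    then show ?case using UZ[of t] by (auto simp: Z_def)
  qed
  have sol: "is_solution (\<lambda>t. pr1 (U t)) p (\<lambda>t. pr2 (U t)) (\<lambda>t. pr3 (U t))"
    by (rule system_solution[OF _ d sys init]) (use UW pS in blast)
  define g where "g = (\<lambda>t. (vhm1_norm \<Omega> (f t))\<^sup>2)"
  define K where "K = (l2_norm \<Omega> u\<^sub>0)\<^sup>2"
  define \<Phi> where "\<Phi> = (\<integral>t. g t \<partial>lebesgue_on I)"
  define \<kappa> where "\<kappa> = c\<^sub>K\<^sup>2 / (4 * \<mu>inf)"
  define G where "G = (\<lambda>s. l2_inner \<Omega> (sym_grad \<Omega> (pr1 (U s))) (sym_grad \<Omega> (pr1 (U s))))"
  have gi: "integrable (lebesgue_on I) g" using f_int by (simp add: g_def)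
  have g0: "0 \<le> g s" for s by (simp add: g_def)
  have gt: "integrable (lebesgue_on {0..t}) g" "itg t g \<le> \<Phi>" if "t \<in> I" for t
    unfolding \<Phi>_def using itg_le_integral[OF T I gi g0 that] by auto
  have \<kappa>0: "0 \<le> \<kappa>" and K0: "0 \<le> K" using mu_pos by (simp_all add: \<kappa>_def K_def)
  have \<Phi>0: "0 \<le> \<Phi>" unfolding \<Phi>_def using g0 by (intro integral_nonneg_AE) auto
  have cont: "z \<in> L2 \<Omega> \<Longrightarrow> continuous_on {0..t} (\<lambda>s. l2_inner \<Omega> (A (U s)) z)"
      "continuous_on {0..t} (\<lambda>s. l2_inner \<Omega> (A (U s)) (A (U s)))"
    if A: "ae_linear \<Omega> W A" and t: "t \<in> I" for A :: "_ \<Rightarrow> _ \<Rightarrow> 'e::euclidean_space" and t z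
    unfolding U_def by (rule continuous_l2_inner_expansion[OF A eW x[OF _ t]]; assumption)+
  have Gc: "continuous_on {0..t} G" if "t \<in> I" for t
    unfolding G_def by (rule cont(2)[OF ae_linear_W[OF ae_linear_V_sym_grad] that])
  have G0: "0 \<le> G s" for s by (simp add: G_def l2_inner_ge_0)
  have Gi: "integrable (lebesgue_on {0..t}) G" if "t \<in> I" for t by (rule continuous_integrable[OF Gc[OF that]])
  \<comment> \<open>The term \<open>3 * K\<close> is the bound of the initial energy by
    \<open>U0_norm\<close>; the force term is doubled because the energy identity is about the full
    squared norm, not half of it.\<close>
  define M where "M = 3 * K + 2 * \<kappa> * \<Phi>"
  have M0: "0 \<le> M" using K0 \<kappa>0 \<Phi>0 by (simp add: M_def)
  \<comment> \<open>Of the coercivity constant \<open>2 * \<mu>inf\<close> one half absorbs the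
    force; the other half is doubled by the energy identity, which leaves
    \<open>2 * \<mu>inf\<close> in front of the dissipation.\<close>
  have energy: "l2_inner \<Omega> (U t) (U t) + 2 * \<mu>inf * itg t G \<le> M" if t: "t \<in> I" for t
  proof -
    have "itg t (\<lambda>s. l2_inner \<Omega> (U' s) (U s)) \<le> itg t (\<lambda>s. \<kappa> * g s + (- \<mu>inf) * G s)"
    proof (rule itg_mono)
      show "integrable (lebesgue_on {0..t}) (\<lambda>s. l2_inner \<Omega> (U' s) (U s))"
        by (rule energy_identity(1)[OF T I W_fin d _ t]) (use UW in blast)
      show "integrable (lebesgue_on {0..t}) (\<lambda>s. \<kappa> * g s + (- \<mu>inf) * G s)" using gt(1)[OF t] Gi[OF t] by auto
      show "AE s in lebesgue_on {0..t}. l2_inner \<Omega> (U' s) (U s) \<le> \<kappa> * g s + (- \<mu>inf) * G s"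
        using AE_sub[OF t sys] AE_sub[OF t AE_I] AE_sub[OF t f_AE]
      proof eventually_elim
        case (elim s)
        have "B (p s) (U s) = 0" using elim(1) pS by blast
        moreover have "l2_inner \<Omega> (U' s) (U s) + a s (U s) (U s) - B (p s) (U s) = F s (U s)" using elim(1) UW by blast
        moreover have "2 * \<mu>inf * G s \<le> a s (U s) (U s)" unfolding G_def by (rule coercive[OF elim(2) UW(1)])
        moreover have "F s (U s) \<le> \<mu>inf * G s + \<kappa> * g s"
          unfolding G_def \<kappa>_def g_def by (rule F_bound[OF elim(3) UW(1)])
        ultimately show ?case by linarith
      qed
    qed
    also have "\<dots> = \<kappa> * itg t g + (- \<mu>inf) * itg t G"
    proof -
      have "integrable (lebesgue_on {0..t}) (\<lambda>s. \<kappa> * g s)" "integrable (lebesgue_on {0..t}) (\<lambda>s. (- \<mu>inf) * G s)"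
        using gt(1)[OF t] Gi[OF t] by auto
      from itg_add[OF this] show ?thesis by (simp only: itg_mult_left)
    qed
    also have "\<dots> \<le> \<kappa> * \<Phi> + (- \<mu>inf) * itg t G" using mult_left_mono[OF gt(2)[OF t] \<kappa>0] by simp
    finally have "2 * itg t (\<lambda>s. l2_inner \<Omega> (U' s) (U s)) \<le> 2 * \<kappa> * \<Phi> - 2 * \<mu>inf * itg t G" by simp
    moreover have "l2_inner \<Omega> (U t) (U t) = l2_inner \<Omega> (U 0) (U 0) + 2 * itg t (\<lambda>s. l2_inner \<Omega> (U' s) (U s))"
      by (rule energy_identity(2)[OF T I W_fin d _ t]) (use UW in blast)
    moreover have "l2_inner \<Omega> (U 0) (U 0) = l2_inner \<Omega> U0 U0"
      by (rule l2_inner_cong[OF init init]) (use UW W_L2 U0_Z ZW in blast)+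
    ultimately show ?thesis using U0_norm by (simp add: M_def K_def)
  qed
  have itgG0: "0 \<le> itg t G" for t using G0 by (intro itg_nonneg) auto
  have E: "l2_inner \<Omega> (U t) (U t) \<le> M" if "t \<in> I" for t
    using energy[OF that] mult_nonneg_nonneg[OF less_imp_le[OF mu_pos(1)] itgG0[of t]] by linarith
  have GM: "itg t G \<le> M / (2 * \<mu>inf)" if "t \<in> I" for t
    using energy[OF that] l2_inner_ge_0[of \<Omega> "U t"] mu_pos by (simp add: field_simps)
  have comp: "(l2_norm \<Omega> (pr1 (U t)))\<^sup>2 \<le> M" "(l2_norm \<Omega> (pr2 (U t)))\<^sup>2 \<le> M" "(l2_norm \<Omega> (pr3 (U t)))\<^sup>2 \<le> M"
    if "t \<in> I" for t
  proof -
    have "U t \<in> L2 \<Omega>" using UW W_L2 by blast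
    from inner_W[OF this this] E[OF that] l2_inner_ge_0[of \<Omega> "pr1 (U t)"] l2_inner_ge_0[of \<Omega> "pr2 (U t)"]
      l2_inner_ge_0[of \<Omega> "pr3 (U t)"]
    show "(l2_norm \<Omega> (pr1 (U t)))\<^sup>2 \<le> M" "(l2_norm \<Omega> (pr2 (U t)))\<^sup>2 \<le> M" "(l2_norm \<Omega> (pr3 (U t)))\<^sup>2 \<le> M"
      unfolding l2_norm_power2 by linarith+
  qed
  have meas: "l2_measurable \<Omega> I (\<lambda>t. A (U t))" if A: "ae_linear \<Omega> W A" for A :: "_ \<Rightarrow> _ \<Rightarrow> 'e::euclidean_space"
    by (intro l2_measurable_continuous cont(1)[OF A])
  have Linf: "(\<lambda>t. P (U t)) \<in> Linf_L2 \<Omega> I"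
    if P: "ae_linear \<Omega> W P" and b: "\<And>t. t \<in> I \<Longrightarrow> (l2_norm \<Omega> (P (U t)))\<^sup>2 \<le> M"
    for P :: "_ \<Rightarrow> _ \<Rightarrow> real^'d"
  proof -
    have "AE t in lebesgue_on I. l2_norm \<Omega> (P (U t)) \<le> sqrt M"
      using AE_I by eventually_elim (use b in \<open>auto intro: real_le_rsqrt\<close>)
    moreover have "AE t in lebesgue_on I. P (U t) \<in> L2 \<Omega>"
      by (intro AE_I2 ae_linearD(3)[OF P] UW)
    ultimately show ?thesis unfolding Linf_L2_def using meas[OF P] by blast
  qed
  \<comment> \<open>\<open>GM\<close> is uniform in \<open>t\<close>, so it extends to the whole
    time interval, also for infinite \<open>T\<close>.\<close>
  have nnG: "(\<integral>\<^sup>+t. ennreal (G t) \<partial>lebesgue_on I) \<le> ennreal (M / (2 * \<mu>inf))"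
  proof (rule nn_integral_time_interval_le[OF T I])
    have "G \<in> borel_measurable (lebesgue_on I)" by (rule continuous_measurable_time_interval[OF T I Gc])
    then show "(\<lambda>t. ennreal (G t)) \<in> borel_measurable (lebesgue_on I)" by simp
    fix t assume t: "t \<in> I"
    have "(\<integral>\<^sup>+s. ennreal (G s) \<partial>lebesgue_on {0..t}) = ennreal (itg t G)"
      unfolding itg_def by (rule nn_integral_eq_integral[OF Gi[OF t]]) (use G0 in simp)
    then show "(\<integral>\<^sup>+s. ennreal (G s) \<partial>lebesgue_on {0..t}) \<le> ennreal (M / (2 * \<mu>inf))"
      using GM[OF t] by (simp add: ennreal_leI)
  qed
  have H1: "(\<lambda>t. pr1 (U t)) \<in> L2_H1 \<Omega> I"
  proof -
    let ?h = "\<lambda>t. (vh1_norm \<Omega> (pr1 (U t)))\<^sup>2"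
    note vg = ae_linear_W[OF ae_linear_V_vgrad]
    have heq: "?h t = l2_inner \<Omega> (pr1 (U t)) (pr1 (U t)) + l2_inner \<Omega> (vgrad \<Omega> (pr1 (U t))) (vgrad \<Omega> (pr1 (U t)))" for t
      by (simp add: vh1_norm_def l2_norm_power2 l2_inner_ge_0)
    have hm: "?h \<in> borel_measurable (lebesgue_on I)"
      unfolding heq by (intro borel_measurable_add continuous_measurable_time_interval[OF T I] cont(2)[OF ae_linear_pr(1)] cont(2)[OF vg])
    \<comment> \<open>Korn's inequality dominates the full norm of the velocity by the dissipation,
      which is integrable over the whole interval.\<close>
    have hle: "?h t \<le> c\<^sub>K\<^sup>2 * G t" for t
    proof -
      have "pr1 (U t) \<in> vec_fields (H10 \<Omega>)" using W_pr(1)[OF UW(1)] V_h_sub(2) by blast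
      from power_mono[OF korn[OF this] vh1_norm_ge_0, of 2]
      show ?thesis by (simp add: power_mult_distrib l2_norm_power2 G_def)
    qed
    have "(\<integral>\<^sup>+t. ennreal (?h t) \<partial>lebesgue_on I) \<le> (\<integral>\<^sup>+t. ennreal (c\<^sub>K\<^sup>2) * ennreal (G t) \<partial>lebesgue_on I)"
      by (intro nn_integral_mono) (use hle G0 in \<open>simp add: ennreal_mult[symmetric] ennreal_leI\<close>)
    also have "\<dots> = ennreal (c\<^sub>K\<^sup>2) * (\<integral>\<^sup>+t. ennreal (G t) \<partial>lebesgue_on I)"
      using continuous_measurable_time_interval[OF T I Gc] by (intro nn_integral_cmult) simp
    also have "\<dots> \<le> ennreal (c\<^sub>K\<^sup>2) * ennreal (M / (2 * \<mu>inf))" by (intro mult_left_mono nnG) simp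
    also have "\<dots> < \<infinity>" by (simp add: ennreal_mult_less_top)
    finally have "integrable (lebesgue_on I) ?h"
      using hm by (intro integrableI_nonneg) auto
    moreover have "AE t in lebesgue_on I. pr1 (U t) \<in> vec_fields (H1 \<Omega>)"
      using W_pr(1)[OF UW(1)] V_h_sub(1) by (intro AE_I2) blast
    ultimately show ?thesis unfolding L2_H1_def using meas[OF ae_linear_pr(1)] meas[OF vg] by blast
  qed
  have sup: "(SUP t\<in>I. ennreal ((l2_norm \<Omega> (P (U t)))\<^sup>2)) \<le> ennreal M"
    if b: "\<And>t. t \<in> I \<Longrightarrow> (l2_norm \<Omega> (P (U t)))\<^sup>2 \<le> M" for P :: "_ \<Rightarrow> _ \<Rightarrow> real^'d"
    by (intro SUP_least ennreal_leI b)
  have nng: "(\<integral>\<^sup>+t. ennreal (g t) \<partial>lebesgue_on I) = ennreal \<Phi>"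
    unfolding \<Phi>_def by (rule nn_integral_eq_integral[OF gi]) (use g0 in simp)
  \<comment> \<open>Each of the three suprema is bounded by \<open>M\<close> separately, since they
    need not be attained at a common time; the dissipation contributes \<open>M / 2\<close>.\<close>
  have "(SUP t\<in>I. ennreal ((l2_norm \<Omega> (pr1 (U t)))\<^sup>2)) + (SUP t\<in>I. ennreal ((l2_norm \<Omega> (pr2 (U t)))\<^sup>2))
      + (SUP t\<in>I. ennreal ((l2_norm \<Omega> (pr3 (U t)))\<^sup>2))
      + ennreal \<mu>inf * (\<integral>\<^sup>+t. ennreal (G t) \<partial>lebesgue_on I)
      \<le> ennreal M + ennreal M + ennreal M + ennreal \<mu>inf * ennreal (M / (2 * \<mu>inf))"
    by (intro add_mono sup comp mult_left_mono nnG) auto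
  also have "\<dots> = ennreal (3 * M + M / 2)"
    using M0 mu_pos by (simp add: ennreal_plus[symmetric] ennreal_mult[symmetric] del: ennreal_plus)
  also have "\<dots> \<le> ennreal (12 * (c\<^sub>K\<^sup>2 / \<mu>inf * \<Phi> + K))"
  proof (rule ennreal_leI)
    \<comment> \<open>With \<open>b = \<kappa> * \<Phi>\<close> the left side of the estimate is
      \<open>7 / 2 * (3 * K + 2 * b)\<close>, that is 21/2 times \<open>K\<close> plus 7/4 times
      \<open>4 * b\<close>; the constant 12 is a round number above both factors.\<close>
    have eq: "c\<^sub>K\<^sup>2 / \<mu>inf * \<Phi> = 4 * (\<kappa> * \<Phi>)" using mu_pos by (simp add: \<kappa>_def)
    have "3 * M + M / 2 \<le> 12 * (4 * b + K)" if "M = 3 * K + 2 * b" "0 \<le> b" for b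
      using that K0 by (simp add: field_simps)
    then show "3 * M + M / 2 \<le> 12 * (c\<^sub>K\<^sup>2 / \<mu>inf * \<Phi> + K)"
      unfolding eq by this (use \<kappa>0 \<Phi>0 in \<open>simp_all add: M_def\<close>)
  qed
  also have "\<dots> = ennreal 12 * (ennreal (c\<^sub>K\<^sup>2 / \<mu>inf) * (\<integral>\<^sup>+t. ennreal (g t) \<partial>lebesgue_on I) + ennreal K)"
  proof -
    have eq: "ennreal (12 * (\<alpha> * \<Phi> + K)) = ennreal 12 * (ennreal \<alpha> * ennreal \<Phi> + ennreal K)" if "0 \<le> \<alpha>" for \<alpha>
      using that \<Phi>0 K0 by (simp add: ennreal_mult)
    show ?thesis unfolding nng by (rule eq) (use mu_pos in simp)
  qed
  finally have est: "(SUP t\<in>I. ennreal ((l2_norm \<Omega> (pr1 (U t)))\<^sup>2)) + (SUP t\<in>I. ennreal ((l2_norm \<Omega> (pr2 (U t)))\<^sup>2))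
      + (SUP t\<in>I. ennreal ((l2_norm \<Omega> (pr3 (U t)))\<^sup>2))
      + ennreal \<mu>inf * (\<integral>\<^sup>+t. ennreal ((l2_norm \<Omega> (sym_grad \<Omega> (pr1 (U t))))\<^sup>2) \<partial>lebesgue_on I)
    \<le> ennreal 12 * (ennreal (c\<^sub>K\<^sup>2 / \<mu>inf) * (\<integral>\<^sup>+t. ennreal ((vhm1_norm \<Omega> (f t))\<^sup>2) \<partial>lebesgue_on I)
        + ennreal ((l2_norm \<Omega> u\<^sub>0)\<^sup>2))"
    unfolding G_def g_def K_def l2_norm_power2[of \<Omega> "sym_grad \<Omega> _", symmetric] .
  show ?thesis
    using sol Linf[OF ae_linear_pr(1) comp(1)] Linf[OF ae_linear_pr(2) comp(2)] Linf[OF ae_linear_pr(3) comp(3)] H1 est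
    by blast
qed

end

text \<open>\<open>C\<close> is quantified before the mesh, the bases, the viscosity and the data,
  which expresses its independence of the mesh size and the physical parameters. Suprema and
  integrals are taken in the extended nonnegative reals, so the estimate includes the finiteness of
  its left side, the right side being finite for such data.\<close>

theorem theorem4p2:
  fixes \<Omega> :: "(real^'d) set" and \<F> :: "(real^'d) set set set" and k :: nat
    and c\<^sub>1 c\<^sub>2 c\<^sub>K \<beta>\<^sub>0 :: real
  assumes dim: "CARD('d) \<in> {2, 3}"
    and domain: "polyhedral_domain \<Omega>"
    and family: "\<And>\<T>. \<T> \<in> \<F> \<Longrightarrow> fe_partition \<Omega> \<T>" "quasi_uniform \<F>"
    and degree: "k \<ge> 1"
    and algorithmic: "c\<^sub>1 > 0" "c\<^sub>2 > 0"
    and korn: "\<And>v. v \<in> vec_fields (H10 \<Omega>) \<Longrightarrow> vh1_norm \<Omega> v \<le> c\<^sub>K * l2_norm \<Omega> (sym_grad \<Omega> v)"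
    and stability: "\<beta>\<^sub>0 > 0" "\<And>\<T>. \<T> \<in> \<F> \<Longrightarrow> projection_stability \<Omega> \<T> k \<beta>\<^sub>0"
  shows "\<exists>C>0. \<forall>\<T>\<in>\<F>. \<forall>n\<^sub>u \<phi> n\<^sub>p \<psi> V\<^sub>1 V\<^sub>2.
    is_basis \<Omega> (V_h \<Omega> \<T> k) n\<^sub>u \<phi> \<longrightarrow>
    is_basis_mod_const \<Omega> (S_h \<Omega> \<T> k) n\<^sub>p \<psi> \<longrightarrow>
    V\<^sub>1 = subscales1 \<Omega> \<T> k n\<^sub>u \<phi> \<longrightarrow>
    V\<^sub>2 = subscales2 \<Omega> \<T> k n\<^sub>p \<psi> \<longrightarrow>
    (\<forall>T C\<^sub>\<mu> \<mu>inf \<mu>\<^sub>0 \<mu> m f u\<^sub>0 w I.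
      0 < T \<longrightarrow> I = time_interval T \<longrightarrow>
      viscosity \<Omega> C\<^sub>\<mu> \<mu>inf \<mu>\<^sub>0 \<mu> \<longrightarrow>
      m \<in> borel_measurable (lebesgue_on I) \<longrightarrow> (\<forall>t\<in>I. \<mu>inf \<le> m t \<and> m t \<le> \<mu>\<^sub>0) \<longrightarrow>
      f \<in> L2_Hm1 \<Omega> I \<longrightarrow>
      u\<^sub>0 \<in> L2 \<Omega> \<longrightarrow> compatible_initial_data \<Omega> \<T> k V\<^sub>2 u\<^sub>0 \<longrightarrow>
      (\<forall>t\<in>I. w t \<in> V_h \<Omega> \<T> k) \<longrightarrow> l2_measurable \<Omega> I w \<longrightarrow>
      (\<forall>t\<in>I. integrable (lebesgue_on {0..t}) (\<lambda>s. l2_norm \<Omega> (w s))) \<longrightarrow>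
      (\<exists>u p u\<^sub>1 u\<^sub>2.
        linearised_solution \<Omega> \<T> k V\<^sub>1 V\<^sub>2 c\<^sub>1 c\<^sub>2 \<mu> m w f u\<^sub>0 I u p u\<^sub>1 u\<^sub>2 \<and>
        (\<forall>v q v\<^sub>1 v\<^sub>2.
          linearised_solution \<Omega> \<T> k V\<^sub>1 V\<^sub>2 c\<^sub>1 c\<^sub>2 \<mu> m w f u\<^sub>0 I v q v\<^sub>1 v\<^sub>2 \<longrightarrow>
          (\<forall>t\<in>I. l2_eq \<Omega> (v t) (u t) \<and> l2_eq \<Omega> (v\<^sub>1 t) (u\<^sub>1 t) \<and> l2_eq \<Omega> (v\<^sub>2 t) (u\<^sub>2 t)) \<and>
          (AE t in lebesgue_on I. eq_mod_const \<Omega> (q t) (p t))) \<and>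
        u \<in> Linf_L2 \<Omega> I \<and> u\<^sub>1 \<in> Linf_L2 \<Omega> I \<and> u\<^sub>2 \<in> Linf_L2 \<Omega> I \<and> u \<in> L2_H1 \<Omega> I \<and>
        (SUP t\<in>I. ennreal ((l2_norm \<Omega> (u t))\<^sup>2))
        + (SUP t\<in>I. ennreal ((l2_norm \<Omega> (u\<^sub>1 t))\<^sup>2))
        + (SUP t\<in>I. ennreal ((l2_norm \<Omega> (u\<^sub>2 t))\<^sup>2))
        + ennreal \<mu>inf * (\<integral>\<^sup>+t. ennreal ((l2_norm \<Omega> (sym_grad \<Omega> (u t)))\<^sup>2) \<partial>lebesgue_on I)
        \<le> ennreal C *
          (ennreal (c\<^sub>K\<^sup>2 / \<mu>inf) * (\<integral>\<^sup>+t. ennreal ((vhm1_norm \<Omega> (f t))\<^sup>2) \<partial>lebesgue_on I)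
           + ennreal ((l2_norm \<Omega> u\<^sub>0)\<^sup>2))))"
proof (intro exI[of _ "12::real"] conjI ballI allI impI)
  fix \<T> n\<^sub>u \<phi> n\<^sub>p \<psi> V\<^sub>1 V\<^sub>2 T C\<^sub>\<mu> \<mu>inf \<mu>\<^sub>0 \<mu> m f u\<^sub>0 w I
  assume \<T>: "\<T> \<in> \<F>" and bu: "is_basis \<Omega> (V_h \<Omega> \<T> k) n\<^sub>u \<phi>"
    and bp: "is_basis_mod_const \<Omega> (S_h \<Omega> \<T> k) n\<^sub>p \<psi>"
    and V: "V\<^sub>1 = subscales1 \<Omega> \<T> k n\<^sub>u \<phi>" "V\<^sub>2 = subscales2 \<Omega> \<T> k n\<^sub>p \<psi>"
    and h: "0 < T" "I = time_interval T" "viscosity \<Omega> C\<^sub>\<mu> \<mu>inf \<mu>\<^sub>0 \<mu>" "m \<in> borel_measurable (lebesgue_on I)"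
      "\<forall>t\<in>I. \<mu>inf \<le> m t \<and> m t \<le> \<mu>\<^sub>0" "f \<in> L2_Hm1 \<Omega> I" "u\<^sub>0 \<in> L2 \<Omega>" "compatible_initial_data \<Omega> \<T> k V\<^sub>2 u\<^sub>0"
      "\<forall>t\<in>I. w t \<in> V_h \<Omega> \<T> k" "l2_measurable \<Omega> I w"
      "\<forall>t\<in>I. integrable (lebesgue_on {0..t}) (\<lambda>s. l2_norm \<Omega> (w s))"
  interpret linearised_problem \<Omega> \<T> k n\<^sub>u \<phi> n\<^sub>p \<psi> T I C\<^sub>\<mu> \<mu>inf \<mu>\<^sub>0 c\<^sub>1 c\<^sub>2 c\<^sub>K \<beta>\<^sub>0 \<mu> m f u\<^sub>0 w
    using domain family(1)[OF \<T>] bu bp h algorithmic korn stability(1) stability(2)[OF \<T>] V(2)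
    by unfold_locales auto
  obtain u p u\<^sub>1 u\<^sub>2 where sol: "is_solution u p u\<^sub>1 u\<^sub>2"
    and rest: "u \<in> Linf_L2 \<Omega> I \<and> u\<^sub>1 \<in> Linf_L2 \<Omega> I \<and> u\<^sub>2 \<in> Linf_L2 \<Omega> I \<and> u \<in> L2_H1 \<Omega> I \<and>
    (SUP t\<in>I. ennreal ((l2_norm \<Omega> (u t))\<^sup>2)) + (SUP t\<in>I. ennreal ((l2_norm \<Omega> (u\<^sub>1 t))\<^sup>2))
      + (SUP t\<in>I. ennreal ((l2_norm \<Omega> (u\<^sub>2 t))\<^sup>2))
      + ennreal \<mu>inf * (\<integral>\<^sup>+t. ennreal ((l2_norm \<Omega> (sym_grad \<Omega> (u t)))\<^sup>2) \<partial>lebesgue_on I)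
    \<le> ennreal 12 * (ennreal (c\<^sub>K\<^sup>2 / \<mu>inf) * (\<integral>\<^sup>+t. ennreal ((vhm1_norm \<Omega> (f t))\<^sup>2) \<partial>lebesgue_on I)
        + ennreal ((l2_norm \<Omega> u\<^sub>0)\<^sup>2))"
    using solution_exists by blast
  show "\<exists>u p u\<^sub>1 u\<^sub>2.
        linearised_solution \<Omega> \<T> k V\<^sub>1 V\<^sub>2 c\<^sub>1 c\<^sub>2 \<mu> m w f u\<^sub>0 I u p u\<^sub>1 u\<^sub>2 \<and>
        (\<forall>v q v\<^sub>1 v\<^sub>2.
          linearised_solution \<Omega> \<T> k V\<^sub>1 V\<^sub>2 c\<^sub>1 c\<^sub>2 \<mu> m w f u\<^sub>0 I v q v\<^sub>1 v\<^sub>2 \<longrightarrow>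
          (\<forall>t\<in>I. l2_eq \<Omega> (v t) (u t) \<and> l2_eq \<Omega> (v\<^sub>1 t) (u\<^sub>1 t) \<and> l2_eq \<Omega> (v\<^sub>2 t) (u\<^sub>2 t)) \<and>
          (AE t in lebesgue_on I. eq_mod_const \<Omega> (q t) (p t))) \<and>
        u \<in> Linf_L2 \<Omega> I \<and> u\<^sub>1 \<in> Linf_L2 \<Omega> I \<and> u\<^sub>2 \<in> Linf_L2 \<Omega> I \<and> u \<in> L2_H1 \<Omega> I \<and>
        (SUP t\<in>I. ennreal ((l2_norm \<Omega> (u t))\<^sup>2))
        + (SUP t\<in>I. ennreal ((l2_norm \<Omega> (u\<^sub>1 t))\<^sup>2))
        + (SUP t\<in>I. ennreal ((l2_norm \<Omega> (u\<^sub>2 t))\<^sup>2))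
        + ennreal \<mu>inf * (\<integral>\<^sup>+t. ennreal ((l2_norm \<Omega> (sym_grad \<Omega> (u t)))\<^sup>2) \<partial>lebesgue_on I)
        \<le> ennreal 12 *
          (ennreal (c\<^sub>K\<^sup>2 / \<mu>inf) * (\<integral>\<^sup>+t. ennreal ((vhm1_norm \<Omega> (f t))\<^sup>2) \<partial>lebesgue_on I)
           + ennreal ((l2_norm \<Omega> u\<^sub>0)\<^sup>2))"
    unfolding V
    by (intro exI[of _ u] exI[of _ p] exI[of _ u\<^sub>1] exI[of _ u\<^sub>2] conjI[OF sol] conjI[OF _ rest] allI impI solution_unique[OF sol])
qed simp

end
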